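(* Let $0<p<1$, $\alpha\in\mathbb{R}$ and $u\in h(\mathbb{B})$. The following are equivalent: (a) For every $N\in\mathbb{N}$ with $\alpha+pN>-1$, we have $(1-|x|^2)^N\partial^m u\in L^p_\alpha$ for every multi-index $m$ with $|m|=N$. (b) There exists an $N\in\mathbb{N}$ with $\alpha+pN>-1$ such that $(1-|x|^2)^N\partial^m u\in L^p_\alpha$ for every multi-index $m$ with $|m|=N$. (c) For every $N\in\mathbb{N}$ with $\alpha+pN>-1$, we have $(1-|x|^2)^N\mathcal{R}^N u\in L^p_\alpha$. (d) There exists an $N\in\mathbb{N}$ with $\alpha+pN>-1$ such that $(1-|x|^2)^N\mathcal{R}^N u\in L^p_\alpha$. (e) For every $s,t\in\mathbb{R}$ with $\alpha+pt>-1$, we have $(1-|x|^2)^tD^t_su\in L^p_\alpha$. (f) There exist $s,t\in\mathbb{R}$ with $\alpha+pt>-1$ such that $(1-|x|^2)^tD^t_su\in L^p_\alpha$. Moreover, if $\alpha+pN>-1$ and $\alpha+pt>-1$ (with $N\in\mathbb{N}$, $s,t\in\mathbb{R}$), then $$\|(1-|x|^2)^tD^t_su\|_{L^p_\alpha}\sim |u(0)|+\|(1-|x|^2)^N\mathcal{R}^Nu\|_{L^p_\alpha}\sim\sum_{|m|\le N-1}|(\partial^mu)(0)|+\sum_{|m|=N}\|(1-|x|^2)^N\partial^mu\|_{L^p_\alpha}.$$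
   Context: $\mathbb{B}$ is the open unit ball of $\mathbb{R}^n$, $n\ge2$; $\mathbb{N}=\{0,1,2,\dots\}$; $d\nu$ is Lebesgue measure on $\mathbb{B}$ normalized by $\nu(\mathbb{B})=1$. For $\alpha\in\mathbb{R}$, $d\nu_\alpha(x)=\frac1{V_\alpha}(1-|x|^2)^\alpha d\nu(x)$, where $V_\alpha$ is chosen so that $\nu_\alpha(\mathbb{B})=1$ if $\alpha>-1$ and $V_\alpha=1$ if $\alpha\le-1$. $L^p_\alpha=L^p(d\nu_\alpha)$, with $\|f\|_{L^p_\alpha}=(\int_{\mathbb{B}}|f|^pd\nu_\alpha)^{1/p}$ for $0<p<\infty$. $h(\mathbb{B})$ is the space of complex-valued harmonic functions on $\mathbb{B}$. For a multi-index $m=(m_1,\dots,m_n)$ of non-negative integers, $|m|=m_1+\dots+m_n$ and $\partial^mu=\frac{\partial^{|m|}u}{\partial x_1^{m_1}\cdots\partial x_n^{m_n}}$. Every $u\in h(\mathbb{B})$ has a homogeneous expansion $u=\sum_{k\ge0}u_k$, with $u_k$ a homogeneous harmonic polynomial of degree $k$, converging absolutely and uniformly on compact subsets of $\mathbb{B}$. The radial derivative is $\mathcal{R}u(x)=x\cdot\nabla u(x)=\sum_k k\,u_k(x)$, with iterates $\mathcal{R}^Nu=\sum_k k^Nu_k$ for $N\geq 1$ and $\mathcal{R}^0u=u$. With $(a)_b=\Gamma(a+b)/\Gamma(a)$, define for $\alpha\in\mathbb{R}$ $$\gamma_k(\alpha)=\begin{cases}\dfrac{(1+n/2+\alpha)_k}{(n/2)_k},&\alpha>-(1+n/2),\\[2mm]\dfrac{((1)_k)^2}{(1-(n/2+\alpha))_k(n/2)_k},&\alpha\le-(1+n/2).\end{cases}$$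 For $s,t\in\mathbb{R}$, $D^t_s:h(\mathbb{B})\to h(\mathbb{B})$ is defined by $D^t_su=\sum_{k=0}^\infty\frac{\gamma_k(s+t)}{\gamma_k(s)}u_k$. $X\lesssim Y$ means $X\le CY$ with a constant $C>0$ independent of $u$ (it may depend on $n,p,\alpha,s,t,N$), and $X\sim Y$ means $X\lesssim Y$ and $Y\lesssim X$. *)

theory Defs
  imports "HOL-Analysis.Analysis"
begin

text \<open>
  Functions on the unit ball are total functions on \<open>real ^ 'n\<close>; their values outside
  \<open>ball 0 1\<close> never matter below.
\<close>

definition partial_deriv :: "'n \<Rightarrow> (real ^ 'n \<Rightarrow> complex) \<Rightarrow> real ^ 'n \<Rightarrow> complex" where
  "partial_deriv i f x = vector_derivative (\<lambda>t. f (x + t *\<^sub>R axis i 1)) (at 0)"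

text \<open>
  Being twice continuously differentiable is spelled out through differentiability, because
  \<open>partial_deriv\<close> is an unspecified value where the partial derivative does not exist.
  The definition is meant for open \<open>S\<close>.
\<close>

definition harmonic_on :: "(real ^ 'n \<Rightarrow> complex) \<Rightarrow> (real ^ 'n) set \<Rightarrow> bool" where
  "harmonic_on u S \<longleftrightarrow>
     u differentiable_on S \<and>
     (\<forall>i. partial_deriv i u differentiable_on S) \<and>
     (\<forall>i j. continuous_on S (partial_deriv i (partial_deriv j u))) \<and>
     (\<forall>x\<in>S. (\<Sum>i\<in>UNIV. partial_deriv i (partial_deriv i u) x) = 0)"

definition harmonic_ball :: "(real ^ 'n \<Rightarrow> complex) set" where
  "harmonic_ball = {u. harmonic_on u (ball 0 1)}"


definition mi_size :: "('n::finite \<Rightarrow> nat) \<Rightarrow> nat" where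
  "mi_size m = (\<Sum>i\<in>UNIV. m i)"

text \<open>
  The linear order on the index type supplies the order \<open>1, \<dots>, n\<close> of the coordinates:
  derivatives with respect to the last coordinate are taken first.
\<close>

definition mi_deriv ::
    "('n::{finite,linorder} \<Rightarrow> nat) \<Rightarrow>
     (real ^ 'n::{finite,linorder} \<Rightarrow> complex) \<Rightarrow> real ^ 'n::{finite,linorder} \<Rightarrow> complex" where
  "mi_deriv m u =
     foldr (\<lambda>i f. (partial_deriv i ^^ m i) f) (sorted_list_of_set UNIV) u"

definition radial_deriv :: "(real ^ 'n \<Rightarrow> complex) \<Rightarrow> real ^ 'n \<Rightarrow> complex" where
  "radial_deriv u x = (\<Sum>i\<in>UNIV. of_real (x $ i) * partial_deriv i u x)"


definition homogeneous_poly :: "nat \<Rightarrow> (real ^ 'n \<Rightarrow> complex) \<Rightarrow> bool" where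
  "homogeneous_poly k P \<longleftrightarrow>
     (\<exists>c. \<forall>x. P x = (\<Sum>m | mi_size m = k. c m * of_real (\<Prod>i\<in>UNIV. (x $ i) ^ m i)))"

definition homogeneous_expansion ::
    "(real ^ 'n \<Rightarrow> complex) \<Rightarrow> (nat \<Rightarrow> real ^ 'n \<Rightarrow> complex) \<Rightarrow> bool" where
  "homogeneous_expansion u U \<longleftrightarrow>
     (\<forall>k. homogeneous_poly k (U k) \<and> harmonic_on (U k) UNIV) \<and>
     (\<forall>x\<in>ball 0 1. summable (\<lambda>k. norm (U k x))) \<and>
     (\<forall>K. compact K \<and> K \<subseteq> ball 0 1 \<longrightarrow>
        uniform_limit K (\<lambda>N x. \<Sum>k<N. U k x) u sequentially)"

text \<open>
  For a harmonic function on the unit ball the expansion exists and is unique.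
\<close>

definition homogeneous_part :: "(real ^ 'n \<Rightarrow> complex) \<Rightarrow> nat \<Rightarrow> real ^ 'n \<Rightarrow> complex" where
  "homogeneous_part u = (THE U. homogeneous_expansion u U)"

text \<open>
  In \<open>gamma_coeff n k a\<close>, \<open>n\<close> is the dimension. All bases of the Pochhammer symbols are
  positive, so that \<open>pochhammer b k = Gamma (b + k) / Gamma b\<close>.
\<close>

definition gamma_coeff :: "nat \<Rightarrow> nat \<Rightarrow> real \<Rightarrow> real" where
  "gamma_coeff n k a =
     (if a > - (1 + real n / 2)
      then pochhammer (1 + real n / 2 + a) k / pochhammer (real n / 2) k
      else (pochhammer 1 k)\<^sup>2 /
             (pochhammer (1 - (real n / 2 + a)) k * pochhammer (real n / 2) k))"

definition D_op :: "real \<Rightarrow> real \<Rightarrow> (real ^ 'n \<Rightarrow> complex) \<Rightarrow> real ^ 'n \<Rightarrow> complex" where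
  "D_op s t u x =
     (\<Sum>k. of_real (gamma_coeff CARD('n) k (s + t) / gamma_coeff CARD('n) k s)
            * homogeneous_part u k x)"


definition nu :: "(real ^ 'n) measure" where
  "nu = uniform_measure (lebesgue_on (ball 0 1)) (ball 0 1)"

definition V_const :: "'n::finite itself \<Rightarrow> real \<Rightarrow> real" where
  "V_const _ \<alpha> =
     (if \<alpha> > -1 then (LINT x|(nu :: (real ^ 'n::finite) measure). (1 - (norm x)\<^sup>2) powr \<alpha>) else 1)"

definition nu_weighted :: "real \<Rightarrow> (real ^ 'n) measure" where
  "nu_weighted \<alpha> =
     density nu (\<lambda>x. ennreal ((1 - (norm x)\<^sup>2) powr \<alpha> / V_const TYPE('n) \<alpha>))"

text \<open>The \<open>L\<^sup>p\<close> norm takes the value \<open>\<infinity>\<close> when the integral diverges.\<close>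

definition Lp_norm :: "real \<Rightarrow> real \<Rightarrow> (real ^ 'n \<Rightarrow> complex) \<Rightarrow> ennreal" where
  "Lp_norm p \<alpha> f =
     (let I = (\<integral>\<^sup>+ x. ennreal (norm (f x) powr p) \<partial>nu_weighted \<alpha>)
      in if I = \<infinity> then \<infinity> else ennreal (enn2real I powr (1 / p)))"

definition Lp_space :: "real \<Rightarrow> real \<Rightarrow> (real ^ 'n \<Rightarrow> complex) set" where
  "Lp_space p \<alpha> = {f. f \<in> borel_measurable (nu_weighted \<alpha>) \<and> Lp_norm p \<alpha> f < \<infinity>}"

text \<open>\<open>X \<sim> Y\<close> for quantities depending on \<open>u \<in> A\<close>; the constants do not depend on \<open>u\<close>.\<close>

definition comparable_on :: "'a set \<Rightarrow> ('a \<Rightarrow> ennreal) \<Rightarrow> ('a \<Rightarrow> ennreal) \<Rightarrow> bool" where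
  "comparable_on A X Y \<longleftrightarrow>
     (\<exists>C>0. \<forall>u\<in>A. X u \<le> ennreal C * Y u) \<and>
     (\<exists>C>0. \<forall>u\<in>A. Y u \<le> ennreal C * X u)"


text \<open>Multiplication by the weight \<open>(1 - |x|\<^sup>2)\<^sup>t\<close>.\<close>

definition weighted :: "real \<Rightarrow> (real ^ 'n \<Rightarrow> complex) \<Rightarrow> real ^ 'n \<Rightarrow> complex" where
  "weighted t f x = of_real ((1 - (norm x)\<^sup>2) powr t) * f x"

end

theory Submission
 imports Defs
begin

text \<open>
  The functions \<open>\<R>\<^sup>N u\<close> and \<open>D\<^sup>t\<^sub>s u\<close> arise from \<open>u\<close> by multipliers: on the homogeneous
  expansion \<open>u = \<Sum>\<^sub>k u\<^sub>k\<close> of a harmonic function, \<open>\<R>\<^sup>N\<close> multiplies \<open>u\<^sub>k\<close> by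
  \<open>k\<^sup>N\<close> and \<open>D\<^sup>t\<^sub>s\<close> multiplies it by a ratio of Gamma functions of size \<open>k\<^sup>t\<close>. A multiplier
  of size \<open>k\<^sup>\<tau>\<close> should behave like a derivative of order \<open>\<tau>\<close>, that is, be bounded from the
  functions with \<open>\<integral> |u|\<^sup>p (1 - |x|)\<^sup>\<beta> dx < \<infinity>\<close> to those with
  \<open>\<integral> |u|\<^sup>p (1 - |x|)\<^sup>\<gamma> dx < \<infinity>\<close>, \<open>\<gamma> = \<beta> + p\<tau>\<close>, as long as \<open>\<gamma> > -1\<close>. The proof
  establishes this for the multipliers that occur (\<open>has_order\<close>, \<open>has_order_gamma_ratio\<close>); the
  comparison of their norms then follows by writing each of them as a multiplier of the other one.
  Partial derivatives join in because they commute with multipliers up to a shift of \<open>k\<close>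
  (\<open>iter_partial_mult_op\<close>) and because \<open>\<R>\<close> is a combination of them.

  Going up in order costs nothing but the Cauchy estimate for derivatives (\<open>wint_partial\<close>).
  Going down requires an integration, since for \<open>\<delta> > 0\<close> the Beta integral turns the multiplier
  \<open>B(b + k, \<delta>)\<close> into the mean \<open>\<integral>\<^sub>0\<^sup>1 r\<^sup>b\<^sup>-\<^sup>1 (1 - r)\<^sup>\<delta>\<^sup>-\<^sup>1 u(rx) dr\<close>
  (\<open>mult_op_radial_representation\<close>). For \<open>p < 1\<close> the \<open>p\<close>-th power of such a mean is not dominated
  by the mean of the \<open>p\<close>-th powers; Hoelder's inequality points the wrong way. What saves the
  estimate is that \<open>|u|\<^sup>p\<close> has a sub-mean-value property up to a constant, although it need not
  be subharmonic (\<open>hardy_littlewood\<close>). Hence \<open>|u(rx)|\<^sup>p\<close> is bounded by an average over a ball of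
  radius comparable to \<open>1 - r|x|\<close>, nearby values of \<open>r\<close> have comparable bounds, and the radial
  integral can be raised to the power \<open>p\<close> like a sum (\<open>weighted_power_integral\<close>). Fubini's theorem
  then gives the weighted bound (\<open>mult_op_down\<close>); this is where \<open>\<gamma> > -1\<close> enters.

  Harmonicity is used through one mean value property with a fixed continuous radial weight
  supported in the unit ball (\<open>mean_value\<close>). It passes to derivatives, linear combinations and
  locally uniform limits, and it yields smoothness, Cauchy estimates and local Taylor expansions by
  differentiating the weight. That the homogeneous parts of \<open>u\<close> converge in the whole ball, and
  not only near the origin, follows from an orthogonality relation given by Green's formula
  (\<open>dilation_moment\<close>).
\<close>

section \<open>Partial derivatives and integration by parts\<close>

lemmas complex_scaleR = scaleR_conv_of_real[where 'a=complex]

lemma vector_derivative_cong_open: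
 assumes "open S" "0 \<in> S" "\<And>t. t \<in> S \<Longrightarrow> f t = g t"
 shows "vector_derivative f (at (0::real)) = vector_derivative g (at 0)"
proof -
 have "(f has_vector_derivative D) (at 0) \<longleftrightarrow> (g has_vector_derivative D) (at 0)" for D
  using has_vector_derivative_transform_within_open[of f D 0 S g]
   has_vector_derivative_transform_within_open[of g D 0 S f] assms by auto
 then show ?thesis unfolding vector_derivative_def by simp
qed

lemma partial_deriv_cong:
 fixes f :: "real ^ 'n \<Rightarrow> complex"
 assumes S: "open S" "x \<in> S" and eq: "\<And>y. y \<in> S \<Longrightarrow> f y = g y"
 shows "partial_deriv i f x = partial_deriv i g x"
 unfolding partial_deriv_def
proof (rule vector_derivative_cong_open)
 have "continuous_on UNIV (\<lambda>t::real. x + t *\<^sub>R (axis i 1 :: real ^ 'n))"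
  by (intro continuous_intros)
 then show "open ((\<lambda>t::real. x + t *\<^sub>R axis i 1) -` S)"
  using S open_vimage by blast
qed (use assms in auto)

lemma partial_deriv_eq:
 fixes f :: "real ^ 'n \<Rightarrow> complex"
 assumes "(f has_derivative f') (at x)"
 shows "partial_deriv i f x = f' (axis i 1)"
proof -
 interpret bounded_linear f' using assms by (rule has_derivative_bounded_linear)
 have "((\<lambda>t::real. f (x + t *\<^sub>R axis i 1)) has_derivative (\<lambda>t. f' (t *\<^sub>R axis i 1))) (at 0)"
  by (rule has_derivative_compose[of "\<lambda>t. x + t *\<^sub>R axis i 1", where g = f])
    (use assms in \<open>auto intro!: derivative_eq_intros\<close>)
 then have "((\<lambda>t::real. f (x + t *\<^sub>R axis i 1)) has_vector_derivative f' (axis i 1)) (at 0)"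
  unfolding has_vector_derivative_def by (simp add: scaleR)
 then show ?thesis unfolding partial_deriv_def by (rule vector_derivative_at)
qed

lemma axis_expansion: "(h :: real ^ 'n) = (\<Sum>i\<in>UNIV. (h $ i) *\<^sub>R axis i 1)"
 by (simp add: vec_eq_iff axis_def if_distrib sum.If_cases cong: if_cong)

lemma sum_of_real_axis:
 "(\<Sum>j\<in>UNIV. of_real ((t *\<^sub>R axis i 1 :: real ^ 'n) $ j) * c j) = (of_real t * c i :: complex)"
proof -
 have "of_real ((t *\<^sub>R axis i 1 :: real ^ 'n) $ j) * c j = (if j = i then of_real t * c i else 0)" for j
  by (simp add: axis_def)
 then show ?thesis by simp
qed

lemma differentiable_partials:
 fixes f :: "real ^ 'n \<Rightarrow> complex"
 assumes "f differentiable (at x)"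
 shows "(f has_derivative (\<lambda>h. \<Sum>i\<in>UNIV. of_real (h $ i) * partial_deriv i f x)) (at x)"
proof -
 obtain f' where f': "(f has_derivative f') (at x)"
  using assms by (auto simp: differentiable_def)
 interpret bounded_linear f' using f' by (rule has_derivative_bounded_linear)
 have "f' h = (\<Sum>i\<in>UNIV. of_real (h $ i) * partial_deriv i f x)" for h
  by (subst axis_expansion) (simp add: sum scaleR partial_deriv_eq[OF f'], simp add: scaleR_conv_of_real)
 then show ?thesis using f' by (metis (no_types, lifting) ext)
qed

definition C1_on :: "(real ^ 'n) set \<Rightarrow> (real ^ 'n \<Rightarrow> complex) \<Rightarrow> bool" where
 "C1_on S u \<longleftrightarrow> u differentiable_on S \<and> (\<forall>i. continuous_on S (partial_deriv i u))"

lemma C1_on_cont: "C1_on S u \<Longrightarrow> continuous_on S u"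
 unfolding C1_on_def by (auto intro: differentiable_imp_continuous_on)

lemma C1_on_has_derivative:
 assumes "C1_on S u" "open S" "x \<in> S"
 shows "(u has_derivative (\<lambda>h. \<Sum>i\<in>UNIV. of_real (h $ i) * partial_deriv i u x)) (at x)"
 using assms unfolding C1_on_def
 by (auto intro!: differentiable_partials simp: differentiable_on_eq_differentiable_at)

lemma C1_on_subset: "C1_on S u \<Longrightarrow> T \<subseteq> S \<Longrightarrow> C1_on T u"
 unfolding C1_on_def by (meson continuous_on_subset differentiable_on_subset)

text \<open>Integrals over the unit ball are taken over this box containing it, with integrands that vanish
 outside the ball: a fixed box is the simplest domain for differentiating under the integral sign.\<close>

definition cube :: "(real ^ 'n) set" where "cube = cbox (- 1) 1"

lemma cball_subset_cube: "cball 0 1 \<subseteq> (cube :: (real ^ 'n) set)"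
proof
 fix x :: "real ^ 'n" assume "x \<in> cball 0 1"
 then have "\<bar>x $ i\<bar> \<le> 1" for i
  using component_le_norm_cart[of x i] by simp
 then have "- 1 \<le> x $ i \<and> x $ i \<le> 1" for i by (simp add: abs_le_iff minus_le_iff)
 then show "x \<in> cube" unfolding cube_def mem_box_cart by simp
qed

text \<open>The weights \<open>(1 - |y|\<^sup>2)\<^sub>+\<^sup>m\<close>: differentiation lowers \<open>m\<close> by one and brings down the
 factor \<open>y\<close>, so that integrals against \<open>y\<close> and integrals of derivatives are related without
 surface integrals.\<close>

definition bump :: "nat \<Rightarrow> real ^ 'n \<Rightarrow> real" where
 "bump m y = (max 0 (1 - (norm y)\<^sup>2)) ^ m"

lemma DERIV_max_power:
 assumes "m \<ge> 2"
 shows "((\<lambda>s::real. (max 0 s) ^ m) has_field_derivative (real m * (max 0 s) ^ (m - 1))) (at s)"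
proof -
 consider "s < 0" | "s > 0" | "s = 0" by linarith
 then show ?thesis
 proof cases
  case 1
  have "((\<lambda>s::real. 0) has_field_derivative (real m * (max 0 s) ^ (m - 1))) (at s)"
   using 1 assms by (simp add: max_def zero_power)
  then show ?thesis
   by (rule has_field_derivative_transform_within_open[where S="{..<0}"])
    (use 1 assms in \<open>auto simp: max_def zero_power\<close>)
 next
  case 2
  have "((\<lambda>s::real. s ^ m) has_field_derivative (real m * (max 0 s) ^ (m - 1))) (at s)"
   using 2 by (auto intro!: derivative_eq_intros simp: max_def)
  then show ?thesis
   by (rule has_field_derivative_transform_within_open[where S="{0<..}"])
    (use 2 assms in \<open>auto simp: max_def zero_power\<close>)
 next
  case 3
  have m: "m - 1 > 0" using assms by simp
  have "((\<lambda>h::real. (max 0 h) ^ m / h) \<longlongrightarrow> 0) (at 0)"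
  proof (rule Lim_null_comparison[where g="\<lambda>h. \<bar>h\<bar> ^ (m - 1)"])
   have "norm ((max 0 h) ^ m / h) \<le> \<bar>h\<bar> ^ (m - 1)" for h :: real
   proof (cases "h > 0")
    case True
    have "h ^ m = h * h ^ (m - 1)" using assms power_minus_mult[of m h] by (simp add: mult.commute)
    then show ?thesis using True by (simp add: max_def)
   qed (use assms in \<open>auto simp: max_def zero_power\<close>)
   then show "\<forall>\<^sub>F h in at 0. norm ((max 0 h) ^ m / (h::real)) \<le> \<bar>h\<bar> ^ (m - 1)" by simp
   have "((\<lambda>h::real. \<bar>h\<bar> ^ (m - 1)) \<longlongrightarrow> \<bar>0\<bar> ^ (m - 1)) (at 0)"
    by (intro tendsto_intros)
   then show "((\<lambda>h::real. \<bar>h\<bar> ^ (m - 1)) \<longlongrightarrow> 0) (at 0)"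
    using m by (metis abs_zero zero_power)
  qed
  then show ?thesis using 3 m assms by (simp add: DERIV_def zero_power)
 qed
qed

lemma bump_has_derivative:
 fixes y :: "real ^ 'n"
 assumes "m \<ge> 2"
 shows "(bump m has_derivative (\<lambda>h. - (2 * real m) * bump (m - 1) y * (y \<bullet> h))) (at y)"
proof -
 have 1: "((\<lambda>y::real ^ 'n. 1 - (norm y)\<^sup>2) has_derivative (\<lambda>h. - 2 * (y \<bullet> h))) (at y)"
  unfolding power2_norm_eq_inner
  by (auto intro!: derivative_eq_intros simp: inner_commute)
 have "((\<lambda>s::real. (max 0 s) ^ m) has_derivative
     ((*) (real m * (max 0 (1 - (norm y)\<^sup>2)) ^ (m - 1)))) (at (1 - (norm y)\<^sup>2))"
  using DERIV_max_power[OF assms] unfolding has_field_derivative_def .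
 from has_derivative_compose[OF 1 this]
 show ?thesis unfolding bump_def by (simp add: mult_ac)
qed

lemma continuous_on_bump [continuous_intros]:
 "continuous_on S f \<Longrightarrow> continuous_on S (\<lambda>x. bump m (f x))"
 unfolding bump_def by (intro continuous_intros)

lemma bump_eq_0: "norm y \<ge> 1 \<Longrightarrow> m > 0 \<Longrightarrow> bump m y = 0"
proof -
 assume *: "norm y \<ge> 1" "m > 0"
 then have "1 - (norm y)\<^sup>2 \<le> 0" using power_mono[of 1 "norm y" 2] by simp
 then have "max 0 (1 - (norm y)\<^sup>2) = 0" by linarith
 then show ?thesis using * unfolding bump_def by simp
qed

lemma bump_nonneg [simp]: "bump m y \<ge> 0"
 unfolding bump_def by simp

lemma bump_le_1: "bump m y \<le> 1"
 unfolding bump_def by (intro power_le_one) auto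

lemma partial_deriv_bump_times:
 fixes w :: "real ^ 'n \<Rightarrow> complex"
 assumes "m \<ge> 2" "w differentiable (at y)"
 shows "((\<lambda>y. of_real (bump m y) * w y) has_derivative
      (\<lambda>h. \<Sum>i\<in>UNIV. of_real (h $ i) *
       (of_real (bump m y) * partial_deriv i w y
        - of_real (2 * real m * bump (m - 1) y * y $ i) * w y))) (at y)"
proof -
 have "((\<lambda>y. bump m y *\<^sub>R w y) has_derivative
   (\<lambda>h. bump m y *\<^sub>R (\<Sum>i\<in>UNIV. of_real (h $ i) * partial_deriv i w y) +
     (- (2 * real m) * bump (m - 1) y * (y \<bullet> h)) *\<^sub>R w y)) (at y)"
  by (rule has_derivative_scaleR[OF bump_has_derivative differentiable_partials]) fact+
 moreover have "bump m y *\<^sub>R (\<Sum>i\<in>UNIV. of_real (h $ i) * partial_deriv i w y) +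
     (- (2 * real m) * bump (m - 1) y * (y \<bullet> h)) *\<^sub>R w y =
   (\<Sum>i\<in>UNIV. of_real (h $ i) *
       (of_real (bump m y) * partial_deriv i w y
        - of_real (2 * real m * bump (m - 1) y * y $ i) * w y))" for h
  by (simp add: inner_vec_def scaleR_conv_of_real sum_distrib_left sum_distrib_right
    sum_subtractf algebra_simps sum_negf)
 ultimately show ?thesis by (simp add: scaleR_conv_of_real)
qed

text \<open>The integral of \<open>f(y + te)\<close> over a larger box does not depend on small \<open>t\<close>, since \<open>f\<close> vanishes
 outside the unit ball; its derivative at \<open>t = 0\<close> is the integral in question.\<close>

lemma integral_partial_eq_0:
 fixes f f' :: "real ^ 'n \<Rightarrow> complex"
 assumes der: "\<And>x. ((\<lambda>t. f (x + t *\<^sub>R axis i 1)) has_vector_derivative f' x) (at 0)"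
  and cont: "continuous_on UNIV f" "continuous_on UNIV f'"
  and zero: "\<And>x. norm x \<ge> 1 \<Longrightarrow> f x = 0" "\<And>x. norm x \<ge> 1 \<Longrightarrow> f' x = 0"
 shows "integral cube f' = 0"
proof -
 define Q where "Q = cbox (-2) (2 :: real ^ 'n)"
 define e where "e = (axis i 1 :: real ^ 'n)"
 have der': "((\<lambda>t. f (x + t *\<^sub>R e)) has_vector_derivative f' (x + t *\<^sub>R e)) (at t)" for x t
 proof -
  have "((\<lambda>s. f ((x + t *\<^sub>R e) + s *\<^sub>R e)) has_vector_derivative f' (x + t *\<^sub>R e)) (at (0))"
   using der[of "x + t *\<^sub>R e"] unfolding e_def .
  then have 1: "((\<lambda>s. f ((x + t *\<^sub>R e) + s *\<^sub>R e)) has_vector_derivative f' (x + t *\<^sub>R e)) (at (t - t))"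
   by simp
  have "((\<lambda>s. s - t) has_vector_derivative 1) (at t)" by (auto intro!: derivative_eq_intros)
  from vector_diff_chain_at[OF this 1] show ?thesis
   by (simp add: o_def algebra_simps)
 qed
 have cubeQ: "f' x = 0" if "x \<notin> cube" for x
  using that zero(2)[of x] cball_subset_cube by (metis linorder_linear mem_cball_0 subsetD)
 have shift: "integral Q (\<lambda>y. f (y + t *\<^sub>R e)) = integral Q f" if "t \<in> {-1..1}" for t
 proof -
  have in_Q: "x \<in> Q" if "norm x \<le> 2" for x
  proof -
   have "\<bar>x $ i\<bar> \<le> 2" for i using component_le_norm_cart[of x i] that by linarith
   then have "- 2 \<le> x $ i \<and> x $ i \<le> 2" for i by (simp add: abs_le_iff minus_le_iff)
   then show ?thesis unfolding Q_def mem_box_cart by simp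
  qed
  have z: "x \<in> cbox (- 2 + t *\<^sub>R e) (2 + t *\<^sub>R e)" if "norm x < 1" for x
  proof -
   have "norm (x - t *\<^sub>R e) \<le> 2"
    using norm_triangle_ineq4[of x "t *\<^sub>R e"] that \<open>t \<in> {-1..1}\<close> by (auto simp: e_def)
   then have "x - t *\<^sub>R e \<in> Q" by (rule in_Q)
   then show ?thesis unfolding Q_def mem_box by (auto simp: inner_diff_left inner_add_left)
  qed
  have "integral Q (\<lambda>y. f (y + t *\<^sub>R e)) = integral (cbox (- 2 + t *\<^sub>R e) (2 + t *\<^sub>R e)) f"
   unfolding Q_def using integral_shift_cbox_plus[of "- 2" 2 f "t *\<^sub>R e"] by (simp add: o_def add.commute)
  also have "\<dots> = integral Q f"
  proof (rule integral_spike_set)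
   show "negligible {x \<in> cbox (- 2 + t *\<^sub>R e) (2 + t *\<^sub>R e) - Q. f x \<noteq> 0}"
    by (rule negligible_subset[OF negligible_empty]) (use in_Q zero(1) in force)
   show "negligible {x \<in> Q - cbox (- 2 + t *\<^sub>R e) (2 + t *\<^sub>R e). f x \<noteq> 0}"
    by (rule negligible_subset[OF negligible_empty]) (use z zero(1) in force)
  qed
  finally show ?thesis .
 qed
 have "((\<lambda>t. integral Q (\<lambda>y. f (y + t *\<^sub>R e))) has_vector_derivative
      integral Q (\<lambda>y. f' (y + 0 *\<^sub>R e))) (at 0 within {-1..1})"
  unfolding Q_def
 proof (rule leibniz_rule_vector_derivative)
  fix t y show "((\<lambda>t. f (y + t *\<^sub>R e)) has_vector_derivative f' (y + t *\<^sub>R e)) (at t within {-1..1})"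
   using der' by (rule has_vector_derivative_at_within)
 next
  fix t show "(\<lambda>y. f (y + t *\<^sub>R e)) integrable_on cbox (- 2) 2"
   by (intro integrable_continuous continuous_on_compose2[OF cont(1)] continuous_intros) auto
 next
  show "continuous_on ({-1..1} \<times> cbox (- 2) 2) (\<lambda>(t, y). f' (y + t *\<^sub>R e))"
   unfolding split_beta
   by (intro continuous_on_compose2[OF cont(2)] continuous_intros) auto
 qed auto
 then have h1: "((\<lambda>t. integral Q (\<lambda>y. f (y + t *\<^sub>R e))) has_vector_derivative integral Q f') (at 0 within {-1..1})"
  by simp
 have "((\<lambda>t. integral Q f) has_vector_derivative integral Q f') (at 0 within {-1..1})"
  by (rule has_vector_derivative_transform[OF _ _ h1]) (simp_all add: shift)
 moreover have "((\<lambda>t. integral Q f) has_vector_derivative 0) (at 0 within {-1..1})"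
  by simp
 ultimately have "integral Q f' = 0"
  by (intro vector_derivative_unique_within_closed_interval[of "-1" 1 0]) auto
 moreover have "integral cube f' = integral Q f'"
 proof (rule integral_spike_set)
  have "cube \<subseteq> Q"
  proof
   fix x :: "real ^ 'n" assume "x \<in> cube"
   then have "- 1 \<le> x $ i \<and> x $ i \<le> 1" for i unfolding cube_def mem_box_cart by simp
   then have "- 2 \<le> x $ i \<and> x $ i \<le> 2" for i by (smt (verit))
   then show "x \<in> Q" unfolding Q_def mem_box_cart by simp
  qed
  then show "negligible {x \<in> cube - Q. f' x \<noteq> 0}"
   by (auto intro!: negligible_subset[OF negligible_empty])
  show "negligible {x \<in> Q - cube. f' x \<noteq> 0}"
   using cubeQ by (auto intro!: negligible_subset[OF negligible_empty])
 qed
 ultimately show ?thesis by simp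
qed

lemma continuous_on_support:
 fixes f :: "real ^ 'n \<Rightarrow> complex"
 assumes "open V" "cball 0 1 \<subseteq> V" "continuous_on V f" "\<And>x. norm x \<ge> 1 \<Longrightarrow> f x = 0"
 shows "continuous_on UNIV f"
proof -
 have "continuous_on (V \<union> - cball 0 1) f"
 proof (rule continuous_on_open_Un)
  show "continuous_on (- cball 0 1) f"
   by (rule continuous_on_eq[of _ "\<lambda>_. 0"]) (use assms(4) in auto)
 qed (use assms in auto)
 moreover have "V \<union> - cball 0 1 = UNIV" using assms by auto
 ultimately show ?thesis by simp
qed

lemma integral_by_parts_bump:
 fixes w :: "real ^ 'n \<Rightarrow> complex"
 assumes m: "m \<ge> 2" and V: "open V" "cball 0 1 \<subseteq> V" and w: "C1_on V w"
 shows "integral cube (\<lambda>y. of_real (2 * real m * bump (m - 1) y * y $ i) * w y)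
    = integral cube (\<lambda>y. of_real (bump m y) * partial_deriv i w y)"
proof -
 let ?a = "\<lambda>y. of_real (bump m y) * partial_deriv i w y"
 let ?b = "\<lambda>y. of_real (2 * real m * bump (m - 1) y * y $ i) * w y"
 let ?f = "\<lambda>y. of_real (bump m y) * w y"
 have bz: "bump m y = 0" "bump (m - Suc 0) y = 0" if "norm y \<ge> 1" for y :: "real ^ 'n"
  using that m by (auto intro!: bump_eq_0)
 have ca: "continuous_on UNIV ?a"
  by (rule continuous_on_support[OF V])
   (use w bz in \<open>auto simp: C1_on_def intro!: continuous_intros\<close>)
 have cb: "continuous_on UNIV ?b"
  by (rule continuous_on_support[OF V])
   (use C1_on_cont[OF w] bz in \<open>auto intro!: continuous_intros\<close>)
 have cf: "continuous_on UNIV ?f"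
  by (rule continuous_on_support[OF V])
   (use C1_on_cont[OF w] bz in \<open>auto intro!: continuous_intros\<close>)
 have h0: "integral cube (\<lambda>y. ?a y - ?b y) = 0"
 proof (rule integral_partial_eq_0[where f = ?f and i = i])
  fix y :: "real ^ 'n"
  show "((\<lambda>t. of_real (bump m (y + t *\<^sub>R axis i 1)) * w (y + t *\<^sub>R axis i 1))
      has_vector_derivative (?a y - ?b y)) (at 0)"
  proof (cases "y \<in> V")
   case True
   have "w differentiable (at y)" using w V True unfolding C1_on_def
    by (simp add: differentiable_on_eq_differentiable_at)
   then have 1: "(?f has_derivative
     (\<lambda>h. \<Sum>j\<in>UNIV. of_real (h $ j) * (of_real (bump m y) * partial_deriv j w y
        - of_real (2 * real m * bump (m - 1) y * y $ j) * w y))) (at (y + 0 *\<^sub>R axis i 1))"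
    using partial_deriv_bump_times[OF m] by simp
   have 2: "((\<lambda>t. y + t *\<^sub>R axis i 1) has_derivative (\<lambda>t. t *\<^sub>R axis i 1)) (at (0::real))"
    by (auto intro!: derivative_eq_intros)
   have "((\<lambda>t. ?f (y + t *\<^sub>R axis i 1)) has_derivative
     (\<lambda>t. \<Sum>j\<in>UNIV. of_real ((t *\<^sub>R axis i 1 :: real ^ 'n) $ j) * (of_real (bump m y) * partial_deriv j w y
        - of_real (2 * real m * bump (m - 1) y * y $ j) * w y))) (at 0)"
    by (rule has_derivative_compose[OF 2 1])
   moreover have "(\<Sum>j\<in>UNIV. of_real ((t *\<^sub>R axis i 1 :: real ^ 'n) $ j) * (of_real (bump m y) * partial_deriv j w y
        - of_real (2 * real m * bump (m - 1) y * y $ j) * w y)) = t *\<^sub>R (?a y - ?b y)" for t :: real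
    by (subst sum_of_real_axis) (simp add: scaleR_conv_of_real)
   ultimately show ?thesis unfolding has_vector_derivative_def by simp
  next
   case False
   then have ny: "norm y > 1" using V(2) by (metis linorder_not_less mem_cball_0 subsetD)
   have "open ((\<lambda>t::real. y + t *\<^sub>R axis i 1) -` (- cball 0 1))"
    by (rule open_vimage) (auto intro!: continuous_intros)
   then have "((\<lambda>t. of_real (bump m (y + t *\<^sub>R axis i 1)) * w (y + t *\<^sub>R axis i 1))
      has_vector_derivative 0) (at 0)"
    by (rule has_vector_derivative_transform_within_open[of "\<lambda>_. 0" 0 0, rotated])
      (use ny bz in auto)
   moreover have "?a y - ?b y = 0" using ny bz by simp
   ultimately show ?thesis by simp
  qed
 next
  show "continuous_on UNIV (\<lambda>y. ?a y - ?b y)" by (rule continuous_on_diff[OF ca cb])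
 qed (use cf bz in simp_all)
 have ia: "?a integrable_on cube"
  unfolding cube_def by (rule integrable_continuous[OF continuous_on_subset[OF ca subset_UNIV]])
 have ib: "?b integrable_on cube"
  unfolding cube_def by (rule integrable_continuous[OF continuous_on_subset[OF cb subset_UNIV]])
 have "integral cube ?b = integral cube ?a - integral cube (\<lambda>y. ?a y - ?b y)"
  unfolding Henstock_Kurzweil_Integration.integral_diff[OF ia ib] by (simp only: diff_diff_eq2 add_diff_cancel_left')
 then show ?thesis unfolding h0 diff_zero .
qed

lemma continuous_on_weighted:
 fixes u g :: "real ^ 'n \<Rightarrow> complex" and \<gamma> :: "'b::{t2_space,metric_space} \<Rightarrow> real ^ 'n \<Rightarrow> real ^ 'n"
 assumes u: "continuous_on S u" and g: "continuous_on UNIV g" "\<And>y. norm y \<ge> 1 \<Longrightarrow> g y = 0"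
  and \<gamma>: "continuous_on (U \<times> UNIV) (\<lambda>(t, y). \<gamma> t y)"
  and U: "closed U" and in_S: "\<And>t y. t \<in> U \<Longrightarrow> norm y \<le> 1 \<Longrightarrow> \<gamma> t y \<in> S"
 shows "continuous_on (U \<times> UNIV) (\<lambda>(t, y). g y * u (\<gamma> t y))"
proof -
 have "continuous_on (U \<times> cball 0 1 \<union> U \<times> (- ball 0 1)) (\<lambda>(t, y). g y * u (\<gamma> t y))"
 proof (rule continuous_on_closed_Un)
  have "continuous_on (U \<times> cball 0 1) (\<lambda>(t, y). \<gamma> t y)"
   by (rule continuous_on_subset[OF \<gamma>]) auto
  then show "continuous_on (U \<times> cball 0 1) (\<lambda>(t, y). g y * u (\<gamma> t y))"
   unfolding split_beta using in_S
   by (intro continuous_intros continuous_on_compose2[OF u] continuous_on_compose2[OF g(1)]) auto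
  show "continuous_on (U \<times> (- ball 0 1)) (\<lambda>(t, y). g y * u (\<gamma> t y))"
   by (rule continuous_on_eq[of _ "\<lambda>_. 0"]) (use g(2) in auto)
 qed (use U in \<open>auto intro!: closed_Times\<close>)
 moreover have "U \<times> cball 0 1 \<union> U \<times> (- ball 0 1) = U \<times> (UNIV :: (real ^ 'n) set)" by auto
 ultimately show ?thesis by simp
qed

text \<open>The point \<open>x + t z(y) + r y\<close> covers both uses: \<open>z(y) = y\<close> differentiates a mean with
 respect to its radius, constant \<open>z\<close> with respect to its centre.\<close>

lemma weighted_leibniz:
 fixes u g :: "real ^ 'n \<Rightarrow> complex" and z :: "real ^ 'n \<Rightarrow> real ^ 'n"
 assumes S: "open S" and u: "C1_on S u" and g: "continuous_on UNIV g" "\<And>y. norm y \<ge> 1 \<Longrightarrow> g y = 0"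
  and z: "continuous_on UNIV z" and t0: "t0 \<in> {a..b}"
  and in_S: "\<And>t y. t \<in> {a..b} \<Longrightarrow> norm y \<le> 1 \<Longrightarrow> x + t *\<^sub>R z y + r *\<^sub>R y \<in> S"
 shows "((\<lambda>t. integral cube (\<lambda>y. g y * u (x + t *\<^sub>R z y + r *\<^sub>R y))) has_vector_derivative
   integral cube (\<lambda>y. g y * (\<Sum>i\<in>UNIV. of_real (z y $ i) * partial_deriv i u (x + t0 *\<^sub>R z y + r *\<^sub>R y))))
   (at t0 within {a..b})"
 unfolding cube_def
proof (rule leibniz_rule_vector_derivative)
 let ?w = "\<lambda>t y. x + t *\<^sub>R z y + r *\<^sub>R y"
 have cont: "continuous_on ({a..b} \<times> UNIV) (\<lambda>(t, y). x + t *\<^sub>R z y + r *\<^sub>R y)"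
  unfolding split_beta by (intro continuous_intros continuous_on_compose2[OF z]) auto
 have zi: "continuous_on UNIV (\<lambda>y. z y $ i)" for i
  using z by (intro continuous_intros)
 show "continuous_on ({a..b} \<times> cbox (- 1) 1) (\<lambda>(t, y). g y * (\<Sum>i\<in>UNIV. of_real (z y $ i) *
     partial_deriv i u (?w t y)))"
 proof -
  have "continuous_on ({a..b} \<times> UNIV) (\<lambda>(t, y). (g y * of_real (z y $ i)) *
     partial_deriv i u (?w t y))" for i
   by (rule continuous_on_weighted[of S])
    (use u g in_S cont z in \<open>auto simp: C1_on_def intro!: continuous_intros\<close>)
  then have "continuous_on ({a..b} \<times> UNIV) (\<lambda>p. \<Sum>i\<in>UNIV. (g (snd p) * of_real (z (snd p) $ i)) *
     partial_deriv i u (x + fst p *\<^sub>R z (snd p) + r *\<^sub>R snd p))"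
   by (intro continuous_on_sum) (simp add: split_beta)
  moreover have "(\<lambda>(t, y). g y * (\<Sum>i\<in>UNIV. of_real (z y $ i) *
     partial_deriv i u (?w t y))) =
    (\<lambda>p. \<Sum>i\<in>UNIV. (g (snd p) * of_real (z (snd p) $ i)) *
     partial_deriv i u (x + fst p *\<^sub>R z (snd p) + r *\<^sub>R snd p))"
   by (simp add: fun_eq_iff sum_distrib_left mult.assoc)
  ultimately show ?thesis by (metis (no_types, lifting) continuous_on_subset Sigma_mono order_refl subset_UNIV)
 qed
 show "(\<lambda>y. g y * u (?w t y)) integrable_on cbox (- 1) 1" if "t \<in> {a..b}" for t
 proof (rule integrable_continuous)
  have "continuous_on ({a..b} \<times> UNIV) (\<lambda>(t, y). g y * u (?w t y))"
   by (rule continuous_on_weighted[of S]) (use C1_on_cont[OF u] g in_S cont in auto)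
  then have "continuous_on (cbox (- 1) 1) (\<lambda>y. (\<lambda>(t, y). g y * u (?w t y)) (Pair t y))"
   by (rule continuous_on_compose2[where f = "Pair t"]) (use that in \<open>auto intro!: continuous_intros\<close>)
  then show "continuous_on (cbox (- 1) 1) (\<lambda>y. g y * u (?w t y))"
   by simp
 qed
 fix t y assume t: "t \<in> {a..b}"
 show "((\<lambda>t. g y * u (?w t y)) has_vector_derivative
     g y * (\<Sum>i\<in>UNIV. of_real (z y $ i) * partial_deriv i u (?w t y))) (at t within {a..b})"
 proof (cases "norm y < 1")
  case True
  have "((\<lambda>t. u (?w t y)) has_derivative
    (\<lambda>h. \<Sum>i\<in>UNIV. of_real ((h *\<^sub>R z y) $ i) * partial_deriv i u (?w t y))) (at t within {a..b})"
  proof (rule has_derivative_compose[of "\<lambda>t. x + t *\<^sub>R z y + r *\<^sub>R y", where g = u])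
   show "((\<lambda>t. x + t *\<^sub>R z y + r *\<^sub>R y) has_derivative (\<lambda>h. h *\<^sub>R z y)) (at t within {a..b})"
    by (auto intro!: derivative_eq_intros)
   show "(u has_derivative (\<lambda>h. \<Sum>i\<in>UNIV. of_real (h $ i) * partial_deriv i u (?w t y)))
     (at (?w t y))"
    by (rule C1_on_has_derivative[OF u S in_S]) (use True t in auto)
  qed
  then have "((\<lambda>t. u (?w t y)) has_vector_derivative
    (\<Sum>i\<in>UNIV. of_real (z y $ i) * partial_deriv i u (?w t y))) (at t within {a..b})"
   unfolding has_vector_derivative_def
   unfolding vector_scaleR_component
   by (simp add: sum_distrib_left complex_scaleR mult.assoc)
  then show ?thesis by (rule has_vector_derivative_mult_right)
 qed (use g in auto)
qed (use t0 in auto)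

section \<open>Weighted mean values of harmonic functions\<close>

lemma continuous_on_of_real_bump: "continuous_on UNIV (\<lambda>y. complex_of_real (bump m y))"
 by (intro continuous_intros)

lemma integrable_weighted:
 fixes u g :: "real ^ 'n \<Rightarrow> complex"
 assumes u: "continuous_on S u" and g: "continuous_on UNIV g" "\<And>y. norm y \<ge> 1 \<Longrightarrow> g y = 0"
  and in_S: "\<And>y. norm y \<le> 1 \<Longrightarrow> x + t *\<^sub>R y \<in> S"
 shows "(\<lambda>y. g y * u (x + t *\<^sub>R y)) integrable_on cube"
 unfolding cube_def
proof (rule integrable_continuous)
 have "continuous_on ({0} \<times> UNIV) (\<lambda>(s::real, y). g y * u (x + t *\<^sub>R y))"
  by (rule continuous_on_weighted[OF u g]) (use in_S in \<open>auto simp: split_beta intro!: continuous_intros\<close>)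
 then have "continuous_on (cbox (- 1) 1) (\<lambda>y. (\<lambda>(s::real, y). g y * u (x + t *\<^sub>R y)) (Pair 0 y))"
  by (rule continuous_on_compose2[where f = "Pair 0"]) (auto intro!: continuous_intros)
 then show "continuous_on (cbox (- 1) 1) (\<lambda>y. g y * u (x + t *\<^sub>R y))" by simp
qed

lemma partial_deriv_affine:
 fixes u :: "real ^ 'n \<Rightarrow> complex"
 assumes "u differentiable (at (x + t *\<^sub>R y))"
 shows "((\<lambda>y. u (x + t *\<^sub>R y)) has_derivative
      (\<lambda>h. \<Sum>i\<in>UNIV. of_real ((t *\<^sub>R h) $ i) * partial_deriv i u (x + t *\<^sub>R y))) (at y)"
  and "partial_deriv i (\<lambda>y. u (x + t *\<^sub>R y)) y = of_real t * partial_deriv i u (x + t *\<^sub>R y)"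
proof -
 have 1: "((\<lambda>y. x + t *\<^sub>R y) has_derivative (\<lambda>h. t *\<^sub>R h)) (at y)"
  by (auto intro!: derivative_eq_intros)
 show 2: "((\<lambda>y. u (x + t *\<^sub>R y)) has_derivative
      (\<lambda>h. \<Sum>i\<in>UNIV. of_real ((t *\<^sub>R h) $ i) * partial_deriv i u (x + t *\<^sub>R y))) (at y)"
  by (rule has_derivative_compose[OF 1 differentiable_partials[OF assms]])
 show "partial_deriv i (\<lambda>y. u (x + t *\<^sub>R y)) y = of_real t * partial_deriv i u (x + t *\<^sub>R y)"
  by (subst partial_deriv_eq[OF 2]) (rule sum_of_real_axis)
qed

lemma C1_on_affine:
 assumes "open S" "C1_on S u"
 shows "C1_on {y. x + t *\<^sub>R y \<in> S} (\<lambda>y. u (x + t *\<^sub>R y))"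
 unfolding C1_on_def
proof (intro conjI allI)
 have diff: "u differentiable (at (x + t *\<^sub>R y))" if "x + t *\<^sub>R y \<in> S" for y
  using assms that unfolding C1_on_def by (simp add: differentiable_on_eq_differentiable_at)
 show "(\<lambda>y. u (x + t *\<^sub>R y)) differentiable_on {y. x + t *\<^sub>R y \<in> S}"
  unfolding differentiable_on_def
 proof
  fix y assume "y \<in> {y. x + t *\<^sub>R y \<in> S}"
  then have "(\<lambda>y. u (x + t *\<^sub>R y)) differentiable (at y)"
   by (intro differentiableI[OF partial_deriv_affine(1)[OF diff]]) simp
  then show "(\<lambda>y. u (x + t *\<^sub>R y)) differentiable (at y within {y. x + t *\<^sub>R y \<in> S})"
   by (rule differentiable_at_withinI)
 qed
 fix i
 have "continuous_on {y. x + t *\<^sub>R y \<in> S} (\<lambda>y. of_real t * partial_deriv i u (x + t *\<^sub>R y))"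
  by (rule continuous_on_mult, rule continuous_on_const,
    rule continuous_on_compose2[where g = "partial_deriv i u" and t = S])
    (use assms in \<open>auto simp: C1_on_def intro!: continuous_intros\<close>)
 then show "continuous_on {y. x + t *\<^sub>R y \<in> S} (partial_deriv i (\<lambda>y. u (x + t *\<^sub>R y)))"
  by (rule continuous_on_eq) (use partial_deriv_affine(2)[OF diff] in auto)
qed

lemma open_affine_vimage:
 fixes S :: "(real ^ 'n) set"
 assumes "open S" shows "open {y. x + t *\<^sub>R y \<in> S}"
proof -
 have "open ((\<lambda>y. x + t *\<^sub>R y) -` S)"
  by (rule open_vimage[OF assms]) (intro continuous_intros)
 then show ?thesis by (simp add: vimage_def)
qed

definition laplacian :: "(real ^ 'n \<Rightarrow> complex) \<Rightarrow> real ^ 'n \<Rightarrow> complex" where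
 "laplacian u x = (\<Sum>i\<in>UNIV. partial_deriv i (partial_deriv i u) x)"

lemma bump_weight [simp]:
 "m > 0 \<Longrightarrow> norm y \<ge> 1 \<Longrightarrow> complex_of_real (bump m y) = 0"
 by (simp add: bump_eq_0)

text \<open>The divergence theorem against a radial weight: \<open>y\<^sub>i (1 - |y|\<^sup>2)\<^sup>2\<close> is, up to the factor
 \<open>-6\<close>, the \<open>i\<close>-th derivative of \<open>(1 - |y|\<^sup>2)\<^sup>3\<close>.\<close>

lemma integral_bump_radial:
 fixes w :: "'n \<Rightarrow> real ^ 'n \<Rightarrow> complex"
 assumes V: "open V" "cball 0 1 \<subseteq> V" and w: "\<And>i. C1_on V (w i)"
 shows "integral cube (\<lambda>y. of_real (bump 2 y) * (\<Sum>i\<in>UNIV. of_real (y $ i) * w i y)) =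
   integral cube (\<lambda>y. of_real (bump 3 y) * (\<Sum>i\<in>UNIV. partial_deriv i (w i) y)) / 6"
proof -
 let ?f = "\<lambda>i y. (of_real (bump 2 y) * of_real (y $ i)) * w i y"
 let ?g = "\<lambda>i y. of_real (bump 3 y) * partial_deriv i (w i) y"
 have c: "continuous_on V (w i)" "continuous_on V (partial_deriv i (w i))" for i
  using w[of i] C1_on_cont[OF w[of i]] by (auto simp: C1_on_def)
 have sub: "y \<in> V" if "norm y \<le> 1" for y using V that by auto
 have int1: "(\<lambda>y. ?f i y) integrable_on cube" for i
  using integrable_weighted[of V "w i" "\<lambda>y. of_real (bump 2 y) * of_real (y $ i)" 0 1] c sub
  by (simp add: continuous_intros)
 have int2: "(\<lambda>y. ?g i y) integrable_on cube" for i
  using integrable_weighted[of V "partial_deriv i (w i)" "\<lambda>y. of_real (bump 3 y)" 0 1] c sub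
  by (simp add: continuous_intros)
 have "6 * integral cube (\<lambda>y. ?f i y) =
    integral cube (\<lambda>y. ?g i y)" for i
 proof -
  have "integral cube (\<lambda>y. ?g i y) =
    integral cube (\<lambda>y. of_real (2 * real 3 * bump (3 - 1) y * y $ i) * w i y)"
   by (rule integral_by_parts_bump[symmetric]) (use V w in auto)
  also have "\<dots> = integral cube (\<lambda>y. 6 * (?f i y))"
   by (rule integral_cong) (simp add: mult_ac)
  also have "\<dots> = 6 * integral cube (\<lambda>y. ?f i y)"
   by (rule integral_mult_right)
  finally show ?thesis by simp
 qed
 then have *: "integral cube (\<lambda>y. ?f i y) =
    integral cube (\<lambda>y. ?g i y) / 6" for i
  by (simp add: field_simps)
 have "integral cube (\<lambda>y. of_real (bump 2 y) * (\<Sum>i\<in>UNIV. of_real (y $ i) * w i y)) =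
   integral cube (\<lambda>y. \<Sum>i\<in>UNIV. ?f i y)"
  by (simp add: sum_distrib_left mult.assoc)
 also have "\<dots> = (\<Sum>i\<in>UNIV. integral cube (\<lambda>y. ?f i y))"
  by (rule integral_sum) (use int1 in auto)
 also have "\<dots> = (\<Sum>i\<in>UNIV. integral cube (\<lambda>y. ?g i y)) / 6"
  by (simp add: * sum_divide_distrib)
 also have "(\<Sum>i\<in>UNIV. integral cube (\<lambda>y. ?g i y)) =
   integral cube (\<lambda>y. \<Sum>i\<in>UNIV. ?g i y)"
  by (rule integral_sum[symmetric]) (use int2 in auto)
 also have "\<dots> = integral cube (\<lambda>y. of_real (bump 3 y) * (\<Sum>i\<in>UNIV. partial_deriv i (w i) y))"
  by (simp add: sum_distrib_left)
 finally show ?thesis .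
qed

lemma radial_mean_derivative:
 fixes u :: "real ^ 'n \<Rightarrow> complex"
 assumes S: "open S" and u: "C1_on S u" "\<And>i. C1_on S (partial_deriv i u)"
  and in_S: "\<And>y. norm y \<le> 1 \<Longrightarrow> x + t *\<^sub>R y \<in> S"
 shows "integral cube (\<lambda>y. of_real (bump 2 y) * (\<Sum>i\<in>UNIV. of_real (y $ i) * partial_deriv i u (x + t *\<^sub>R y))) =
   of_real (t / 6) * integral cube (\<lambda>y. of_real (bump 3 y) * laplacian u (x + t *\<^sub>R y))"
proof -
 let ?V = "{y. x + t *\<^sub>R y \<in> S}"
 have V: "cball 0 1 \<subseteq> ?V" using in_S by auto
 have "integral cube (\<lambda>y. of_real (bump 2 y) * (\<Sum>i\<in>UNIV. of_real (y $ i) * partial_deriv i u (x + t *\<^sub>R y))) =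
  integral cube (\<lambda>y. of_real (bump 3 y) * (\<Sum>i\<in>UNIV. partial_deriv i (\<lambda>y. partial_deriv i u (x + t *\<^sub>R y)) y)) / 6"
  by (rule integral_bump_radial[OF open_affine_vimage[OF S] V C1_on_affine[OF S u(2)]])
 also have "integral cube (\<lambda>y. of_real (bump 3 y) * (\<Sum>i\<in>UNIV. partial_deriv i (\<lambda>y. partial_deriv i u (x + t *\<^sub>R y)) y)) =
   integral cube (\<lambda>y. of_real t * (of_real (bump 3 y) * laplacian u (x + t *\<^sub>R y)))"
 proof (rule integral_cong)
  fix y :: "real ^ 'n"
  show "of_real (bump 3 y) * (\<Sum>i\<in>UNIV. partial_deriv i (\<lambda>y. partial_deriv i u (x + t *\<^sub>R y)) y) =
    of_real t * (of_real (bump 3 y) * laplacian u (x + t *\<^sub>R y))"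
  proof (cases "norm y < 1")
   case True
   then have "x + t *\<^sub>R y \<in> S" using in_S by simp
   then have "partial_deriv i u differentiable (at (x + t *\<^sub>R y))" for i
    using u(2)[of i] S unfolding C1_on_def by (simp add: differentiable_on_eq_differentiable_at)
   then show ?thesis
    by (simp add: partial_deriv_affine(2) laplacian_def sum_distrib_left mult_ac)
  qed (simp add: bump_eq_0)
 qed
 also have "\<dots> = of_real t * integral cube (\<lambda>y. of_real (bump 3 y) * laplacian u (x + t *\<^sub>R y))"
  by (rule integral_mult_right)
 finally show ?thesis by simp
qed

definition bump_mass :: "nat \<Rightarrow> 'n::finite itself \<Rightarrow> real" where
 "bump_mass m _ = integral cube (bump m :: real ^ 'n \<Rightarrow> real)"

lemma bump_integrable: "(bump m :: real ^ 'n \<Rightarrow> real) integrable_on cube"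
 unfolding cube_def
 by (rule integrable_continuous) (use continuous_on_bump[OF continuous_on_id] in simp)

lemma bump_mass_pos: "bump_mass m TYPE('n::finite) > 0"
proof -
 have nn: "bump_mass m TYPE('n) \<ge> 0" unfolding bump_mass_def
  by (rule integral_nonneg[OF bump_integrable]) simp
 have "bump_mass m TYPE('n) \<noteq> 0"
 proof
  assume "bump_mass m TYPE('n) = 0"
  then have "((bump m :: real ^ 'n \<Rightarrow> real) has_integral 0) (cbox (-1) 1)"
   using integrable_integral[OF bump_integrable[of m]] unfolding bump_mass_def cube_def by metis
  moreover have "(0 :: real ^ 'n) \<in> box (- 1) 1" by (simp add: mem_box_cart)
  then have "box (- 1) (1 :: real ^ 'n) \<noteq> {}" by blast
  ultimately have "bump m (0 :: real ^ 'n) = 0"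
   by (rule has_integral_0_cbox_imp_0[rotated 2])
     (use continuous_on_bump[OF continuous_on_id] in \<open>auto simp: mem_box_cart\<close>)
  then show False by (simp add: bump_def)
 qed
 then show ?thesis using nn by simp
qed

lemma integral_of_real_bump:
 "integral cube (\<lambda>y :: real ^ 'n. complex_of_real (bump m y) * c) = of_real (bump_mass m TYPE('n)) * c"
proof -
 have "(\<lambda>y :: real ^ 'n. complex_of_real (bump m y) * c) = (\<lambda>y. bump m y *\<^sub>R c)"
  by (simp add: scaleR_conv_of_real)
 moreover have "((\<lambda>y :: real ^ 'n. bump m y *\<^sub>R c) has_integral (bump_mass m TYPE('n)) *\<^sub>R c) cube"
  unfolding bump_mass_def
  by (rule has_integral_scaleR_left[OF integrable_integral[OF bump_integrable]])
 ultimately show ?thesis unfolding scaleR_conv_of_real by (simp only: integral_unique)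
qed

lemma integral_bump_complex:
 "integral cube (\<lambda>y :: real ^ 'n. complex_of_real (bump m y)) = of_real (bump_mass m TYPE('n))"
 using integral_of_real_bump[of m 1] by simp

text \<open>On functions on the unit ball this is equivalent to being harmonic. The exponent \<open>2\<close> makes the
 weight continuously differentiable.\<close>

definition mean_value :: "(real ^ 'n \<Rightarrow> complex) \<Rightarrow> bool" where
 "mean_value u \<longleftrightarrow> continuous_on (ball 0 1) u \<and>
   (\<forall>x r. 0 < r \<longrightarrow> norm x + r < 1 \<longrightarrow>
    integral cube (\<lambda>y. of_real (bump 2 y) * u (x + r *\<^sub>R y)) = of_real (bump_mass 2 TYPE('n)) * u x)"

lemma in_ball_affine:
 assumes "norm x + r < 1" "0 \<le> r" "norm y \<le> (1::real)"
 shows "x + r *\<^sub>R y \<in> ball 0 1"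
proof -
 have "norm (x + r *\<^sub>R y) \<le> norm x + r * norm y" using norm_triangle_ineq[of x "r *\<^sub>R y"] assms by simp
 also have "\<dots> \<le> norm x + r" using assms by (simp add: mult_left_le)
 finally show ?thesis using assms by simp
qed

lemma bump_radial_leibniz:
 fixes u :: "real ^ 'n \<Rightarrow> complex"
 assumes u: "C1_on (ball 0 1) u" and xr: "norm x + r < 1" and t: "t \<in> {0..r}"
 shows "((\<lambda>t. integral cube (\<lambda>y. of_real (bump 2 y) * u (x + t *\<^sub>R y))) has_vector_derivative
   integral cube (\<lambda>y. of_real (bump 2 y) * (\<Sum>i\<in>UNIV. of_real (y $ i) * partial_deriv i u (x + t *\<^sub>R y))))
   (at t within {0..r})"
proof -
 have "x + s *\<^sub>R y + 0 *\<^sub>R y \<in> ball 0 1" if "s \<in> {0..r}" "norm y \<le> 1" for s and y :: "real ^ 'n"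
  using in_ball_affine[of x s y] that xr by simp
 then show ?thesis
  using weighted_leibniz[of "ball 0 1" u "\<lambda>y. of_real (bump 2 y)" "\<lambda>y. y" t 0 r x 0] u t
  by (simp add: continuous_intros)
qed

text \<open>The weighted mean over the ball of radius \<open>t\<close> has derivative zero in \<open>t\<close>, because the derivative
 is a weighted mean of the Laplacian, and it tends to a multiple of \<open>u(x)\<close> as \<open>t \<rightarrow> 0\<close>.\<close>

lemma harmonic_imp_mean_value:
 fixes u :: "real ^ 'n \<Rightarrow> complex"
 assumes "u \<in> harmonic_ball"
 shows "mean_value u"
proof -
 have h: "harmonic_on u (ball 0 1)" using assms by (simp add: harmonic_ball_def)
 have u2: "C1_on (ball 0 1) (partial_deriv i u)" for i
  using h unfolding harmonic_on_def C1_on_def by blast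
 have u1: "C1_on (ball 0 1) u"
  using h C1_on_cont[OF u2] unfolding harmonic_on_def C1_on_def by blast
 have lap: "laplacian u z = 0" if "z \<in> ball 0 1" for z
  using h that unfolding harmonic_on_def laplacian_def by blast
 have "integral cube (\<lambda>y. of_real (bump 2 y) * u (x + r *\<^sub>R y)) = of_real (bump_mass 2 TYPE('n)) * u x"
  if r: "0 < r" "norm x + r < 1" for x r
 proof -
  let ?F = "\<lambda>t. integral cube (\<lambda>y. of_real (bump 2 y) * u (x + t *\<^sub>R y))"
  have "(?F has_derivative (\<lambda>h. 0)) (at t within {0..r})" if t: "t \<in> {0..r}" for t
  proof -
   have in_b: "x + t *\<^sub>R y \<in> ball 0 1" if "norm y \<le> 1" for y
    using in_ball_affine[of x t y] that t r by simp
   have "integral cube (\<lambda>y. of_real (bump 3 y) * laplacian u (x + t *\<^sub>R y)) = integral cube (\<lambda>y :: real ^ 'n. 0)"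
   proof (rule integral_cong)
    fix y :: "real ^ 'n"
    show "of_real (bump 3 y) * laplacian u (x + t *\<^sub>R y) = 0"
     using in_b[of y] lap[of "x + t *\<^sub>R y"] bump_eq_0[of y 3] by (cases "norm y \<le> 1") auto
   qed
   then have "integral cube (\<lambda>y. of_real (bump 2 y) * (\<Sum>i\<in>UNIV. of_real (y $ i) * partial_deriv i u (x + t *\<^sub>R y))) = 0"
    using radial_mean_derivative[OF open_ball u1 u2 in_b] by simp
   then show ?thesis
    using bump_radial_leibniz[OF u1 r(2) t] by (simp add: has_vector_derivative_def)
  qed
  then have "\<exists>c. \<forall>t\<in>{0..r}. ?F t = c"
   by (intro has_derivative_zero_constant) auto
  then obtain c where "\<forall>t\<in>{0..r}. ?F t = c" by blast
  then have Fc: "?F s = c" if "s \<in> {0..r}" for s using that by blast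
  have "?F r = ?F 0" by (rule trans[OF Fc Fc[symmetric]]) (use r(1) in simp_all)
  then show ?thesis by (simp add: integral_of_real_bump integral_bump_complex)
 qed
 then show ?thesis using C1_on_cont[OF u1] unfolding mean_value_def by blast
qed

lemma mean_value_eq:
 fixes u :: "real ^ 'n \<Rightarrow> complex"
 assumes "mean_value u" "0 < r" "norm x + r < 1"
 shows "integral cube (\<lambda>y. of_real (bump 2 y) * u (x + r *\<^sub>R y)) = of_real (bump_mass 2 TYPE('n)) * u x"
 using assms(1)[unfolded mean_value_def, THEN conjunct2, rule_format, OF assms(2,3)] .

text \<open>Substituting \<open>z = x + ry\<close> moves the dependence on \<open>x\<close> from \<open>u\<close> to the weight, which can be
 differentiated; so continuity of \<open>u\<close> suffices for smoothness. Outside a neighbourhood of the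
 point \<open>u\<close> is replaced by a bounded continuous function on the whole space, to have an integrand
 without restrictions on \<open>x\<close>.\<close>

lemma mean_value_local_representation:
 fixes u :: "real ^ 'n \<Rightarrow> complex"
 assumes mv: "mean_value u" and x0: "x0 \<in> ball 0 1"
 obtains r \<Phi> where "r > 0" "ball x0 r \<subseteq> ball 0 1" "C1_on UNIV \<Phi>" "\<And>x. x \<in> ball x0 r \<Longrightarrow> u x = \<Phi> x"
proof -
 define r where "r = (1 - norm x0) / 4"
 have r: "r > 0" using x0 by (simp add: r_def)
 define v where "v z = u (closest_point (cball x0 (2 * r)) z)" for z :: "real ^ 'n"
 have sub: "cball x0 (2 * r) \<subseteq> ball 0 1"
 proof
  fix z assume "z \<in> cball x0 (2 * r)"
  then have "norm z \<le> norm x0 + 2 * r" using norm_triangle_sub[of z x0] by (simp add: dist_norm norm_minus_commute)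
  also have "\<dots> < 1" using x0 by (simp add: r_def field_simps)
  finally show "z \<in> ball 0 1" by simp
 qed
 have cv: "continuous_on UNIV v"
  unfolding v_def
 proof (rule continuous_on_compose2[where g = u and t = "cball x0 (2 * r)"])
  show "continuous_on (cball x0 (2 * r)) u"
   using mv sub continuous_on_subset unfolding mean_value_def by blast
  show "continuous_on UNIV (closest_point (cball x0 (2 * r)))"
   by (rule continuous_on_closest_point) (use r in auto)
  show "closest_point (cball x0 (2 * r)) ` UNIV \<subseteq> cball x0 (2 * r)"
   using r by (auto simp del: mem_cball intro!: closest_point_in_set)
 qed
 have v_eq: "v z = u z" if "z \<in> cball x0 (2 * r)" for z
  unfolding v_def using that by (simp add: closest_point_self)
 define Q where "Q = cbox (x0 - (2 * r) *\<^sub>R 1) (x0 + (2 * r) *\<^sub>R 1)"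
 define f where "f x z = bump 2 ((1 / r) *\<^sub>R (z - x)) *\<^sub>R v z" for x z :: "real ^ 'n"
 define fx where "fx x z = blinfun_scaleR_left (v z) o\<^sub>L
    blinfun_inner_left ((4 / r * bump 1 ((1 / r) *\<^sub>R (z - x))) *\<^sub>R ((1 / r) *\<^sub>R (z - x)))" for x z :: "real ^ 'n"
 define \<Phi>' where "\<Phi>' x = integral Q (f x)" for x
 have cvz: "continuous_on A (\<lambda>x. v (g x))" if "continuous_on A g" for A :: "((real ^ 'n) \<times> (real ^ 'n)) set" and g
  by (rule continuous_on_compose2[OF cv that]) auto
 have fx_cont: "continuous_on (UNIV \<times> Q) (\<lambda>(x, z). fx x z)"
  unfolding fx_def split_beta
  by (intro bounded_bilinear.continuous_on[OF bounded_bilinear_blinfun_compose]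
    bounded_linear.continuous_on[OF bounded_linear_blinfun_scaleR_left]
    bounded_linear.continuous_on[OF bounded_linear_blinfun_inner_left]
    continuous_intros cvz)
 have der: "(\<Phi>' has_derivative blinfun_apply (integral Q (fx x))) (at x)" for x
 proof -
  have "((\<lambda>x. integral Q (f x)) has_derivative blinfun_apply (integral Q (fx x))) (at x within UNIV)"
   unfolding Q_def
  proof (rule leibniz_rule)
   show "continuous_on (UNIV \<times> cbox (x0 - (2 * r) *\<^sub>R 1) (x0 + (2 * r) *\<^sub>R 1)) (\<lambda>(x, z). fx x z)"
    using fx_cont unfolding Q_def .
   show "f x integrable_on cbox (x0 - (2 * r) *\<^sub>R 1) (x0 + (2 * r) *\<^sub>R 1)" for x
    unfolding f_def
    by (intro integrable_continuous continuous_intros continuous_on_subset[OF cv]) auto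
   fix x z :: "real ^ 'n"
   have 1: "((\<lambda>x. (1 / r) *\<^sub>R (z - x)) has_derivative (\<lambda>h. - ((1 / r) *\<^sub>R h))) (at x)"
    by (auto intro!: derivative_eq_intros)
   let ?w = "(1 / r) *\<^sub>R (z - x)"
   have "((\<lambda>x. bump 2 ((1 / r) *\<^sub>R (z - x)) *\<^sub>R v z) has_derivative
     (\<lambda>h. (- (2 * real 2) * bump (2 - 1) ?w * (?w \<bullet> - ((1 / r) *\<^sub>R h))) *\<^sub>R v z)) (at x)"
    by (rule has_derivative_scaleR_left[OF has_derivative_compose[OF 1 bump_has_derivative]]) simp
   moreover have "(- (2 * real 2) * bump (2 - 1) ?w * (?w \<bullet> - ((1 / r) *\<^sub>R h))) *\<^sub>R v z = blinfun_apply (fx x z) h" for h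
   proof -
    obtain w where w: "w = ?w" by blast
    have "(- (2 * real 2) * bump (2 - 1) w * (w \<bullet> - ((1 / r) *\<^sub>R h))) *\<^sub>R v z = blinfun_apply (fx x z) h"
     unfolding fx_def w[symmetric] by (simp add: inner_commute)
    then show ?thesis unfolding w .
   qed
   ultimately show "((\<lambda>x. f x z) has_derivative blinfun_apply (fx x z)) (at x within UNIV)"
    unfolding f_def by simp
  qed auto
  then show ?thesis unfolding \<Phi>'_def .
 qed
 have "continuous_on UNIV (\<lambda>x. integral Q (fx x))"
  using fx_cont unfolding Q_def by (rule integral_continuous_on_param)
 then have c: "continuous_on UNIV (\<lambda>x. blinfun_apply (integral Q (fx x)) h)" for h
  by (intro continuous_intros)
 define c0 where "c0 = (1 / r ^ CARD('n)) / bump_mass 2 TYPE('n)"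
 define \<Phi> where "\<Phi> x = c0 *\<^sub>R \<Phi>' x" for x
 have der2: "(\<Phi> has_derivative (\<lambda>h. c0 *\<^sub>R blinfun_apply (integral Q (fx x)) h)) (at x)" for x
  unfolding \<Phi>_def by (rule has_derivative_scaleR_right[OF der])
 have "C1_on UNIV \<Phi>"
  unfolding C1_on_def
 proof (intro conjI allI)
  show "\<Phi> differentiable_on UNIV"
   using der2 by (auto simp: differentiable_on_def differentiable_def)
  fix i
  show "continuous_on UNIV (partial_deriv i \<Phi>)"
   using c[of "axis i 1"] by (auto simp: partial_deriv_eq[OF der2] intro!: continuous_intros)
 qed
 moreover have "u x = \<Phi> x" if x: "x \<in> ball x0 r" for x
 proof -
  have nx: "norm x + r < 1"
  proof -
   have "norm x \<le> norm x0 + r" using x norm_triangle_sub[of x x0] by (simp add: dist_norm norm_minus_commute)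
   moreover have "4 * r = 1 - norm x0" by (simp add: r_def)
   ultimately show ?thesis using r by linarith
  qed
  have "of_real (bump_mass 2 TYPE('n)) * u x = integral cube (\<lambda>y. of_real (bump 2 y) * u (x + r *\<^sub>R y))"
   by (rule mean_value_eq[OF mv r nx, symmetric])
  also have "\<dots> = integral cube (\<lambda>y. f x (r *\<^sub>R y + x))"
  proof (rule integral_cong)
   fix y :: "real ^ 'n"
   show "of_real (bump 2 y) * u (x + r *\<^sub>R y) = f x (r *\<^sub>R y + x)"
   proof (cases "norm y < 1")
    case True
    have "dist x0 (x + r *\<^sub>R y) \<le> dist x0 x + norm (r *\<^sub>R y)"
     using dist_triangle[of x0 "x + r *\<^sub>R y" x] by (simp add: dist_norm)
    also have "norm (r *\<^sub>R y) \<le> r * 1"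
     using mult_left_mono[of "norm y" 1 r] True r by simp
    also have "dist x0 x + r * 1 \<le> 2 * r" using x by simp
    finally have "x + r *\<^sub>R y \<in> cball x0 (2 * r)" by simp
    then have "v (x + r *\<^sub>R y) = u (x + r *\<^sub>R y)" by (rule v_eq)
    then show ?thesis using r by (simp add: f_def complex_scaleR add.commute)
   qed (use r in \<open>simp add: f_def bump_eq_0\<close>)
  qed
  also have "\<dots> = (1 / r ^ CARD('n)) *\<^sub>R integral (cbox (x - r *\<^sub>R 1) (x + r *\<^sub>R 1)) (f x)"
  proof -
   have "(f x has_integral integral (cbox (x - r *\<^sub>R 1) (x + r *\<^sub>R 1)) (f x)) (cbox (x - r *\<^sub>R 1) (x + r *\<^sub>R 1))"
    unfolding f_def
    by (intro integrable_integral integrable_continuous continuous_intros continuous_on_subset[OF cv]) auto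
   from has_integral_affinity'[OF this r, of x] show ?thesis
    using r by (simp add: cube_def integral_unique divide_inverse)
  qed
  also have "integral (cbox (x - r *\<^sub>R 1) (x + r *\<^sub>R 1)) (f x) = \<Phi>' x"
   unfolding \<Phi>'_def
  proof (rule integral_spike_set)
   have comp: "\<bar>x $ i - x0 $ i\<bar> < r" for i
    using component_le_norm_cart[of "x - x0" i] x by (simp add: dist_norm norm_minus_commute)
   have "cbox (x - r *\<^sub>R 1) (x + r *\<^sub>R 1) \<subseteq> Q"
   proof
    fix z assume "z \<in> cbox (x - r *\<^sub>R 1) (x + r *\<^sub>R 1)"
    then have a: "x $ i - r \<le> z $ i \<and> z $ i \<le> x $ i + r" for i by (simp add: mem_box_cart)
    have "x0 $ i - 2 * r \<le> z $ i \<and> z $ i \<le> x0 $ i + 2 * r" for i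
     using a[of i] comp[of i] by linarith
    then show "z \<in> Q" by (simp add: Q_def mem_box_cart)
   qed
   then show "negligible {z \<in> cbox (x - r *\<^sub>R 1) (x + r *\<^sub>R 1) - Q. f x z \<noteq> 0}"
    by (auto intro!: negligible_subset[OF negligible_empty])
   have "z \<in> cbox (x - r *\<^sub>R 1) (x + r *\<^sub>R 1)" if "f x z \<noteq> 0" for z
   proof -
    have "norm ((1 / r) *\<^sub>R (z - x)) < 1" using that by (metis bump_eq_0 f_def not_le scale_eq_0_iff zero_less_numeral)
    then have "\<bar>1 / r\<bar> * norm (z - x) < 1" unfolding norm_scaleR .
    then have "norm (z - x) < r" using r by (simp add: field_simps)
    then have "\<bar>z $ i - x $ i\<bar> < r" for i using component_le_norm_cart[of "z - x" i] by simp
    then have "x $ i - r \<le> z $ i \<and> z $ i \<le> x $ i + r" for i by (smt (verit))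
    then show ?thesis by (simp add: mem_box_cart)
   qed
   then show "negligible {z \<in> Q - cbox (x - r *\<^sub>R 1) (x + r *\<^sub>R 1). f x z \<noteq> 0}"
    by (auto intro!: negligible_subset[OF negligible_empty])
  qed
  finally have e: "of_real (bump_mass 2 TYPE('n)) * u x = (1 / r ^ CARD('n)) *\<^sub>R \<Phi>' x" .
  have "u x = of_real (1 / bump_mass 2 TYPE('n)) * (of_real (bump_mass 2 TYPE('n)) * u x)"
   using bump_mass_pos[of 2, where 'n='n] by simp
  then show ?thesis unfolding e \<Phi>_def c0_def by (simp add: complex_scaleR)
 qed
 moreover have "ball x0 r \<subseteq> ball 0 1" using sub r by force
 ultimately show ?thesis using that r by blast
qed

lemma mean_value_C1:
 assumes "mean_value u"
 shows "C1_on (ball 0 1) u"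
 unfolding C1_on_def
proof (intro conjI allI)
 have *: "u differentiable (at x) \<and> (\<forall>i. isCont (partial_deriv i u) x)" if x: "x \<in> ball 0 1" for x
 proof -
  obtain r \<Phi> where r: "r > 0" "ball x r \<subseteq> ball 0 1" "C1_on UNIV \<Phi>" "\<And>y. y \<in> ball x r \<Longrightarrow> u y = \<Phi> y"
   using mean_value_local_representation[OF assms x] by metis
  have xr: "x \<in> ball x r" using r by simp
  have "(\<Phi> has_derivative (\<lambda>h. \<Sum>i\<in>UNIV. of_real (h $ i) * partial_deriv i \<Phi> x)) (at x)"
   by (rule C1_on_has_derivative[OF r(3)]) auto
  then have "(u has_derivative (\<lambda>h. \<Sum>i\<in>UNIV. of_real (h $ i) * partial_deriv i \<Phi> x)) (at x)"
   by (rule has_derivative_transform_within_open[OF _ open_ball xr]) (use r in simp)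
  moreover have "isCont (partial_deriv i u) x" for i
  proof -
   have "continuous_on (ball x r) (partial_deriv i \<Phi>)"
    using r(3) continuous_on_subset unfolding C1_on_def by blast
   then have "continuous_on (ball x r) (partial_deriv i u)"
    by (rule continuous_on_eq) (rule partial_deriv_cong[OF open_ball, symmetric], use r in auto)
   then show ?thesis using xr by (simp add: continuous_on_eq_continuous_at)
  qed
  ultimately show ?thesis by (auto simp: differentiable_def)
 qed
 show "u differentiable_on ball 0 1"
  using * by (simp add: differentiable_on_eq_differentiable_at)
 show "continuous_on (ball 0 1) (partial_deriv i u)" for i
  using * by (simp add: continuous_on_eq_continuous_at)
qed

lemma partial_deriv_weighted_mean:
 fixes u g :: "real ^ 'n \<Rightarrow> complex"
 assumes u: "C1_on (ball 0 1) u" and g: "continuous_on UNIV g" "\<And>y. norm y \<ge> 1 \<Longrightarrow> g y = 0"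
  and xr: "norm x + r < 1" "0 \<le> r"
 shows "partial_deriv i (\<lambda>x. integral cube (\<lambda>y. g y * u (x + r *\<^sub>R y))) x =
     integral cube (\<lambda>y. g y * partial_deriv i u (x + r *\<^sub>R y))"
proof -
 define e where "e = (1 - (norm x + r)) / 2"
 have e: "e > 0" "norm x + e + r < 1" using xr by (simp_all add: e_def field_simps)
 have "((\<lambda>t. integral cube (\<lambda>y. g y * u (x + t *\<^sub>R axis i 1 + r *\<^sub>R y))) has_vector_derivative
   integral cube (\<lambda>y. g y * (\<Sum>j\<in>UNIV. of_real ((axis i 1 :: real ^ 'n) $ j) * partial_deriv j u (x + 0 *\<^sub>R axis i 1 + r *\<^sub>R y))))
   (at 0 within {-e..e})"
 proof (rule weighted_leibniz[OF open_ball u g])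
  fix t and y :: "real ^ 'n" assume t: "t \<in> {-e..e}" "norm y \<le> 1"
  have "norm (x + t *\<^sub>R axis i 1) \<le> norm x + e"
   using norm_triangle_ineq[of x "t *\<^sub>R axis i 1"] t by (auto simp: abs_le_iff)
  then show "x + t *\<^sub>R axis i 1 + r *\<^sub>R y \<in> ball 0 1"
   by (intro in_ball_affine) (use e xr t in auto)
 qed (use e in auto)
 moreover have "(\<Sum>j\<in>UNIV. of_real ((axis i 1 :: real ^ 'n) $ j) * c j) = (c i :: complex)" for c
  using sum_of_real_axis[of 1 i c] by simp
 ultimately have "((\<lambda>t. integral cube (\<lambda>y. g y * u (x + t *\<^sub>R axis i 1 + r *\<^sub>R y))) has_vector_derivative
   integral cube (\<lambda>y. g y * partial_deriv i u (x + r *\<^sub>R y))) (at 0 within {-e..e})"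
  by simp
 moreover have "at 0 within {-e..e} = at 0"
  using e by (intro at_within_interior) simp
 ultimately show ?thesis unfolding partial_deriv_def by (simp add: vector_derivative_at)
qed

lemma partial_deriv_cmult:
 assumes "u differentiable (at x)"
 shows "partial_deriv i (\<lambda>x. c * u x) x = c * partial_deriv i u x"
proof -
 have "((\<lambda>x. c * u x) has_derivative (\<lambda>h. c * (\<Sum>i\<in>UNIV. of_real (h $ i) * partial_deriv i u x))) (at x)"
  by (rule has_derivative_mult_right[OF differentiable_partials[OF assms]])
 from partial_deriv_eq[OF this, of i] sum_of_real_axis[of 1 i "\<lambda>j. partial_deriv j u x"]
 show ?thesis by simp
qed

lemma C1_on_differentiable: "C1_on S u \<Longrightarrow> open S \<Longrightarrow> x \<in> S \<Longrightarrow> u differentiable (at x)"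
 unfolding C1_on_def by (simp add: differentiable_on_eq_differentiable_at)

lemma open_norm_less: "open {x :: real ^ 'n. norm x + r < 1}"
 by (intro open_Collect_less continuous_intros)

lemma mean_value_partial:
 fixes u :: "real ^ 'n \<Rightarrow> complex"
 assumes mv: "mean_value u"
 shows "mean_value (partial_deriv i u)"
 unfolding mean_value_def
proof (intro conjI allI impI)
 have C1: "C1_on (ball 0 1) u" by (rule mean_value_C1[OF mv])
 then show "continuous_on (ball 0 1) (partial_deriv i u)" by (simp add: C1_on_def)
 fix x :: "real ^ 'n" and r :: real assume r: "0 < r" "norm x + r < 1"
 have "integral cube (\<lambda>y. of_real (bump 2 y) * partial_deriv i u (x + r *\<^sub>R y)) =
   partial_deriv i (\<lambda>x. integral cube (\<lambda>y. of_real (bump 2 y) * u (x + r *\<^sub>R y))) x"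
  by (rule partial_deriv_weighted_mean[OF C1 continuous_on_of_real_bump _ r(2), symmetric]) (use r in simp_all)
 also have "\<dots> = partial_deriv i (\<lambda>x. of_real (bump_mass 2 TYPE('n)) * u x) x"
  by (rule partial_deriv_cong[OF open_norm_less[of r]]) (use r in simp, rule mean_value_eq[OF mv r(1)], simp)
 also have "\<dots> = of_real (bump_mass 2 TYPE('n)) * partial_deriv i u x"
  by (rule partial_deriv_cmult, rule C1_on_differentiable[OF C1 open_ball]) (use r in simp)
 finally show "integral cube (\<lambda>y. of_real (bump 2 y) * partial_deriv i u (x + r *\<^sub>R y)) =
   of_real (bump_mass 2 TYPE('n)) * partial_deriv i u x" .
qed

text \<open>The formula puts the derivative on the weight. It gives the Cauchy estimate and, as the weight
 does not depend on \<open>x\<close>, the symmetry of second derivatives.\<close>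

lemma mean_value_partial_formula:
 fixes u :: "real ^ 'n \<Rightarrow> complex"
 assumes mv: "mean_value u" and r: "0 < r" "norm x + r < 1"
 shows "partial_deriv i u x = (1 / (of_real (r * bump_mass 2 TYPE('n)))) *
   integral cube (\<lambda>y. of_real (4 * bump 1 y * y $ i) * u (x + r *\<^sub>R y))"
proof -
 have C1: "C1_on (ball 0 1) u" by (rule mean_value_C1[OF mv])
 let ?V = "{y. x + r *\<^sub>R y \<in> ball 0 1}"
 have in_b: "x + r *\<^sub>R y \<in> ball 0 1" if "norm y \<le> 1" for y
  by (rule in_ball_affine) (use r that in auto)
 have V: "open ?V" "cball 0 1 \<subseteq> ?V"
  by (rule open_affine_vimage[OF open_ball]) (use in_b in auto)
 have "integral cube (\<lambda>y. of_real (2 * real 2 * bump (2 - 1) y * y $ i) * u (x + r *\<^sub>R y)) =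
   integral cube (\<lambda>y. of_real (bump 2 y) * partial_deriv i (\<lambda>y. u (x + r *\<^sub>R y)) y)"
  by (rule integral_by_parts_bump[OF _ V C1_on_affine[OF open_ball C1]]) simp
 also have "\<dots> = integral cube (\<lambda>y. of_real r * (of_real (bump 2 y) * partial_deriv i u (x + r *\<^sub>R y)))"
 proof (rule integral_cong)
  fix y :: "real ^ 'n"
  show "of_real (bump 2 y) * partial_deriv i (\<lambda>y. u (x + r *\<^sub>R y)) y =
    of_real r * (of_real (bump 2 y) * partial_deriv i u (x + r *\<^sub>R y))"
  proof (cases "norm y \<le> 1")
   case True
   then have "u differentiable (at (x + r *\<^sub>R y))"
    by (intro C1_on_differentiable[OF C1] in_b) auto
   then show ?thesis by (simp add: partial_deriv_affine(2) mult_ac)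
  qed (simp add: bump_eq_0)
 qed
 also have "\<dots> = of_real r * integral cube (\<lambda>y. of_real (bump 2 y) * partial_deriv i u (x + r *\<^sub>R y))"
  by (rule integral_mult_right)
 also have "\<dots> = of_real r * (of_real (bump_mass 2 TYPE('n)) * partial_deriv i u x)"
  using mean_value_eq[OF mean_value_partial[OF mv] r] by simp
 finally show ?thesis using r bump_mass_pos[of 2, where 'n='n] by (simp add: field_simps)
qed

lemma mean_value_mixed_partials:
 fixes u :: "real ^ 'n \<Rightarrow> complex"
 assumes mv: "mean_value u" and x: "x \<in> ball 0 1"
 shows "partial_deriv j (partial_deriv i u) x = partial_deriv i (partial_deriv j u) x"
proof -
 define r where "r = (1 - norm x) / 2"
 have r: "0 < r" "norm x + r < 1" using x by (simp_all add: r_def field_simps)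
 have C1: "C1_on (ball 0 1) u" by (rule mean_value_C1[OF mv])
 define c where "c = complex_of_real (r * bump_mass 2 TYPE('n))"
 have c: "c \<noteq> 0" using r bump_mass_pos[of 2, where 'n='n] by (simp add: c_def)
 let ?W = "\<lambda>x. integral cube (\<lambda>y. of_real (4 * bump 1 y * y $ i) * u (x + r *\<^sub>R y))"
 have "partial_deriv j ?W x = integral cube (\<lambda>y. of_real (4 * bump 1 y * y $ i) * partial_deriv j u (x + r *\<^sub>R y))"
  by (rule partial_deriv_weighted_mean[OF C1]) (use r in \<open>auto intro!: continuous_intros simp: bump_eq_0\<close>)
 also have "\<dots> = c * partial_deriv i (partial_deriv j u) x"
  using mean_value_partial_formula[OF mean_value_partial[OF mv] r, where i=i] c by (simp add: c_def)
 finally have 1: "partial_deriv j ?W x = c * partial_deriv i (partial_deriv j u) x" .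
 have "partial_deriv j ?W x = partial_deriv j (\<lambda>x. c * partial_deriv i u x) x"
  by (rule partial_deriv_cong[OF open_norm_less[of r]])
    (use r mean_value_partial_formula[OF mv r(1), where i=i] c in \<open>auto simp: c_def\<close>)
 also have "\<dots> = c * partial_deriv j (partial_deriv i u) x"
  by (rule partial_deriv_cmult, rule C1_on_differentiable[OF mean_value_C1[OF mean_value_partial[OF mv]]])
    (use x in auto)
 finally show ?thesis using 1 c by simp
qed

text \<open>The factor \<open>4\<close> bounds \<open>4 y\<^sub>i (1 - |y|\<^sup>2)\<close>, the derivative of the weight up to sign.\<close>

definition cauchy_const :: "'n::finite itself \<Rightarrow> real" where
 "cauchy_const _ = 4 * measure lborel (cube :: (real ^ 'n) set) / bump_mass 2 TYPE('n)"

lemma cauchy_const_nonneg: "cauchy_const TYPE('n::finite) \<ge> 0"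
 unfolding cauchy_const_def using bump_mass_pos[of 2, where 'n='n] by (simp add: cube_def)

lemma mean_value_cauchy_estimate:
 fixes u :: "real ^ 'n \<Rightarrow> complex"
 assumes mv: "mean_value u" and r: "0 < r" "norm x + r < 1"
  and A: "\<And>z. z \<in> cball x r \<Longrightarrow> norm (u z) \<le> A"
 shows "norm (partial_deriv i u x) \<le> cauchy_const TYPE('n) / r * A"
proof -
 have A0: "0 \<le> A" using A[of x] r by (meson norm_ge_zero centre_in_cball less_imp_le order_trans)
 let ?f = "\<lambda>y. of_real (4 * bump 1 y * y $ i) * u (x + r *\<^sub>R y)"
 have bound: "norm (?f y) \<le> 4 * A" for y
 proof (cases "norm y \<le> 1")
  case True
  have "x + r *\<^sub>R y \<in> cball x r" using True r by (simp add: dist_norm mult_left_le)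
  then have 1: "norm (u (x + r *\<^sub>R y)) \<le> A" by (rule A)
  have "\<bar>y $ i\<bar> \<le> 1" using component_le_norm_cart[of y i] True by linarith
  then have "\<bar>bump 1 y\<bar> * \<bar>y $ i\<bar> \<le> 1 * 1"
   by (intro mult_mono) (auto simp: bump_le_1)
  then have "4 * (\<bar>bump 1 y\<bar> * \<bar>y $ i\<bar>) * norm (u (x + r *\<^sub>R y)) \<le> 4 * A"
   using 1 A0 by (intro mult_mono) auto
  then show ?thesis by (simp add: norm_mult abs_mult mult.assoc)
 qed (use A0 in \<open>simp add: bump_eq_0\<close>)
 have "?f integrable_on cube"
 proof (rule integrable_weighted[where S = "ball 0 1"])
  show "continuous_on (ball 0 1) u" using mv by (simp add: mean_value_def)
  show "x + r *\<^sub>R y \<in> ball 0 1" if "norm y \<le> 1" for y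
   by (rule in_ball_affine) (use r that in auto)
 qed (auto simp: bump_eq_0 intro!: continuous_intros)
 then have "norm (integral cube ?f) \<le> 4 * A * measure lborel (cube :: (real ^ 'n) set)"
  unfolding cube_def
  by (intro has_integral_bound[OF _ integrable_integral]) (use A0 bound in auto)
 then have "norm (partial_deriv i u x) \<le> (1 / (r * bump_mass 2 TYPE('n))) * (4 * A * measure lborel (cube :: (real ^ 'n) set))"
  unfolding mean_value_partial_formula[OF mv r] norm_mult
  using r bump_mass_pos[of 2, where 'n='n]
  by (intro mult_mono) (auto simp: norm_divide norm_mult)
 then show ?thesis by (simp add: cauchy_const_def field_simps)
qed

text \<open>The weighted means of the Laplacian vanish for all small radii \<open>t > 0\<close>, hence by continuity for
 \<open>t = 0\<close>, where the mean is a multiple of the Laplacian at \<open>x\<close>.\<close>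

lemma mean_value_imp_harmonic:
 fixes u :: "real ^ 'n \<Rightarrow> complex"
 assumes mv: "mean_value u"
 shows "u \<in> harmonic_ball"
proof -
 have C1: "C1_on (ball 0 1) u" by (rule mean_value_C1[OF mv])
 have C2: "C1_on (ball 0 1) (partial_deriv i u)" for i
  by (rule mean_value_C1[OF mean_value_partial[OF mv]])
 have lap: "laplacian u x = 0" if x: "x \<in> ball 0 1" for x
 proof -
  define r where "r = (1 - norm x) / 2"
  have r: "0 < r" "norm x + r < 1" using x by (simp_all add: r_def field_simps)
  have in_b: "x + t *\<^sub>R y \<in> ball 0 1" if "norm y \<le> 1" "t \<in> {0..r}" for y t
   using in_ball_affine[of x t y] that r by simp
  have cl: "continuous_on (ball 0 1) (laplacian u)"
   unfolding laplacian_def by (intro continuous_on_sum) (use C2 in \<open>auto simp: C1_on_def\<close>)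
  let ?I = "\<lambda>t. integral cube (\<lambda>y. of_real (bump 3 y) * laplacian u (x + t *\<^sub>R y))"
  have cI: "continuous_on {0..r} ?I"
   unfolding cube_def
  proof (rule integral_continuous_on_param)
   have "continuous_on ({0..r} \<times> UNIV) (\<lambda>(t, y). of_real (bump 3 y) * laplacian u (x + t *\<^sub>R y))"
    by (rule continuous_on_weighted[OF cl])
      (use in_b in \<open>auto simp: split_beta bump_eq_0 intro!: continuous_intros\<close>)
   then show "continuous_on ({0..r} \<times> cbox (- 1) 1) (\<lambda>(t, y). of_real (bump 3 y) * laplacian u (x + t *\<^sub>R y))"
    by (rule continuous_on_subset) auto
  qed
  have "?I t = 0" if t: "t \<in> {0<..r}" for t
  proof -
   have t': "t \<in> {0..r}" using t by auto
   let ?F = "\<lambda>t. integral cube (\<lambda>y. of_real (bump 2 y) * u (x + t *\<^sub>R y))"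
   let ?G = "integral cube (\<lambda>y. of_real (bump 2 y) * (\<Sum>i\<in>UNIV. of_real (y $ i) * partial_deriv i u (x + t *\<^sub>R y)))"
   have F: "?F s = of_real (bump_mass 2 TYPE('n)) * u x" if "s \<in> {0..r}" for s
   proof (cases "s = 0")
    case True then show ?thesis by (simp add: integral_of_real_bump integral_bump_complex)
   next
    case False then show ?thesis using that r by (intro mean_value_eq[OF mv]) auto
   qed
   have d1: "(?F has_vector_derivative ?G) (at t within {0..r})"
    by (rule bump_radial_leibniz[OF C1 r(2) t'])
   have "((\<lambda>s. of_real (bump_mass 2 TYPE('n)) * u x) has_vector_derivative ?G) (at t within {0..r})"
    by (rule has_vector_derivative_transform[OF t' _ d1]) (simp add: F)
   moreover have "((\<lambda>s. of_real (bump_mass 2 TYPE('n)) * u x) has_vector_derivative 0) (at t within {0..r})"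
    by simp
   ultimately have "?G = 0"
    by (intro vector_derivative_unique_within_closed_interval[of 0 r t]) (use r t' in auto)
   moreover have "?G = of_real (t / 6) * ?I t"
    by (rule radial_mean_derivative[OF open_ball C1 C2 in_b]) (use t in auto)
   ultimately show ?thesis using t by simp
  qed
  moreover have "closure {0<..r} = {0..r}" using r by (simp add: closure_greaterThanAtMost)
  ultimately have "?I 0 = 0"
   using continuous_constant_on_closure[of "{0<..r}" ?I 0 0] cI r by auto
  then show ?thesis
   using bump_mass_pos[of 3, where 'n='n] by (simp add: integral_of_real_bump integral_bump_complex)
 qed
 show ?thesis
  unfolding harmonic_ball_def harmonic_on_def
  using C1 C2 lap by (auto simp: C1_on_def laplacian_def)
qed

theorem harmonic_ball_iff_mean_value: "u \<in> harmonic_ball \<longleftrightarrow> mean_value u"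
 using harmonic_imp_mean_value mean_value_imp_harmonic by blast

section \<open>Differentials of all orders and Taylor expansion\<close>

lemma mean_value_cont: "mean_value u \<Longrightarrow> continuous_on (ball 0 1) u"
 by (simp add: mean_value_def)

fun diff_form :: "nat \<Rightarrow> (real ^ 'n \<Rightarrow> complex) \<Rightarrow> real ^ 'n \<Rightarrow> real ^ 'n \<Rightarrow> complex" where
 "diff_form 0 u y v = u y"
| "diff_form (Suc k) u y v = (\<Sum>i\<in>UNIV. of_real (v $ i) * diff_form k (partial_deriv i u) y v)"

lemma diff_form_cong:
 assumes "open S" "y \<in> S" "\<And>z. z \<in> S \<Longrightarrow> u z = w z"
 shows "diff_form k u y v = diff_form k w y v"
 using assms(3)
proof (induction k arbitrary: u w)
 case (Suc k)
 have "diff_form k (partial_deriv i u) y v = diff_form k (partial_deriv i w) y v" for i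
  by (rule Suc.IH) (rule partial_deriv_cong[OF assms(1) _ Suc.prems])
 then show ?case by simp
qed (use assms in simp)

lemma partial_deriv_const [simp]: "partial_deriv i (\<lambda>_. c) = (\<lambda>_. 0)"
 unfolding partial_deriv_def by (intro ext vector_derivative_at) simp

lemma diff_form_zero: "diff_form k (\<lambda>_. 0) y v = 0"
 by (induction k) simp_all

lemma diff_form_scale: "diff_form k u y (t *\<^sub>R v) = of_real t ^ k * diff_form k u y v"
proof (induction k arbitrary: u)
 case (Suc k)
 then show ?case by (simp add: sum_distrib_left mult_ac)
qed simp

lemma diff_form_line_derivative:
 assumes mv: "mean_value u" and xt: "x + t *\<^sub>R v \<in> ball 0 1"
 shows "((\<lambda>t. diff_form k u (x + t *\<^sub>R v) v) has_vector_derivative diff_form (Suc k) u (x + t *\<^sub>R v) v) (at t within T)"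
 using mv
proof (induction k arbitrary: u)
 case 0
 have 1: "((\<lambda>t. x + t *\<^sub>R v) has_derivative (\<lambda>h. h *\<^sub>R v)) (at t within T)"
  by (auto intro!: derivative_eq_intros)
 have 2: "(u has_derivative (\<lambda>h. \<Sum>i\<in>UNIV. of_real (h $ i) * partial_deriv i u (x + t *\<^sub>R v))) (at (x + t *\<^sub>R v))"
  by (rule C1_on_has_derivative[OF mean_value_C1[OF 0] open_ball xt])
 have "((\<lambda>t. u (x + t *\<^sub>R v)) has_derivative (\<lambda>h. \<Sum>i\<in>UNIV. of_real ((h *\<^sub>R v) $ i) * partial_deriv i u (x + t *\<^sub>R v))) (at t within T)"
  by (rule has_derivative_compose[OF 1 2])
 moreover have "(\<Sum>i\<in>UNIV. of_real ((h *\<^sub>R v) $ i) * partial_deriv i u (x + t *\<^sub>R v)) =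
   h *\<^sub>R (\<Sum>i\<in>UNIV. of_real (v $ i) * partial_deriv i u (x + t *\<^sub>R v))" for h :: real
  by (simp add: complex_scaleR sum_distrib_left mult.assoc)
 ultimately show ?case by (simp add: has_vector_derivative_def)
next
 case (Suc k)
 have "((\<lambda>t. \<Sum>i\<in>UNIV. of_real (v $ i) * diff_form k (partial_deriv i u) (x + t *\<^sub>R v) v) has_vector_derivative
   (\<Sum>i\<in>UNIV. of_real (v $ i) * diff_form (Suc k) (partial_deriv i u) (x + t *\<^sub>R v) v)) (at t within T)"
  by (intro has_vector_derivative_sum has_vector_derivative_mult_right Suc.IH mean_value_partial Suc.prems)
 then show ?case unfolding diff_form.simps(2)[of "Suc k"] diff_form.simps(2)[of k u] .
qed

text \<open>The Cauchy estimate is applied \<open>k\<close> times, each time on balls of radius \<open>h\<close>, which keeps the centres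
 in the large ball.\<close>

lemma diff_form_bound:
 fixes u :: "real ^ 'n \<Rightarrow> complex"
 assumes "mean_value u" "0 < h" "norm x0 + \<rho> < 1" "\<And>z. z \<in> cball x0 \<rho> \<Longrightarrow> norm (u z) \<le> A"
  and "y \<in> cball x0 (\<rho> - real k * h)" "norm v \<le> 1" "0 \<le> A"
 shows "norm (diff_form k u y v) \<le> (real CARD('n) * cauchy_const TYPE('n) / h) ^ k * A"
 using assms
proof (induction k arbitrary: u A \<rho>)
 case (Suc k)
 let ?C = "cauchy_const TYPE('n)"
 have "norm (of_real (v $ i) * diff_form k (partial_deriv i u) y v) \<le>
    (real CARD('n) * ?C / h) ^ k * (?C / h * A)" for i
 proof -
  have "norm (diff_form k (partial_deriv i u) y v) \<le> (real CARD('n) * ?C / h) ^ k * (?C / h * A)"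
  proof (rule Suc.IH[where \<rho> = "\<rho> - h"])
   show "mean_value (partial_deriv i u)" by (rule mean_value_partial[OF Suc.prems(1)])
   show "norm x0 + (\<rho> - h) < 1" using Suc.prems by simp
   show "y \<in> cball x0 (\<rho> - h - real k * h)" using Suc.prems(5) by (simp add: algebra_simps)
   show "0 \<le> ?C / h * A" using Suc.prems cauchy_const_nonneg[where 'n='n] by simp
   fix z assume z: "z \<in> cball x0 (\<rho> - h)"
   have nz: "norm z + h < 1"
    using z Suc.prems(3) norm_triangle_sub[of z x0] by (simp add: dist_norm norm_minus_commute)
   show "norm (partial_deriv i u z) \<le> ?C / h * A"
   proof (rule mean_value_cauchy_estimate[OF Suc.prems(1,2) nz])
    fix z' assume "z' \<in> cball z h"
    then have "z' \<in> cball x0 \<rho>" using z dist_triangle[of x0 z' z] by simp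
    then show "norm (u z') \<le> A" by (rule Suc.prems(4))
   qed
  qed (use Suc.prems in auto)
  moreover have "\<bar>v $ i\<bar> \<le> 1" using component_le_norm_cart[of v i] Suc.prems by linarith
  ultimately show ?thesis
   using mult_mono[of "\<bar>v $ i\<bar>" 1 "norm (diff_form k (partial_deriv i u) y v)"] by (simp add: norm_mult)
 qed
 then have "norm (diff_form (Suc k) u y v) \<le> (\<Sum>i\<in>(UNIV :: 'n set). (real CARD('n) * ?C / h) ^ k * (?C / h * A))"
  unfolding diff_form.simps by (intro sum_norm_le)
 then show ?case by (simp add: mult_ac)
qed simp

lemma power_self_le_fact: "real k ^ k \<le> exp 1 ^ k * fact k"
proof -
 have "real k ^ k / fact k \<le> exp (real k)"
 proof -
  have "(\<lambda>j. real k ^ j /\<^sub>R fact j) sums exp (real k)" by (rule exp_converges)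
  then have "(\<Sum>j\<in>{k}. real k ^ j /\<^sub>R fact j) \<le> exp (real k)"
   using sum_le_suminf[of "\<lambda>j. real k ^ j /\<^sub>R fact j" "{k}"] by (simp add: sums_iff)
  then show ?thesis by (simp add: divide_inverse mult.commute)
 qed
 also have "exp (real k) = exp 1 ^ k" by (simp add: exp_of_nat_mult[symmetric])
 finally show ?thesis by (simp add: field_simps)
qed

text \<open>With \<open>k\<close> Cauchy estimates on balls of radius \<open>\<rho>/(2k)\<close> the \<open>k\<close>-th differential is bounded by a
 geometric term times \<open>k\<^sup>k \<le> e\<^sup>k k!\<close>; this explains the factor \<open>e\<close>.\<close>

definition taylor_radius :: "'n::finite itself \<Rightarrow> real" where
 "taylor_radius _ = 1 / (4 * exp 1 * (real CARD('n) * cauchy_const TYPE('n) + 1))"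

lemma taylor_radius: "0 < taylor_radius TYPE('n::finite)" "taylor_radius TYPE('n) \<le> 1 / 4"
proof -
 have *: "real CARD('n) * cauchy_const TYPE('n) \<ge> 0" using cauchy_const_nonneg[where 'n='n] by simp
 then show "0 < taylor_radius TYPE('n::finite)" unfolding taylor_radius_def by simp
 have "1 * 1 \<le> exp 1 * (real CARD('n) * cauchy_const TYPE('n) + 1)"
  using * by (intro mult_mono) auto
 then have "4 \<le> 4 * exp 1 * (real CARD('n) * cauchy_const TYPE('n) + 1)" by simp
 then show "taylor_radius TYPE('n) \<le> 1 / 4" unfolding taylor_radius_def by (intro divide_left_mono) auto
qed

lemma diff_form_bound_fact:
 fixes u :: "real ^ 'n \<Rightarrow> complex"
 assumes mv: "mean_value u" and \<rho>: "0 < \<rho>" "norm x0 + \<rho> < 1"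
  and A: "\<And>z. z \<in> cball x0 \<rho> \<Longrightarrow> norm (u z) \<le> A"
  and y: "y \<in> cball x0 (\<rho> / 2)" and v: "norm v \<le> 1"
 shows "norm (diff_form k u y v) \<le> (1 / (2 * taylor_radius TYPE('n) * \<rho>)) ^ k * fact k * A"
proof (cases "k = 0")
 case True
 then show ?thesis using A[of y] y \<rho> by simp
next
 case False
 let ?M = "real CARD('n) * cauchy_const TYPE('n)"
 have M: "?M \<ge> 0" using cauchy_const_nonneg[where 'n='n] by simp
 have A0: "0 \<le> A" using A[of x0] \<rho> by (meson norm_ge_zero centre_in_cball less_imp_le order_trans)
 define h where "h = \<rho> / (2 * real k)"
 have h: "h > 0" "real k * h = \<rho> / 2" using \<rho> False by (simp_all add: h_def)
 have "norm (diff_form k u y v) \<le> (?M / h) ^ k * A"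
  by (rule diff_form_bound[OF mv h(1) \<rho>(2) A _ v A0]) (use y h in auto)
 also have "(?M / h) ^ k = (2 * ?M / \<rho>) ^ k * real k ^ k"
  unfolding h_def by (simp add: power_mult_distrib[symmetric] mult_ac)
 also have "\<dots> * A \<le> ((2 * ?M / \<rho>) ^ k * (exp 1 ^ k * fact k)) * A"
  using M A0 \<rho> by (intro mult_right_mono mult_left_mono power_self_le_fact) auto
 also have "\<dots> = (2 * ?M * exp 1 / \<rho>) ^ k * fact k * A"
  by (simp add: power_mult_distrib[symmetric] mult_ac)
 also have "\<dots> \<le> (1 / (2 * taylor_radius TYPE('n) * \<rho>)) ^ k * fact k * A"
 proof -
  have "2 * ?M * exp 1 / \<rho> \<le> 1 / (2 * taylor_radius TYPE('n) * \<rho>)"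
   using \<rho> unfolding taylor_radius_def by (simp add: field_simps)
  then show ?thesis using M A0 \<rho> by (intro mult_right_mono power_mono) auto
 qed
 finally show ?thesis .
qed

lemma cball_subset_unit_ball:
 assumes "norm x + R < 1"
 shows "cball x R \<subseteq> ball 0 1"
proof
 fix z assume "z \<in> cball x R"
 then show "z \<in> ball 0 1" using assms norm_triangle_sub[of z x] by (simp add: dist_norm norm_minus_commute)
qed

lemma mean_value_bounded_on_cball:
 assumes mv: "mean_value u" and R: "norm x + R < 1"
 obtains B where "\<And>z. z \<in> cball x R \<Longrightarrow> norm (u z) \<le> B"
proof -
 have "bounded (u ` cball x R)"
  by (intro compact_imp_bounded compact_continuous_image compact_cball continuous_on_subset[OF mean_value_cont[OF mv] cball_subset_unit_ball[OF R]])
 then obtain B where B: "\<forall>c\<in>u ` cball x R. norm c \<le> B" unfolding bounded_iff by blast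
 show ?thesis by (rule that[of B]) (use B in blast)
qed

lemma taylor_sums:
 fixes u :: "real ^ 'n \<Rightarrow> complex"
 assumes mv: "mean_value u" and \<rho>: "0 < \<rho>" "norm x0 + \<rho> < 1"
  and w: "norm w \<le> taylor_radius TYPE('n) * \<rho>"
 shows "(\<lambda>k. diff_form k u x0 w / fact k) sums u (x0 + w)"
proof -
 define \<tau> v where "\<tau> = norm w" and "v = w /\<^sub>R norm w"
 have wv: "w = \<tau> *\<^sub>R v" "norm v \<le> 1" by (cases "w = 0"; simp add: \<tau>_def v_def)+
 let ?\<delta> = "taylor_radius TYPE('n)"
 have tau: "0 \<le> \<tau>" "\<tau> \<le> ?\<delta> * \<rho>" using w by (simp_all add: \<tau>_def)
 have \<tau>2: "\<tau> \<le> \<rho> / 2"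
 proof -
  have "?\<delta> * \<rho> \<le> (1 / 4) * \<rho>" using taylor_radius(2)[where 'n='n] \<rho> by (intro mult_right_mono) auto
  then show ?thesis using tau \<rho> by linarith
 qed
 have sub: "cball x0 \<rho> \<subseteq> ball 0 1" by (rule cball_subset_unit_ball[OF \<rho>(2)])
 obtain A where A: "\<And>z. z \<in> cball x0 \<rho> \<Longrightarrow> norm (u z) \<le> A"
  by (rule mean_value_bounded_on_cball[OF mv \<rho>(2)]) (rule that)
 have A0: "0 \<le> A" using A[of x0] \<rho> by (meson norm_ge_zero centre_in_cball less_imp_le order_trans)
 have line: "x0 + t *\<^sub>R v \<in> cball x0 (\<rho> / 2)" if "t \<in> {0..\<tau>}" for t
 proof -
  have "t * norm v \<le> \<rho> / 2 * 1" using that \<tau>2 wv(2) \<rho> by (intro mult_mono) auto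
  then show ?thesis using that by (simp add: dist_norm)
 qed
 have line': "x0 + t *\<^sub>R v \<in> ball 0 1" if "t \<in> {0..\<tau>}" for t
  by (rule subsetD[OF sub]) (use line[OF that] \<rho>(1) in \<open>unfold mem_cball, linarith\<close>)
 have rem: "norm (u (x0 + w) - (\<Sum>k<p. diff_form k u x0 w / fact k)) \<le> real p * (1 / 2) ^ p * A" if p: "p > 0" for p
 proof -
  let ?Df = "\<lambda>k t. diff_form k u (x0 + t *\<^sub>R v) v"
  let ?i = "\<lambda>t. ((\<tau> - t) ^ (p - 1) / fact (p - 1)) *\<^sub>R ?Df p t"
  have int: "(?i has_integral ?Df 0 \<tau> - (\<Sum>i<p. ((\<tau> - 0) ^ i / fact i) *\<^sub>R ?Df i 0)) {0..\<tau>}"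
  proof (rule Taylor_has_integral[OF p _ _ tau(1)])
   show "?Df 0 = ?Df 0" ..
   show "(?Df m has_vector_derivative ?Df (Suc m) t) (at t within {0..\<tau>})" if "m < p" "0 \<le> t" "t \<le> \<tau>" for m t
    by (rule diff_form_line_derivative[OF mv line']) (use that in auto)
  qed
  have eq: "?Df 0 \<tau> - (\<Sum>i<p. ((\<tau> - 0) ^ i / fact i) *\<^sub>R ?Df i 0) = u (x0 + w) - (\<Sum>k<p. diff_form k u x0 w / fact k)"
  proof -
   have "((\<tau> - 0) ^ i / fact i) *\<^sub>R ?Df i 0 = diff_form i u x0 w / fact i" for i
    unfolding wv(1) diff_form_scale by (simp add: complex_scaleR)
   then show ?thesis using wv(1) by simp
  qed
  let ?q = "1 / (2 * ?\<delta> * \<rho>)"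
  have q: "?q > 0" using taylor_radius(1)[where 'n='n] \<rho> by simp
  let ?B = "\<tau> ^ (p - 1) / fact (p - 1) * (?q ^ p * fact p * A)"
  have "norm (u (x0 + w) - (\<Sum>k<p. diff_form k u x0 w / fact k)) \<le> ?B * measure lborel (cbox 0 \<tau>)"
  proof (rule has_integral_bound)
   show "0 \<le> ?B" using tau q A0 by simp
   show "(?i has_integral u (x0 + w) - (\<Sum>k<p. diff_form k u x0 w / fact k)) (cbox 0 \<tau>)"
    using int unfolding eq by simp
   fix t assume t: "t \<in> cbox 0 \<tau>"
   have "norm (?Df p t) \<le> ?q ^ p * fact p * A"
    by (rule diff_form_bound_fact[OF mv \<rho> A line wv(2)]) (use t in auto)
   moreover have "(\<tau> - t) ^ (p - 1) / fact (p - 1) \<le> \<tau> ^ (p - 1) / fact (p - 1)"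
    using t by (intro divide_right_mono power_mono) auto
   moreover have "norm (?i t) = (\<tau> - t) ^ (p - 1) / fact (p - 1) * norm (?Df p t)"
    unfolding norm_scaleR using t by (simp add: abs_of_nonneg)
   moreover have "0 \<le> \<tau> ^ (p - 1) / fact (p - 1)" using tau by simp
   ultimately show "norm (?i t) \<le> ?B"
    by (metis mult_mono norm_ge_zero)
  qed
  also have "?B * measure lborel (cbox 0 \<tau>) = ?B * \<tau>" using tau by simp
  also have "\<dots> = real p * (\<tau> * ?q) ^ p * A"
  proof -
   obtain p' where "p = Suc p'" using p by (cases p) auto
   then show ?thesis by (simp add: power_mult_distrib divide_simps)
  qed
  also have "\<dots> \<le> real p * (1 / 2) ^ p * A"
  proof -
   have "\<tau> * ?q \<le> (?\<delta> * \<rho>) * ?q" using tau q by (intro mult_right_mono) auto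
   also have "\<dots> = 1 / 2" using taylor_radius(1)[where 'n='n] \<rho> by simp
   finally show ?thesis using A0 tau q by (intro mult_right_mono mult_left_mono power_mono) auto
  qed
  finally show ?thesis .
 qed
 have lim0: "(\<lambda>p. real p * (1 / 2) ^ p * A) \<longlonglongrightarrow> 0"
 proof -
  have "(\<lambda>p. real p * (1 / 2) ^ p) = (\<lambda>n. of_nat n / (2 :: real) ^ n)"
   by (simp add: fun_eq_iff power_one_over)
  then have "(\<lambda>p. real p * (1 / 2) ^ p) \<longlonglongrightarrow> 0"
   using lim_n_over_pown[of "2 :: real"] by simp
  then have "(\<lambda>p. real p * (1 / 2) ^ p * A) \<longlonglongrightarrow> 0 * A"
   by (intro tendsto_mult tendsto_const)
  then show ?thesis by simp
 qed
 have "(\<lambda>p. (\<Sum>k<p. diff_form k u x0 w / fact k) - u (x0 + w)) \<longlonglongrightarrow> 0"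
 proof (rule Lim_null_comparison[OF _ lim0])
  show "\<forall>\<^sub>F p in sequentially. norm ((\<Sum>k<p. diff_form k u x0 w / fact k) - u (x0 + w)) \<le> real p * (1 / 2) ^ p * A"
   using eventually_gt_at_top[of 0] by eventually_elim (subst norm_minus_commute, rule rem)
 qed
 then show ?thesis unfolding sums_def by (rule LIM_zero_cancel)
qed

text \<open>If \<open>u\<close> vanishes for \<open>|x| < s\<close>, the Taylor expansions at such points show that it vanishes on a ball
 whose distance to the unit sphere is smaller by a fixed factor. This is iterated.\<close>

lemma mean_value_identity:
 fixes u :: "real ^ 'n \<Rightarrow> complex"
 assumes mv: "mean_value u" and e: "0 < e" and zero: "\<And>x. norm x < e \<Longrightarrow> u x = 0"
  and x: "norm x < 1"
 shows "u x = 0"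
proof -
 let ?\<delta> = "taylor_radius TYPE('n)"
 have step: "u x = 0" if s: "0 < s" "s < 1" and z: "\<And>x. norm x < s \<Longrightarrow> u x = 0" and x: "norm x < s + ?\<delta> * ((1 - s) / 2)" for s x
 proof -
  define \<kappa> where "\<kappa> = ?\<delta> * ((1 - s) / 2)"
  have k: "\<kappa> > 0" using s taylor_radius(1)[where 'n='n] by (simp add: \<kappa>_def)
  define x0 where "x0 = (s / (s + \<kappa>)) *\<^sub>R x"
  have n0: "norm x0 < s"
  proof -
   have "s * norm x < s * (s + \<kappa>)" using x s by (simp add: \<kappa>_def)
   then show ?thesis using s k by (simp add: x0_def field_simps)
  qed
  have nx: "norm (x - x0) \<le> \<kappa>"
  proof -
   have "x - x0 = (1 - s / (s + \<kappa>)) *\<^sub>R x" by (simp add: x0_def scaleR_diff_left)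
   also have "1 - s / (s + \<kappa>) = \<kappa> / (s + \<kappa>)" using s k by (simp add: field_simps)
   finally have e: "norm (x - x0) = \<kappa> / (s + \<kappa>) * norm x" using s k by simp
   have "norm x \<le> s + \<kappa>" using x unfolding \<kappa>_def by (rule less_imp_le)
   then have "\<kappa> * norm x \<le> \<kappa> * (s + \<kappa>)" by (rule mult_left_mono) (use k in simp)
   then show ?thesis unfolding e using s k by (simp add: field_simps)
  qed
  have "(\<lambda>k. diff_form k u x0 (x - x0) / fact k) sums u (x0 + (x - x0))"
   by (rule taylor_sums[OF mv, of "(1 - s) / 2"]) (use s n0 nx in \<open>auto simp: \<kappa>_def field_simps\<close>)
  moreover have "diff_form k u x0 (x - x0) = 0" for k
   using diff_form_cong[of "ball 0 s" x0 u "\<lambda>_. 0" k "x - x0"] n0 z by (simp add: diff_form_zero)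
  ultimately show ?thesis by (simp add: sums_iff)
 qed
 \<comment> \<open>one step multiplies the distance to the unit sphere by at most \<open>\<theta>\<close>\<close>
 define \<theta> where "\<theta> = 1 - ?\<delta> / 2"
 have \<theta>: "0 < \<theta>" "\<theta> < 1" using taylor_radius[where 'n='n] by (auto simp: \<theta>_def)
 define e' where "e' = min e (1 / 2)"
 have e': "0 < e'" "e' < 1" "e' \<le> e" using e by (auto simp: e'_def)
 have iter: "\<forall>x. norm x < 1 - (1 - e') * \<theta> ^ j \<longrightarrow> u x = 0" for j
 proof (induction j)
  case 0
  then show ?case using zero e' by auto
 next
  case (Suc j)
  define s where "s = 1 - (1 - e') * \<theta> ^ j"
  have p: "0 < \<theta> ^ j" "\<theta> ^ j \<le> 1" using \<theta> by (auto intro: power_le_one)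
  have q: "(1 - e') * \<theta> ^ j \<le> 1 - e'" using mult_left_mono[of "\<theta> ^ j" 1 "1 - e'"] e' p by simp
  have "0 < (1 - e') * \<theta> ^ j" using e' p by (intro mult_pos_pos) auto
  then have s2: "s < 1" unfolding s_def by linarith
  have s: "0 < s" using order_le_less_trans[OF q, of 1] e' unfolding s_def by simp
  have "s + ?\<delta> * ((1 - s) / 2) = 1 - (1 - e') * \<theta> ^ Suc j"
   unfolding s_def \<theta>_def by (simp add: algebra_simps)
  then show ?case using step[OF s s2] Suc.IH unfolding s_def by auto
 qed
 have "(\<lambda>j. 1 - (1 - e') * \<theta> ^ j) \<longlonglongrightarrow> 1 - (1 - e') * 0"
  using \<theta> by (intro tendsto_intros LIMSEQ_realpow_zero) auto
 then have "\<forall>\<^sub>F j in sequentially. norm x < 1 - (1 - e') * \<theta> ^ j"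
  using x by (intro order_tendstoD(1)) auto
 then obtain j where "norm x < 1 - (1 - e') * \<theta> ^ j"
  by (meson eventually_happens' sequentially_bot)
 then show ?thesis using iter by blast
qed

lemma finite_mi_size_le: "finite {m :: 'n::finite \<Rightarrow> nat. mi_size m \<le> k}"
proof -
 have "{m :: 'n \<Rightarrow> nat. mi_size m \<le> k} \<subseteq> PiE UNIV (\<lambda>_. {..k})"
 proof
  fix m :: "'n \<Rightarrow> nat" assume m: "m \<in> {m. mi_size m \<le> k}"
  have "m i \<le> mi_size m" for i
   unfolding mi_size_def by (rule member_le_sum) auto
  then show "m \<in> PiE UNIV (\<lambda>_. {..k})" using m by (auto intro: order_trans simp: PiE_def)
 qed
 then show ?thesis by (rule finite_subset) (simp add: finite_PiE)
qed

lemma finite_mi_size_eq: "finite {m :: 'n::finite \<Rightarrow> nat. mi_size m = k}"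
 by (rule finite_subset[OF _ finite_mi_size_le[of k]]) auto

lemma homogeneous_poly_0: "homogeneous_poly 0 (\<lambda>_. c)"
proof -
 have "{m :: 'a \<Rightarrow> nat. mi_size m = 0} = {\<lambda>_. 0}"
  by (auto simp: mi_size_def)
 then show ?thesis unfolding homogeneous_poly_def by (intro exI[of _ "\<lambda>_. c"]) simp
qed

lemma homogeneous_poly_sum:
 assumes "\<And>i. i \<in> I \<Longrightarrow> homogeneous_poly k (P i)"
 shows "homogeneous_poly k (\<lambda>x. \<Sum>i\<in>I. P i x)"
proof -
 have "\<forall>i\<in>I. \<exists>c. \<forall>x. P i x = (\<Sum>m | mi_size m = k. c m * of_real (\<Prod>j\<in>UNIV. (x $ j) ^ m j))"
  using assms unfolding homogeneous_poly_def by blast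
 from bchoice[OF this] obtain c
  where c: "\<And>i x. i \<in> I \<Longrightarrow> P i x = (\<Sum>m | mi_size m = k. c i m * of_real (\<Prod>j\<in>UNIV. (x $ j) ^ m j))"
  by blast
 show ?thesis unfolding homogeneous_poly_def
 proof (intro exI allI)
  fix x
  have "(\<Sum>i\<in>I. P i x) = (\<Sum>i\<in>I. \<Sum>m | mi_size m = k. c i m * of_real (\<Prod>j\<in>UNIV. (x $ j) ^ m j))"
   by (rule sum.cong) (use c in auto)
  also have "\<dots> = (\<Sum>m | mi_size m = k. \<Sum>i\<in>I. c i m * of_real (\<Prod>j\<in>UNIV. (x $ j) ^ m j))"
   by (rule sum.swap)
  finally show "(\<Sum>i\<in>I. P i x) = (\<Sum>m | mi_size m = k. (\<Sum>i\<in>I. c i m) * of_real (\<Prod>j\<in>UNIV. (x $ j) ^ m j))"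
   by (simp add: sum_distrib_right)
 qed
qed

lemma homogeneous_poly_cmult:
 assumes "homogeneous_poly k P"
 shows "homogeneous_poly k (\<lambda>x. a * P x)"
proof -
 obtain c where c: "\<And>x. P x = (\<Sum>m | mi_size m = k. c m * of_real (\<Prod>j\<in>UNIV. (x $ j) ^ m j))"
  using assms unfolding homogeneous_poly_def by metis
 show ?thesis unfolding homogeneous_poly_def
  by (intro exI[of _ "\<lambda>m. a * c m"] allI) (simp add: c sum_distrib_left mult.assoc)
qed

lemma homogeneous_poly_coordinate_mult:
 fixes P :: "real ^ 'n \<Rightarrow> complex"
 assumes "homogeneous_poly k P"
 shows "homogeneous_poly (Suc k) (\<lambda>x. of_real (x $ i) * P x)"
proof -
 obtain c where c: "\<And>x. P x = (\<Sum>m | mi_size m = k. c m * of_real (\<Prod>j\<in>UNIV. (x $ j) ^ m j))"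
  using assms unfolding homogeneous_poly_def by metis
 let ?up = "\<lambda>m :: 'n \<Rightarrow> nat. m(i := Suc (m i))"
 have size: "mi_size (?up m) = Suc (mi_size m)" for m
  unfolding mi_size_def by (subst (1 2) sum.remove[of _ i]) auto
 have inj: "inj_on ?up S" for S
  by (rule inj_onI) (metis fun_upd_same fun_upd_triv fun_upd_upd nat.inject)
 define c' where "c' m = (if m i > 0 then c (m(i := m i - 1)) else 0)" for m
 have mono: "of_real (x $ i) * of_real (\<Prod>j\<in>UNIV. (x $ j) ^ m j) = (of_real (\<Prod>j\<in>UNIV. (x $ j) ^ (?up m) j) :: complex)" for x m
 proof -
  have "(\<Prod>j\<in>UNIV. (x $ j) ^ (?up m) j) = (x $ i) ^ Suc (m i) * (\<Prod>j\<in>UNIV - {i}. (x $ j) ^ m j)"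
   by (subst prod.remove[of _ i]) auto
  also have "\<dots> = x $ i * (\<Prod>j\<in>UNIV. (x $ j) ^ m j)"
   by (subst prod.remove[of UNIV i "\<lambda>j. (x $ j) ^ m j"]) auto
  finally show ?thesis by simp
 qed
 show ?thesis unfolding homogeneous_poly_def
 proof (intro exI allI)
  fix x
  have "of_real (x $ i) * P x = (\<Sum>m | mi_size m = k. c' (?up m) * of_real (\<Prod>j\<in>UNIV. (x $ j) ^ (?up m) j))"
   unfolding c sum_distrib_left mono[symmetric] by (rule sum.cong) (auto simp: c'_def mult_ac)
  also have "\<dots> = (\<Sum>m\<in>?up ` {m. mi_size m = k}. c' m * of_real (\<Prod>j\<in>UNIV. (x $ j) ^ m j))"
   by (subst sum.reindex[OF inj]) (simp add: o_def)
  also have "\<dots> = (\<Sum>m | mi_size m = Suc k. c' m * of_real (\<Prod>j\<in>UNIV. (x $ j) ^ m j))"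
  proof (rule sum.mono_neutral_left)
   show "?up ` {m. mi_size m = k} \<subseteq> {m. mi_size m = Suc k}" using size by auto
   show "\<forall>m\<in>{m. mi_size m = Suc k} - ?up ` {m. mi_size m = k}. c' m * of_real (\<Prod>j\<in>UNIV. (x $ j) ^ m j) = 0"
   proof
    fix m assume m: "m \<in> {m. mi_size m = Suc k} - ?up ` {m. mi_size m = k}"
    have "m i = 0"
    proof (rule ccontr)
     assume "m i \<noteq> 0"
     then have up: "?up (m(i := m i - 1)) = m" by auto
     then have "mi_size (m(i := m i - 1)) = k" using m size[of "m(i := m i - 1)"] by auto
     then show False using m up by (metis (mono_tags, lifting) DiffD2 imageI mem_Collect_eq)
    qed
    then show "c' m * of_real (\<Prod>j\<in>UNIV. (x $ j) ^ m j) = 0" by (simp add: c'_def)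
   qed
  qed (rule finite_mi_size_eq)
  finally show "of_real (x $ i) * P x = (\<Sum>m | mi_size m = Suc k. c' m * of_real (\<Prod>j\<in>UNIV. (x $ j) ^ m j))" .
 qed
qed

lemma homogeneous_poly_scale:
 assumes "homogeneous_poly k P"
 shows "P (t *\<^sub>R x) = of_real t ^ k * P x"
proof -
 obtain c where c: "\<And>x. P x = (\<Sum>m | mi_size m = k. c m * of_real (\<Prod>j\<in>UNIV. (x $ j) ^ m j))"
  using assms unfolding homogeneous_poly_def by metis
 have "(\<Prod>j\<in>UNIV. ((t *\<^sub>R x) $ j) ^ m j) = t ^ mi_size m * (\<Prod>j\<in>UNIV. (x $ j) ^ m j)" for m
  by (simp add: power_mult_distrib prod.distrib mi_size_def power_sum)
 then show ?thesis unfolding c by (auto simp: sum_distrib_left mult_ac intro!: sum.cong)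
qed

lemma homogeneous_poly_diff_form: "homogeneous_poly k (diff_form k u y)"
proof (induction k arbitrary: u)
 case 0
 have "diff_form 0 u y = (\<lambda>_. u y)" by auto
 show ?case unfolding \<open>diff_form 0 u y = (\<lambda>_. u y)\<close> by (rule homogeneous_poly_0)
next
 case (Suc k)
 have eq: "diff_form (Suc k) u y = (\<lambda>v. \<Sum>i\<in>UNIV. of_real (v $ i) * diff_form k (partial_deriv i u) y v)" by auto
 show ?case unfolding eq by (intro homogeneous_poly_sum homogeneous_poly_coordinate_mult Suc.IH)
qed

lemma mean_value_mixed_diff_form:
 assumes "mean_value u" "y \<in> ball 0 1"
 shows "diff_form k (partial_deriv i (partial_deriv j u)) y v = diff_form k (partial_deriv j (partial_deriv i u)) y v"
 by (rule diff_form_cong[OF open_ball assms(2)]) (rule mean_value_mixed_partials[OF assms(1)])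

lemma diff_form_has_derivative:
 assumes "mean_value u" and y: "y \<in> ball 0 1"
 shows "(diff_form (Suc k) u y has_derivative
   (\<lambda>h. \<Sum>j\<in>UNIV. of_real (h $ j) * (of_nat (Suc k) * diff_form k (partial_deriv j u) y v))) (at v)"
 using assms(1)
proof (induction k arbitrary: u)
 case 0
 have "((\<lambda>v. \<Sum>i\<in>UNIV. of_real (v $ i) * partial_deriv i u y) has_derivative
    (\<lambda>h. \<Sum>i\<in>UNIV. of_real (h $ i) * partial_deriv i u y)) (at v)"
  by (intro bounded_linear_imp_has_derivative bounded_linear_intros bounded_linear_vec_nth
    bounded_linear_compose[OF bounded_linear_of_real])
 moreover have "diff_form (Suc 0) u y = (\<lambda>v. \<Sum>i\<in>UNIV. of_real (v $ i) * partial_deriv i u y)" by auto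
 ultimately show ?case by simp
next
 case (Suc k)
 let ?D = "\<lambda>i h. \<Sum>j\<in>UNIV. of_real (h $ j) * (of_nat (Suc k) * diff_form k (partial_deriv j (partial_deriv i u)) y v)"
 have coord: "((\<lambda>v. complex_of_real (v $ i)) has_derivative (\<lambda>h. of_real (h $ i))) (at v)" for i
  by (intro bounded_linear_imp_has_derivative bounded_linear_compose[OF bounded_linear_of_real] bounded_linear_vec_nth)
 have "((\<lambda>v. \<Sum>i\<in>UNIV. of_real (v $ i) * diff_form (Suc k) (partial_deriv i u) y v) has_derivative
   (\<lambda>h. \<Sum>i\<in>UNIV. of_real (v $ i) * ?D i h + of_real (h $ i) * diff_form (Suc k) (partial_deriv i u) y v)) (at v)"
  by (intro has_derivative_sum has_derivative_mult[OF coord] Suc.IH mean_value_partial Suc.prems)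
 moreover have "(\<lambda>h. \<Sum>i\<in>UNIV. of_real (v $ i) * ?D i h + of_real (h $ i) * diff_form (Suc k) (partial_deriv i u) y v) =
  (\<lambda>h. \<Sum>j\<in>UNIV. of_real (h $ j) * (of_nat (Suc (Suc k)) * diff_form (Suc k) (partial_deriv j u) y v))"
 proof
  fix h
  have "(\<Sum>i\<in>UNIV. of_real (v $ i) * ?D i h) =
    (\<Sum>i\<in>UNIV. \<Sum>j\<in>UNIV. of_real (v $ i) * (of_real (h $ j) * (of_nat (Suc k) * diff_form k (partial_deriv j (partial_deriv i u)) y v)))"
   by (simp only: sum_distrib_left)
  also have "\<dots> = (\<Sum>j\<in>UNIV. \<Sum>i\<in>UNIV. of_real (v $ i) * (of_real (h $ j) * (of_nat (Suc k) * diff_form k (partial_deriv j (partial_deriv i u)) y v)))"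
   by (rule sum.swap)
  also have "\<dots> = (\<Sum>j\<in>UNIV. of_real (h $ j) * (of_nat (Suc k) * diff_form (Suc k) (partial_deriv j u) y v))"
   unfolding diff_form.simps(2)[of k] sum_distrib_left
   by (intro sum.cong refl) (subst mean_value_mixed_diff_form[OF Suc.prems y], simp only: mult_ac)
  finally have *: "(\<Sum>i\<in>UNIV. of_real (v $ i) * ?D i h) = (\<Sum>j\<in>UNIV. of_real (h $ j) * (of_nat (Suc k) * diff_form (Suc k) (partial_deriv j u) y v))" .
  show "(\<Sum>i\<in>UNIV. of_real (v $ i) * ?D i h + of_real (h $ i) * diff_form (Suc k) (partial_deriv i u) y v) =
    (\<Sum>j\<in>UNIV. of_real (h $ j) * (of_nat (Suc (Suc k)) * diff_form (Suc k) (partial_deriv j u) y v))"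
   unfolding sum.distrib * unfolding sum.distrib[symmetric]
   by (intro sum.cong refl) (simp only: of_nat_Suc[of "Suc k"] distrib_left distrib_right mult_1_left mult_1_right add.commute)
 qed
 moreover have "diff_form (Suc (Suc k)) u y = (\<lambda>v. \<Sum>i\<in>UNIV. of_real (v $ i) * diff_form (Suc k) (partial_deriv i u) y v)" by auto
 ultimately show ?case by simp
qed

lemma partial_deriv_diff_form:
 assumes "mean_value u" "y \<in> ball 0 1"
 shows "partial_deriv j (diff_form (Suc k) u y) = (\<lambda>v. of_nat (Suc k) * diff_form k (partial_deriv j u) y v)"
proof
 fix v
 have "partial_deriv j (diff_form (Suc k) u y) v =
  (\<Sum>i\<in>UNIV. of_real ((1 *\<^sub>R axis j 1) $ i) * (of_nat (Suc k) * diff_form k (partial_deriv i u) y v))"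
  by (subst partial_deriv_eq[OF diff_form_has_derivative[OF assms]]) simp
 also have "\<dots> = of_nat (Suc k) * diff_form k (partial_deriv j u) y v"
  by (subst sum_of_real_axis) simp
 finally show "partial_deriv j (diff_form (Suc k) u y) v = of_nat (Suc k) * diff_form k (partial_deriv j u) y v" .
qed

lemma diff_form_differentiable:
 assumes "mean_value u" "y \<in> ball 0 1"
 shows "diff_form k u y differentiable (at v)"
proof (cases k)
 case 0
 then have "diff_form k u y = (\<lambda>_. u y)" by auto
 then show ?thesis by simp
next
 case (Suc k')
 then show ?thesis using diff_form_has_derivative[OF assms] by (auto simp: differentiable_def)
qed

lemma partial_deriv_sum:
 assumes "\<And>i. i \<in> I \<Longrightarrow> f i differentiable (at x)"
 shows "partial_deriv j (\<lambda>x. \<Sum>i\<in>I. f i x) x = (\<Sum>i\<in>I. partial_deriv j (f i) x)"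
proof -
 have "((\<lambda>x. \<Sum>i\<in>I. f i x) has_derivative (\<lambda>h. \<Sum>i\<in>I. \<Sum>l\<in>UNIV. of_real (h $ l) * partial_deriv l (f i) x)) (at x)"
  by (intro has_derivative_sum differentiable_partials assms)
 from partial_deriv_eq[OF this, of j] show ?thesis
  using sum_of_real_axis[of 1 j] by simp
qed

lemma diff_form_sum_zero:
 fixes f :: "'b \<Rightarrow> real ^ 'n \<Rightarrow> complex"
 assumes "\<And>i. i \<in> I \<Longrightarrow> mean_value (f i)" "\<And>z. z \<in> ball 0 1 \<Longrightarrow> (\<Sum>i\<in>I. f i z) = 0" "y \<in> ball 0 1"
 shows "(\<Sum>i\<in>I. diff_form k (f i) y v) = 0"
 using assms(1,2)
proof (induction k arbitrary: f)
 case 0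
 then show ?case using assms(3) by simp
next
 case (Suc k)
 have "(\<Sum>i\<in>I. partial_deriv j (f i) z) = 0" if z: "z \<in> ball 0 1" for j z
 proof -
  have "(\<Sum>i\<in>I. partial_deriv j (f i) z) = partial_deriv j (\<lambda>x. \<Sum>i\<in>I. f i x) z"
   by (rule partial_deriv_sum[symmetric]) (rule C1_on_differentiable[OF mean_value_C1[OF Suc.prems(1)] open_ball z])
  also have "\<dots> = partial_deriv j (\<lambda>x. 0) z"
   by (rule partial_deriv_cong[OF open_ball z]) (rule Suc.prems(2))
  finally show ?thesis by simp
 qed
 then have "(\<Sum>i\<in>I. diff_form k (partial_deriv j (f i)) y v) = 0" for j
  by (intro Suc.IH mean_value_partial Suc.prems)
 then have "(\<Sum>j\<in>UNIV. of_real (v $ j) * (\<Sum>i\<in>I. diff_form k (partial_deriv j (f i)) y v)) = 0" by simp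
 then show ?case unfolding diff_form.simps sum_distrib_left by (subst sum.swap)
qed

lemma mean_value_laplacian:
 assumes "mean_value u" "x \<in> ball 0 1"
 shows "(\<Sum>i\<in>UNIV. partial_deriv i (partial_deriv i u) x) = 0"
 using mean_value_imp_harmonic[OF assms(1)] assms(2) by (simp add: harmonic_ball_def harmonic_on_def)

text \<open>The Laplacian in \<open>v\<close> of the \<open>k\<close>-th differential is \<open>k(k-1)\<close> times the \<open>(k-2)\<close>-th differential of the
 Laplacian of \<open>u\<close>.\<close>

lemma harmonic_on_diff_form:
 assumes mv: "mean_value u" and y: "y \<in> ball 0 1"
 shows "harmonic_on (diff_form k u y) UNIV"
proof -
 have pd: "\<exists>c w. mean_value w \<and> partial_deriv i (diff_form k u y) = (\<lambda>v. c * diff_form (k - 1) w y v)" for i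
 proof (cases k)
  case 0
  then have "diff_form k u y = (\<lambda>_. u y)" by auto
  then show ?thesis using mv by (intro exI[of _ 0] exI[of _ u]) simp
 next
  case (Suc k')
  then show ?thesis using partial_deriv_diff_form[OF mv y] mean_value_partial[OF mv] by (metis diff_Suc_1)
 qed
 have pdd: "\<exists>c w. mean_value w \<and> partial_deriv j (partial_deriv i (diff_form k u y)) = (\<lambda>v. c * diff_form (k - 2) w y v)" for i j
 proof -
  obtain c w where w: "mean_value w" "partial_deriv i (diff_form k u y) = (\<lambda>v. c * diff_form (k - 1) w y v)" using pd by blast
  have e: "partial_deriv j (\<lambda>v. c * diff_form (k - 1) w y v) = (\<lambda>v. c * partial_deriv j (diff_form (k - 1) w y) v)"
   by (rule ext) (rule partial_deriv_cmult[OF diff_form_differentiable[OF w(1) y]])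
  show ?thesis
  proof (cases "k - 1")
   case 0
   then have "diff_form (k - 1) w y = (\<lambda>_. w y)" by auto
   then show ?thesis unfolding w(2) e using mv by (intro exI[of _ 0] exI[of _ u]) simp
  next
   case (Suc k')
   then have "k - 2 = k'" by simp
   then show ?thesis unfolding w(2) e using Suc partial_deriv_diff_form[OF w(1) y, of j k'] mean_value_partial[OF w(1), of j]
    by (intro exI[of _ "c * of_nat (Suc k')"] exI[of _ "partial_deriv j w"]) (simp add: mult.assoc)
  qed
 qed
 have lap: "(\<Sum>i\<in>UNIV. partial_deriv i (partial_deriv i (diff_form k u y)) v) = 0" for v
 proof -
  consider "k = 0" | "k = Suc 0" | k' where "k = Suc (Suc k')" by (metis not0_implies_Suc)
  then show ?thesis
  proof cases
   case 1
   then have "diff_form k u y = (\<lambda>_. u y)" by auto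
   then show ?thesis by simp
  next
   case 2
   have "partial_deriv i (diff_form k u y) = (\<lambda>v. partial_deriv i u y)" for i
    using 2 partial_deriv_diff_form[OF mv y, of i 0] by simp
   then show ?thesis by simp
  next
   case 3
   have "partial_deriv i (partial_deriv i (diff_form k u y)) v = of_nat (Suc (Suc k')) * (of_nat (Suc k') * diff_form k' (partial_deriv i (partial_deriv i u)) y v)" for i
    unfolding 3 partial_deriv_diff_form[OF mv y]
    by (subst partial_deriv_cmult[OF diff_form_differentiable[OF mean_value_partial[OF mv] y]])
      (simp only: partial_deriv_diff_form[OF mean_value_partial[OF mv] y])
   then have "(\<Sum>i\<in>UNIV. partial_deriv i (partial_deriv i (diff_form k u y)) v) =
    of_nat (Suc (Suc k')) * (of_nat (Suc k') * (\<Sum>i\<in>UNIV. diff_form k' (partial_deriv i (partial_deriv i u)) y v))"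
    by (simp only: sum_distrib_left)
   also have "(\<Sum>i\<in>UNIV. diff_form k' (partial_deriv i (partial_deriv i u)) y v) = 0"
    by (rule diff_form_sum_zero[OF mean_value_partial[OF mean_value_partial[OF mv]] mean_value_laplacian[OF mv] y])
   finally show ?thesis by simp
  qed
 qed
 have dcm: "(\<lambda>v. c * diff_form l w y v) differentiable (at v)" if "mean_value w" for c l w v
  using diff_form_differentiable[OF that y] by (intro derivative_intros) auto
 show ?thesis unfolding harmonic_on_def
 proof (intro conjI allI ballI)
  show "diff_form k u y differentiable_on UNIV"
   using diff_form_differentiable[OF mv y] by (simp add: differentiable_on_def)
  show "partial_deriv i (diff_form k u y) differentiable_on UNIV" for i
   using pd[of i] dcm by (auto simp: differentiable_on_def)
  show "continuous_on UNIV (partial_deriv i (partial_deriv j (diff_form k u y)))" for i j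
   using pdd[where i=j and j=i] dcm by (auto simp: differentiable_on_def intro!: differentiable_imp_continuous_on)
  show "(\<Sum>i\<in>UNIV. partial_deriv i (partial_deriv i (diff_form k u y)) x) = 0" for x by (rule lap)
 qed
qed

lemma harmonic_on_subset:
 assumes "harmonic_on u T" "S \<subseteq> T"
 shows "harmonic_on u S"
 using assms unfolding harmonic_on_def
 by (meson continuous_on_subset differentiable_on_subset subsetD)

section \<open>The homogeneous parts of a harmonic function\<close>

lemma mean_value_const: "mean_value (\<lambda>_. c)"
 unfolding mean_value_def by (simp add: integral_of_real_bump integral_bump_complex)

lemma mean_value_integrable:
 fixes u g :: "real ^ 'n \<Rightarrow> complex"
 assumes u: "continuous_on (ball 0 1) u" and g: "continuous_on UNIV g" "\<And>y. norm y \<ge> 1 \<Longrightarrow> g y = 0"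
  and r: "0 \<le> r" "norm x + r < 1"
 shows "(\<lambda>y. g y * u (x + r *\<^sub>R y)) integrable_on cube"
 by (rule integrable_weighted[OF u g]) (use r in_ball_affine in blast)+

lemma mean_value_linear:
 fixes u w :: "real ^ 'n \<Rightarrow> complex"
 assumes u: "mean_value u" and w: "mean_value w"
 shows "mean_value (\<lambda>x. a * u x + b * w x)"
 unfolding mean_value_def
proof (intro conjI allI impI)
 show "continuous_on (ball 0 1) (\<lambda>x. a * u x + b * w x)"
  using mean_value_cont[OF u] mean_value_cont[OF w] by (intro continuous_intros)
 fix x :: "real ^ 'n" and r :: real assume r: "0 < r" "norm x + r < 1"
 have i: "(\<lambda>y. of_real (bump 2 y) * f (x + r *\<^sub>R y)) integrable_on cube" if "mean_value f" for f
  by (rule mean_value_integrable[OF mean_value_cont[OF that] continuous_on_of_real_bump]) (use r in auto)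
 have "integral cube (\<lambda>y. of_real (bump 2 y) * (a * u (x + r *\<^sub>R y) + b * w (x + r *\<^sub>R y))) =
  integral cube (\<lambda>y. a * (of_real (bump 2 y) * u (x + r *\<^sub>R y)) + b * (of_real (bump 2 y) * w (x + r *\<^sub>R y)))"
  by (rule integral_cong) (simp add: algebra_simps)
 also have "\<dots> = integral cube (\<lambda>y. a * (of_real (bump 2 y) * u (x + r *\<^sub>R y))) +
   integral cube (\<lambda>y. b * (of_real (bump 2 y) * w (x + r *\<^sub>R y)))"
  by (rule Henstock_Kurzweil_Integration.integral_add) (intro integrable_on_mult_right i u w)+
 also have "\<dots> = of_real (bump_mass 2 TYPE('n)) * (a * u x + b * w x)"
  using mean_value_eq[OF u r] mean_value_eq[OF w r] by (simp add: algebra_simps)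
 finally show "integral cube (\<lambda>y. of_real (bump 2 y) * (a * u (x + r *\<^sub>R y) + b * w (x + r *\<^sub>R y))) =
   of_real (bump_mass 2 TYPE('n)) * (a * u x + b * w x)" .
qed

lemma mean_value_cmult: "mean_value u \<Longrightarrow> mean_value (\<lambda>x. a * u x)"
 using mean_value_linear[of u u a 0] by simp

lemma mean_value_diff: "mean_value u \<Longrightarrow> mean_value w \<Longrightarrow> mean_value (\<lambda>x. u x - w x)"
 using mean_value_linear[of u w 1 "-1"] by simp

lemma mean_value_add: "mean_value u \<Longrightarrow> mean_value w \<Longrightarrow> mean_value (\<lambda>x. u x + w x)"
 using mean_value_linear[of u w 1 1] by simp

lemma mean_value_sum:
 assumes "\<And>i. i \<in> I \<Longrightarrow> mean_value (f i)"
 shows "mean_value (\<lambda>x. \<Sum>i\<in>I. f i x)"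
proof (cases "finite I")
 case True
 then show ?thesis using assms
  by (induction I) (simp_all add: mean_value_const mean_value_add)
qed (simp add: mean_value_const)

lemma uniform_limit_integral_cube:
 fixes f :: "nat \<Rightarrow> real ^ 'n \<Rightarrow> complex"
 assumes lim: "uniform_limit cube f g sequentially" and c: "\<And>n. continuous_on cube (f n)"
 shows "(\<lambda>n. integral cube (f n)) \<longlonglongrightarrow> integral cube g"
proof (rule uniform_limit_integral_cbox[OF lim[unfolded cube_def] c[unfolded cube_def] trivial_limit_sequentially])
 fix I J assume I: "\<And>n. (f n has_integral I n) (cbox (- 1) 1)" and J: "(g has_integral J) (cbox (- 1) 1)" "I \<longlonglongrightarrow> J"
 have "I = (\<lambda>n. integral cube (f n))" unfolding cube_def by (rule ext) (rule integral_unique[OF I, symmetric])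
 then show ?thesis using J by (simp add: cube_def integral_unique)
qed

lemma uniform_limit_bump_weight:
 fixes f :: "nat \<Rightarrow> real ^ 'n \<Rightarrow> complex"
 assumes lim: "uniform_limit (cball 0 s) f u sequentially" and r: "0 \<le> r" "norm x + r \<le> s"
 shows "uniform_limit cube (\<lambda>k y. of_real (bump 2 y) * f k (x + r *\<^sub>R y)) (\<lambda>y. of_real (bump 2 y) * u (x + r *\<^sub>R y)) sequentially"
proof (rule uniform_limitI)
 fix e :: real assume e: "e > 0"
 have "\<forall>\<^sub>F k in sequentially. \<forall>z\<in>cball 0 s. dist (f k z) (u z) < e"
  by (rule uniform_limitD[OF lim e])
 then show "\<forall>\<^sub>F k in sequentially. \<forall>y\<in>cube. dist (of_real (bump 2 y) * f k (x + r *\<^sub>R y)) (of_real (bump 2 y) * u (x + r *\<^sub>R y)) < e"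
 proof eventually_elim
  case (elim k)
  show ?case
  proof
   fix y :: "real ^ 'n"
   show "dist (of_real (bump 2 y) * f k (x + r *\<^sub>R y)) (of_real (bump 2 y) * u (x + r *\<^sub>R y)) < e"
   proof (cases "norm y \<le> 1")
    case True
    have "norm (x + r *\<^sub>R y) \<le> norm x + r * 1"
     using norm_triangle_ineq[of x "r *\<^sub>R y"] mult_left_mono[OF True r(1)] r(1) by simp
    then have "x + r *\<^sub>R y \<in> cball 0 s" using r by simp
    then have d: "dist (f k (x + r *\<^sub>R y)) (u (x + r *\<^sub>R y)) < e" using elim by blast
    have "dist (of_real (bump 2 y) * f k (x + r *\<^sub>R y)) (of_real (bump 2 y) * u (x + r *\<^sub>R y)) =
     bump 2 y * dist (f k (x + r *\<^sub>R y)) (u (x + r *\<^sub>R y))"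
     by (simp add: dist_norm right_diff_distrib[symmetric] norm_mult)
    also have "\<dots> \<le> 1 * dist (f k (x + r *\<^sub>R y)) (u (x + r *\<^sub>R y))"
     by (intro mult_right_mono bump_le_1) simp
    finally show ?thesis using d by simp
   qed (use e in \<open>simp add: bump_eq_0\<close>)
  qed
 qed
qed

lemma mean_value_uniform_limit:
 fixes f :: "nat \<Rightarrow> real ^ 'n \<Rightarrow> complex"
 assumes mv: "\<And>k. mean_value (f k)" and lim: "\<And>s. s < 1 \<Longrightarrow> uniform_limit (cball 0 s) f u sequentially"
 shows "mean_value u"
 unfolding mean_value_def
proof (intro conjI allI impI)
 have fc: "continuous_on (cball 0 s) (f k)" if "s < 1" for k s
  by (rule continuous_on_subset[OF mean_value_cont[OF mv]]) (use that in auto)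
 have cu: "continuous_on (cball 0 s) u" if "s < 1" for s
  by (rule uniform_limit_theorem[OF _ lim[OF that]]) (use fc[OF that] in simp_all)
 show "continuous_on (ball 0 1) u"
 proof (rule continuous_at_imp_continuous_on, rule)
  fix x :: "real ^ 'n" assume x: "x \<in> ball 0 1"
  define s where "s = (1 + norm x) / 2"
  have s: "s < 1" "x \<in> ball 0 s" using x by (simp_all add: s_def)
  have "continuous_on (ball 0 s) u" by (rule continuous_on_subset[OF cu[OF s(1)]]) auto
  then show "isCont u x" using s by (simp add: continuous_on_eq_continuous_at)
 qed
 fix x :: "real ^ 'n" and r :: real assume r: "0 < r" "norm x + r < 1"
 let ?F = "\<lambda>k y. of_real (bump 2 y) * f k (x + r *\<^sub>R y)"
 let ?G = "\<lambda>y. of_real (bump 2 y) * u (x + r *\<^sub>R y)"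
 have cF: "continuous_on (cbox (- 1) 1) (?F k)" for k
 proof -
  have "continuous_on UNIV (?F k)"
  proof (rule continuous_on_support[of "{y. x + r *\<^sub>R y \<in> ball 0 1}"])
   show "open {y. x + r *\<^sub>R y \<in> ball 0 1}" by (rule open_affine_vimage) simp
   show "cball 0 1 \<subseteq> {y. x + r *\<^sub>R y \<in> ball 0 1}"
    using in_ball_affine[OF r(2)] r(1) by (simp add: subset_iff)
   show "continuous_on {y. x + r *\<^sub>R y \<in> ball 0 1} (?F k)"
    by (intro continuous_on_mult continuous_on_subset[OF continuous_on_of_real_bump subset_UNIV]
      continuous_on_compose2[OF mean_value_cont[OF mv]] continuous_intros) auto
  qed (simp add: bump_eq_0)
  then show ?thesis by (rule continuous_on_subset) simp
 qed
 have "(\<lambda>k. integral cube (?F k)) \<longlonglongrightarrow> integral cube ?G"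
  by (rule uniform_limit_integral_cube[OF uniform_limit_bump_weight[OF lim[OF r(2)]]])
    (use r cF in \<open>simp_all add: cube_def\<close>)
 then have 1: "(\<lambda>k. of_real (bump_mass 2 TYPE('n)) * f k x) \<longlonglongrightarrow> integral cube ?G"
  using mean_value_eq[OF mv r] by simp
 have "(\<lambda>k. f k x) \<longlonglongrightarrow> u x"
  using tendsto_uniform_limitI[OF lim[of "norm x"]] r by simp
 then have "(\<lambda>k. of_real (bump_mass 2 TYPE('n)) * f k x) \<longlonglongrightarrow> of_real (bump_mass 2 TYPE('n)) * u x"
  by (intro tendsto_intros)
 then show "integral cube ?G = of_real (bump_mass 2 TYPE('n)) * u x"
  using LIMSEQ_unique[OF 1] by simp
qed

lemma partial_deriv_bounded_linear:
 assumes L: "bounded_linear (L :: complex \<Rightarrow> complex)" and f: "f differentiable (at x)"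
 shows "(\<lambda>x. L (f x)) differentiable (at x)"
  and "partial_deriv i (\<lambda>x. L (f x)) x = L (partial_deriv i f x)"
proof -
 have *: "((\<lambda>x. L (f x)) has_derivative (\<lambda>h. L (\<Sum>i\<in>UNIV. of_real (h $ i) * partial_deriv i f x))) (at x)"
  by (rule bounded_linear.has_derivative[OF L differentiable_partials[OF f]])
 then show "(\<lambda>x. L (f x)) differentiable (at x)" by (rule differentiableI)
 show "partial_deriv i (\<lambda>x. L (f x)) x = L (partial_deriv i f x)"
  using partial_deriv_eq[OF *, of i] sum_of_real_axis[of 1 i] by simp
qed

lemma harmonic_on_UNIV_C1:
 assumes "harmonic_on f UNIV"
 shows "C1_on UNIV f" "C1_on UNIV (partial_deriv i f)"
proof -
 show *: "C1_on UNIV (partial_deriv i f)" for i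
  using assms unfolding harmonic_on_def C1_on_def by simp
 show "C1_on UNIV f" using C1_on_cont[OF *] assms unfolding harmonic_on_def C1_on_def by simp
qed

lemma C1_on_bounded_linear:
 assumes L: "bounded_linear (L :: complex \<Rightarrow> complex)" and f: "C1_on UNIV f"
 shows "C1_on UNIV (\<lambda>x. L (f x))" "partial_deriv i (\<lambda>x. L (f x)) = (\<lambda>x. L (partial_deriv i f x))"
proof -
 have d: "f differentiable (at x)" for x using f by (simp add: C1_on_differentiable)
 show *: "partial_deriv i (\<lambda>x. L (f x)) = (\<lambda>x. L (partial_deriv i f x))" for i
  by (rule ext) (rule partial_deriv_bounded_linear(2)[OF L d])
 have "continuous_on UNIV (\<lambda>x. L (partial_deriv i f x))" for i
  by (rule bounded_linear.continuous_on[OF L]) (use f in \<open>simp add: C1_on_def\<close>)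
 then show "C1_on UNIV (\<lambda>x. L (f x))"
  unfolding C1_on_def * using partial_deriv_bounded_linear(1)[OF L d] by (simp add: differentiable_on_def)
qed

lemma harmonic_on_bounded_linear:
 assumes L: "bounded_linear (L :: complex \<Rightarrow> complex)" and f: "harmonic_on f UNIV"
 shows "harmonic_on (\<lambda>x. L (f x)) UNIV" "partial_deriv i (\<lambda>x. L (f x)) = (\<lambda>x. L (partial_deriv i f x))"
proof -
 note c = harmonic_on_UNIV_C1[OF f]
 show *: "partial_deriv i (\<lambda>x. L (f x)) = (\<lambda>x. L (partial_deriv i f x))" for i
  by (rule C1_on_bounded_linear[OF L c(1)])
 have lap: "(\<Sum>i\<in>UNIV. L (partial_deriv i (partial_deriv i f) x)) = 0" for x
  using f linear_sum[OF bounded_linear.linear[OF L], of "\<lambda>i. partial_deriv i (partial_deriv i f) x" UNIV]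
   linear_0[OF bounded_linear.linear[OF L]] by (simp add: harmonic_on_def)
 show "harmonic_on (\<lambda>x. L (f x)) UNIV"
  unfolding harmonic_on_def * C1_on_bounded_linear(2)[OF L c(2)]
 proof (intro conjI allI ballI)
  show "(\<lambda>x. L (f x)) differentiable_on UNIV"
   using C1_on_bounded_linear(1)[OF L c(1)] by (simp add: C1_on_def)
  show "(\<lambda>x. L (partial_deriv i f x)) differentiable_on UNIV" for i
   using C1_on_bounded_linear(1)[OF L c(2)] by (simp add: C1_on_def)
  show "continuous_on UNIV (\<lambda>x. L (partial_deriv i (partial_deriv j f) x))" for i j
   by (rule bounded_linear.continuous_on[OF L]) (use c(2) in \<open>simp add: C1_on_def\<close>)
 qed (rule lap)
qed

lemma harmonic_on_UNIV_mean_value: "harmonic_on f UNIV \<Longrightarrow> mean_value f"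
 by (rule harmonic_imp_mean_value) (simp add: harmonic_ball_def harmonic_on_subset[OF _ subset_UNIV])

definition taylor_part :: "(real ^ 'n \<Rightarrow> complex) \<Rightarrow> nat \<Rightarrow> real ^ 'n \<Rightarrow> complex" where
 "taylor_part u k x = diff_form k u 0 x / fact k"

lemma taylor_part_alt: "taylor_part u k = (\<lambda>x. (1 / fact k) * diff_form k u 0 x)"
 by (simp add: taylor_part_def fun_eq_iff)

lemma harmonic_on_taylor_part: "mean_value u \<Longrightarrow> harmonic_on (taylor_part u k) UNIV"
 unfolding taylor_part_alt
 by (rule harmonic_on_bounded_linear[OF bounded_linear_mult_right]) (rule harmonic_on_diff_form, auto)

lemma homogeneous_poly_taylor_part: "homogeneous_poly k (taylor_part u k)"
 unfolding taylor_part_alt by (intro homogeneous_poly_cmult homogeneous_poly_diff_form)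

lemma taylor_part_scale: "taylor_part u k (t *\<^sub>R x) = of_real t ^ k * taylor_part u k x"
 by (rule homogeneous_poly_scale[OF homogeneous_poly_taylor_part])

lemma mean_value_taylor_part: "mean_value u \<Longrightarrow> mean_value (taylor_part u k)"
 by (rule harmonic_on_UNIV_mean_value[OF harmonic_on_taylor_part])

lemma euler_taylor_part:
 assumes "mean_value u"
 shows "(\<Sum>i\<in>UNIV. of_real (y $ i) * partial_deriv i (taylor_part u k) y) = of_nat k * taylor_part u k y"
proof -
 have pd: "partial_deriv i (taylor_part u k) y = (1 / fact k) * partial_deriv i (diff_form k u 0) y" for i
  unfolding taylor_part_alt by (rule partial_deriv_cmult[OF diff_form_differentiable[OF assms]]) simp
 show ?thesis
 proof (cases k)
  case 0
  have "taylor_part u 0 = (\<lambda>_. u 0)" by (simp add: taylor_part_def fun_eq_iff)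
  then show ?thesis using 0 by simp
 next
  case (Suc k')
  have pd': "partial_deriv i (taylor_part u k) y = (1 / fact k) * (of_nat k * diff_form k' (partial_deriv i u) 0 y)" for i
   unfolding pd unfolding Suc by (subst partial_deriv_diff_form[OF assms]) simp_all
  have "(\<Sum>i\<in>UNIV. of_real (y $ i) * partial_deriv i (taylor_part u k) y) =
    (\<Sum>i\<in>UNIV. (1 / fact k) * (of_nat k * (of_real (y $ i) * diff_form k' (partial_deriv i u) 0 y)))"
   unfolding pd' by (simp only: mult_ac)
  also have "\<dots> = (1 / fact k) * (of_nat k * diff_form k u 0 y)"
   unfolding Suc diff_form.simps(2)[of k'] sum_distrib_left ..
  finally show ?thesis by (simp add: taylor_part_def)
 qed
qed

lemma partial_deriv_mult:
 assumes f: "f differentiable (at x)" and g: "g differentiable (at x)"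
 shows "(\<lambda>x. f x * g x) differentiable (at x)"
  and "partial_deriv i (\<lambda>x. f x * g x) x = partial_deriv i f x * g x + f x * partial_deriv i g x"
proof -
 have *: "((\<lambda>x. f x * g x) has_derivative (\<lambda>h. f x * (\<Sum>i\<in>UNIV. of_real (h $ i) * partial_deriv i g x) +
   (\<Sum>i\<in>UNIV. of_real (h $ i) * partial_deriv i f x) * g x)) (at x)"
  by (rule has_derivative_mult[OF differentiable_partials[OF f] differentiable_partials[OF g]])
 then show "(\<lambda>x. f x * g x) differentiable (at x)" by (rule differentiableI)
 show "partial_deriv i (\<lambda>x. f x * g x) x = partial_deriv i f x * g x + f x * partial_deriv i g x"
  using partial_deriv_eq[OF *, of i] sum_of_real_axis[of 1 i] by simp
qed

lemma C1_on_mult: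
 assumes S: "open S" and f: "C1_on S f" and g: "C1_on S g"
 shows "C1_on S (\<lambda>x. f x * g x)"
 unfolding C1_on_def
proof (intro conjI allI)
 have d: "f differentiable (at x)" "g differentiable (at x)" if "x \<in> S" for x
  using C1_on_differentiable[OF f S that] C1_on_differentiable[OF g S that] by auto
 show "(\<lambda>x. f x * g x) differentiable_on S"
  using partial_deriv_mult(1)[OF d] S by (simp add: differentiable_on_eq_differentiable_at)
 show "continuous_on S (partial_deriv i (\<lambda>x. f x * g x))" for i
 proof (rule continuous_on_eq)
  show "continuous_on S (\<lambda>x. partial_deriv i f x * g x + f x * partial_deriv i g x)"
   using f g C1_on_cont[OF f] C1_on_cont[OF g] unfolding C1_on_def by (intro continuous_intros) auto
  show "partial_deriv i f x * g x + f x * partial_deriv i g x = partial_deriv i (\<lambda>x. f x * g x) x" if "x \<in> S" for x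
   by (rule partial_deriv_mult(2)[OF d[OF that], symmetric])
 qed
qed

lemma C1_on_diff:
 assumes S: "open S" and f: "C1_on S f" and g: "C1_on S g"
 shows "C1_on S (\<lambda>x. f x - g x)"
  and "x \<in> S \<Longrightarrow> partial_deriv i (\<lambda>x. f x - g x) x = partial_deriv i f x - partial_deriv i g x"
proof -
 have d: "f differentiable (at x)" "g differentiable (at x)" if "x \<in> S" for x
  using C1_on_differentiable[OF f S that] C1_on_differentiable[OF g S that] by auto
 have *: "((\<lambda>x. f x - g x) has_derivative (\<lambda>h. (\<Sum>i\<in>UNIV. of_real (h $ i) * partial_deriv i f x) -
   (\<Sum>i\<in>UNIV. of_real (h $ i) * partial_deriv i g x))) (at x)" if "x \<in> S" for x
  by (intro has_derivative_diff differentiable_partials d that)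
 show e: "partial_deriv i (\<lambda>x. f x - g x) x = partial_deriv i f x - partial_deriv i g x" if "x \<in> S" for x i
  using partial_deriv_eq[OF *[OF that], of i] sum_of_real_axis[of 1 i] by simp
 show "C1_on S (\<lambda>x. f x - g x)"
  unfolding C1_on_def
 proof (intro conjI allI)
  show "(\<lambda>x. f x - g x) differentiable_on S"
   using * S by (auto simp: differentiable_on_eq_differentiable_at differentiable_def)
  show "continuous_on S (partial_deriv i (\<lambda>x. f x - g x))" for i
   by (rule continuous_on_eq[of _ "\<lambda>x. partial_deriv i f x - partial_deriv i g x"])
     (use f g e in \<open>auto simp: C1_on_def intro!: continuous_on_diff\<close>)
 qed
qed

text \<open>Green's formula for \<open>y \<mapsto> u(ty)\<close> and \<open>h\<close> with the radial weight, in which the normal derivatives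
 have become radial derivatives. For \<open>h\<close> homogeneous of degree \<open>c\<close> the one on \<open>h\<close> is \<open>ch\<close>.\<close>

lemma green_dilation:
 fixes u h :: "real ^ 'n \<Rightarrow> complex"
 assumes mv: "mean_value u" and h: "harmonic_on h UNIV" and t: "0 \<le> t" "t < 1"
  and euler: "\<And>y. (\<Sum>i\<in>UNIV. of_real (y $ i) * partial_deriv i h y) = c * h y"
 shows "of_real t * integral cube (\<lambda>y. (of_real (bump 2 y) * h y) * (\<Sum>i\<in>UNIV. of_real (y $ i) * partial_deriv i u (t *\<^sub>R y)))
   = c * integral cube (\<lambda>y. (of_real (bump 2 y) * h y) * u (t *\<^sub>R y))"
proof -
 have u1: "C1_on (ball 0 1) u" and u2: "C1_on (ball 0 1) (partial_deriv i u)" for i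
  by (intro mean_value_C1 mean_value_partial mv)+
 note hC = harmonic_on_UNIV_C1[OF h]
 define V where "V = {y :: real ^ 'n. 0 + t *\<^sub>R y \<in> ball 0 1}"
 have V: "open V" "cball 0 1 \<subseteq> V"
  unfolding V_def by (rule open_affine_vimage[OF open_ball]) (use in_ball_affine[of 0 t] t in auto)
 have dil: "C1_on V (\<lambda>y. f (t *\<^sub>R y))" "y \<in> V \<Longrightarrow> partial_deriv i (\<lambda>y. f (t *\<^sub>R y)) y = of_real t * partial_deriv i f (t *\<^sub>R y)"
  if f: "C1_on (ball 0 1) f" for f i y
  using C1_on_affine[OF open_ball f, of 0 t] partial_deriv_affine(2)[of f 0 t y i]
   C1_on_differentiable[OF f open_ball, of "t *\<^sub>R y"] by (simp_all add: V_def)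
 have hV: "C1_on V h" "C1_on V (partial_deriv i h)" for i
  using hC by (auto intro: C1_on_subset)
 define w where "w i y = of_real t * partial_deriv i u (t *\<^sub>R y) * h y - u (t *\<^sub>R y) * partial_deriv i h y" for i y
 have tC: "C1_on V (\<lambda>y. of_real t * partial_deriv i u (t *\<^sub>R y))"
  "y \<in> V \<Longrightarrow> partial_deriv i (\<lambda>y. of_real t * partial_deriv i u (t *\<^sub>R y)) y = of_real t * (of_real t * partial_deriv i (partial_deriv i u) (t *\<^sub>R y))" for i y
 proof -
  have c: "C1_on V (\<lambda>_. complex_of_real t)" by (simp add: C1_on_def)
  show "C1_on V (\<lambda>y. of_real t * partial_deriv i u (t *\<^sub>R y))"
   by (rule C1_on_mult[OF V(1) c dil(1)[OF u2]])
  show "partial_deriv i (\<lambda>y. of_real t * partial_deriv i u (t *\<^sub>R y)) y = of_real t * (of_real t * partial_deriv i (partial_deriv i u) (t *\<^sub>R y))" if "y \<in> V"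
   using partial_deriv_cmult[OF C1_on_differentiable[OF dil(1)[OF u2] V(1) that]] dil(2)[OF u2 that] by metis
 qed
 have p1: "C1_on V (\<lambda>y. of_real t * partial_deriv i u (t *\<^sub>R y) * h y)" for i
  by (rule C1_on_mult[OF V(1) tC(1) hV(1)])
 have p2: "C1_on V (\<lambda>y. u (t *\<^sub>R y) * partial_deriv i h y)" for i
  by (rule C1_on_mult[OF V(1) dil(1)[OF u1] hV(2)])
 have wC: "C1_on V (w i)" for i
  unfolding w_def by (rule C1_on_diff(1)[OF V(1) p1 p2])
 have wp: "partial_deriv i (w i) y = of_real t * (of_real t * partial_deriv i (partial_deriv i u) (t *\<^sub>R y)) * h y
    - u (t *\<^sub>R y) * partial_deriv i (partial_deriv i h) y" if y: "y \<in> V" for i y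
 proof -
  have "partial_deriv i (w i) y = partial_deriv i (\<lambda>y. of_real t * partial_deriv i u (t *\<^sub>R y) * h y) y -
    partial_deriv i (\<lambda>y. u (t *\<^sub>R y) * partial_deriv i h y) y"
   unfolding w_def by (rule C1_on_diff(2)[OF V(1) p1 p2 y])
  also have "partial_deriv i (\<lambda>y. of_real t * partial_deriv i u (t *\<^sub>R y) * h y) y =
    of_real t * (of_real t * partial_deriv i (partial_deriv i u) (t *\<^sub>R y)) * h y + of_real t * partial_deriv i u (t *\<^sub>R y) * partial_deriv i h y"
   by (subst partial_deriv_mult(2)[OF C1_on_differentiable[OF tC(1) V(1) y] C1_on_differentiable[OF hV(1) V(1) y]])
     (simp only: tC(2)[OF y])
  also have "partial_deriv i (\<lambda>y. u (t *\<^sub>R y) * partial_deriv i h y) y =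
    of_real t * partial_deriv i u (t *\<^sub>R y) * partial_deriv i h y + u (t *\<^sub>R y) * partial_deriv i (partial_deriv i h) y"
   by (subst partial_deriv_mult(2)[OF C1_on_differentiable[OF dil(1)[OF u1] V(1) y] C1_on_differentiable[OF hV(2) V(1) y]])
     (simp only: dil(2)[OF u1 y])
  finally show ?thesis by simp
 qed
 have lap: "(\<Sum>i\<in>UNIV. partial_deriv i (w i) y) = 0" if y: "y \<in> V" for y
 proof -
  have ty: "t *\<^sub>R y \<in> ball 0 1" using y by (simp add: V_def)
  have "(\<Sum>i\<in>UNIV. partial_deriv i (w i) y) =
   of_real t * (of_real t * (\<Sum>i\<in>UNIV. partial_deriv i (partial_deriv i u) (t *\<^sub>R y))) * h y
    - u (t *\<^sub>R y) * (\<Sum>i\<in>UNIV. partial_deriv i (partial_deriv i h) y)"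
   by (simp only: wp[OF y] sum_subtractf sum_distrib_left sum_distrib_right)
  moreover have "(\<Sum>i\<in>UNIV. partial_deriv i (partial_deriv i h) y) = 0" using h by (simp add: harmonic_on_def)
  ultimately show ?thesis using mean_value_laplacian[OF mv ty] by simp
 qed
 have "integral cube (\<lambda>y. of_real (bump 3 y) * (\<Sum>i\<in>UNIV. partial_deriv i (w i) y)) = integral cube (\<lambda>y :: real ^ 'n. 0)"
 proof (rule integral_cong)
  fix y :: "real ^ 'n"
  show "of_real (bump 3 y) * (\<Sum>i\<in>UNIV. partial_deriv i (w i) y) = 0"
   using V(2) lap[of y] bump_eq_0[of y 3] by (cases "norm y \<le> 1") auto
 qed
 then have 0: "integral cube (\<lambda>y. of_real (bump 2 y) * (\<Sum>i\<in>UNIV. of_real (y $ i) * w i y)) = 0"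
  using integral_bump_radial[OF V, of w, OF wC] by simp
 let ?a = "\<lambda>y. (of_real (bump 2 y) * h y) * (\<Sum>i\<in>UNIV. of_real (y $ i) * partial_deriv i u (t *\<^sub>R y))"
 let ?b = "\<lambda>y. (of_real (bump 2 y) * h y) * u (t *\<^sub>R y)"
 have eq: "of_real (bump 2 y) * (\<Sum>i\<in>UNIV. of_real (y $ i) * w i y) = of_real t * ?a y - c * ?b y" for y
 proof -
  have "(\<Sum>i\<in>UNIV. of_real (y $ i) * w i y) =
    (\<Sum>i\<in>UNIV. of_real t * h y * (of_real (y $ i) * partial_deriv i u (t *\<^sub>R y)) - u (t *\<^sub>R y) * (of_real (y $ i) * partial_deriv i h y))"
   unfolding w_def by (rule sum.cong) (simp_all add: algebra_simps)
  also have "\<dots> = of_real t * h y * (\<Sum>i\<in>UNIV. of_real (y $ i) * partial_deriv i u (t *\<^sub>R y)) - u (t *\<^sub>R y) * (c * h y)"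
   by (simp only: sum_subtractf sum_distrib_left[symmetric] euler)
  finally have e: "(\<Sum>i\<in>UNIV. of_real (y $ i) * w i y) =
    of_real t * h y * (\<Sum>i\<in>UNIV. of_real (y $ i) * partial_deriv i u (t *\<^sub>R y)) - u (t *\<^sub>R y) * (c * h y)" .
  show ?thesis unfolding e by (simp add: algebra_simps)
 qed
 have hc: "continuous_on UNIV h" by (rule C1_on_cont[OF hC(1)])
 have g: "continuous_on UNIV (\<lambda>y. of_real (bump 2 y) * h y)"
  by (intro continuous_on_mult continuous_on_of_real_bump hc)
 have ib: "?b integrable_on cube"
  using mean_value_integrable[OF mean_value_cont[OF mv] g _ t(1), of 0] t by (simp add: bump_eq_0)
 have ia: "?a integrable_on cube"
 proof -
  have gi: "continuous_on UNIV (\<lambda>y. (of_real (bump 2 y) * h y) * of_real (y $ i))" for i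
   by (intro continuous_on_mult g continuous_intros)
  have "(\<lambda>y. \<Sum>i\<in>UNIV. ((of_real (bump 2 y) * h y) * of_real (y $ i)) * partial_deriv i u (0 + t *\<^sub>R y)) integrable_on cube"
   by (rule integrable_sum, simp, rule mean_value_integrable[OF C1_on_cont[OF u2] gi])
     (use t in \<open>simp_all add: bump_eq_0\<close>)
  then show ?thesis by (simp add: sum_distrib_left mult.assoc)
 qed
 have "0 = integral cube (\<lambda>y. of_real t * ?a y - c * ?b y)" using 0 unfolding eq by simp
 also have "\<dots> = integral cube (\<lambda>y. of_real t * ?a y) - integral cube (\<lambda>y. c * ?b y)"
  by (rule Henstock_Kurzweil_Integration.integral_diff) (intro integrable_on_mult_right ia ib)+
 also have "\<dots> = of_real t * integral cube ?a - c * integral cube ?b"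
  by (simp only: integral_mult_right)
 finally show ?thesis by simp
qed

section \<open>Convergence of the homogeneous expansion\<close>

lemma taylor_part_near_zero:
 fixes u :: "real ^ 'n \<Rightarrow> complex"
 assumes mv: "mean_value u"
 obtains \<epsilon> A where "0 < \<epsilon>" "\<epsilon> < 1"
  "\<And>j y. norm y \<le> 1 \<Longrightarrow> norm (taylor_part u j (\<epsilon> *\<^sub>R y)) \<le> A * (1 / 2) ^ j"
  "\<And>y. norm y \<le> 1 \<Longrightarrow> (\<lambda>j. taylor_part u j (\<epsilon> *\<^sub>R y)) sums u (\<epsilon> *\<^sub>R y)"
proof -
 let ?\<delta> = "taylor_radius TYPE('n)"
 note d = taylor_radius[where 'n='n]
 define \<epsilon> where "\<epsilon> = ?\<delta> / 2"
 have e: "0 < \<epsilon>" "\<epsilon> < 1" using d by (auto simp: \<epsilon>_def)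
 have "norm (0 :: real ^ 'n) + 1 / 2 < 1" by simp
 then obtain A where A: "\<And>z. z \<in> cball 0 (1 / 2) \<Longrightarrow> norm (u z) \<le> A"
  by (rule mean_value_bounded_on_cball[OF mv]) (rule that)
 have bound: "norm (taylor_part u j (\<epsilon> *\<^sub>R y)) \<le> A * (1 / 2) ^ j" if y: "norm y \<le> 1" for j y
 proof -
  have "norm (diff_form j u 0 y) \<le> (1 / (2 * ?\<delta> * (1 / 2))) ^ j * fact j * A"
   by (rule diff_form_bound_fact[OF mv, where ?x0.0 = 0 and \<rho> = "1 / 2" and y = 0]) (use A y in auto)
  then have 1: "norm (taylor_part u j y) \<le> (1 / ?\<delta>) ^ j * A"
   unfolding taylor_part_def by (simp add: norm_divide field_simps)
  have "norm (taylor_part u j (\<epsilon> *\<^sub>R y)) = \<epsilon> ^ j * norm (taylor_part u j y)"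
   unfolding taylor_part_scale using e by (simp add: norm_mult norm_power)
  also have "\<dots> \<le> \<epsilon> ^ j * ((1 / ?\<delta>) ^ j * A)" using 1 e by (intro mult_left_mono) auto
  also have "\<dots> = A * (\<epsilon> * (1 / ?\<delta>)) ^ j" by (simp only: power_mult_distrib mult_ac)
  also have "\<epsilon> * (1 / ?\<delta>) = 1 / 2" using d by (simp add: \<epsilon>_def)
  finally show ?thesis .
 qed
 have sums: "(\<lambda>j. taylor_part u j (\<epsilon> *\<^sub>R y)) sums u (\<epsilon> *\<^sub>R y)" if y: "norm y \<le> 1" for y
 proof -
  have n: "norm (\<epsilon> *\<^sub>R y) \<le> ?\<delta> * (1 / 2)"
   using mult_left_mono[OF y, of \<epsilon>] e unfolding norm_scaleR by (simp add: \<epsilon>_def)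
  have "(\<lambda>k. diff_form k u 0 (\<epsilon> *\<^sub>R y) / fact k) sums u (0 + \<epsilon> *\<^sub>R y)"
   by (rule taylor_sums[OF mv _ _ n]) auto
  then show ?thesis by (simp add: taylor_part_def)
 qed
 show ?thesis by (rule that[OF e bound sums])
qed

text \<open>The moments \<open>G(t) = \<integral> w h u(t \<cdot>)\<close> satisfy \<open>t G' = kG\<close> by Green's formula, so they are multiples of
 \<open>t\<^sup>k\<close>. The factor is determined near \<open>t = 0\<close>, where the Taylor expansion of \<open>u\<close> may be
 integrated term by term and all terms of degree different from \<open>k\<close> are orthogonal to \<open>h\<close>.\<close>

lemma dilation_moment:
 fixes u h :: "real ^ 'n \<Rightarrow> complex"
 assumes mv: "mean_value u" and h: "harmonic_on h UNIV" and R: "0 < R" "R < 1"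
  and euler: "\<And>y. (\<Sum>i\<in>UNIV. of_real (y $ i) * partial_deriv i h y) = of_nat k * h y"
 shows "integral cube (\<lambda>y. (of_real (bump 2 y) * h y) * u (R *\<^sub>R y)) =
   of_real R ^ k * integral cube (\<lambda>y. (of_real (bump 2 y) * h y) * taylor_part u k y)"
proof -
 let ?g = "\<lambda>y. of_real (bump 2 y) * h y"
 have hc: "continuous_on UNIV h" by (rule C1_on_cont[OF harmonic_on_UNIV_C1(1)[OF h]])
 have g: "continuous_on UNIV ?g" by (intro continuous_on_mult continuous_on_of_real_bump hc)
 have g0: "?g y = 0" if "norm y \<ge> 1" for y using that by (simp add: bump_eq_0)
 define G where "G w t = integral cube (\<lambda>y. ?g y * w (t *\<^sub>R y))" for w :: "real ^ 'n \<Rightarrow> complex" and t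
 define G1 where "G1 w t = integral cube (\<lambda>y. ?g y * (\<Sum>i\<in>UNIV. of_real (y $ i) * partial_deriv i w (t *\<^sub>R y)))"
  for w :: "real ^ 'n \<Rightarrow> complex" and t
 have green: "of_real t * G1 w t = of_nat k * G w t" if "mean_value w" "0 \<le> t" "t < 1" for w t
  unfolding G_def G1_def by (rule green_dilation[OF that(1) h that(2,3) euler])
 \<comment> \<open>the Euler equation makes the moments multiples of a power of the dilation parameter\<close>
 have ratio: "G u a = of_real (a / b) ^ k * G u b" if ab: "0 < a" "a \<le> b" "b < 1" for a b
 proof -
  have der: "((\<lambda>t. (inverse t ^ k) *\<^sub>R G u t) has_derivative (\<lambda>h. 0)) (at t within {a..b})" if t: "t \<in> {a..b}" for t
  proof -
   have t0: "t > 0" "t < 1" using t ab by auto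
   define D where "D = real k * (- (inverse t ^ Suc (Suc 0)) * inverse t ^ (k - Suc 0))"
   have leib: "((\<lambda>t. integral cube (\<lambda>y. ?g y * u (0 + t *\<^sub>R y + 0 *\<^sub>R y))) has_vector_derivative
    integral cube (\<lambda>y. ?g y * (\<Sum>i\<in>UNIV. of_real (y $ i) * partial_deriv i u (0 + t *\<^sub>R y + 0 *\<^sub>R y)))) (at t within {a..b})"
   proof (rule weighted_leibniz[OF open_ball mean_value_C1[OF mv] g g0 continuous_on_id t])
    fix s and y :: "real ^ 'n" assume s: "s \<in> {a..b}" "norm y \<le> 1"
    have "norm (s *\<^sub>R y) \<le> b * 1" unfolding norm_scaleR using s ab by (intro mult_mono) auto
    then show "0 + s *\<^sub>R y + 0 *\<^sub>R y \<in> ball 0 1" using ab by simp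
   qed
   then have "(G u has_vector_derivative G1 u t) (at t within {a..b})"
    by (simp add: G_def[abs_def] G1_def)
   moreover have "((\<lambda>t. inverse t ^ k) has_field_derivative D) (at t within {a..b})"
    unfolding D_def
    by (rule DERIV_power[OF has_field_derivative_at_within[OF DERIV_inverse]]) (use t0 in simp)
   ultimately have "((\<lambda>t. (inverse t ^ k) *\<^sub>R G u t) has_vector_derivative
     (inverse t ^ k) *\<^sub>R G1 u t + D *\<^sub>R G u t) (at t within {a..b})"
    by (rule has_vector_derivative_scaleR[rotated])
   moreover have "(inverse t ^ k) *\<^sub>R G1 u t + D *\<^sub>R G u t = 0"
   proof -
    have "G1 u t = (inverse t * real k) *\<^sub>R G u t"
     using green[OF mv, of t] t0 by (simp add: field_simps complex_scaleR)
    moreover have "D = - (inverse t ^ k * (inverse t * real k))"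
     unfolding D_def by (cases k) simp_all
    ultimately show ?thesis by (simp add: algebra_simps)
   qed
   ultimately show ?thesis by (simp add: has_vector_derivative_def)
  qed
  have "\<exists>c. \<forall>t\<in>{a..b}. (inverse t ^ k) *\<^sub>R G u t = c"
   by (rule has_derivative_zero_constant[OF _ der]) auto
  then obtain c where c: "\<And>t. t \<in> {a..b} \<Longrightarrow> (inverse t ^ k) *\<^sub>R G u t = c" by blast
  have "(inverse a ^ k) *\<^sub>R G u a = (inverse b ^ k) *\<^sub>R G u b"
   by (rule trans[OF c c[symmetric]]) (use ab in auto)
  then have "(a ^ k) *\<^sub>R ((inverse a ^ k) *\<^sub>R G u a) = (a ^ k) *\<^sub>R ((inverse b ^ k) *\<^sub>R G u b)" by (rule arg_cong)
  moreover have "a ^ k * inverse a ^ k = 1" using ab by (simp add: power_mult_distrib[symmetric])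
  moreover have "a ^ k * inverse b ^ k = (a / b) ^ k" by (simp add: power_mult_distrib[symmetric] divide_inverse)
  ultimately have "1 *\<^sub>R G u a = ((a / b) ^ k) *\<^sub>R G u b" unfolding scaleR_scaleR by (simp only:)
  then show ?thesis by (simp only: scaleR_one complex_scaleR of_real_power of_real_1 mult_1_left)
 qed
 define a where "a j = integral cube (\<lambda>y. ?g y * taylor_part u j y)" for j
 have Gt: "G (taylor_part u j) t = of_real t ^ j * a j" for j t
 proof -
  have "G (taylor_part u j) t = integral cube (\<lambda>y. of_real t ^ j * (?g y * taylor_part u j y))"
   unfolding G_def by (rule integral_cong) (simp add: taylor_part_scale mult_ac)
  then show ?thesis unfolding a_def by (simp only: integral_mult_right)
 qed
 \<comment> \<open>a moment of a homogeneous part satisfies the Euler equations of two different degrees\<close>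
 have orth: "a j = 0" if "j \<noteq> k" for j
 proof -
  let ?t = "1 / 2 :: real"
  have "of_real ?t * G1 (taylor_part u j) ?t = of_nat j * G (taylor_part u j) ?t"
  proof -
   have e: "of_real ?t * (?g y * (\<Sum>i\<in>UNIV. of_real (y $ i) * partial_deriv i (taylor_part u j) (?t *\<^sub>R y))) =
     of_nat j * (?g y * taylor_part u j (?t *\<^sub>R y))" for y
   proof -
    let ?S = "\<Sum>i\<in>UNIV. of_real (y $ i) * partial_deriv i (taylor_part u j) (?t *\<^sub>R y)"
    have "(\<Sum>i\<in>UNIV. of_real ((?t *\<^sub>R y) $ i) * partial_deriv i (taylor_part u j) (?t *\<^sub>R y)) = of_real ?t * ?S"
     unfolding vector_scaleR_component sum_distrib_left by (simp add: mult.assoc)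
    then have a: "of_real ?t * ?S = of_nat j * taylor_part u j (?t *\<^sub>R y)"
     using euler_taylor_part[OF mv, of "?t *\<^sub>R y" j] by (rule subst)
    have "of_real ?t * (?g y * ?S) = ?g y * (of_real ?t * ?S)" by (rule mult.left_commute)
    also have "\<dots> = of_nat j * (?g y * taylor_part u j (?t *\<^sub>R y))" unfolding a by (rule mult.left_commute)
    finally show ?thesis .
   qed
   then show ?thesis unfolding G1_def G_def integral_mult_right[symmetric] by (intro integral_cong e)
  qed
  then have "of_nat j * G (taylor_part u j) ?t = of_nat k * G (taylor_part u j) ?t"
   using green[OF mean_value_taylor_part[OF mv], of ?t j] by simp
  then have "G (taylor_part u j) ?t = 0" using that by simp
  then show ?thesis unfolding Gt by simp
 qed
 obtain \<epsilon> A where \<epsilon>: "0 < \<epsilon>" "\<epsilon> < 1"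
  and bound: "\<And>j y. norm y \<le> 1 \<Longrightarrow> norm (taylor_part u j (\<epsilon> *\<^sub>R y)) \<le> A * (1 / 2) ^ j"
  and sums: "\<And>y. norm y \<le> 1 \<Longrightarrow> (\<lambda>j. taylor_part u j (\<epsilon> *\<^sub>R y)) sums u (\<epsilon> *\<^sub>R y)"
  using taylor_part_near_zero[OF mv] by blast
 \<comment> \<open>term by term integration at the small radius \<open>\<epsilon>\<close>\<close>
 have Ge: "G u e = of_real e ^ k * a k" if e: "e = \<epsilon>" for e
 proof -
  have "bounded (?g ` cube)" unfolding cube_def
   by (intro compact_imp_bounded compact_continuous_image continuous_on_subset[OF g]) auto
  then obtain H where "\<forall>c\<in>?g ` cube. norm c \<le> H" unfolding bounded_iff by blast
  then have H: "norm (?g y) \<le> H" if "y \<in> cube" for y using that by blast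
  have H0: "0 \<le> H" using H[of 0] by (meson cball_subset_cube centre_in_cball norm_ge_zero order_trans subsetD zero_le_one)
  have A0: "0 \<le> A" using bound[of 0 0] by (simp add: order_trans[OF norm_ge_zero])
  let ?f = "\<lambda>j y. ?g y * taylor_part u j (\<epsilon> *\<^sub>R y)"
  have fb: "norm (?f j y) \<le> H * A * (1 / 2) ^ j" if y: "y \<in> cube" for j y
  proof (cases "norm y \<le> 1")
   case True
   have "norm (?f j y) \<le> H * (A * (1 / 2) ^ j)"
    unfolding norm_mult[of "?g y"] using H[OF y] bound[OF True] H0 by (intro mult_mono) auto
   then show ?thesis by (simp add: mult.assoc)
  next
   case False
   then have z: "?g y = 0" using g0[of y] by simp
   have "norm (?f j y) = 0" unfolding z by simp
   moreover have "0 \<le> H * A * (1 / 2) ^ j" using H0 A0 by simp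
   ultimately show ?thesis by linarith
  qed
  have summ: "summable (\<lambda>j. H * A * (1 / 2 :: real) ^ j)" by (intro summable_mult summable_geometric) simp
  have lim: "uniform_limit cube (\<lambda>n y. \<Sum>j<n. ?f j y) (\<lambda>y. suminf (\<lambda>j. ?f j y)) sequentially"
   by (rule Weierstrass_m_test[OF fb summ])
  have sumf: "suminf (\<lambda>j. ?f j y) = ?g y * u (\<epsilon> *\<^sub>R y)" for y
  proof (cases "norm y \<le> 1")
   case True
   from sums_mult[OF sums[OF True], of "?g y"] show ?thesis by (simp add: sums_iff)
  next
   case False
   then show ?thesis using g0[of y] by simp
  qed
  have tc: "continuous_on UNIV (\<lambda>y. taylor_part u j (\<epsilon> *\<^sub>R y))" for j
   by (rule continuous_on_compose2[OF C1_on_cont[OF harmonic_on_UNIV_C1(1)[OF harmonic_on_taylor_part[OF mv]]]])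
     (auto intro!: continuous_intros)
  have fc: "continuous_on (cbox (- 1) 1) (?f j)" for j
   by (rule continuous_on_subset[OF continuous_on_mult[OF g tc]]) simp
  have c: "continuous_on (cbox (- 1) 1) (\<lambda>y. \<Sum>j<n. ?f j y)" for n
   by (intro continuous_on_sum fc)
  define I where "I n = integral cube (\<lambda>y. \<Sum>j<n. ?f j y)" for n
  have lim2: "I \<longlonglongrightarrow> G u \<epsilon>"
   unfolding I_def[abs_def] G_def
   by (rule uniform_limit_integral_cube[OF lim[unfolded sumf] c[folded cube_def]])
  have In: "I n = (\<Sum>j<n. of_real \<epsilon> ^ j * a j)" for n
  proof -
   have "I n = (\<Sum>j<n. integral cube (?f j))"
    unfolding I_def cube_def by (rule integral_sum) (auto intro: integrable_continuous fc)
   also have "\<dots> = (\<Sum>j<n. of_real \<epsilon> ^ j * a j)" using Gt[where t=\<epsilon>] unfolding G_def by simp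
   finally show ?thesis .
  qed
  have Ik: "I n = of_real \<epsilon> ^ k * a k" if "n > k" for n
  proof -
   have "I n = (\<Sum>j\<in>{k}. of_real \<epsilon> ^ j * a j)"
    unfolding In by (rule sum.mono_neutral_right) (use that orth in auto)
   then show ?thesis by simp
  qed
  have "\<forall>\<^sub>F n in sequentially. I n = of_real \<epsilon> ^ k * a k"
   by (rule eventually_sequentiallyI[of "Suc k"]) (rule Ik, simp)
  then have "I \<longlonglongrightarrow> of_real \<epsilon> ^ k * a k" by (rule tendsto_eventually)
  then show ?thesis using lim2 unfolding e by (rule LIMSEQ_unique[rotated])
 qed
 define e where "e = \<epsilon>"
 have "G u R = of_real R ^ k * a k"
 proof (cases "e \<le> R")
  case True
  have "of_real (e / R) ^ k * G u R = of_real e ^ k * a k"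
   using ratio[of e R] Ge[OF e_def] \<epsilon> True R by (simp add: e_def)
  then show ?thesis using \<epsilon> R by (simp add: e_def power_divide field_simps)
 next
  case False
  have "G u R = of_real (R / e) ^ k * (of_real e ^ k * a k)"
   using ratio[of R e] Ge[OF e_def] \<epsilon> False R by (simp add: e_def)
  then show ?thesis using \<epsilon> by (simp add: e_def power_divide)
 qed
 then show ?thesis unfolding G_def a_def .
qed

lemma integral_bump_const: "integral cube (\<lambda>y :: real ^ 'n. bump m y * c) = bump_mass m TYPE('n) * c"
 unfolding bump_mass_def by (rule integral_mult_left)

lemma bump_weighted_integrable:
 fixes f :: "real ^ 'n \<Rightarrow> real"
 assumes "continuous_on UNIV f"
 shows "(\<lambda>y. bump m y * f y) integrable_on cube"
 unfolding cube_def
 by (rule integrable_continuous, rule continuous_on_subset[of UNIV])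
   (use assms in \<open>auto intro!: continuous_on_mult continuous_on_bump continuous_on_id\<close>)

lemma taylor_part_cont: "mean_value u \<Longrightarrow> continuous_on UNIV (taylor_part u k)"
 by (rule C1_on_cont[OF harmonic_on_UNIV_C1(1)[OF harmonic_on_taylor_part]])

lemma scaled_am_gm:
 fixes a b p :: real
 assumes "p > 0"
 shows "b * a \<le> (a\<^sup>2 / p) / 2 + (p / 2) * b\<^sup>2"
proof -
 have "0 \<le> (a - p * b)\<^sup>2 / (2 * p)" using assms by simp
 also have "\<dots> = (a\<^sup>2 / p) / 2 + (p / 2) * b\<^sup>2 - b * a"
  using assms by (simp add: power2_eq_square field_simps)
 finally show ?thesis by simp
qed

text \<open>The moment of \<open>u(R \<cdot>)\<close> against the conjugate of its \<open>k\<close>-th part is \<open>R\<^sup>k\<close> times the square norm of that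
 part; the inequality of Cauchy and Schwarz, in the form of a weighted arithmetic-geometric mean,
 bounds it. As \<open>R < 1\<close> is arbitrary, the parts grow at most like \<open>R\<^sup>-\<^sup>k\<close>, which local Cauchy
 estimates would not give.\<close>

lemma bessel_inequality:
 fixes u :: "real ^ 'n \<Rightarrow> complex"
 assumes mv: "mean_value u" and R: "0 < R" "R < 1" and A: "\<And>x. x \<in> cball 0 R \<Longrightarrow> norm (u x) \<le> A"
 shows "integral cube (\<lambda>y. bump 2 y * (norm (taylor_part u k y))\<^sup>2) \<le> (A / R ^ k)\<^sup>2 * bump_mass 2 TYPE('n)"
proof -
 let ?U = "taylor_part u k"
 let ?h = "\<lambda>y. cnj (?U y)"
 define E where "E = integral cube (\<lambda>y. bump 2 y * (norm (?U y))\<^sup>2)"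
 note hU = harmonic_on_taylor_part[OF mv, of k]
 have cU: "continuous_on UNIV ?U" by (rule taylor_part_cont[OF mv])
 have h: "harmonic_on ?h UNIV" "partial_deriv i ?h = (\<lambda>x. cnj (partial_deriv i ?U x))" for i
  using harmonic_on_bounded_linear[OF bounded_linear_cnj hU] by auto
 have euler: "(\<Sum>i\<in>UNIV. of_real (y $ i) * partial_deriv i ?h y) = of_nat k * ?h y" for y
 proof -
  have "(\<Sum>i\<in>UNIV. of_real (y $ i) * partial_deriv i ?h y) = cnj (\<Sum>i\<in>UNIV. of_real (y $ i) * partial_deriv i ?U y)"
   by (simp add: h(2))
  also have "\<dots> = of_nat k * ?h y" unfolding euler_taylor_part[OF mv] by simp
  finally show ?thesis .
 qed
 let ?g = "\<lambda>y. of_real (bump 2 y) * ?h y"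
 have gc: "continuous_on UNIV ?g"
  by (intro continuous_on_mult continuous_on_of_real_bump continuous_on_cnj cU)
 have main: "integral cube (\<lambda>y. ?g y * u (R *\<^sub>R y)) = of_real R ^ k * integral cube (\<lambda>y. ?g y * ?U y)"
  by (rule dilation_moment[OF mv h(1) R euler])
 have "integral cube (\<lambda>y. ?g y * ?U y) = integral cube (\<lambda>y. complex_of_real (bump 2 y * (norm (?U y))\<^sup>2))"
  by (rule integral_cong) (simp add: complex_norm_square[symmetric] mult_ac flip: of_real_power)
 also have "\<dots> = of_real E"
 proof -
  have "((\<lambda>y. bump 2 y * (norm (?U y))\<^sup>2) has_integral E) cube"
   unfolding E_def by (rule integrable_integral, rule bump_weighted_integrable) (intro continuous_intros cU)
  from has_integral_linear[OF this bounded_linear_of_real] show ?thesis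
   unfolding o_def by (rule integral_unique)
 qed
 finally have main2: "integral cube (\<lambda>y. ?g y * u (R *\<^sub>R y)) = of_real (R ^ k * E)" using main by simp
 let ?b = "\<lambda>y :: real ^ 'n. bump 2 y * ((A\<^sup>2 / R ^ k) / 2) + (R ^ k / 2) * (bump 2 y * (norm (?U y))\<^sup>2)"
 have i1: "(\<lambda>y :: real ^ 'n. bump 2 y * ((A\<^sup>2 / R ^ k) / 2)) integrable_on cube"
  by (rule bump_weighted_integrable) simp
 have i2: "(\<lambda>y :: real ^ 'n. (R ^ k / 2) * (bump 2 y * (norm (?U y))\<^sup>2)) integrable_on cube"
  by (rule integrable_on_mult_right, rule bump_weighted_integrable) (intro continuous_intros cU)
 have "norm (integral cube (\<lambda>y. ?g y * u (R *\<^sub>R y))) \<le> integral cube ?b"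
 proof (rule Henstock_Kurzweil_Integration.integral_norm_bound_integral)
  show "(\<lambda>y. ?g y * u (R *\<^sub>R y)) integrable_on cube"
   using mean_value_integrable[OF mean_value_cont[OF mv] gc, of R 0] R by (simp add: bump_eq_0)
  show "?b integrable_on cube" by (rule integrable_add[OF i1 i2])
  fix y :: "real ^ 'n"
  show "norm (?g y * u (R *\<^sub>R y)) \<le> ?b y"
  proof (cases "norm y \<le> 1")
   case True
   have "R *\<^sub>R y \<in> cball 0 R" using mult_left_mono[OF True, of R] R by simp
   then have uA: "norm (u (R *\<^sub>R y)) \<le> A" by (rule A)
   have "norm (?U y) * norm (u (R *\<^sub>R y)) \<le> norm (?U y) * A"
    using uA by (rule mult_left_mono) simp
   also have "\<dots> \<le> (A\<^sup>2 / R ^ k) / 2 + (R ^ k / 2) * (norm (?U y))\<^sup>2"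
    by (rule scaled_am_gm) (use R in simp)
   finally have "bump 2 y * (norm (?U y) * norm (u (R *\<^sub>R y))) \<le> bump 2 y * ((A\<^sup>2 / R ^ k) / 2 + (R ^ k / 2) * (norm (?U y))\<^sup>2)"
    by (rule mult_left_mono) simp
   then show ?thesis by (simp add: norm_mult algebra_simps)
  next
   case False
   then show ?thesis by (simp add: bump_eq_0)
  qed
 qed
 also have "integral cube ?b = bump_mass 2 TYPE('n) * ((A\<^sup>2 / R ^ k) / 2) + (R ^ k / 2) * E"
  by (subst Henstock_Kurzweil_Integration.integral_add[OF i1 i2]) (simp only: integral_bump_const integral_mult_right E_def)
 finally have *: "norm (complex_of_real (R ^ k * E)) \<le> bump_mass 2 TYPE('n) * ((A\<^sup>2 / R ^ k) / 2) + (R ^ k / 2) * E"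
  unfolding main2 .
 have "R ^ k * E \<le> norm (complex_of_real (R ^ k * E))" unfolding norm_of_real by (rule abs_ge_self)
 with * have "(R ^ k / 2) * E \<le> bump_mass 2 TYPE('n) * ((A\<^sup>2 / R ^ k) / 2)" by simp
 then have "E \<le> (A / R ^ k)\<^sup>2 * bump_mass 2 TYPE('n)"
  using R by (simp add: power2_eq_square field_simps)
 then show ?thesis unfolding E_def .
qed

text \<open>For \<open>|x| \<le> q\<close> a ball around \<open>x\<close> of fixed radius lies in the region where the weight is bounded
 below, so a mean value over it is controlled by the quadratic mean.\<close>

lemma mean_value_quadratic_bound:
 assumes q: "0 < q" "q < 1"
 shows "\<exists>C\<ge>0. \<forall>(f :: real ^ 'n \<Rightarrow> complex) L x. mean_value f \<longrightarrow> continuous_on UNIV f \<longrightarrow> L > 0 \<longrightarrow>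
   integral cube (\<lambda>y. bump 2 y * (norm (f y))\<^sup>2) \<le> L\<^sup>2 \<longrightarrow> norm x \<le> q \<longrightarrow> norm (f x) \<le> C * L"
proof -
 define \<rho> where "\<rho> = (1 - q) / 2"
 have \<rho>: "0 < \<rho>" "q + \<rho> < 1" using q by (auto simp: \<rho>_def field_simps)
 define \<kappa> where "\<kappa> = (1 - (q + \<rho>)\<^sup>2)\<^sup>2"
 have \<kappa>: "\<kappa> > 0" using q \<rho> by (simp add: \<kappa>_def power_less_one_iff abs_square_less_1 power2_eq_square[of "1 - _"])
 define M where "M = bump_mass 2 TYPE('n)"
 have M: "M > 0" unfolding M_def by (rule bump_mass_pos)
 define c0 where "c0 = 1 / (\<rho> ^ CARD('n) * \<kappa>)"
 have c0: "c0 > 0" using \<rho> \<kappa> by (simp add: c0_def)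
 define C where "C = (M + c0) / (2 * M)"
 have C0: "0 \<le> C" using M c0 by (simp add: C_def)
 have "norm (f x) \<le> C * L" if mv: "mean_value f" and cf: "continuous_on UNIV f" and L: "L > 0"
  and E: "integral cube (\<lambda>y. bump 2 y * (norm (f y))\<^sup>2) \<le> L\<^sup>2" and x: "norm x \<le> q" for f :: "real ^ 'n \<Rightarrow> complex" and L x
 proof -
  have xr: "norm x + \<rho> < 1" using x \<rho> by simp
  let ?F = "\<lambda>z. bump 2 z * (norm (f z))\<^sup>2"
  let ?Fx = "\<lambda>y. bump 2 y * (norm (f (x + \<rho> *\<^sub>R y)))\<^sup>2"
  have cfx: "continuous_on UNIV (\<lambda>y. (norm (f (x + \<rho> *\<^sub>R y)))\<^sup>2)"
   by (intro continuous_intros continuous_on_compose2[OF cf]) auto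
  have cF: "continuous_on UNIV ?F" by (intro continuous_intros cf)
  \<comment> \<open>change of variables\<close>
  have I: "integral cube ?Fx \<le> c0 * L\<^sup>2"
  proof -
   define Q where "Q = cbox (- 2) (2 :: real ^ 'n)"
   let ?H = "\<lambda>z. bump 2 ((1 / \<rho>) *\<^sub>R (z - x)) * (norm (f z))\<^sup>2"
   let ?bx = "cbox (x - \<rho> *\<^sub>R 1) (x + \<rho> *\<^sub>R 1)"
   have iH: "?H integrable_on ?bx"
    by (intro integrable_continuous continuous_intros continuous_on_subset[OF cf]) auto
   have iF: "?F integrable_on S" if "S = ?bx \<or> S = Q" for S
    using that unfolding Q_def by (auto intro!: integrable_continuous continuous_on_subset[OF cF])
   have "integral cube ?Fx = (1 / \<rho> ^ CARD('n)) * integral ?bx ?H"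
    using has_integral_affinity'[OF integrable_integral[OF iH] \<rho>(1), of x] \<rho>
    by (simp add: cube_def integral_unique divide_inverse add.commute mult.commute)
   also have "integral ?bx ?H \<le> integral ?bx (\<lambda>z. (1 / \<kappa>) * ?F z)"
   proof (rule integral_le[OF iH integrable_on_mult_right[OF iF]])
    fix z
    show "?H z \<le> (1 / \<kappa>) * ?F z"
    proof (cases "norm ((1 / \<rho>) *\<^sub>R (z - x)) < 1")
     case True
     then have "\<bar>1 / \<rho>\<bar> * norm (z - x) < 1" unfolding norm_scaleR .
     then have "norm (z - x) < \<rho>" using \<rho> by (simp add: field_simps)
     then have nz: "norm z < q + \<rho>" using norm_triangle_sub[of z x] x by simp
     have "(norm z)\<^sup>2 \<le> (q + \<rho>)\<^sup>2" using nz by (intro power_mono) auto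
     moreover have "(q + \<rho>)\<^sup>2 \<le> 1" using q \<rho> by (intro power_le_one) auto
     ultimately have "\<kappa> \<le> bump 2 z" unfolding \<kappa>_def bump_def by (intro power_mono) auto
     then have "1 \<le> (1 / \<kappa>) * bump 2 z" using \<kappa> by simp
     then have "bump 2 ((1 / \<rho>) *\<^sub>R (z - x)) \<le> (1 / \<kappa>) * bump 2 z"
      using bump_le_1[of 2 "(1 / \<rho>) *\<^sub>R (z - x)"] by linarith
     then have "?H z \<le> ((1 / \<kappa>) * bump 2 z) * (norm (f z))\<^sup>2" by (rule mult_right_mono) simp
     then show ?thesis by (simp only: mult.assoc)
    next
     case False
     then have "bump 2 ((1 / \<rho>) *\<^sub>R (z - x)) = 0" by (intro bump_eq_0) auto
     then show ?thesis using \<kappa> by simp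
    qed
   qed simp
   also have "\<dots> = (1 / \<kappa>) * integral ?bx ?F" by (rule integral_mult_right)
   also have "integral ?bx ?F \<le> integral Q ?F"
   proof (rule integral_subset_le)
    show "?bx \<subseteq> Q"
    proof
     fix z assume "z \<in> ?bx"
     then have a: "x $ i - \<rho> \<le> z $ i \<and> z $ i \<le> x $ i + \<rho>" for i by (simp add: mem_box_cart)
     have "\<bar>x $ i\<bar> \<le> 1" for i using component_le_norm_cart[of x i] x q by linarith
     then have "- 2 \<le> z $ i \<and> z $ i \<le> 2" for i using a[of i] \<rho> q by (smt (verit))
     then show "z \<in> Q" unfolding Q_def mem_box_cart by simp
    qed
   qed (use iF in auto)
   also have "integral Q ?F = integral cube ?F"
   proof (rule integral_spike_set)
    have "z \<in> cube" if "?F z \<noteq> 0" for z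
    proof -
     have "norm z < 1" using that bump_eq_0[of z 2] by (cases "norm z < 1") auto
     then show ?thesis using cball_subset_cube by (meson less_imp_le mem_cball_0 subsetD)
    qed
    then show "negligible {z \<in> Q - cube. ?F z \<noteq> 0}" by (auto intro!: negligible_subset[OF negligible_empty])
    have "cube \<subseteq> Q"
    proof
     fix z :: "real ^ 'n" assume "z \<in> cube"
     then have "- 1 \<le> z $ i \<and> z $ i \<le> 1" for i unfolding cube_def mem_box_cart by simp
     then have "- 2 \<le> z $ i \<and> z $ i \<le> 2" for i by (smt (verit))
     then show "z \<in> Q" unfolding Q_def mem_box_cart by simp
    qed
    then show "negligible {z \<in> cube - Q. ?F z \<noteq> 0}" by (auto intro!: negligible_subset[OF negligible_empty])
   qed
   also have "\<dots> \<le> L\<^sup>2" by (rule E)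
   finally have "integral cube ?Fx \<le> (1 / \<rho> ^ CARD('n)) * ((1 / \<kappa>) * L\<^sup>2)"
    using \<rho> \<kappa> by (simp add: mult_left_mono divide_right_mono)
   then show ?thesis by (simp add: c0_def)
  qed
  let ?b = "\<lambda>y :: real ^ 'n. bump 2 y * (L / 2) + (1 / (2 * L)) * ?Fx y"
  have i1: "(\<lambda>y :: real ^ 'n. bump 2 y * (L / 2)) integrable_on cube" by (rule bump_weighted_integrable) simp
  have i2: "(\<lambda>y. (1 / (2 * L)) * ?Fx y) integrable_on cube"
   by (rule integrable_on_mult_right[OF bump_weighted_integrable[OF cfx]])
  have "M * norm (f x) = norm (integral cube (\<lambda>y. of_real (bump 2 y) * f (x + \<rho> *\<^sub>R y)))"
   unfolding mean_value_eq[OF mv \<rho>(1) xr] using M by (simp add: norm_mult M_def)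
  also have "\<dots> \<le> integral cube ?b"
  proof (rule Henstock_Kurzweil_Integration.integral_norm_bound_integral)
   show "(\<lambda>y. of_real (bump 2 y) * f (x + \<rho> *\<^sub>R y)) integrable_on cube"
    by (rule mean_value_integrable[OF mean_value_cont[OF mv] continuous_on_of_real_bump]) (use \<rho> xr in auto)
   show "?b integrable_on cube" by (rule integrable_add[OF i1 i2])
   fix y :: "real ^ 'n"
   let ?a = "norm (f (x + \<rho> *\<^sub>R y))"
   have "1 * ?a \<le> L / 2 + (1 / (2 * L)) * ?a\<^sup>2"
    using scaled_am_gm[OF L, of 1 ?a] L by (simp add: field_simps)
   then have "?a \<le> L / 2 + (1 / (2 * L)) * ?a\<^sup>2" by simp
   then have "bump 2 y * ?a \<le> bump 2 y * (L / 2 + (1 / (2 * L)) * ?a\<^sup>2)" by (intro mult_left_mono) auto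
   then show "norm (of_real (bump 2 y) * f (x + \<rho> *\<^sub>R y)) \<le> ?b y" by (simp add: norm_mult algebra_simps)
  qed
  also have "integral cube ?b = M * (L / 2) + (1 / (2 * L)) * integral cube ?Fx"
   by (subst Henstock_Kurzweil_Integration.integral_add[OF i1 i2]) (simp only: integral_bump_const integral_mult_right M_def)
  also have "\<dots> \<le> M * (L / 2) + (1 / (2 * L)) * (c0 * L\<^sup>2)" using I L by (intro add_left_mono mult_left_mono) auto
  also have "\<dots> = M * (C * L)" using L M unfolding C_def by (simp add: field_simps power2_eq_square)
  finally show ?thesis using M by simp
 qed
 then show ?thesis using C0 by blast
qed

lemma taylor_part_geometric_bound:
 fixes u :: "real ^ 'n \<Rightarrow> complex"
 assumes mv: "mean_value u" and s: "0 < s" "s < 1"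
 shows "\<exists>C\<ge>0. \<forall>k x. norm (taylor_part u k x) \<le> C * (norm x / s) ^ k"
proof -
 \<comment> \<open>one factor \<open>q\<close> pays for the bound on the parts, the other for the passage from means to values\<close>
 define q where "q = sqrt s"
 have q: "0 < q" "q < 1" "q * q = s" using s by (auto simp: q_def real_sqrt_lt_1_iff)
 have "norm (0 :: real ^ 'n) + q < 1" using q by simp
 then obtain A0 where A0: "\<And>z. z \<in> cball 0 q \<Longrightarrow> norm (u z) \<le> A0"
  by (rule mean_value_bounded_on_cball[OF mv]) (rule that)
 define A where "A = max A0 1"
 have A: "A > 0" "\<And>z. z \<in> cball 0 q \<Longrightarrow> norm (u z) \<le> A"
  unfolding A_def using A0 by (auto simp: le_max_iff_disj)
 define M where "M = bump_mass 2 TYPE('n)"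
 have M: "M > 0" unfolding M_def by (rule bump_mass_pos)
 obtain C where C: "C \<ge> 0" and bound: "\<And>(f :: real ^ 'n \<Rightarrow> complex) L x. mean_value f \<Longrightarrow> continuous_on UNIV f \<Longrightarrow> L > 0 \<Longrightarrow>
   integral cube (\<lambda>y. bump 2 y * (norm (f y))\<^sup>2) \<le> L\<^sup>2 \<Longrightarrow> norm x \<le> q \<Longrightarrow> norm (f x) \<le> C * L"
  using mean_value_quadratic_bound[OF q(1,2), where 'n='n] by blast
 have main: "norm (taylor_part u k x) \<le> (C * A * sqrt M) * (norm x / s) ^ k" for k x
 proof -
  let ?L = "A / q ^ k * sqrt M"
  define x' where "x' = q *\<^sub>R sgn x"
  have x: "x = (norm x / q) *\<^sub>R x'" using q by (cases "x = 0") (simp_all add: x'_def sgn_div_norm)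
  have nx: "norm x' \<le> q" using q by (simp add: x'_def norm_sgn)
  have b: "norm (taylor_part u k x') \<le> C * ?L"
  proof (rule bound[OF mean_value_taylor_part[OF mv] taylor_part_cont[OF mv] _ _ nx])
   show "?L > 0" using A q M by simp
   have "?L\<^sup>2 = (A / q ^ k)\<^sup>2 * M" using M by (simp add: power_mult_distrib power_divide)
   then show "integral cube (\<lambda>y. bump 2 y * (norm (taylor_part u k y))\<^sup>2) \<le> ?L\<^sup>2"
    using bessel_inequality[OF mv q(1,2) A(2)] unfolding M_def by simp
  qed
  have e: "norm (taylor_part u k x) = (norm x / q) ^ k * norm (taylor_part u k x')"
   by (subst x, subst taylor_part_scale) (use q in \<open>simp add: norm_mult norm_power norm_divide\<close>)
  have "norm (taylor_part u k x) \<le> (norm x / q) ^ k * (C * ?L)"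
   unfolding e by (rule mult_left_mono[OF b]) (use q in simp)
  also have "\<dots> = (C * A * sqrt M) * (norm x / (q * q)) ^ k"
   by (simp add: power_divide power_mult_distrib)
  finally show ?thesis unfolding q(3) .
 qed
 show ?thesis by (rule exI[of _ "C * A * sqrt M"]) (use main C A M in simp)
qed

text \<open>Allowing every \<open>s < 1\<close> makes the condition stable under multipliers of subexponential growth, and
 still gives convergence in the whole ball.\<close>

definition geometric_bound :: "(nat \<Rightarrow> real ^ 'n \<Rightarrow> complex) \<Rightarrow> bool" where
 "geometric_bound U \<longleftrightarrow> (\<forall>s. 0 < s \<longrightarrow> s < 1 \<longrightarrow> (\<exists>C\<ge>0. \<forall>k x. norm (U k x) \<le> C * (norm x / s) ^ k))"

lemma geometric_bound_majorant:
 fixes U :: "nat \<Rightarrow> real ^ 'n \<Rightarrow> complex"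
 assumes "geometric_bound U" "q < 1"
 shows "\<exists>M. summable M \<and> (\<forall>k. \<forall>x\<in>cball 0 q. norm (U k x) \<le> M k)"
proof (cases "0 \<le> q")
 case True
 define s where "s = (1 + q) / 2"
 have s: "0 < s" "s < 1" "q < s" using True assms by (auto simp: s_def)
 obtain C where C: "C \<ge> 0" "\<And>k x. norm (U k x) \<le> C * (norm x / s) ^ k"
  using assms(1) s unfolding geometric_bound_def by blast
 have "norm (U k x) \<le> C * (q / s) ^ k" if "x \<in> cball 0 q" for k x
 proof -
  have "C * (norm x / s) ^ k \<le> C * (q / s) ^ k"
   using that s C by (intro mult_left_mono power_mono divide_right_mono) auto
  then show ?thesis using C(2)[of k x] by linarith
 qed
 moreover have "summable (\<lambda>k. C * (q / s) ^ k)"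
  using s True by (intro summable_mult summable_geometric) simp
 ultimately show ?thesis by blast
next
 case False
 then have "cball (0 :: real ^ 'n) q = {}" by simp
 then show ?thesis using summable_zero by blast
qed

lemma geometric_bound_summable:
 fixes U :: "nat \<Rightarrow> real ^ 'n \<Rightarrow> complex"
 assumes "geometric_bound U" "x \<in> ball 0 1"
 shows "summable (\<lambda>k. norm (U k x))"
proof -
 obtain M where "summable M" "\<forall>k. \<forall>x\<in>cball 0 (norm x). norm (U k x) \<le> M k"
  using geometric_bound_majorant[OF assms(1), of "norm x"] assms(2) by auto
 then show ?thesis by (intro summable_comparison_test[of "\<lambda>k. norm (U k x)" M]) auto
qed

lemma geometric_bound_uniform_limit:
 fixes U :: "nat \<Rightarrow> real ^ 'n \<Rightarrow> complex"
 assumes "geometric_bound U" "q < 1"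
 shows "uniform_limit (cball 0 q) (\<lambda>N x. \<Sum>k<N. U k x) (\<lambda>x. \<Sum>k. U k x) sequentially"
proof -
 obtain M where M: "summable M" "\<And>k x. x\<in>cball 0 q \<Longrightarrow> norm (U k x) \<le> M k"
  using geometric_bound_majorant[OF assms] by blast
 show ?thesis by (rule Weierstrass_m_test[OF M(2) M(1)])
qed

lemma mean_value_series:
 fixes U :: "nat \<Rightarrow> real ^ 'n \<Rightarrow> complex"
 assumes U: "geometric_bound U" and mv: "\<And>k. mean_value (U k)"
 shows "mean_value (\<lambda>x. \<Sum>k. U k x)"
proof (rule mean_value_uniform_limit)
 show "mean_value (\<lambda>x. \<Sum>k<N. U k x)" for N by (rule mean_value_sum[OF mv])
 show "uniform_limit (cball 0 s) (\<lambda>N x. \<Sum>k<N. U k x) (\<lambda>x. \<Sum>k. U k x) sequentially" if "s < 1" for s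
  by (rule geometric_bound_uniform_limit[OF U that])
qed

lemma compact_subset_cball:
 fixes K :: "(real ^ 'n) set"
 assumes "compact K" "K \<subseteq> ball 0 1"
 shows "\<exists>q<1. K \<subseteq> cball 0 q"
proof (cases "K = {}")
 case True
 then show ?thesis by (intro exI[of _ 0]) auto
next
 case False
 obtain z where z: "z \<in> K" "\<And>x. x \<in> K \<Longrightarrow> norm x \<le> norm z"
  using continuous_attains_sup[OF assms(1) False, of norm] continuous_on_norm_id by blast
 then show ?thesis using assms(2) by (intro exI[of _ "norm z"]) auto
qed

lemma homogeneous_expansion_series:
 fixes U :: "nat \<Rightarrow> real ^ 'n \<Rightarrow> complex"
 assumes U: "geometric_bound U" and h: "\<And>k. homogeneous_poly k (U k)" "\<And>k. harmonic_on (U k) UNIV"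
  and eq: "\<And>x. x \<in> ball 0 1 \<Longrightarrow> u x = (\<Sum>k. U k x)"
 shows "homogeneous_expansion u U"
 unfolding homogeneous_expansion_def
proof (intro conjI allI ballI impI)
 show "homogeneous_poly k (U k)" "harmonic_on (U k) UNIV" for k using h by auto
 show "summable (\<lambda>k. norm (U k x))" if "x \<in> ball 0 1" for x
  by (rule geometric_bound_summable[OF U that])
 fix K :: "(real ^ 'n) set" assume K: "compact K \<and> K \<subseteq> ball 0 1"
 then obtain q where q: "q < 1" "K \<subseteq> cball 0 q" using compact_subset_cball by blast
 have "uniform_limit K (\<lambda>N x. \<Sum>k<N. U k x) (\<lambda>x. \<Sum>k. U k x) sequentially"
  by (rule uniform_limit_on_subset[OF geometric_bound_uniform_limit[OF U q(1)] q(2)])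
 then show "uniform_limit K (\<lambda>N x. \<Sum>k<N. U k x) u sequentially"
  by (rule uniform_limit_cong'[THEN iffD1, rotated 2]) (use K eq in auto)
qed

theorem homogeneous_expansion_taylor:
 fixes u :: "real ^ 'n \<Rightarrow> complex"
 assumes mv: "mean_value u"
 shows "geometric_bound (taylor_part u)" "homogeneous_expansion u (taylor_part u)"
proof -
 show gb: "geometric_bound (taylor_part u)"
  unfolding geometric_bound_def using taylor_part_geometric_bound[OF mv] by blast
 define v where "v x = (\<Sum>k. taylor_part u k x)" for x
 have "mean_value v" unfolding v_def by (rule mean_value_series[OF gb mean_value_taylor_part[OF mv]])
 then have d: "mean_value (\<lambda>x. u x - v x)" by (rule mean_value_diff[OF mv])
 obtain \<epsilon> A where e: "0 < \<epsilon>" "\<epsilon> < 1"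
  and sums: "\<And>y. norm y \<le> 1 \<Longrightarrow> (\<lambda>j. taylor_part u j (\<epsilon> *\<^sub>R y)) sums u (\<epsilon> *\<^sub>R y)"
  using taylor_part_near_zero[OF mv] by metis
 have zero: "u x - v x = 0" if "norm x < \<epsilon>" for x
 proof -
  have "norm ((1 / \<epsilon>) *\<^sub>R x) \<le> 1" using that e by simp
  from sums[OF this] show ?thesis using e by (simp add: v_def sums_iff)
 qed
 have "u x = v x" if "x \<in> ball 0 1" for x
  using mean_value_identity[OF d e(1) zero, of x] that by simp
 then show "homogeneous_expansion u (taylor_part u)"
  unfolding v_def
  by (intro homogeneous_expansion_series gb homogeneous_poly_taylor_part harmonic_on_taylor_part[OF mv])
qed

lemma real_powser_zero:
 fixes a :: "nat \<Rightarrow> real"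
 assumes "\<And>t. \<bar>t\<bar> < 1 \<Longrightarrow> (\<lambda>k. a k * t ^ k) sums 0"
 shows "a k = 0"
proof (induction k rule: less_induct)
 case (less k)
 have "(\<lambda>n. a (n + k) * t ^ n) sums 0" if t: "t \<noteq> 0" "norm t < 1" for t
 proof -
  have "(\<lambda>n. a (n + k) * t ^ (n + k)) sums (0 - (\<Sum>i<k. a i * t ^ i))"
   using assms[of t] t by (intro sums_split_initial_segment) auto
  also have "(\<Sum>i<k. a i * t ^ i) = 0" using less by simp
  finally have "(\<lambda>n. inverse (t ^ k) * (a (n + k) * t ^ (n + k))) sums (inverse (t ^ k) * 0)"
   by (intro sums_mult) simp
  moreover have "inverse (t ^ k) * (a (n + k) * t ^ (n + k)) = a (n + k) * t ^ n" for n
   using t by (simp add: power_add field_simps)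
  ultimately show ?thesis by simp
 qed
 then have "((\<lambda>_. 0) \<longlongrightarrow> a (0 + k)) (at (0 :: real))"
  by (intro powser_limit_0_strong[of 1 "\<lambda>n. a (n + k)"]) auto
 then show ?case by (simp add: tendsto_const_iff)
qed

lemma homogeneous_expansion_sums:
 assumes "homogeneous_expansion u U" "x \<in> ball 0 1"
 shows "(\<lambda>k. U k x) sums u x"
proof -
 have *: "\<forall>K. compact K \<and> K \<subseteq> ball 0 1 \<longrightarrow> uniform_limit K (\<lambda>N x. \<Sum>k<N. U k x) u sequentially"
  using assms(1) unfolding homogeneous_expansion_def by blast
 have "uniform_limit {x} (\<lambda>N x. \<Sum>k<N. U k x) u sequentially"
  by (rule *[rule_format]) (use assms(2) in simp)
 then have "(\<lambda>N. \<Sum>k<N. U k x) \<longlonglongrightarrow> u x"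
  by (rule tendsto_uniform_limitI) simp
 then show ?thesis by (simp add: sums_def)
qed

text \<open>On each ray both expansions are power series in the dilation parameter.\<close>

lemma homogeneous_expansion_unique:
 assumes U: "homogeneous_expansion u U" and V: "homogeneous_expansion u V"
 shows "U = V"
proof (intro ext)
 fix k and x :: "real ^ 'a"
 have hU: "homogeneous_poly k (U k)" "homogeneous_poly k (V k)" for k
  using U V unfolding homogeneous_expansion_def by auto
 \<comment> \<open>a point of the unit ball on the same ray, as \<open>x\<close> itself is arbitrary\<close>
 define x' where "x' = (1 / (norm x + 1)) *\<^sub>R x"
 have n1: "norm x + 1 > 0" by (simp add: add_nonneg_pos)
 have nx: "norm x' < 1"
 proof -
  have "norm x / (norm x + 1) < 1" by (subst pos_divide_less_eq[OF n1]) simp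
  then show ?thesis using n1 by (simp add: x'_def)
 qed
 have x: "x = (norm x + 1) *\<^sub>R x'"
  using n1 by (simp add: x'_def)
 have s: "(\<lambda>k. (U k x' - V k x') * of_real t ^ k) sums 0" if "\<bar>t\<bar> < 1" for t
 proof -
  have "norm (t *\<^sub>R x') < 1" using that nx mult_strict_mono'[of "\<bar>t\<bar>" 1 "norm x'" 1] by simp
  then have tx: "t *\<^sub>R x' \<in> ball 0 1" by simp
  have "(\<lambda>k. U k (t *\<^sub>R x') - V k (t *\<^sub>R x')) sums (u (t *\<^sub>R x') - u (t *\<^sub>R x'))"
   by (intro sums_diff homogeneous_expansion_sums[OF U tx] homogeneous_expansion_sums[OF V tx])
  then show ?thesis by (simp add: homogeneous_poly_scale[OF hU(1)] homogeneous_poly_scale[OF hU(2)] algebra_simps)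
 qed
 have "(\<lambda>k. Re (U k x' - V k x') * t ^ k) sums 0" "(\<lambda>k. Im (U k x' - V k x') * t ^ k) sums 0" if "\<bar>t\<bar> < 1" for t
  using sums_Re[OF s[OF that]] sums_Im[OF s[OF that]] by (simp_all flip: of_real_power)
 then have "Re (U k x' - V k x') = 0" "Im (U k x' - V k x') = 0" for k
  by (intro real_powser_zero[of "\<lambda>k. Re (U k x' - V k x')"] real_powser_zero[of "\<lambda>k. Im (U k x' - V k x')"]; simp)+
 then have "U k x' = V k x'" by (simp add: complex_eq_iff)
 then show "U k x = V k x"
  by (subst (1 2) x) (simp only: homogeneous_poly_scale[OF hU(1)] homogeneous_poly_scale[OF hU(2)])
qed

lemma homogeneous_part_eq:
 assumes "homogeneous_expansion u U"
 shows "homogeneous_part u = U"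
 unfolding homogeneous_part_def
 by (rule the_equality[where P = "homogeneous_expansion u" and a = U, OF assms])
   (rule homogeneous_expansion_unique[OF _ assms])

section \<open>Multiplier operators\<close>

text \<open>The growth that does not change the radius of convergence of a homogeneous expansion.\<close>

definition subexp :: "(nat \<Rightarrow> real) \<Rightarrow> bool" where
 "subexp \<sigma> \<longleftrightarrow> (\<forall>q>1. \<exists>C\<ge>0. \<forall>k. \<bar>\<sigma> k\<bar> \<le> C * q ^ k)"

lemma subexp_mult:
 assumes "subexp \<sigma>" "subexp \<tau>"
 shows "subexp (\<lambda>k. \<sigma> k * \<tau> k)"
 unfolding subexp_def
proof (intro allI impI)
 fix q :: real assume q: "q > 1"
 have q': "sqrt q > 1" using q by simp
 obtain C where C: "C \<ge> 0" "\<And>k. \<bar>\<sigma> k\<bar> \<le> C * sqrt q ^ k" using assms(1) q' unfolding subexp_def by blast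
 obtain D where D: "D \<ge> 0" "\<And>k. \<bar>\<tau> k\<bar> \<le> D * sqrt q ^ k" using assms(2) q' unfolding subexp_def by blast
 have "\<bar>\<sigma> k * \<tau> k\<bar> \<le> (C * D) * q ^ k" for k
 proof -
  have "\<bar>\<sigma> k * \<tau> k\<bar> \<le> (C * sqrt q ^ k) * (D * sqrt q ^ k)"
   unfolding abs_mult using C D q by (intro mult_mono) auto
  also have "\<dots> = (C * D) * (sqrt q * sqrt q) ^ k" by (simp only: power_mult_distrib mult_ac)
  finally show ?thesis using q by simp
 qed
 then show "\<exists>C\<ge>0. \<forall>k. \<bar>\<sigma> k * \<tau> k\<bar> \<le> C * q ^ k" using C D by (intro exI[of _ "C * D"]) simp
qed

lemma subexp_bounded:
 assumes "\<And>k. \<bar>\<sigma> k\<bar> \<le> B"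
 shows "subexp \<sigma>"
 unfolding subexp_def
proof (intro allI impI)
 fix q :: real assume q: "q > 1"
 have B: "B \<ge> 0" using assms[of 0] by linarith
 have "\<bar>\<sigma> k\<bar> \<le> B * q ^ k" for k
 proof -
  have "B * 1 \<le> B * q ^ k" using B q by (intro mult_left_mono one_le_power) auto
  then show ?thesis using assms[of k] by linarith
 qed
 then show "\<exists>C\<ge>0. \<forall>k. \<bar>\<sigma> k\<bar> \<le> C * q ^ k" using B by blast
qed

lemma subexp_shift:
 assumes "subexp \<sigma>"
 shows "subexp (\<lambda>k. \<sigma> (k + n))"
 unfolding subexp_def
proof (intro allI impI)
 fix q :: real assume q: "q > 1"
 obtain C where C: "C \<ge> 0" "\<And>k. \<bar>\<sigma> k\<bar> \<le> C * q ^ k" using assms(1) q unfolding subexp_def by blast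
 have "\<bar>\<sigma> (k + n)\<bar> \<le> (C * q ^ n) * q ^ k" for k using C(2)[of "k + n"] by (simp add: power_add mult_ac)
 then show "\<exists>C\<ge>0. \<forall>k. \<bar>\<sigma> (k + n)\<bar> \<le> C * q ^ k" using C q by (intro exI[of _ "C * q ^ n"]) auto
qed

lemma subexp_ratio:
 assumes pos: "\<And>k. \<sigma> k > 0" and lim: "(\<lambda>k. \<sigma> (Suc k) / \<sigma> k) \<longlonglongrightarrow> 1"
 shows "subexp \<sigma>"
 unfolding subexp_def
proof (intro allI impI)
 fix q :: real assume q: "q > 1"
 then have "\<forall>\<^sub>F k in sequentially. \<sigma> (Suc k) / \<sigma> k < q" using lim by (simp add: order_tendstoD(2))
 then obtain K where K: "\<And>k. k \<ge> K \<Longrightarrow> \<sigma> (Suc k) / \<sigma> k < q" unfolding eventually_sequentially by blast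
 define C where "C = (\<Sum>j\<le>K. \<sigma> j)"
 have C: "C \<ge> 0" unfolding C_def using pos by (intro sum_nonneg) (simp add: less_imp_le)
 have le: "\<sigma> k \<le> C" if "k \<le> K" for k
  unfolding C_def using that pos by (intro member_le_sum) (auto simp: less_imp_le)
 have "\<sigma> k \<le> C * q ^ k" for k
 proof (induction k)
  case 0
  then show ?case using le[of 0] by simp
 next
  case (Suc k)
  show ?case
  proof (cases "Suc k \<le> K")
   case True
   have "C * 1 \<le> C * q ^ Suc k" using C q by (intro mult_left_mono one_le_power) auto
   then show ?thesis using le[OF True] by linarith
  next
   case False
   then have "\<sigma> (Suc k) / \<sigma> k < q" by (intro K) simp
   then have "\<sigma> (Suc k) < q * \<sigma> k" using pos[of k] by (simp add: field_simps)
   also have "q * \<sigma> k \<le> q * (C * q ^ k)" using Suc q by (intro mult_left_mono) auto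
   finally show ?thesis by (simp add: mult_ac)
  qed
 qed
 then show "\<exists>C\<ge>0. \<forall>k. \<bar>\<sigma> k\<bar> \<le> C * q ^ k" using C pos by (intro exI[of _ C]) (simp add: less_imp_le)
qed

lemma affine_ratio_tendsto:
 fixes a b :: real
 shows "(\<lambda>k. (b + real k) / (a + real k)) \<longlonglongrightarrow> 1"
proof -
 have l: "(\<lambda>k. c / real k) \<longlonglongrightarrow> 0" for c :: real by (rule lim_const_over_n)
 have "(\<lambda>k. (b / real k + 1) / (a / real k + 1)) \<longlonglongrightarrow> (0 + 1) / (0 + 1)"
  by (intro tendsto_intros l) auto
 then have *: "(\<lambda>k. (b / real k + 1) / (a / real k + 1)) \<longlonglongrightarrow> 1" by simp
 show ?thesis
 proof (rule Lim_transform_eventually[OF *])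
  show "\<forall>\<^sub>F k in sequentially. (b / real k + 1) / (a / real k + 1) = (b + real k) / (a + real k)"
   using eventually_gt_at_top[of 0]
  proof eventually_elim
   case (elim k)
   have "b / real k + 1 = (b + real k) / real k" "a / real k + 1 = (a + real k) / real k"
    using elim by (simp_all add: add_divide_distrib)
   then show ?case using elim by simp
  qed
 qed
qed

lemma subexp_affine: "subexp (\<lambda>k. real k + c)"
proof -
 have "subexp (\<lambda>k. (\<bar>c\<bar> + 1) + real k)"
 proof (rule subexp_ratio)
  show "(\<lambda>k. ((\<bar>c\<bar> + 1) + real (Suc k)) / ((\<bar>c\<bar> + 1) + real k)) \<longlonglongrightarrow> 1"
   using affine_ratio_tendsto[of "\<bar>c\<bar> + 2" "\<bar>c\<bar> + 1"] by (simp add: add_ac)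
 qed linarith
 moreover have "subexp (\<lambda>k. (real k + c) / ((\<bar>c\<bar> + 1) + real k))"
  by (rule subexp_bounded[of _ 1]) (auto simp: abs_le_iff divide_le_eq le_divide_eq)
 ultimately have "subexp (\<lambda>k. ((\<bar>c\<bar> + 1) + real k) * ((real k + c) / ((\<bar>c\<bar> + 1) + real k)))"
  by (rule subexp_mult)
 moreover have "(\<bar>c\<bar> + 1) + real k \<noteq> 0" for k by (smt (verit) of_nat_0_le_iff)
 ultimately show ?thesis by simp
qed

lemma subexp_power: "subexp \<sigma> \<Longrightarrow> subexp (\<lambda>k. \<sigma> k ^ N)"
proof (induction N)
 case 0
 then show ?case by (intro subexp_bounded[of _ 1]) simp
next
 case (Suc N)
 then show ?case using subexp_mult[of \<sigma> "\<lambda>k. \<sigma> k ^ N"] by simp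
qed

lemma subexp_real_power: "subexp (\<lambda>k. real k ^ N)"
 using subexp_power[OF subexp_affine[of 0]] by simp

lemma subexp_pochhammer_ratio:
 fixes a b :: real
 assumes "a > 0" "b > 0"
 shows "subexp (\<lambda>k. pochhammer b k / pochhammer a k)"
proof (rule subexp_ratio)
 show "pochhammer b k / pochhammer a k > 0" for k using assms by (simp add: pochhammer_pos)
 have "(pochhammer b (Suc k) / pochhammer a (Suc k)) / (pochhammer b k / pochhammer a k) = (b + real k) / (a + real k)" for k
  using pochhammer_pos[OF assms(1), of k] pochhammer_pos[OF assms(2), of k] by (simp add: pochhammer_Suc)
 then show "(\<lambda>k. (pochhammer b (Suc k) / pochhammer a (Suc k)) / (pochhammer b k / pochhammer a k)) \<longlonglongrightarrow> 1"
  using affine_ratio_tendsto[of b a] by simp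
qed

definition mult_op :: "(nat \<Rightarrow> real) \<Rightarrow> (real ^ 'n \<Rightarrow> complex) \<Rightarrow> real ^ 'n \<Rightarrow> complex" where
 "mult_op \<sigma> u x = (\<Sum>k. of_real (\<sigma> k) * taylor_part u k x)"

lemma homogeneous_part_taylor: "mean_value u \<Longrightarrow> homogeneous_part u = taylor_part u"
 by (rule homogeneous_part_eq) (rule homogeneous_expansion_taylor)

lemma geometric_bound_mult:
 assumes \<sigma>: "subexp \<sigma>" and U: "geometric_bound U"
 shows "geometric_bound (\<lambda>k x. of_real (\<sigma> k) * U k x)"
 unfolding geometric_bound_def
proof (intro allI impI)
 fix s :: real assume s: "0 < s" "s < 1"
 define s' where "s' = (1 + s) / 2"
 have s': "0 < s'" "s' < 1" "s' / s > 1" using s by (auto simp: s'_def field_simps)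
 obtain C where C: "C \<ge> 0" "\<And>k x. norm (U k x) \<le> C * (norm x / s') ^ k"
  using U s' unfolding geometric_bound_def by blast
 obtain D where D: "D \<ge> 0" "\<And>k. \<bar>\<sigma> k\<bar> \<le> D * (s' / s) ^ k"
  using \<sigma> s' unfolding subexp_def by blast
 have "norm (of_real (\<sigma> k) * U k x) \<le> (D * C) * (norm x / s) ^ k" for k x
 proof -
  have "norm (of_real (\<sigma> k) * U k x) \<le> (D * (s' / s) ^ k) * (C * (norm x / s') ^ k)"
   unfolding norm_mult norm_of_real using C D s s' by (intro mult_mono) auto
  also have "\<dots> = (D * C) * ((s' / s) * (norm x / s')) ^ k" by (simp only: power_mult_distrib mult_ac)
  also have "(s' / s) * (norm x / s') = norm x / s" using s' by simp
  finally show ?thesis .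
 qed
 then show "\<exists>C\<ge>0. \<forall>k x. norm (of_real (\<sigma> k) * U k x) \<le> C * (norm x / s) ^ k"
  using C D by (intro exI[of _ "D * C"]) simp
qed

lemma mult_op:
 fixes u :: "real ^ 'n \<Rightarrow> complex"
 assumes mv: "mean_value u" and \<sigma>: "subexp \<sigma>"
 shows "mean_value (mult_op \<sigma> u)"
  and "taylor_part (mult_op \<sigma> u) k = (\<lambda>x. of_real (\<sigma> k) * taylor_part u k x)"
  and "x \<in> ball 0 1 \<Longrightarrow> (\<lambda>k. of_real (\<sigma> k) * taylor_part u k x) sums mult_op \<sigma> u x"
proof -
 have gb: "geometric_bound (\<lambda>k x. of_real (\<sigma> k) * taylor_part u k x)"
  by (rule geometric_bound_mult[OF \<sigma> homogeneous_expansion_taylor(1)[OF mv]])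
 have m: "mean_value (\<lambda>x. of_real (\<sigma> k) * taylor_part u k x)" for k
  by (rule mean_value_cmult[OF mean_value_taylor_part[OF mv]])
 show mvm: "mean_value (mult_op \<sigma> u)"
  unfolding mult_op_def by (rule mean_value_series[OF gb m])
 have he: "homogeneous_expansion (mult_op \<sigma> u) (\<lambda>k x. of_real (\<sigma> k) * taylor_part u k x)"
  by (rule homogeneous_expansion_series[OF gb])
    (auto intro: homogeneous_poly_cmult homogeneous_poly_taylor_part
     harmonic_on_bounded_linear(1)[OF bounded_linear_mult_right] harmonic_on_taylor_part mv simp: mult_op_def)
 show "taylor_part (mult_op \<sigma> u) k = (\<lambda>x. of_real (\<sigma> k) * taylor_part u k x)"
  using homogeneous_expansion_unique[OF homogeneous_expansion_taylor(2)[OF mvm] he] by metis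
 show "(\<lambda>k. of_real (\<sigma> k) * taylor_part u k x) sums mult_op \<sigma> u x" if "x \<in> ball 0 1"
  by (rule homogeneous_expansion_sums[OF he that])
qed

lemma mult_op_mult_op:
 assumes "mean_value u" "subexp \<tau>"
 shows "mult_op \<sigma> (mult_op \<tau> u) = mult_op (\<lambda>k. \<sigma> k * \<tau> k) u"
 unfolding mult_op_def[of \<sigma> "mult_op \<tau> u"] mult_op(2)[OF assms] by (simp add: mult_op_def fun_eq_iff mult.assoc)

lemma taylor_sums_ball:
 assumes "mean_value u" "x \<in> ball 0 1"
 shows "(\<lambda>k. taylor_part u k x) sums u x"
 by (rule homogeneous_expansion_sums[OF homogeneous_expansion_taylor(2)[OF assms(1)] assms(2)])

lemma mult_op_one:
 assumes "mean_value u" "x \<in> ball 0 1"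
 shows "mult_op (\<lambda>_. 1) u x = u x"
 using taylor_sums_ball[OF assms] by (simp add: mult_op_def sums_iff)

lemma taylor_part_0: "taylor_part u 0 x = u 0"
 by (simp add: taylor_part_def)

lemma mult_op_change_0:
 assumes mv: "mean_value u" and \<sigma>: "subexp \<sigma>" and x: "x \<in> ball 0 1" and eq: "\<And>k. k \<ge> 1 \<Longrightarrow> \<sigma> k = \<tau> k"
 shows "mult_op \<tau> u x = mult_op \<sigma> u x + of_real (\<tau> 0 - \<sigma> 0) * u 0"
proof -
 have "(\<lambda>k. of_real (\<sigma> k) * taylor_part u k x) sums mult_op \<sigma> u x" by (rule mult_op(3)[OF mv \<sigma> x])
 moreover have "(\<lambda>k. if k = 0 then of_real (\<tau> 0 - \<sigma> 0) * u 0 else 0) sums (of_real (\<tau> 0 - \<sigma> 0) * u 0)"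
  using sums_single[of 0 "\<lambda>k. of_real (\<tau> 0 - \<sigma> 0) * u 0"] by (simp add: eq_commute cong: if_cong)
 ultimately have "(\<lambda>k. of_real (\<sigma> k) * taylor_part u k x + (if k = 0 then of_real (\<tau> 0 - \<sigma> 0) * u 0 else 0)) sums
   (mult_op \<sigma> u x + of_real (\<tau> 0 - \<sigma> 0) * u 0)" by (rule sums_add)
 moreover have "of_real (\<sigma> k) * taylor_part u k x + (if k = 0 then of_real (\<tau> 0 - \<sigma> 0) * u 0 else 0) = of_real (\<tau> k) * taylor_part u k x" for k
 proof (cases "k = 0")
  case True
  then show ?thesis by (simp add: taylor_part_0 algebra_simps)
 next
  case False
  then show ?thesis using eq[of k] by simp
 qed
 ultimately show ?thesis by (simp add: mult_op_def sums_iff)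
qed

lemma mult_op_at_0:
 assumes mv: "mean_value u" and \<sigma>: "subexp \<sigma>"
 shows "mult_op \<sigma> u 0 = of_real (\<sigma> 0) * u 0"
 using mult_op(2)[OF assms, of 0] taylor_part_0[of "mult_op \<sigma> u" 0] taylor_part_0[of u 0] by (simp add: fun_eq_iff)

lemma mean_value_eqI:
 assumes "mean_value u" "mean_value w" "\<And>k. taylor_part u k = taylor_part w k" "x \<in> ball 0 1"
 shows "u x = w x"
 using taylor_sums_ball[OF assms(1,4)] taylor_sums_ball[OF assms(2,4)] assms(3) by (simp add: sums_iff)

lemma taylor_part_partial:
 assumes "mean_value u"
 shows "taylor_part (partial_deriv i u) k = partial_deriv i (taylor_part u (Suc k))"
proof
 fix x
 have "partial_deriv i (taylor_part u (Suc k)) x = (1 / fact (Suc k)) * partial_deriv i (diff_form (Suc k) u 0) x"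
  unfolding taylor_part_alt by (rule partial_deriv_cmult[OF diff_form_differentiable[OF assms]]) simp
 also have "partial_deriv i (diff_form (Suc k) u 0) x = of_nat (Suc k) * diff_form k (partial_deriv i u) 0 x"
  using partial_deriv_diff_form[OF assms, of 0 i k] by simp
 also have "(1 / fact (Suc k)) * (of_nat (Suc k) * diff_form k (partial_deriv i u) 0 x) = taylor_part (partial_deriv i u) k x"
  unfolding taylor_part_def fact_Suc by (simp del: of_nat_Suc)
 finally show "taylor_part (partial_deriv i u) k x = partial_deriv i (taylor_part u (Suc k)) x" by (rule sym)
qed

lemma partial_mult_op:
 assumes mv: "mean_value u" and \<sigma>: "subexp \<sigma>" and x: "x \<in> ball 0 1"
 shows "partial_deriv i (mult_op \<sigma> u) x = mult_op (\<lambda>k. \<sigma> (Suc k)) (partial_deriv i u) x"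
proof (rule mean_value_eqI[OF _ _ _ x])
 have s: "subexp (\<lambda>k. \<sigma> (Suc k))" using subexp_shift[OF \<sigma>, of 1] by simp
 show "mean_value (partial_deriv i (mult_op \<sigma> u))" by (rule mean_value_partial[OF mult_op(1)[OF mv \<sigma>]])
 show "mean_value (mult_op (\<lambda>k. \<sigma> (Suc k)) (partial_deriv i u))"
  by (rule mult_op(1)[OF mean_value_partial[OF mv] s])
 fix k
 have "partial_deriv i (\<lambda>x. of_real (\<sigma> (Suc k)) * taylor_part u (Suc k) x) y =
   of_real (\<sigma> (Suc k)) * partial_deriv i (taylor_part u (Suc k)) y" for y
  by (rule partial_deriv_cmult)
    (use harmonic_on_taylor_part[OF mv] in \<open>simp add: harmonic_on_def differentiable_on_def\<close>)
 then show "taylor_part (partial_deriv i (mult_op \<sigma> u)) k = taylor_part (mult_op (\<lambda>k. \<sigma> (Suc k)) (partial_deriv i u)) k"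
  unfolding taylor_part_partial[OF mult_op(1)[OF mv \<sigma>]] mult_op(2)[OF mv \<sigma>] mult_op(2)[OF mean_value_partial[OF mv] s]
  by (simp add: fun_eq_iff taylor_part_partial[OF mv])
qed

text \<open>On a ray the expansion is a power series in the dilation parameter, convergent beyond \<open>1\<close> because
 the ball is open; it is differentiated termwise at \<open>1\<close>.\<close>

lemma radial_deriv_mult_op:
 fixes u :: "real ^ 'n \<Rightarrow> complex"
 assumes mv: "mean_value u" and x: "x \<in> ball 0 1"
 shows "radial_deriv u x = mult_op real u x"
proof -
 \<comment> \<open>any dilation beyond \<open>1\<close> that keeps \<open>x\<close> in the ball\<close>
 define \<rho> where "\<rho> = 2 / (1 + norm x)"
 have nx: "norm x < 1" using x by simp
 have \<rho>: "\<rho> > 1" "\<rho> * norm x < 1"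
 proof -
  have p: "1 + norm x > 0" by (simp add: add_pos_nonneg)
  show "\<rho> > 1" using nx p by (simp add: \<rho>_def)
  have "2 * norm x < 1 + norm x" using nx by simp
  then show "\<rho> * norm x < 1" using p by (simp add: \<rho>_def)
 qed
 define c where "c k = taylor_part u k x" for k
 have sums: "(\<lambda>k. c k * of_real t ^ k) sums u (t *\<^sub>R x)" if "t *\<^sub>R x \<in> ball 0 1" for t
  using taylor_sums_ball[OF mv that] by (simp add: taylor_part_scale c_def mult.commute)
 have summ: "summable (\<lambda>k. c k * (of_real \<rho> :: complex) ^ k)"
  using sums[of \<rho>] \<rho> by (auto simp: sums_iff)
 have "((\<lambda>z. \<Sum>k. c k * z ^ k) has_field_derivative (\<Sum>k. diffs c k * of_real 1 ^ k)) (at (of_real 1))"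
  by (rule termdiffs_strong[OF summ]) (use \<rho> in simp)
 then have "((\<lambda>t. \<Sum>k. c k * of_real t ^ k) has_vector_derivative (\<Sum>k. diffs c k * of_real 1 ^ k)) (at (1 :: real))"
  by (rule has_vector_derivative_real_field)
 then have "((\<lambda>t. u (t *\<^sub>R x)) has_vector_derivative (\<Sum>k. diffs c k * of_real 1 ^ k)) (at 1)"
 proof (rule has_vector_derivative_transform_within_open)
  show "open ((\<lambda>t. t *\<^sub>R x) -` ball 0 1)"
   by (rule open_vimage) (auto intro!: continuous_intros)
  show "(\<Sum>k. c k * of_real t ^ k) = u (t *\<^sub>R x)" if "t \<in> (\<lambda>t. t *\<^sub>R x) -` ball 0 1" for t
   using sums[of t] that by (simp add: sums_iff)
 qed (use x in simp)
 then have 1: "((\<lambda>t. u (t *\<^sub>R x)) has_vector_derivative (\<Sum>k. diffs c k)) (at 1)" by simp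
 have "((\<lambda>t. diff_form 0 u (0 + t *\<^sub>R x) x) has_vector_derivative diff_form (Suc 0) u (0 + 1 *\<^sub>R x) x) (at 1)"
  by (rule diff_form_line_derivative[OF mv]) (use x in simp)
 then have 2: "((\<lambda>t. u (t *\<^sub>R x)) has_vector_derivative radial_deriv u x) (at 1)"
  by (simp add: radial_deriv_def)
 have 3: "radial_deriv u x = (\<Sum>k. diffs c k)"
  using vector_derivative_at[OF 1] vector_derivative_at[OF 2] by simp
 have "(\<lambda>k. of_real (real k) * c k) sums mult_op real u x"
  unfolding c_def using mult_op(3)[OF mv subexp_affine[of 0] x] by simp
 then have "(\<lambda>k. of_real (real (Suc k)) * c (Suc k)) sums mult_op real u x"
  by (subst sums_Suc_iff) simp
 then have "(\<lambda>k. diffs c k) sums mult_op real u x" by (simp add: diffs_def)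
 then show ?thesis using 3 by (simp add: sums_iff)
qed

lemma radial_deriv_cong:
 assumes "\<And>y. y \<in> ball 0 1 \<Longrightarrow> u y = w y" "x \<in> ball 0 1"
 shows "radial_deriv u x = radial_deriv w x"
 unfolding radial_deriv_def using partial_deriv_cong[OF open_ball assms(2,1)] by simp

lemma radial_deriv_iterate:
 assumes mv: "mean_value u" and x: "x \<in> ball 0 1"
 shows "(radial_deriv ^^ N) u x = mult_op (\<lambda>k. real k ^ N) u x"
 using x
proof (induction N arbitrary: x)
 case 0
 then show ?case using mult_op_one[OF mv] by simp
next
 case (Suc N)
 have s: "subexp (\<lambda>k. real k ^ N)" using subexp_power[OF subexp_affine[of 0]] by simp
 have "(radial_deriv ^^ Suc N) u x = radial_deriv (mult_op (\<lambda>k. real k ^ N) u) x"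
  using radial_deriv_cong[OF Suc.IH Suc.prems] by simp
 also have "\<dots> = mult_op real (mult_op (\<lambda>k. real k ^ N) u) x"
  by (rule radial_deriv_mult_op[OF mult_op(1)[OF mv s] Suc.prems])
 finally show ?case by (simp add: mult_op_mult_op[OF mv s])
qed

definition iter_partial :: "'n list \<Rightarrow> (real ^ 'n \<Rightarrow> complex) \<Rightarrow> real ^ 'n \<Rightarrow> complex" where
 "iter_partial is u = foldr partial_deriv is u"

lemma iter_partial_simps [simp]:
 "iter_partial [] u = u" "iter_partial (i # is) u = partial_deriv i (iter_partial is u)"
 by (simp_all add: iter_partial_def)

lemma mean_value_iter_partial: "mean_value u \<Longrightarrow> mean_value (iter_partial is u)"
 by (induction "is") (simp_all add: mean_value_partial)

text \<open>Each derivative lowers the degree by one, hence the shift of the multiplier.\<close>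

lemma iter_partial_mult_op:
 assumes mv: "mean_value u" and \<sigma>: "subexp \<sigma>" and x: "x \<in> ball 0 1"
 shows "iter_partial is (mult_op \<sigma> u) x = mult_op (\<lambda>k. \<sigma> (k + length is)) (iter_partial is u) x"
 using x
proof (induction "is" arbitrary: x)
 case (Cons i "is")
 have "iter_partial (i # is) (mult_op \<sigma> u) x = partial_deriv i (mult_op (\<lambda>k. \<sigma> (k + length is)) (iter_partial is u)) x"
  using partial_deriv_cong[OF open_ball Cons.prems Cons.IH] by simp
 also have "\<dots> = mult_op (\<lambda>k. \<sigma> (Suc k + length is)) (partial_deriv i (iter_partial is u)) x"
  by (rule partial_mult_op[OF mean_value_iter_partial[OF mv] subexp_shift[OF \<sigma>] Cons.prems])
 finally show ?case by simp
qed simp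

lemma D_op_mult_op:
 fixes u :: "real ^ 'n \<Rightarrow> complex"
 assumes "mean_value u"
 shows "D_op s t u = mult_op (\<lambda>k. gamma_coeff CARD('n) k (s + t) / gamma_coeff CARD('n) k s) u"
 by (simp add: fun_eq_iff D_op_def mult_op_def homogeneous_part_taylor[OF assms])

section \<open>Weighted integrals of powers\<close>

lemma nn_integral_lborel_affine:
 fixes g :: "'a::euclidean_space \<Rightarrow> ennreal"
 assumes g: "g \<in> borel_measurable borel" and c: "c \<noteq> 0"
 shows "(\<integral>\<^sup>+x. g x \<partial>lborel) = ennreal (\<bar>c\<bar> ^ DIM('a)) * (\<integral>\<^sup>+x. g (t + c *\<^sub>R x) \<partial>lborel)"
proof -
 have m: "(\<lambda>x. t + c *\<^sub>R x) \<in> borel_measurable borel" by measurable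
 note [measurable] = g m
 have "(\<integral>\<^sup>+x. g x \<partial>lborel) = (\<integral>\<^sup>+x. g x \<partial>(density (distr lborel borel (\<lambda>x. t + c *\<^sub>R x)) (\<lambda>_. ennreal (\<bar>c\<bar> ^ DIM('a)))))"
  using lborel_affine[OF c, of t] by (simp add: ennreal_power[symmetric])
 also have "\<dots> = (\<integral>\<^sup>+x. ennreal (\<bar>c\<bar> ^ DIM('a)) * g x \<partial>distr lborel borel (\<lambda>x. t + c *\<^sub>R x))"
  by (subst nn_integral_density) simp_all
 also have "\<dots> = (\<integral>\<^sup>+x. ennreal (\<bar>c\<bar> ^ DIM('a)) * g (t + c *\<^sub>R x) \<partial>lborel)"
  by (subst nn_integral_distr) simp_all
 also have "\<dots> = ennreal (\<bar>c\<bar> ^ DIM('a)) * (\<integral>\<^sup>+x. g (t + c *\<^sub>R x) \<partial>lborel)"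
  by (rule nn_integral_cmult) simp
 finally show ?thesis .
qed

lemma ball_in_borel [measurable]: "ball x r \<in> sets (borel :: 'a::metric_space measure)"
 by simp

definition absp :: "real \<Rightarrow> (real ^ 'n \<Rightarrow> complex) \<Rightarrow> real ^ 'n \<Rightarrow> ennreal" where
 "absp p f x = ennreal (norm (f x) powr p) * indicator (ball 0 1) x"

lemma absp_measurable:
 fixes f :: "real ^ 'n \<Rightarrow> complex"
 assumes "continuous_on (ball 0 1) f"
 shows "absp p f \<in> borel_measurable borel"
proof -
 have [measurable]: "(\<lambda>x. indicator (ball 0 1) x *\<^sub>R f x) \<in> borel_measurable borel"
  by (rule borel_measurable_continuous_on_indicator[OF _ assms]) simp
 have m: "(\<lambda>x. ennreal (norm (indicator (ball 0 1) x *\<^sub>R f x) powr p)) \<in> borel_measurable borel"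
  by measurable
 have eq: "(\<lambda>x. ennreal (norm (indicator (ball 0 1) x *\<^sub>R f x) powr p)) = absp p f"
  by (auto simp: absp_def fun_eq_iff indicator_def)
 show ?thesis using m unfolding eq .
qed

lemma mean_value_L1_bound:
 fixes u :: "real ^ 'n \<Rightarrow> complex"
 assumes mv: "mean_value u" and d: "0 < d" "norm y + d < 1"
 shows "ennreal (norm (u y)) \<le> ennreal (1 / (bump_mass 2 TYPE('n) * d ^ CARD('n))) *
   (\<integral>\<^sup>+z. absp 1 u z * indicator (ball y d) z \<partial>lborel)"
proof -
 let ?M = "bump_mass 2 TYPE('n)"
 have M: "?M > 0" by (rule bump_mass_pos)
 note [measurable] = absp_measurable[OF mean_value_cont[OF mv], of 1]
 define F where "F w = bump 2 w * norm (u (y + d *\<^sub>R w))" for w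
 have cc: "continuous_on UNIV (\<lambda>w. of_real (bump 2 w) * u (y + d *\<^sub>R w))"
 proof (rule continuous_on_support[of "{w. y + d *\<^sub>R w \<in> ball 0 1}"])
  show "open {w. y + d *\<^sub>R w \<in> ball 0 1}" by (rule open_affine_vimage) simp
  show "cball 0 1 \<subseteq> {w. y + d *\<^sub>R w \<in> ball 0 1}"
   using in_ball_affine[OF d(2)] d(1) by (simp add: subset_iff)
  show "continuous_on {w. y + d *\<^sub>R w \<in> ball 0 1} (\<lambda>w. of_real (bump 2 w) * u (y + d *\<^sub>R w))"
   by (intro continuous_on_mult continuous_on_subset[OF continuous_on_of_real_bump subset_UNIV]
     continuous_on_compose2[OF mean_value_cont[OF mv]] continuous_intros) auto
 qed (simp add: bump_eq_0)
 have Fn: "F w = norm (of_real (bump 2 w) * u (y + d *\<^sub>R w))" for w by (simp add: F_def norm_mult)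
 have cF: "continuous_on UNIV F" unfolding Fn by (intro continuous_on_norm cc)
 have iF: "F integrable_on cube" unfolding cube_def by (rule integrable_continuous, rule continuous_on_subset[OF cF]) simp
 have "?M * norm (u y) = norm (integral cube (\<lambda>w. of_real (bump 2 w) * u (y + d *\<^sub>R w)))"
  unfolding mean_value_eq[OF mv d] using M by (simp add: norm_mult)
 also have "\<dots> \<le> integral cube F"
  by (rule Henstock_Kurzweil_Integration.integral_norm_bound_integral[OF _ iF])
    (use Fn in \<open>auto simp: cube_def intro!: integrable_continuous continuous_on_subset[OF cc]\<close>)
 finally have "ennreal (?M * norm (u y)) \<le> ennreal (integral cube F)" by (rule ennreal_leI)
 also have "ennreal (integral cube F) = (\<integral>\<^sup>+w. ennreal (indicator cube w * F w) \<partial>lborel)"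
 proof (rule nn_integral_has_integral_lborel[symmetric])
  have [measurable]: "F \<in> borel_measurable borel" by (rule borel_measurable_continuous_onI[OF cF])
  have [measurable]: "cube \<in> sets (borel :: (real ^ 'n) measure)" unfolding cube_def by simp
  show "(\<lambda>w. indicator cube w * F w) \<in> borel_measurable borel" by measurable
  show "0 \<le> indicator cube w * F w" for w by (simp add: F_def)
  have "(F has_integral integral cube F) cube" by (rule integrable_integral[OF iF])
  moreover have "(\<lambda>w. indicator cube w * F w) = (\<lambda>w. if w \<in> cube then F w else 0)" by (auto simp: fun_eq_iff)
  ultimately show "((\<lambda>w. indicator cube w * F w) has_integral integral cube F) UNIV"
   by (simp only: has_integral_restrict_UNIV)
 qed
 also have "\<dots> \<le> (\<integral>\<^sup>+w. absp 1 u (y + d *\<^sub>R w) * indicator (ball y d) (y + d *\<^sub>R w) \<partial>lborel)"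
 proof (rule nn_integral_mono)
  fix w :: "real ^ 'n"
  show "ennreal (indicator cube w * F w) \<le> absp 1 u (y + d *\<^sub>R w) * indicator (ball y d) (y + d *\<^sub>R w)"
  proof (cases "norm w < 1")
   case True
   have b: "y + d *\<^sub>R w \<in> ball 0 1" using True d by (intro in_ball_affine) auto
   have b2: "y + d *\<^sub>R w \<in> ball y d" using mult_strict_left_mono[OF True d(1)] d by (simp add: dist_norm)
   have "indicator cube w * F w \<le> 1 * (1 * norm (u (y + d *\<^sub>R w)))"
    unfolding F_def by (intro mult_mono) (auto simp: bump_le_1 indicator_def)
   then show ?thesis using b b2 by (simp add: absp_def ennreal_leI)
  qed (simp add: F_def bump_eq_0)
 qed
 finally have "ennreal (d ^ CARD('n)) * ennreal (?M * norm (u y)) \<le>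
   ennreal (d ^ CARD('n)) * (\<integral>\<^sup>+w. absp 1 u (y + d *\<^sub>R w) * indicator (ball y d) (y + d *\<^sub>R w) \<partial>lborel)"
  by (rule mult_left_mono) simp
 also have "\<dots> = (\<integral>\<^sup>+z. absp 1 u z * indicator (ball y d) z \<partial>lborel)"
 proof -
  have m: "(\<lambda>z. absp 1 u z * indicator (ball y d) z) \<in> borel_measurable borel" by measurable
  show ?thesis using nn_integral_lborel_affine[OF m, of d y] d by simp
 qed
 finally have "ennreal (1 / (?M * d ^ CARD('n))) * (ennreal (d ^ CARD('n)) * ennreal (?M * norm (u y)))
   \<le> ennreal (1 / (?M * d ^ CARD('n))) * (\<integral>\<^sup>+z. absp 1 u z * indicator (ball y d) z \<partial>lborel)"
  by (rule mult_left_mono) simp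
 moreover have "ennreal (1 / (?M * d ^ CARD('n))) * (ennreal (d ^ CARD('n)) * ennreal (?M * norm (u y))) = ennreal (norm (u y))"
  using M d by (simp flip: ennreal_mult'')
 ultimately show ?thesis by simp
qed

text \<open>For \<open>p < 1\<close> this does not follow from the mean value property by convexity. Let \<open>S\<close> be the supremum
 of \<open>(R - |x - y|)\<^sup>e |u(y)|\<close> over the ball, with \<open>e = n/p\<close>. Writing \<open>|u| = |u|\<^sup>1\<^sup>-\<^sup>p |u|\<^sup>p\<close> in
 the mean value inequality and bounding the first factor by \<open>S\<close> gives
 \<open>S \<le> C S\<^sup>1\<^sup>-\<^sup>p \<integral> |u|\<^sup>p\<close>, and \<open>S\<close>, being finite, can be cancelled.\<close>

lemma hardy_littlewood:
 assumes p: "0 < p" "p < 1"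
 shows "\<exists>C>0. \<forall>(u :: real ^ 'n \<Rightarrow> complex) x R. mean_value u \<longrightarrow> 0 < R \<longrightarrow> norm x + R < 1 \<longrightarrow>
   ennreal (norm (u x) powr p) \<le> ennreal (C / R ^ CARD('n)) * (\<integral>\<^sup>+z. absp p u z * indicator (ball x R) z \<partial>lborel)"
proof -
 let ?M = "bump_mass 2 TYPE('n)"
 have M: "?M > 0" by (rule bump_mass_pos)
 define n where "n = real CARD('n)"
 have n: "n > 0" by (simp add: n_def)
 \<comment> \<open>the exponent for which the powers of the distance cancel in the final estimate\<close>
 define e where "e = n / p"
 have e: "e > 0" using n p by (simp add: e_def)
 define C where "C = 2 powr e / ?M"
 have C: "C > 0" using M by (simp add: C_def)
 have "ennreal (norm (u x) powr p) \<le> ennreal (C / R ^ CARD('n)) * (\<integral>\<^sup>+z. absp p u z * indicator (ball x R) z \<partial>lborel)"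
  if mv: "mean_value u" and R: "0 < R" "norm x + R < 1" for u :: "real ^ 'n \<Rightarrow> complex" and x R
 proof -
  note [measurable] = absp_measurable[OF mean_value_cont[OF mv]]
  have sub: "cball x R \<subseteq> ball 0 1" by (rule cball_subset_unit_ball[OF R(2)])
  obtain B where B: "\<And>z. z \<in> cball x R \<Longrightarrow> norm (u z) \<le> B"
   by (rule mean_value_bounded_on_cball[OF mv R(2)]) (rule that)
  have B0: "0 \<le> B" using B[of x] R by (meson norm_ge_zero centre_in_cball less_imp_le order_trans)
  define I where "I = (\<integral>\<^sup>+z. absp p u z * indicator (ball x R) z \<partial>lborel)"
  have "I \<le> (\<integral>\<^sup>+z. ennreal (B powr p) * indicator (ball x R) z \<partial>lborel)"
   unfolding I_def
  proof (rule nn_integral_mono)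
   fix z
   show "absp p u z * indicator (ball x R) z \<le> ennreal (B powr p) * indicator (ball x R) z"
    using B[of z] sub p by (auto simp: absp_def indicator_def intro!: ennreal_leI powr_mono2)
  qed
  also have "\<dots> = ennreal (B powr p) * emeasure lborel (ball x R)" by (rule nn_integral_cmult_indicator) simp
  also have "\<dots> < \<infinity>" using emeasure_lborel_ball_finite[of x R] by (simp add: ennreal_mult_less_top)
  finally obtain J where J: "I = ennreal J" "J \<ge> 0" by (cases I) auto
  let ?D = "\<lambda>y. R - dist x y"
  define S where "S = (SUP y\<in>ball x R. ?D y powr e * norm (u y))"
  have bdd: "bdd_above ((\<lambda>y. ?D y powr e * norm (u y)) ` ball x R)"
  proof (rule bdd_aboveI2)
   fix y assume y: "y \<in> ball x R"
   show "?D y powr e * norm (u y) \<le> R powr e * B"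
    using y B[of y] e by (intro mult_mono powr_mono2) auto
  qed
  have Sle: "?D y powr e * norm (u y) \<le> S" if "y \<in> ball x R" for y
   unfolding S_def by (rule cSUP_upper[OF that bdd])
  have xR: "x \<in> ball x R" using R by simp
  have S0: "S \<ge> 0" using Sle[OF xR] by (meson mult_nonneg_nonneg norm_ge_zero order_trans powr_ge_zero)
  have Sx: "R powr e * norm (u x) \<le> S" using Sle[OF xR] by simp
  show ?thesis
  proof (cases "S = 0")
   case True
   then have "norm (u x) = 0" using Sx R by (simp add: mult_le_0_iff)
   then show ?thesis by simp
  next
   case False
   then have S: "S > 0" using S0 by simp
   have main: "?D y powr e * norm (u y) \<le> C * S powr (1 - p) * J" if y: "y \<in> ball x R" for y
   proof -
    \<comment> \<open>on the ball of radius \<open>d\<close> around \<open>y\<close> the distance to the boundary of the large ball is at least \<open>d\<close>\<close>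
    define d where "d = ?D y / 2"
    have d: "d > 0" using y by (simp add: d_def)
    have "2 * d = R - dist x y" by (simp add: d_def)
    then have dd: "dist x y + 2 * d = R" by linarith
    have yd: "norm y + d < 1" using norm_triangle_sub[of y x] dd d R by (simp add: dist_norm norm_minus_commute)
    have zin: "z \<in> ball x R" "d \<le> ?D z" if "z \<in> ball y d" for z
     using that dist_triangle[of x z y] dd d by auto
    have "absp 1 u z * indicator (ball y d) z \<le> ennreal ((S * d powr (- e)) powr (1 - p)) * (absp p u z * indicator (ball x R) z)" for z
    proof (cases "z \<in> ball y d")
     case True
     note z = zin[OF True]
     have "d powr e * norm (u z) \<le> S"
     proof -
      have "d powr e * norm (u z) \<le> ?D z powr e * norm (u z)"
       using z d e by (intro mult_right_mono powr_mono2) auto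
      then show ?thesis using Sle[OF z(1)] by linarith
     qed
     then have uz: "norm (u z) \<le> S * d powr (- e)"
      using d by (simp add: powr_minus field_simps)
     have "norm (u z) = norm (u z) powr (1 - p) * norm (u z) powr p"
      by (cases "u z = 0") (simp_all flip: powr_add)
     also have "\<dots> \<le> (S * d powr (- e)) powr (1 - p) * norm (u z) powr p"
      using uz p by (intro mult_right_mono powr_mono2) auto
     finally have "ennreal (norm (u z)) \<le> ennreal ((S * d powr (- e)) powr (1 - p)) * ennreal (norm (u z) powr p)"
      by (simp flip: ennreal_mult'' add: ennreal_leI)
     moreover have "z \<in> ball 0 1" by (rule subsetD[OF sub]) (use z(1) in simp)
     ultimately show ?thesis using True z(1) by (simp add: absp_def)
    qed simp
    then have "(\<integral>\<^sup>+z. absp 1 u z * indicator (ball y d) z \<partial>lborel) \<le>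
      (\<integral>\<^sup>+z. ennreal ((S * d powr (- e)) powr (1 - p)) * (absp p u z * indicator (ball x R) z) \<partial>lborel)"
     by (intro nn_integral_mono)
    also have "\<dots> = ennreal ((S * d powr (- e)) powr (1 - p)) * ennreal J"
     unfolding J(1)[symmetric] I_def by (rule nn_integral_cmult) measurable
    finally have i: "(\<integral>\<^sup>+z. absp 1 u z * indicator (ball y d) z \<partial>lborel) \<le> ennreal ((S * d powr (- e)) powr (1 - p)) * ennreal J" .
    have c1: "0 \<le> 1 / (?M * d ^ CARD('n))" using M d by simp
    have "ennreal (norm (u y)) \<le> ennreal (1 / (?M * d ^ CARD('n))) * (ennreal ((S * d powr (- e)) powr (1 - p)) * ennreal J)"
     by (rule order_trans[OF mean_value_L1_bound[OF mv d yd] mult_left_mono[OF i]]) simp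
    also have "\<dots> = ennreal (1 / (?M * d ^ CARD('n)) * ((S * d powr (- e)) powr (1 - p) * J))"
     unfolding ennreal_mult[OF c1 mult_nonneg_nonneg[OF powr_ge_zero J(2)]] ennreal_mult[OF powr_ge_zero J(2)] ..
    finally have "ennreal (norm (u y)) \<le> ennreal (1 / (?M * d ^ CARD('n)) * ((S * d powr (- e)) powr (1 - p) * J))" .
    then have "norm (u y) \<le> 1 / (?M * d ^ CARD('n)) * ((S * d powr (- e)) powr (1 - p) * J)"
     using J M d by (subst (asm) ennreal_le_iff) auto
    then have uy: "norm (u y) \<le> 1 / (?M * d ^ CARD('n)) * ((S * d powr (- e)) powr (1 - p) * J)" .
    have "?D y = 2 * d" by (simp add: d_def)
    then have De: "?D y powr e = 2 powr e * d powr e" using d by (simp add: powr_mult)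
    have "?D y powr e * norm (u y) \<le> (2 powr e * d powr e) * (1 / (?M * d ^ CARD('n)) * ((S * d powr (- e)) powr (1 - p) * J))"
     unfolding De by (rule mult_left_mono[OF uy]) simp
    also have "\<dots> = C * S powr (1 - p) * J"
    proof -
     have "d ^ CARD('n) = d powr n" using d by (simp add: n_def powr_realpow)
     moreover have "(S * d powr (- e)) powr (1 - p) = S powr (1 - p) * d powr (- e * (1 - p))"
      using S d by (simp add: powr_mult powr_powr)
     moreover have "d powr e * (1 / d powr n) * d powr (- e * (1 - p)) = 1"
     proof -
      have "d powr e * (1 / d powr n) * d powr (- e * (1 - p)) = d powr (e + - n + (- e * (1 - p)))"
       by (simp only: powr_add powr_minus_divide[of d n])
      also have "e + - n + (- e * (1 - p)) = 0" using p by (simp add: e_def field_simps)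
      finally show ?thesis using d by simp
     qed
     moreover have "(2 powr e * d powr e) * (1 / (?M * X) * ((Y * Z) * J)) = (2 powr e / ?M) * Y * J * (d powr e * (1 / X) * Z)" for X Y Z
      by simp
     ultimately show ?thesis unfolding C_def by simp
    qed
    finally show ?thesis .
   qed
   have "S \<le> C * S powr (1 - p) * J"
    unfolding S_def by (rule cSUP_least) (use R main in \<open>auto simp: S_def\<close>)
   then have "S powr p * S powr (1 - p) \<le> (C * J) * S powr (1 - p)"
    using S by (simp flip: powr_add add: mult_ac)
   then have Sp: "S powr p \<le> C * J" using S by simp
   have "R ^ CARD('n) * norm (u x) powr p = (R powr e * norm (u x)) powr p"
    using R p by (simp add: powr_mult powr_powr e_def n_def powr_realpow)
   also have "\<dots> \<le> S powr p" using Sx p by (intro powr_mono2) auto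
   finally have "norm (u x) powr p \<le> C / R ^ CARD('n) * J" using Sp R by (simp add: field_simps)
   then have "ennreal (norm (u x) powr p) \<le> ennreal (C / R ^ CARD('n)) * ennreal J"
    using J by (simp flip: ennreal_mult'' add: ennreal_leI)
   then show ?thesis using J(1) unfolding I_def by simp
  qed
 qed
 then show ?thesis using C by blast
qed

text \<open>The average of \<open>|u|\<^sup>p\<close> over the ball around \<open>x\<close> of radius \<open>3/4\<close> of the distance to the boundary. The
 normalizing factor uses the distance of \<open>z\<close> instead of that of \<open>x\<close>, which is comparable and makes
 the integration over \<open>x\<close> in Fubini's theorem immediate.\<close>

definition whitney_avg :: "real \<Rightarrow> (real ^ 'n \<Rightarrow> complex) \<Rightarrow> real ^ 'n \<Rightarrow> ennreal" where
 "whitney_avg p u x = (\<integral>\<^sup>+z. absp p u z *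
   (ennreal ((1 - norm z) powr (- real CARD('n))) * indicator {z. dist x z < 3 / 4 * (1 - norm x)} z) \<partial>lborel)"

lemma whitney_kernel_measurable:
 fixes u :: "real ^ 'n \<Rightarrow> complex"
 assumes "continuous_on (ball 0 1) u"
 shows "(\<lambda>(x, z). absp p u z * (ennreal ((1 - norm z) powr (- real CARD('n))) * indicator {z. dist x z < 3 / 4 * (1 - norm x)} z))
   \<in> borel_measurable (lborel \<Otimes>\<^sub>M lborel)"
proof -
 note [measurable] = absp_measurable[OF assms]
 have "open {q :: (real ^ 'n) \<times> (real ^ 'n). dist (fst q) (snd q) < 3 / 4 * (1 - norm (fst q))}"
  by (intro open_Collect_less continuous_intros)
 then have [measurable]: "Measurable.pred (borel \<Otimes>\<^sub>M borel) (\<lambda>q :: (real ^ 'n) \<times> (real ^ 'n). dist (fst q) (snd q) < 3 / 4 * (1 - norm (fst q)))"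
  unfolding borel_prod by (simp add: pred_def borel_open)
 have "(\<lambda>q. absp p u (snd q) * (ennreal ((1 - norm (snd q)) powr (- real CARD('n))) *
   (if dist (fst q) (snd q) < 3 / 4 * (1 - norm (fst q)) then 1 else 0))) \<in> borel_measurable (lborel \<Otimes>\<^sub>M lborel)"
  by measurable
 then show ?thesis by (simp add: split_beta' indicator_def if_distrib cong: if_cong)
qed

lemma whitney_avg_measurable:
 fixes u :: "real ^ 'n \<Rightarrow> complex"
 assumes "continuous_on (ball 0 1) u"
 shows "whitney_avg p u \<in> borel_measurable borel"
 using lborel.borel_measurable_nn_integral[OF whitney_kernel_measurable[OF assms, of p]]
 unfolding whitney_avg_def[abs_def] by simp

text \<open>The balls of radius \<open>(1 - |x|)/8\<close> around the points \<open>y\<close> lie in the ball of the average, so a single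
 average controls a whole Whitney ball of values.\<close>

lemma whitney_avg_bound:
 assumes p: "0 < p" "p < 1"
 shows "\<exists>C>0. \<forall>(u :: real ^ 'n \<Rightarrow> complex) x y. mean_value u \<longrightarrow> norm x < 1 \<longrightarrow> dist x y \<le> (1 - norm x) / 2 \<longrightarrow>
   ennreal (norm (u y) powr p) \<le> ennreal C * whitney_avg p u x"
proof -
 obtain C where C: "C > 0" and HL: "\<And>(u :: real ^ 'n \<Rightarrow> complex) x R. mean_value u \<Longrightarrow> 0 < R \<Longrightarrow> norm x + R < 1 \<Longrightarrow>
   ennreal (norm (u x) powr p) \<le> ennreal (C / R ^ CARD('n)) * (\<integral>\<^sup>+z. absp p u z * indicator (ball x R) z \<partial>lborel)"
  using hardy_littlewood[OF p, where 'n='n] by blast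
 have "ennreal (norm (u y) powr p) \<le> ennreal (C * 14 ^ CARD('n)) * whitney_avg p u x"
  if mv: "mean_value u" and x: "norm x < 1" and y: "dist x y \<le> (1 - norm x) / 2" for u :: "real ^ 'n \<Rightarrow> complex" and x y
 proof -
  note [measurable] = absp_measurable[OF mean_value_cont[OF mv]]
  \<comment> \<open>an eighth, as \<open>1/2 + 1/8 < 3/4\<close>\<close>
  define R where "R = (1 - norm x) / 8"
  have R: "R > 0" "1 - norm x = 8 * R" using x by (simp_all add: R_def)
  have yR: "norm y + R < 1"
   using norm_triangle_sub[of y x] y R by (simp add: dist_norm norm_minus_commute)
  have "ennreal (norm (u y) powr p) \<le> ennreal (C / R ^ CARD('n)) * (\<integral>\<^sup>+z. absp p u z * indicator (ball y R) z \<partial>lborel)"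
   by (rule HL[OF mv R(1) yR])
  also have "\<dots> = (\<integral>\<^sup>+z. ennreal (C / R ^ CARD('n)) * (absp p u z * indicator (ball y R) z) \<partial>lborel)"
   by (rule nn_integral_cmult[symmetric]) measurable
  also have "\<dots> \<le> (\<integral>\<^sup>+z. ennreal (C * 14 ^ CARD('n)) * (absp p u z *
   (ennreal ((1 - norm z) powr (- real CARD('n))) * indicator {z. dist x z < 3 / 4 * (1 - norm x)} z)) \<partial>lborel)"
  proof (rule nn_integral_mono)
   fix z
   show "ennreal (C / R ^ CARD('n)) * (absp p u z * indicator (ball y R) z) \<le> ennreal (C * 14 ^ CARD('n)) * (absp p u z *
   (ennreal ((1 - norm z) powr (- real CARD('n))) * indicator {z. dist x z < 3 / 4 * (1 - norm x)} z))"
   proof (cases "z \<in> ball y R")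
    case True
    have dz: "dist x z < 5 * R" using True y R dist_triangle[of x z y] by simp
    then have in_set: "dist x z < 3 / 4 * (1 - norm x)" using R by simp
    have nz: "norm z < 1" using norm_triangle_sub[of z x] dz R by (simp add: dist_norm norm_minus_commute)
    have le14: "1 - norm z \<le> 14 * R" using norm_triangle_sub[of x z] dz R by (simp add: dist_norm norm_minus_commute)
    have "1 / R ^ CARD('n) \<le> 14 ^ CARD('n) * (1 - norm z) powr (- real CARD('n))"
    proof -
     have "(1 - norm z) ^ CARD('n) \<le> (14 * R) ^ CARD('n)" using le14 nz by (intro power_mono) auto
     then have "1 / (14 * R) ^ CARD('n) \<le> 1 / (1 - norm z) ^ CARD('n)" using nz R by (intro divide_left_mono) auto
     then have "14 ^ CARD('n) * (1 / (14 * R) ^ CARD('n)) \<le> 14 ^ CARD('n) * (1 / (1 - norm z) ^ CARD('n))"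
      by (intro mult_left_mono) auto
     moreover have "14 ^ CARD('n) * (1 / (14 * R) ^ CARD('n)) = 1 / R ^ CARD('n)"
      by (simp add: power_mult_distrib)
     moreover have "(1 - norm z) powr (- real CARD('n)) = 1 / (1 - norm z) ^ CARD('n)"
      using nz by (simp add: powr_minus powr_realpow divide_inverse)
     ultimately show ?thesis by (simp only:)
    qed
    then have "C * (1 / R ^ CARD('n)) \<le> C * (14 ^ CARD('n) * (1 - norm z) powr (- real CARD('n)))"
     using C by (intro mult_left_mono) auto
    then have "ennreal (C / R ^ CARD('n)) \<le> ennreal (C * 14 ^ CARD('n)) * ennreal ((1 - norm z) powr (- real CARD('n)))"
     using C by (simp flip: ennreal_mult'' add: ennreal_leI mult.assoc)
    then have "ennreal (C / R ^ CARD('n)) * absp p u z \<le> (ennreal (C * 14 ^ CARD('n)) * ennreal ((1 - norm z) powr (- real CARD('n)))) * absp p u z"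
     by (rule mult_right_mono) simp
    then show ?thesis using True in_set by (simp add: mult_ac)
   qed simp
  qed
  also have "\<dots> = ennreal (C * 14 ^ CARD('n)) * whitney_avg p u x"
   unfolding whitney_avg_def by (rule nn_integral_cmult) measurable
  finally show ?thesis .
 qed
 then show ?thesis using C by (intro exI[of _ "C * 14 ^ CARD('n)"]) simp
qed

definition wint :: "real \<Rightarrow> real \<Rightarrow> (real ^ 'n \<Rightarrow> complex) \<Rightarrow> ennreal" where
 "wint p \<beta> f = (\<integral>\<^sup>+x. absp p f x * ennreal ((1 - norm x) powr \<beta>) \<partial>lborel)"

lemma powr_comparable:
 fixes a b \<beta> :: real
 assumes "0 < a" "0 < b" "a \<le> 4 * b" "b \<le> 4 * a"
 shows "a powr \<beta> \<le> 4 powr \<bar>\<beta>\<bar> * b powr \<beta>"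
proof (cases "\<beta> \<ge> 0")
 case True
 have "a powr \<beta> \<le> (4 * b) powr \<beta>" using assms True by (intro powr_mono2) auto
 then show ?thesis using True assms by (simp add: powr_mult)
next
 case False
 have "a powr \<beta> \<le> (b / 4) powr \<beta>" by (rule powr_mono2') (use assms False in simp_all)
 also have "\<dots> = b powr \<beta> / 4 powr \<beta>" by (rule powr_divide)
 also have "\<dots> = b powr \<beta> * inverse (4 powr \<beta>)" by (rule divide_inverse)
 also have "inverse (4 powr \<beta>) = 4 powr (- \<beta>)" by (rule powr_minus[symmetric])
 also have "- \<beta> = \<bar>\<beta>\<bar>" using False by simp
 also have "b powr \<beta> * 4 powr \<bar>\<beta>\<bar> = 4 powr \<bar>\<beta>\<bar> * b powr \<beta>" by (rule mult.commute)
 finally show ?thesis .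
qed

text \<open>By Fubini's theorem: the points \<open>x\<close> whose Whitney ball contains \<open>z\<close> form a set of measure
 comparable to \<open>(1 - |z|)\<^sup>n\<close>, on which the weights are comparable.\<close>

lemma whitney_avg_integral:
 "\<exists>C>0. \<forall>(u :: real ^ 'n \<Rightarrow> complex). continuous_on (ball 0 1) u \<longrightarrow>
   (\<integral>\<^sup>+x. ennreal ((1 - norm x) powr \<beta>) * indicator (ball 0 1) x * whitney_avg p u x \<partial>lborel) \<le> ennreal C * wint p \<beta> u"
proof -
 define C where "C = 4 powr \<bar>\<beta>\<bar> * (unit_ball_vol (real CARD('n)) * 3 ^ CARD('n)) + 1"
 have C: "C > 0" unfolding C_def by (simp add: add_nonneg_pos)
 have "(\<integral>\<^sup>+x. ennreal ((1 - norm x) powr \<beta>) * indicator (ball 0 1) x * whitney_avg p u x \<partial>lborel) \<le> ennreal C * wint p \<beta> u"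
  if cont: "continuous_on (ball 0 1) u" for u :: "real ^ 'n \<Rightarrow> complex"
 proof -
  note [measurable] = absp_measurable[OF cont]
  let ?k = "\<lambda>x z. absp p u z * (ennreal ((1 - norm z) powr (- real CARD('n))) * indicator {z. dist x z < 3 / 4 * (1 - norm x)} z)"
  let ?w = "\<lambda>x :: real ^ 'n. ennreal ((1 - norm x) powr \<beta>) * indicator (ball 0 1) x"
  have km: "(\<lambda>(x, z). ?w x * ?k x z) \<in> borel_measurable (lborel \<Otimes>\<^sub>M lborel)"
  proof -
   have "(\<lambda>q. ?w (fst q) * (case q of (x, z) \<Rightarrow> ?k x z)) \<in> borel_measurable (lborel \<Otimes>\<^sub>M lborel)"
    by (rule borel_measurable_times_ennreal[OF _ whitney_kernel_measurable[OF cont]]) measurable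
   then show ?thesis by (simp add: split_beta')
  qed
  have kx: "?k x \<in> borel_measurable lborel" for x
   by measurable
  have "(\<integral>\<^sup>+x. ?w x * whitney_avg p u x \<partial>lborel) = (\<integral>\<^sup>+x. \<integral>\<^sup>+z. ?w x * ?k x z \<partial>lborel \<partial>lborel)"
   unfolding whitney_avg_def by (intro nn_integral_cong nn_integral_cmult[symmetric] kx)
  also have "\<dots> = (\<integral>\<^sup>+z. \<integral>\<^sup>+x. ?w x * ?k x z \<partial>lborel \<partial>lborel)"
   by (rule lborel_pair.Fubini'[OF km, symmetric])
  also have "\<dots> \<le> (\<integral>\<^sup>+z. ennreal C * (absp p u z * ennreal ((1 - norm z) powr \<beta>)) \<partial>lborel)"
  proof (rule nn_integral_mono)
   fix z
   show "(\<integral>\<^sup>+x. ?w x * ?k x z \<partial>lborel) \<le> ennreal C * (absp p u z * ennreal ((1 - norm z) powr \<beta>))"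
   proof (cases "norm z < 1")
    case False
    then show ?thesis by (simp add: absp_def)
   next
    case True
    define r where "r = 1 - norm z"
    have r: "r > 0" using True by (simp add: r_def)
    let ?a = "absp p u z * (ennreal (r powr (- real CARD('n))) * ennreal (4 powr \<bar>\<beta>\<bar> * r powr \<beta>))"
    have "?w x * ?k x z \<le> ?a * indicator (ball z (3 * r)) x" for x
    proof (cases "norm x < 1 \<and> dist x z < 3 / 4 * (1 - norm x)")
     case True
     have 1: "r \<le> 4 * (1 - norm x)" using norm_triangle_sub[of x z] True by (simp add: r_def dist_norm norm_minus_commute)
     have 2: "1 - norm x \<le> 4 * r" using norm_triangle_sub[of z x] True by (simp add: r_def dist_norm norm_minus_commute)
     have "dist z x < 3 * r" using True 2 by (simp add: dist_commute)
     moreover have "ennreal ((1 - norm x) powr \<beta>) \<le> ennreal (4 powr \<bar>\<beta>\<bar> * r powr \<beta>)"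
      using powr_comparable[of "1 - norm x" r \<beta>] 1 2 True r by (intro ennreal_leI) auto
     moreover have "?w x * ?k x z = absp p u z * (ennreal (r powr (- real CARD('n))) * ennreal ((1 - norm x) powr \<beta>))"
      using True by (simp add: r_def mult_ac)
     ultimately show ?thesis by (simp add: mult_left_mono)
    next
     case False
     then have z0: "?w x * ?k x z = 0" by (auto simp: indicator_def)
     show ?thesis unfolding z0 by simp
    qed
    then have "(\<integral>\<^sup>+x. ?w x * ?k x z \<partial>lborel) \<le>
      (\<integral>\<^sup>+x. ?a * indicator (ball z (3 * r)) x \<partial>lborel)"
     by (intro nn_integral_mono)
    also have "\<dots> = ?a * emeasure lborel (ball z (3 * r))"
     by (rule nn_integral_cmult_indicator) simp
    also have "emeasure lborel (ball z (3 * r)) = ennreal (unit_ball_vol (real CARD('n)) * (3 * r) ^ CARD('n))"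
     using emeasure_ball[of "3 * r" z] r by simp
    also have "?a * ennreal (unit_ball_vol (real CARD('n)) * (3 * r) ^ CARD('n))
      = absp p u z * ennreal (r powr (- real CARD('n)) * (4 powr \<bar>\<beta>\<bar> * r powr \<beta>) * (unit_ball_vol (real CARD('n)) * (3 * r) ^ CARD('n)))"
     using r by (simp add: ennreal_mult mult.assoc)
    also have "r powr (- real CARD('n)) * (4 powr \<bar>\<beta>\<bar> * r powr \<beta>) * (unit_ball_vol (real CARD('n)) * (3 * r) ^ CARD('n)) = (C - 1) * r powr \<beta>"
    proof -
     have "r powr (- real CARD('n)) * r ^ CARD('n) = 1" using r by (simp add: powr_minus powr_realpow)
     then show ?thesis unfolding C_def by (simp add: power_mult_distrib mult_ac)
    qed
    also have "absp p u z * ennreal ((C - 1) * r powr \<beta>) \<le> absp p u z * ennreal (C * r powr \<beta>)"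
     by (intro mult_left_mono ennreal_leI mult_right_mono) auto
    also have "\<dots> = ennreal C * (absp p u z * ennreal ((1 - norm z) powr \<beta>))"
     using C by (simp add: r_def ennreal_mult mult_ac)
    finally show ?thesis .
   qed
  qed
  also have "\<dots> = ennreal C * wint p \<beta> u"
   unfolding wint_def by (rule nn_integral_cmult) measurable
  finally show ?thesis by simp
 qed
 then show ?thesis using C by blast
qed

lemma powr_add_subadditive:
 fixes a b p :: real
 assumes "0 \<le> a" "0 \<le> b" "0 < p" "p \<le> 1"
 shows "(a + b) powr p \<le> a powr p + b powr p"
proof (cases "a = 0 \<or> b = 0")
 case True
 then show ?thesis by auto
next
 case False
 then have ab: "a > 0" "b > 0" using assms by auto
 have "(a + b) powr p = a * (a + b) powr (p - 1) + b * (a + b) powr (p - 1)"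
  using ab powr_mult_base[of "a + b" "p - 1"] by (simp add: algebra_simps)
 also have "\<dots> \<le> a * a powr (p - 1) + b * b powr (p - 1)"
  using ab assms by (intro add_mono mult_left_mono powr_mono2') auto
 also have "\<dots> = a powr p + b powr p"
  using ab powr_mult_base[of a "p - 1"] powr_mult_base[of b "p - 1"] by simp
 finally show ?thesis .
qed

lemma wint_cong:
 assumes "\<And>x. x \<in> ball 0 1 \<Longrightarrow> norm (f x) = norm (g x)"
 shows "wint p \<beta> f = wint p \<beta> g"
 unfolding wint_def by (rule nn_integral_cong) (use assms in \<open>auto simp: absp_def indicator_def\<close>)

lemma wint_mono:
 assumes "p > 0" "\<And>x. x \<in> ball 0 1 \<Longrightarrow> norm (f x) \<le> norm (g x)"
 shows "wint p \<beta> f \<le> wint p \<beta> g"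
 unfolding wint_def
proof (rule nn_integral_mono, rule mult_right_mono)
 fix x
 show "absp p f x \<le> absp p g x"
  using assms(2)[of x] assms(1) by (auto simp: absp_def indicator_def intro!: ennreal_leI powr_mono2)
qed simp

lemma wint_mono_weight:
 fixes f :: "real ^ 'n \<Rightarrow> complex"
 assumes "\<beta> \<le> \<beta>'"
 shows "wint p \<beta>' f \<le> wint p \<beta> f"
 unfolding wint_def
proof (rule nn_integral_mono)
 fix x :: "real ^ 'n"
 show "absp p f x * ennreal ((1 - norm x) powr \<beta>') \<le> absp p f x * ennreal ((1 - norm x) powr \<beta>)"
 proof (cases "norm x < 1")
  case True
  then have "(1 - norm x) powr \<beta>' \<le> (1 - norm x) powr \<beta>" using assms by (intro powr_mono') auto
  then show ?thesis by (intro mult_left_mono ennreal_leI) auto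
 qed (simp add: absp_def)
qed

lemma wint_add:
 fixes f g :: "real ^ 'n \<Rightarrow> complex"
 assumes p: "0 < p" "p \<le> 1" and f: "continuous_on (ball 0 1) f" and g: "continuous_on (ball 0 1) g"
 shows "wint p \<beta> (\<lambda>x. f x + g x) \<le> wint p \<beta> f + wint p \<beta> g"
proof -
 note [measurable] = absp_measurable[OF f] absp_measurable[OF g]
 have "absp p (\<lambda>x. f x + g x) x \<le> absp p f x + absp p g x" for x
 proof -
  have "norm (f x + g x) powr p \<le> (norm (f x) + norm (g x)) powr p"
   using p by (intro powr_mono2 norm_triangle_ineq) auto
  also have "\<dots> \<le> norm (f x) powr p + norm (g x) powr p" by (rule powr_add_subadditive) (use p in auto)
  finally have "ennreal (norm (f x + g x) powr p) \<le> ennreal (norm (f x) powr p) + ennreal (norm (g x) powr p)"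
   by (simp flip: ennreal_plus add: ennreal_leI)
  then show ?thesis unfolding absp_def by (metis distrib_right mult_right_mono zero_le)
 qed
 then have "wint p \<beta> (\<lambda>x. f x + g x) \<le> (\<integral>\<^sup>+x. absp p f x * ennreal ((1 - norm x) powr \<beta>) + absp p g x * ennreal ((1 - norm x) powr \<beta>) \<partial>lborel)"
  unfolding wint_def by (intro nn_integral_mono) (metis distrib_right mult_right_mono zero_le)
 also have "\<dots> = wint p \<beta> f + wint p \<beta> g" unfolding wint_def by (rule nn_integral_add) measurable
 finally show ?thesis .
qed

lemma wint_cmult:
 fixes f :: "real ^ 'n \<Rightarrow> complex"
 assumes f: "continuous_on (ball 0 1) f"
 shows "wint p \<beta> (\<lambda>x. c * f x) = ennreal (norm c powr p) * wint p \<beta> f"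
proof -
 note [measurable] = absp_measurable[OF f]
 have "absp p (\<lambda>x. c * f x) x * w = ennreal (norm c powr p) * (absp p f x * w)" for x w
  unfolding absp_def by (simp add: norm_mult powr_mult ennreal_mult mult.assoc)
 then have "wint p \<beta> (\<lambda>x. c * f x) = (\<integral>\<^sup>+x. ennreal (norm c powr p) * (absp p f x * ennreal ((1 - norm x) powr \<beta>)) \<partial>lborel)"
  unfolding wint_def by simp
 also have "\<dots> = ennreal (norm c powr p) * wint p \<beta> f" unfolding wint_def by (rule nn_integral_cmult) measurable
 finally show ?thesis .
qed

text \<open>Values of \<open>u\<close> near the origin are controlled by an integral over a compact part of the ball, on
 which every weight is bounded above and below; such bounds therefore hold for all exponents
 \<open>\<beta>\<close>.\<close>

definition core_int :: "real \<Rightarrow> (real ^ 'n \<Rightarrow> complex) \<Rightarrow> ennreal" where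
 "core_int p u = (\<integral>\<^sup>+z. absp p u z * indicator (ball 0 (7 / 8)) z \<partial>lborel)"

lemma core_int_le_wint:
 fixes u :: "real ^ 'n \<Rightarrow> complex"
 assumes "continuous_on (ball 0 1) u"
 shows "core_int p u \<le> ennreal (8 powr \<bar>\<beta>\<bar>) * wint p \<beta> u"
proof -
 note [measurable] = absp_measurable[OF assms]
 have "core_int p u \<le> (\<integral>\<^sup>+z. ennreal (8 powr \<bar>\<beta>\<bar>) * (absp p u z * ennreal ((1 - norm z) powr \<beta>)) \<partial>lborel)"
  unfolding core_int_def
 proof (rule nn_integral_mono)
  fix z :: "real ^ 'n"
  show "absp p u z * indicator (ball 0 (7 / 8)) z \<le> ennreal (8 powr \<bar>\<beta>\<bar>) * (absp p u z * ennreal ((1 - norm z) powr \<beta>))"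
  proof (cases "norm z < 7 / 8")
   case True
   have "1 \<le> 8 powr \<bar>\<beta>\<bar> * (1 - norm z) powr \<beta>"
   proof (cases "\<beta> \<ge> 0")
    case b: True
    have "1 powr \<beta> \<le> (8 * (1 - norm z)) powr \<beta>" using True b by (intro powr_mono2) auto
    also have "(8 * (1 - norm z)) powr \<beta> = 8 powr \<beta> * (1 - norm z) powr \<beta>" by (rule powr_mult; use True in simp)
    finally show ?thesis using b by simp
   next
    case b: False
    have "1 powr \<beta> \<le> (1 - norm z) powr \<beta>" using True b by (intro powr_mono2') auto
    moreover have "1 \<le> 8 powr \<bar>\<beta>\<bar>" by (simp add: ge_one_powr_ge_zero)
    ultimately have "1 * 1 \<le> 8 powr \<bar>\<beta>\<bar> * (1 - norm z) powr \<beta>" by (intro mult_mono) auto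
    then show ?thesis by simp
   qed
   then have "ennreal 1 \<le> ennreal (8 powr \<bar>\<beta>\<bar> * (1 - norm z) powr \<beta>)" by (rule ennreal_leI)
   then have "absp p u z * ennreal 1 \<le> absp p u z * (ennreal (8 powr \<bar>\<beta>\<bar>) * ennreal ((1 - norm z) powr \<beta>))"
    by (intro mult_left_mono) (simp_all add: ennreal_mult)
   then show ?thesis using True by (simp add: mult_ac)
  qed simp
 qed
 also have "\<dots> = ennreal (8 powr \<bar>\<beta>\<bar>) * wint p \<beta> u" unfolding wint_def by (rule nn_integral_cmult) measurable
 finally show ?thesis .
qed

lemma core_int_bound:
 assumes p: "0 < p" "p < 1"
 shows "\<exists>C>0. \<forall>(u :: real ^ 'n \<Rightarrow> complex) y. mean_value u \<longrightarrow> norm y \<le> 3 / 4 \<longrightarrow>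
   ennreal (norm (u y) powr p) \<le> ennreal C * core_int p u"
proof -
 obtain C where C: "C > 0" and HL: "\<And>(u :: real ^ 'n \<Rightarrow> complex) x R. mean_value u \<Longrightarrow> 0 < R \<Longrightarrow> norm x + R < 1 \<Longrightarrow>
   ennreal (norm (u x) powr p) \<le> ennreal (C / R ^ CARD('n)) * (\<integral>\<^sup>+z. absp p u z * indicator (ball x R) z \<partial>lborel)"
  using hardy_littlewood[OF p, where 'n='n] by blast
 have "ennreal (norm (u y) powr p) \<le> ennreal (C / (1 / 8) ^ CARD('n)) * core_int p u"
  if mv: "mean_value u" and y: "norm y \<le> 3 / 4" for u :: "real ^ 'n \<Rightarrow> complex" and y
 proof -
  have "ennreal (norm (u y) powr p) \<le> ennreal (C / (1 / 8) ^ CARD('n)) * (\<integral>\<^sup>+z. absp p u z * indicator (ball y (1 / 8)) z \<partial>lborel)"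
   by (rule HL[OF mv]) (use y in auto)
  also have "\<dots> \<le> ennreal (C / (1 / 8) ^ CARD('n)) * core_int p u"
   unfolding core_int_def
  proof (rule mult_left_mono, rule nn_integral_mono)
   fix z
   have "norm z < 7 / 8" if "dist y z < 1 / 8" using that y norm_triangle_sub[of z y] by (simp add: dist_norm norm_minus_commute)
   then show "absp p u z * indicator (ball y (1 / 8)) z \<le> absp p u z * indicator (ball 0 (7 / 8)) z"
    by (auto simp: indicator_def)
  qed simp
  finally show ?thesis .
 qed
 then show ?thesis using C by (intro exI[of _ "C / (1 / 8) ^ CARD('n)"]) simp
qed

lemma point_evaluation_bound:
 assumes p: "0 < p" "p < 1"
 shows "\<exists>C>0. \<forall>(u :: real ^ 'n \<Rightarrow> complex). mean_value u \<longrightarrow> ennreal (norm (u 0) powr p) \<le> ennreal C * wint p \<beta> u"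
proof -
 obtain C where C: "C > 0" and *: "\<And>(u :: real ^ 'n \<Rightarrow> complex) y. mean_value u \<Longrightarrow> norm y \<le> 3 / 4 \<Longrightarrow>
   ennreal (norm (u y) powr p) \<le> ennreal C * core_int p u" using core_int_bound[OF p, where 'n='n] by blast
 have "ennreal (norm (u 0) powr p) \<le> ennreal (C * 8 powr \<bar>\<beta>\<bar>) * wint p \<beta> u" if mv: "mean_value u" for u :: "real ^ 'n \<Rightarrow> complex"
 proof -
  have "ennreal (norm (u 0) powr p) \<le> ennreal C * core_int p u" by (rule *[OF mv]) simp
  also have "\<dots> \<le> ennreal C * (ennreal (8 powr \<bar>\<beta>\<bar>) * wint p \<beta> u)"
   by (intro mult_left_mono core_int_le_wint mean_value_cont[OF mv]) simp
  finally show ?thesis using C by (simp add: ennreal_mult mult.assoc)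
 qed
 then show ?thesis using C by (intro exI[of _ "C * 8 powr \<bar>\<beta>\<bar>"]) simp
qed

lemma powr_bound_transfer:
 fixes a b c p :: real
 assumes p: "p > 0" and c: "c \<ge> 0" and A: "A = ennreal a" "a \<ge> 0" and C: "C \<ge> 0"
  and y: "y \<ge> 0" "ennreal (y powr p) \<le> ennreal C * A"
 shows "y \<le> (C * a) powr (1 / p)"
proof -
 have "ennreal (y powr p) \<le> ennreal (C * a)" using y A C by (simp add: ennreal_mult)
 then have "y powr p \<le> C * a" using A C by (subst (asm) ennreal_le_iff) auto
 then have "(y powr p) powr (1 / p) \<le> (C * a) powr (1 / p)" using p by (intro powr_mono2) auto
 then show ?thesis using p y by (simp add: powr_powr)
qed

text \<open>The Cauchy estimate on the ball of radius \<open>(1 - |x|)/2\<close> bounds \<open>(1 - |x|) |\<partial>\<^sub>i u(x)|\<close> by values of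
 \<open>u\<close> that are controlled by the Whitney average.\<close>

lemma wint_partial:
 assumes p: "0 < p" "p < 1"
 shows "\<exists>C>0. \<forall>(u :: real ^ 'n \<Rightarrow> complex) i. mean_value u \<longrightarrow> wint p (\<beta> + p) (partial_deriv i u) \<le> ennreal C * wint p \<beta> u"
proof -
 obtain C1 where C1: "C1 > 0" and W: "\<And>(u :: real ^ 'n \<Rightarrow> complex) x y. mean_value u \<Longrightarrow> norm x < 1 \<Longrightarrow> dist x y \<le> (1 - norm x) / 2 \<Longrightarrow>
   ennreal (norm (u y) powr p) \<le> ennreal C1 * whitney_avg p u x"
  using whitney_avg_bound[OF p, where 'n='n] by blast
 obtain C2 where C2: "C2 > 0" and I: "\<And>u :: real ^ 'n \<Rightarrow> complex. continuous_on (ball 0 1) u \<Longrightarrow>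
   (\<integral>\<^sup>+x. ennreal ((1 - norm x) powr \<beta>) * indicator (ball 0 1) x * whitney_avg p u x \<partial>lborel) \<le> ennreal C2 * wint p \<beta> u"
  using whitney_avg_integral[where 'n='n] by blast
 define K where "K = cauchy_const TYPE('n)"
 have K: "K \<ge> 0" unfolding K_def by (rule cauchy_const_nonneg)
 define C where "C = (2 * K) powr p * C1 + 1"
 have C: "C > 0" unfolding C_def using C1 by (simp add: add_nonneg_pos)
 have "wint p (\<beta> + p) (partial_deriv i u) \<le> ennreal (C * C2) * wint p \<beta> u" if mv: "mean_value u" for u :: "real ^ 'n \<Rightarrow> complex" and i
 proof -
  have [measurable]: "whitney_avg p u \<in> borel_measurable borel"
   by (rule whitney_avg_measurable[OF mean_value_cont[OF mv]])
  let ?A = "whitney_avg p u"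
  have "wint p (\<beta> + p) (partial_deriv i u) \<le> (\<integral>\<^sup>+x. ennreal C * (ennreal ((1 - norm x) powr \<beta>) * indicator (ball 0 1) x * ?A x) \<partial>lborel)"
   unfolding wint_def
  proof (rule nn_integral_mono)
   fix x :: "real ^ 'n"
   show "absp p (partial_deriv i u) x * ennreal ((1 - norm x) powr (\<beta> + p)) \<le> ennreal C * (ennreal ((1 - norm x) powr \<beta>) * indicator (ball 0 1) x * ?A x)"
   proof (cases "norm x < 1")
    case False
    then show ?thesis by (simp add: absp_def)
   next
    case x: True
    show ?thesis
    proof (cases "?A x = \<infinity>")
     case True
     then show ?thesis using C x by (simp add: ennreal_mult_top)
    next
     case False
     then obtain a where a: "?A x = ennreal a" "a \<ge> 0" by (cases "?A x") auto
     define r where "r = (1 - norm x) / 2"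
     have r: "0 < r" "norm x + r < 1" "1 - norm x = 2 * r" using x by (simp_all add: r_def field_simps)
     define B where "B = (C1 * a) powr (1 / p)"
     have "norm (u z) \<le> B" if "z \<in> cball x r" for z
      unfolding B_def
      by (rule powr_bound_transfer[OF p(1) order_refl a _ _ W[OF mv x]]) (use that C1 r in auto)
     then have "norm (partial_deriv i u x) \<le> K / r * B"
      unfolding K_def by (rule mean_value_cauchy_estimate[OF mv r(1,2)])
     then have "norm (partial_deriv i u x) powr p \<le> (K / r * B) powr p" using p by (intro powr_mono2) auto
     also have "\<dots> = (K / r) powr p * (C1 * a)"
     proof -
      have "(K / r * B) powr p = (K / r) powr p * B powr p" by (rule powr_mult; use K r B_def in simp)
      moreover have "B powr p = C1 * a" unfolding B_def powr_powr using p C1 a by simp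
      ultimately show ?thesis by simp
     qed
     finally have "norm (partial_deriv i u x) powr p * (2 * r) powr (\<beta> + p) \<le> (K / r) powr p * (C1 * a) * (2 * r) powr (\<beta> + p)"
      by (rule mult_right_mono) simp
     also have "\<dots> = ((K / r) powr p * (2 * r) powr p) * (C1 * a) * (2 * r) powr \<beta>" by (simp add: powr_add mult_ac)
     also have "(K / r) powr p * (2 * r) powr p = (2 * K) powr p"
      using r K by (simp flip: powr_mult add: mult.commute)
     also have "(2 * K) powr p * (C1 * a) * (2 * r) powr \<beta> \<le> C * ((2 * r) powr \<beta> * a)"
      unfolding C_def using a C1 by (simp add: algebra_simps)
     finally have "ennreal (norm (partial_deriv i u x) powr p * (2 * r) powr (\<beta> + p)) \<le> ennreal (C * ((2 * r) powr \<beta> * a))"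
      by (rule ennreal_leI)
     then show ?thesis using x a C by (simp add: absp_def r(3) ennreal_mult)
    qed
   qed
  qed
  also have "\<dots> = ennreal C * (\<integral>\<^sup>+x. (ennreal ((1 - norm x) powr \<beta>) * indicator (ball 0 1) x * ?A x) \<partial>lborel)"
   by (rule nn_integral_cmult) measurable
  also have "\<dots> \<le> ennreal C * (ennreal C2 * wint p \<beta> u)"
   by (intro mult_left_mono I mean_value_cont[OF mv]) simp
  finally show ?thesis using C C2 by (simp add: ennreal_mult mult.assoc)
 qed
 then show ?thesis using C C2 by (intro exI[of _ "C * C2"]) simp
qed

lemma nn_integral_Beta:
 fixes a b :: real
 assumes "a > 0" "b > 0"
 shows "(\<integral>\<^sup>+t. ennreal (t powr (a - 1) * (1 - t) powr (b - 1)) * indicator {0<..<1} t \<partial>lborel) = ennreal (Beta a b)"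
proof -
 let ?f = "\<lambda>t. if t \<in> {0..1} then t powr (a - 1) * (1 - t) powr (b - 1) else 0"
 have "(?f has_integral Beta a b) UNIV"
  using has_integral_Beta_real[OF assms] by (simp only: has_integral_restrict_UNIV)
 moreover have "?f \<in> borel_measurable borel" by measurable
 ultimately have "(\<integral>\<^sup>+t. ennreal (?f t) \<partial>lborel) = ennreal (Beta a b)"
  by (intro nn_integral_has_integral_lborel) auto
 moreover have "ennreal (?f t) = ennreal (t powr (a - 1) * (1 - t) powr (b - 1)) * indicator {0<..<1} t" for t
  by (cases "t = 0 \<or> t = 1") (auto simp: indicator_def)
 ultimately show ?thesis by simp
qed

lemma Beta_pos: "a > 0 \<Longrightarrow> b > 0 \<Longrightarrow> Beta a b > (0 :: real)"
 by (simp add: Beta_def)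

lemma nn_integral_Beta_shift:
 fixes a s \<beta> :: real
 assumes "0 \<le> a" "a < 1" "s > 0" "\<beta> > -1"
 shows "(\<integral>\<^sup>+r. ennreal ((1 - r) powr (s - 1) * (r - a) powr \<beta>) * indicator {a<..<1} r \<partial>lborel) =
   ennreal (Beta (\<beta> + 1) s * (1 - a) powr (\<beta> + s))"
proof -
 define c where "c = 1 - a"
 have c: "c > 0" using assms by (simp add: c_def)
 have "(\<integral>\<^sup>+r. ennreal ((1 - r) powr (s - 1) * (r - a) powr \<beta>) * indicator {a<..<1} r \<partial>lborel) =
  \<bar>c\<bar> * (\<integral>\<^sup>+t. ennreal ((1 - (a + c * t)) powr (s - 1) * ((a + c * t) - a) powr \<beta>) * indicator {a<..<1} (a + c * t) \<partial>lborel)"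
  by (rule nn_integral_real_affine) (use c in auto)
 also have "\<dots> = ennreal c * (\<integral>\<^sup>+t. ennreal (c powr (s - 1 + \<beta>)) * (ennreal (t powr ((\<beta> + 1) - 1) * (1 - t) powr (s - 1)) * indicator {0<..<1} t) \<partial>lborel)"
 proof -
  have "ennreal ((1 - (a + c * t)) powr (s - 1) * ((a + c * t) - a) powr \<beta>) * indicator {a<..<1} (a + c * t)
   = ennreal (c powr (s - 1 + \<beta>)) * (ennreal (t powr ((\<beta> + 1) - 1) * (1 - t) powr (s - 1)) * indicator {0<..<1} t)" for t
  proof (cases "0 < t \<and> t < 1")
   case True
   have e: "1 - (a + c * t) = c * (1 - t)" by (simp add: c_def algebra_simps)
   have "a + c * t < 1" using True c e by (metis diff_gt_0_iff_gt mult_pos_pos)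
   then show ?thesis using True c unfolding e
    by (simp add: powr_mult powr_add ennreal_mult[symmetric] mult_ac)
  next
   case False
   have "a + c * t \<notin> {a<..<1}"
   proof
    assume "a + c * t \<in> {a<..<1}"
    then have 1: "0 < c * t" "a + c * t < 1" by auto
    then have "c * t < c * 1" unfolding mult_1_right by (simp only: c_def less_diff_eq add.commute)
    then have "t < 1" using c by (simp only: mult_less_cancel_left_pos)
    moreover have "0 < t" using 1(1) c by (simp only: zero_less_mult_iff) auto
    ultimately show False using False by simp
   qed
   then show ?thesis using False by (auto simp: indicator_def)
  qed
  then show ?thesis using c by simp
 qed
 also have "\<dots> = ennreal c * (ennreal (c powr (s - 1 + \<beta>)) * ennreal (Beta (\<beta> + 1) s))"
  by (subst nn_integral_cmult, measurable) (subst nn_integral_Beta, use assms in auto)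
 also have "\<dots> = ennreal ((c * c powr (s - 1 + \<beta>)) * Beta (\<beta> + 1) s)"
  using c assms by (simp add: ennreal_mult[symmetric] mult.assoc Beta_pos less_imp_le)
 also have "c * c powr (s - 1 + \<beta>) = c powr (\<beta> + s)"
  using powr_mult_base[of c "s - 1 + \<beta>"] c by (simp add: add_ac)
 finally show ?thesis by (simp add: c_def mult.commute)
qed

section \<open>Radial integrals\<close>

text \<open>Fubini's theorem and the substitution \<open>y = rx\<close>. For fixed \<open>y\<close> there remains the integral of
 \<open>(1 - r)\<^sup>s\<^sup>-\<^sup>1 (r - |y|)\<^sup>\<beta>\<close> over \<open>|y| < r < 1\<close>, a Beta integral that converges exactly when
 \<open>s > 0\<close> and \<open>\<beta> > -1\<close>. Restricting to \<open>r > 1/2\<close> bounds the Jacobian \<open>r\<^sup>-\<^sup>n\<close>.\<close>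

lemma radial_integral_bound:
 fixes s \<beta> :: real
 assumes s: "s > 0" and \<beta>: "\<beta> > -1"
 shows "\<exists>C>0. \<forall>G :: real ^ 'n \<Rightarrow> ennreal. G \<in> borel_measurable borel \<longrightarrow>
  (\<integral>\<^sup>+x. ennreal ((1 - norm x) powr \<beta>) * indicator (ball 0 1) x *
    (\<integral>\<^sup>+r. ennreal ((1 - r) powr (s - 1)) * indicator {1/2<..<1} r * G (r *\<^sub>R x) \<partial>lborel) \<partial>lborel) \<le>
  ennreal C * (\<integral>\<^sup>+y. ennreal ((1 - norm y) powr (\<beta> + s)) * indicator (ball 0 1) y * G y \<partial>lborel)"
proof -
 define K where "K = 2 ^ CARD('n) * 4 powr \<bar>\<beta>\<bar>"
 have K: "K > 0" by (simp add: K_def)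
 define C where "C = K * Beta (\<beta> + 1) s"
 have C: "C > 0" using K s \<beta> Beta_pos[of "\<beta> + 1" s] by (simp add: C_def)
 have "(\<integral>\<^sup>+x. ennreal ((1 - norm x) powr \<beta>) * indicator (ball 0 1) x *
    (\<integral>\<^sup>+r. ennreal ((1 - r) powr (s - 1)) * indicator {1/2<..<1} r * G (r *\<^sub>R x) \<partial>lborel) \<partial>lborel) \<le>
  ennreal C * (\<integral>\<^sup>+y. ennreal ((1 - norm y) powr (\<beta> + s)) * indicator (ball 0 1) y * G y \<partial>lborel)"
  if [measurable]: "G \<in> borel_measurable borel" for G :: "real ^ 'n \<Rightarrow> ennreal"
 proof -
  let ?w = "\<lambda>x :: real ^ 'n. ennreal ((1 - norm x) powr \<beta>) * indicator (ball 0 1) x"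
  let ?v = "\<lambda>r :: real. ennreal ((1 - r) powr (s - 1)) * indicator {1/2<..<1} r"
  let ?m = "\<lambda>(r :: real) (y :: real ^ 'n). ennreal ((r - norm y) powr \<beta>) * indicator {norm y<..<1} r"
  have mm: "(\<lambda>y. ?m r y * G y) \<in> borel_measurable lborel" for r
  proof -
   have "(\<lambda>y. ennreal ((r - norm y) powr \<beta>) * (if norm y < r \<and> r < 1 then 1 else 0) * G y) \<in> borel_measurable lborel" by measurable
   moreover have "(\<lambda>y. ennreal ((r - norm y) powr \<beta>) * (if norm y < r \<and> r < 1 then 1 else 0) * G y) = (\<lambda>y. ?m r y * G y)"
    by (auto simp: fun_eq_iff indicator_def)
   ultimately show ?thesis by simp
  qed
  have inner: "(\<integral>\<^sup>+x. ?w x * G (r *\<^sub>R x) \<partial>lborel) \<le> ennreal K * (\<integral>\<^sup>+y. ?m r y * G y \<partial>lborel)"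
   if r: "1 / 2 < r" "r < 1" for r
  proof -
   let ?g = "\<lambda>y. ennreal ((1 - norm y / r) powr \<beta>) * indicator (ball 0 r) y * G y"
   have gm: "?g \<in> borel_measurable borel" by measurable
   have "(\<integral>\<^sup>+y. ?g y \<partial>lborel) = ennreal (r ^ CARD('n)) * (\<integral>\<^sup>+x. ?g (0 + r *\<^sub>R x) \<partial>lborel)"
    using nn_integral_lborel_affine[OF gm, of r 0] r by simp
   also have "(\<integral>\<^sup>+x. ?g (0 + r *\<^sub>R x) \<partial>lborel) = (\<integral>\<^sup>+x. ?w x * G (r *\<^sub>R x) \<partial>lborel)"
   proof (rule nn_integral_cong)
    fix x :: "real ^ 'n"
    have "indicator (ball 0 r) (r *\<^sub>R x) = (indicator (ball 0 1) x :: ennreal)"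
     using r mult_less_cancel_left_pos[of r "norm x" 1] by (simp add: indicator_def)
    moreover have "norm (r *\<^sub>R x) / r = norm x" using r by simp
    ultimately show "?g (0 + r *\<^sub>R x) = ?w x * G (r *\<^sub>R x)" by simp
   qed
   finally have eq: "(\<integral>\<^sup>+y. ?g y \<partial>lborel) = ennreal (r ^ CARD('n)) * (\<integral>\<^sup>+x. ?w x * G (r *\<^sub>R x) \<partial>lborel)" .
   have "1 \<le> 2 ^ CARD('n) * r ^ CARD('n)"
    using r one_le_power[of "2 * r" "CARD('n)"] by (simp add: power_mult_distrib)
   then have "ennreal 1 \<le> ennreal (2 ^ CARD('n)) * ennreal (r ^ CARD('n))"
    using r by (simp add: ennreal_mult[symmetric] ennreal_leI del: ennreal_1)
   then have "ennreal 1 * (\<integral>\<^sup>+x. ?w x * G (r *\<^sub>R x) \<partial>lborel) \<le> (ennreal (2 ^ CARD('n)) * ennreal (r ^ CARD('n))) * (\<integral>\<^sup>+x. ?w x * G (r *\<^sub>R x) \<partial>lborel)"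
    by (rule mult_right_mono) simp
   then have "(\<integral>\<^sup>+x. ?w x * G (r *\<^sub>R x) \<partial>lborel) \<le> ennreal (2 ^ CARD('n)) * (\<integral>\<^sup>+y. ?g y \<partial>lborel)"
    unfolding eq by (simp add: mult.assoc)
   also have "\<dots> \<le> ennreal (2 ^ CARD('n)) * (\<integral>\<^sup>+y. ennreal (4 powr \<bar>\<beta>\<bar>) * (?m r y * G y) \<partial>lborel)"
   proof (rule mult_left_mono, rule nn_integral_mono)
    fix y :: "real ^ 'n"
    show "?g y \<le> ennreal (4 powr \<bar>\<beta>\<bar>) * (?m r y * G y)"
    proof (cases "norm y < r")
     case True
     have e: "1 - norm y / r = (r - norm y) / r" using r by (simp add: diff_divide_distrib)
     have "(1 - norm y / r) powr \<beta> \<le> 4 powr \<bar>\<beta>\<bar> * (r - norm y) powr \<beta>"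
     proof (rule powr_comparable)
      show "0 < 1 - norm y / r" "0 < r - norm y" using True r by simp_all
      have rn: "r - norm y > 0" using True by simp
      show "1 - norm y / r \<le> 4 * (r - norm y)"
      proof -
       have "(r - norm y) * 1 \<le> (r - norm y) * (4 * r)" using rn r by (intro mult_left_mono) auto
       then show ?thesis unfolding e using r by (simp add: field_simps)
      qed
      show "r - norm y \<le> 4 * (1 - norm y / r)"
      proof -
       have "(r - norm y) * r \<le> (r - norm y) * 4" using rn r by (intro mult_left_mono) auto
       then show ?thesis unfolding e using r by (simp add: field_simps)
      qed
     qed
     then have "ennreal ((1 - norm y / r) powr \<beta>) \<le> ennreal (4 powr \<bar>\<beta>\<bar>) * ennreal ((r - norm y) powr \<beta>)"
      by (simp add: ennreal_mult[symmetric] ennreal_leI)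
     then have "ennreal ((1 - norm y / r) powr \<beta>) * G y \<le> (ennreal (4 powr \<bar>\<beta>\<bar>) * ennreal ((r - norm y) powr \<beta>)) * G y"
      by (rule mult_right_mono) simp
     then show ?thesis using True r by (simp add: mult.assoc)
    qed simp
   qed simp
   also have "(\<integral>\<^sup>+y. ennreal (4 powr \<bar>\<beta>\<bar>) * (?m r y * G y) \<partial>lborel) = ennreal (4 powr \<bar>\<beta>\<bar>) * (\<integral>\<^sup>+y. ?m r y * G y \<partial>lborel)"
    by (rule nn_integral_cmult[OF mm])
   finally show ?thesis unfolding K_def by (simp add: ennreal_mult mult.assoc)
  qed
  have vm: "?v \<in> borel_measurable borel" by measurable
  have "(\<integral>\<^sup>+x. ?w x * (\<integral>\<^sup>+r. ?v r * G (r *\<^sub>R x) \<partial>lborel) \<partial>lborel) = (\<integral>\<^sup>+x. \<integral>\<^sup>+r. ?w x * (?v r * G (r *\<^sub>R x)) \<partial>lborel \<partial>lborel)"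
   by (intro nn_integral_cong nn_integral_cmult[symmetric]) measurable
  also have "\<dots> = (\<integral>\<^sup>+r. \<integral>\<^sup>+x. ?w x * (?v r * G (r *\<^sub>R x)) \<partial>lborel \<partial>lborel)"
  proof (rule lborel_pair.Fubini'[symmetric])
   show "(\<lambda>(x, r). ?w x * (?v r * G (r *\<^sub>R x))) \<in> borel_measurable (lborel \<Otimes>\<^sub>M lborel)" by measurable
  qed
  also have "\<dots> \<le> (\<integral>\<^sup>+r. \<integral>\<^sup>+y. ennreal K * (?v r * (?m r y * G y)) \<partial>lborel \<partial>lborel)"
  proof (rule nn_integral_mono)
   fix r
   have "(\<integral>\<^sup>+x. ?w x * (?v r * G (r *\<^sub>R x)) \<partial>lborel) = (\<integral>\<^sup>+x. ?v r * (?w x * G (r *\<^sub>R x)) \<partial>lborel)"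
    by (simp add: mult_ac)
   also have "\<dots> = ?v r * (\<integral>\<^sup>+x. ?w x * G (r *\<^sub>R x) \<partial>lborel)"
    by (rule nn_integral_cmult) measurable
   also have "\<dots> \<le> ?v r * (ennreal K * (\<integral>\<^sup>+y. ?m r y * G y \<partial>lborel))"
   proof (cases "1 / 2 < r \<and> r < 1")
    case True
    then show ?thesis by (intro mult_left_mono inner) auto
   qed (auto simp: indicator_def)
   also have "\<dots> = (\<integral>\<^sup>+y. (?v r * ennreal K) * (?m r y * G y) \<partial>lborel)"
    unfolding mult.assoc[symmetric, of "?v r" "ennreal K"] by (rule nn_integral_cmult[OF mm, symmetric])
   also have "\<dots> = (\<integral>\<^sup>+y. ennreal K * (?v r * (?m r y * G y)) \<partial>lborel)"
    by (simp only: mult_ac)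
   finally show "(\<integral>\<^sup>+x. ?w x * (?v r * G (r *\<^sub>R x)) \<partial>lborel) \<le> (\<integral>\<^sup>+y. ennreal K * (?v r * (?m r y * G y)) \<partial>lborel)" .
  qed
  also have "\<dots> = (\<integral>\<^sup>+y. \<integral>\<^sup>+r. ennreal K * (?v r * (?m r y * G y)) \<partial>lborel \<partial>lborel)"
  proof (rule lborel_pair.Fubini'[symmetric])
   have mind: "(if norm y < r \<and> r < 1 then 1 else 0) = (indicator {norm y<..<1} r :: ennreal)" for r and y :: "real ^ 'n"
    by (simp add: indicator_def)
   have "(\<lambda>(r, y). ennreal K * (?v r * ((ennreal ((r - norm y) powr \<beta>) * (if norm y < r \<and> r < 1 then 1 else 0)) * G y))) \<in> borel_measurable (lborel \<Otimes>\<^sub>M lborel)"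
    by measurable
   then show "(\<lambda>(r, y). ennreal K * (?v r * (?m r y * G y))) \<in> borel_measurable (lborel \<Otimes>\<^sub>M lborel)" unfolding mind .
  qed
  also have "\<dots> \<le> (\<integral>\<^sup>+y. ennreal C * (ennreal ((1 - norm y) powr (\<beta> + s)) * indicator (ball 0 1) y * G y) \<partial>lborel)"
  proof (rule nn_integral_mono)
   fix y :: "real ^ 'n"
   show "(\<integral>\<^sup>+r. ennreal K * (?v r * (?m r y * G y)) \<partial>lborel) \<le> ennreal C * (ennreal ((1 - norm y) powr (\<beta> + s)) * indicator (ball 0 1) y * G y)"
   proof (cases "norm y < 1")
    case False
    then have m0: "?m r y = 0" for r by (auto simp: indicator_def)
    have "(\<integral>\<^sup>+r. ennreal K * (?v r * (?m r y * G y)) \<partial>lborel) = 0" unfolding m0 by simp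
    then show ?thesis by simp
   next
    case True
    have "(\<integral>\<^sup>+r. ennreal K * (?v r * (?m r y * G y)) \<partial>lborel) \<le>
     (\<integral>\<^sup>+r. (ennreal K * G y) * (ennreal ((1 - r) powr (s - 1) * (r - norm y) powr \<beta>) * indicator {norm y<..<1} r) \<partial>lborel)"
    proof (rule nn_integral_mono)
     fix r
     show "ennreal K * (?v r * (?m r y * G y)) \<le> (ennreal K * G y) * (ennreal ((1 - r) powr (s - 1) * (r - norm y) powr \<beta>) * indicator {norm y<..<1} r)"
     proof (cases "r \<in> {1/2<..<1}")
      case True
      then have "ennreal K * (?v r * (?m r y * G y)) = (ennreal K * G y) * ((ennreal ((1 - r) powr (s - 1)) * ennreal ((r - norm y) powr \<beta>)) * indicator {norm y<..<1} r)"
       by (simp add: mult_ac)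
      then show ?thesis unfolding ennreal_mult[OF powr_ge_zero powr_ge_zero, symmetric] by simp
     next
      case False
      then have "?v r = 0" by simp
      then show ?thesis by (simp only: mult_zero_left mult_zero_right zero_le)
     qed
    qed
    also have "\<dots> = (ennreal K * G y) * (\<integral>\<^sup>+r. (ennreal ((1 - r) powr (s - 1) * (r - norm y) powr \<beta>) * indicator {norm y<..<1} r) \<partial>lborel)"
     by (rule nn_integral_cmult) measurable
    also have "\<dots> = (ennreal K * G y) * ennreal (Beta (\<beta> + 1) s * (1 - norm y) powr (\<beta> + s))"
     by (subst nn_integral_Beta_shift) (use True s \<beta> in auto)
    also have "\<dots> = ennreal C * (ennreal ((1 - norm y) powr (\<beta> + s)) * indicator (ball 0 1) y * G y)"
     unfolding C_def using True K Beta_pos[of "\<beta> + 1" s] s \<beta> by (simp add: ennreal_mult mult_ac)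
    finally show ?thesis .
   qed
  qed
  also have "\<dots> = ennreal C * (\<integral>\<^sup>+y. ennreal ((1 - norm y) powr (\<beta> + s)) * indicator (ball 0 1) y * G y \<partial>lborel)"
   by (rule nn_integral_cmult) measurable
  finally show ?thesis .
 qed
 then show ?thesis using C by blast
qed

lemma nn_integral_half_interval:
 assumes "s > 0"
 shows "(\<integral>\<^sup>+r. ennreal ((1 - r) powr (s - 1)) * indicator {0<..<1} r \<partial>lborel) = ennreal (Beta 1 s)"
  and "0 < (\<integral>\<^sup>+r. ennreal ((1 - r) powr (s - 1)) * indicator {1/2<..<1} r \<partial>lborel)"
proof -
 have "(\<integral>\<^sup>+r. ennreal ((1 - r) powr (s - 1)) * indicator {0<..<1} r \<partial>lborel) =
   (\<integral>\<^sup>+r. ennreal (r powr (1 - 1) * (1 - r) powr (s - 1)) * indicator {0<..<1} r \<partial>lborel)"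
  by (rule nn_integral_cong) (auto simp: indicator_def)
 also have "\<dots> = ennreal (Beta 1 s)" by (rule nn_integral_Beta) (use assms in auto)
 finally show "(\<integral>\<^sup>+r. ennreal ((1 - r) powr (s - 1)) * indicator {0<..<1} r \<partial>lborel) = ennreal (Beta 1 s)" .
 show "0 < (\<integral>\<^sup>+r. ennreal ((1 - r) powr (s - 1)) * indicator {1/2<..<1} r \<partial>lborel)"
 proof -
  define q where "q = (1 / 4 :: real) powr \<bar>s - 1\<bar>"
  have q0: "q > 0" by (simp add: q_def)
  have "(\<integral>\<^sup>+r. ennreal q * indicator {1/2<..<3/4} (r :: real) \<partial>lborel) \<le>
   (\<integral>\<^sup>+r. ennreal ((1 - r) powr (s - 1)) * indicator {1/2<..<1} r \<partial>lborel)"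
  proof (rule nn_integral_mono)
   fix r :: real
   show "ennreal q * indicator {1/2<..<3/4} r \<le> ennreal ((1 - r) powr (s - 1)) * indicator {1/2<..<1} r"
   proof (cases "r \<in> {1/2<..<3/4}")
    case True
    have "q \<le> (1 - r) powr (s - 1)"
    proof (cases "s \<ge> 1")
     case s: True
     then show ?thesis using True powr_mono2[of "s - 1" "1/4" "1 - r"] by (simp add: q_def)
    next
     case s: False
     have "1 powr (s - 1) \<le> (1 - r) powr (s - 1)" using True s by (intro powr_mono2') auto
     moreover have "q \<le> 1" unfolding q_def by (rule powr_le1) auto
     ultimately show ?thesis by simp
    qed
    then show ?thesis using True by (simp add: ennreal_leI)
   qed simp
  qed
  moreover have "(\<integral>\<^sup>+r. ennreal q * indicator {1/2<..<3/4} (r :: real) \<partial>lborel) > 0"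
   by (subst nn_integral_cmult_indicator) (use q0 in \<open>auto simp: ennreal_zero_less_mult_iff\<close>)
  ultimately show ?thesis by (rule order_less_le_trans[rotated])
 qed
qed

text \<open>The preceding bound for the constant function and \<open>s = 1\<close> raises the exponent to \<open>\<beta> + 1 > 0\<close>, where
 the weight is bounded.\<close>

lemma wint_const_finite:
 assumes \<beta>: "\<beta> > -1"
 shows "wint p \<beta> (\<lambda>_ :: real ^ 'n. c) < \<infinity>"
proof -
 obtain C where C: "C > 0" and W: "\<And>G :: real ^ 'n \<Rightarrow> ennreal. G \<in> borel_measurable borel \<Longrightarrow>
  (\<integral>\<^sup>+x. ennreal ((1 - norm x) powr \<beta>) * indicator (ball 0 1) x *
    (\<integral>\<^sup>+r. ennreal ((1 - r) powr (1 - 1)) * indicator {1/2<..<1} r * G (r *\<^sub>R x) \<partial>lborel) \<partial>lborel) \<le>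
  ennreal C * (\<integral>\<^sup>+y. ennreal ((1 - norm y) powr (\<beta> + 1)) * indicator (ball 0 1) y * G y \<partial>lborel)"
  using radial_integral_bound[OF zero_less_one \<beta>, where 'n='n] by blast
 define H where "H = (\<integral>\<^sup>+r. ennreal ((1 - r) powr (1 - 1)) * indicator {1/2<..<1} r \<partial>lborel)"
 have H0: "H > 0" unfolding H_def by (rule nn_integral_half_interval) simp
 let ?I = "integral\<^sup>N lborel (\<lambda>x :: real ^ 'n. ennreal ((1 - norm x) powr \<beta>) * indicator (ball 0 1) x)"
 have "?I * H \<le> ennreal C * (integral\<^sup>N lborel (\<lambda>y :: real ^ 'n. ennreal ((1 - norm y) powr (\<beta> + 1)) * indicator (ball 0 1) y * 1))"
 proof -
  have "?I * H = (integral\<^sup>N lborel (\<lambda>x :: real ^ 'n. ennreal ((1 - norm x) powr \<beta>) * indicator (ball 0 1) x * H))"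
   by (rule nn_integral_multc[symmetric]) measurable
  then show ?thesis using W[of "\<lambda>_. 1"] unfolding H_def by simp
 qed
 also have "(integral\<^sup>N lborel (\<lambda>y :: real ^ 'n. ennreal ((1 - norm y) powr (\<beta> + 1)) * indicator (ball 0 1) y * 1)) \<le> (integral\<^sup>N lborel (\<lambda>y :: real ^ 'n. indicator (ball 0 1) y))"
 proof (rule nn_integral_mono)
  fix y :: "real ^ 'n"
  show "ennreal ((1 - norm y) powr (\<beta> + 1)) * indicator (ball 0 1) y * 1 \<le> indicator (ball 0 1) y"
  proof (cases "norm y < 1")
   case True
   then have "(1 - norm y) powr (\<beta> + 1) \<le> 1" using \<beta> by (intro powr_le1) auto
   then show ?thesis using True by (simp add: ennreal_le_1)
  qed simp
 qed
 also have "(integral\<^sup>N lborel (\<lambda>y :: real ^ 'n. indicator (ball 0 1) y)) = emeasure lborel (ball 0 1 :: (real ^ 'n) set)" by simp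
 finally have "?I * H \<le> ennreal C * emeasure lborel (ball 0 1 :: (real ^ 'n) set)" by (simp add: mult_left_mono)
 also have "\<dots> < \<infinity>" using emeasure_lborel_ball_finite[of "0 :: real ^ 'n" 1] by (simp add: ennreal_mult_less_top)
 finally have "?I < \<infinity>" using H0 by (auto simp: ennreal_mult_less_top)
 moreover have "wint p \<beta> (\<lambda>_ :: real ^ 'n. c) = ennreal (norm c powr p) * ?I"
 proof -
  have "wint p \<beta> (\<lambda>_ :: real ^ 'n. c) = (integral\<^sup>N lborel (\<lambda>x :: real ^ 'n. ennreal (norm c powr p) * (ennreal ((1 - norm x) powr \<beta>) * indicator (ball 0 1) x)))"
   unfolding wint_def absp_def by (simp add: mult_ac)
  also have "\<dots> = ennreal (norm c powr p) * ?I" by (rule nn_integral_cmult) measurable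
  finally show ?thesis .
 qed
 ultimately show ?thesis by (simp add: ennreal_mult_less_top)
qed

text \<open>A replacement for Hoelder's inequality, which fails for \<open>p < 1\<close>. Integrating the assumption over
 \<open>[r, r + (1 - r)/4]\<close> gives the pointwise bound \<open>h(r) \<le> C j\<^sup>1\<^sup>/\<^sup>p (1 - r)\<^sup>-\<^sup>\<delta>\<close>. It is applied to
 the first factor of \<open>h = h\<^sup>1\<^sup>-\<^sup>p h\<^sup>p\<close>, and the exponents add up to those of the assumption.\<close>

lemma weighted_power_integral:
 fixes \<delta> p :: real
 assumes p: "0 < p" "p < 1" and \<delta>: "\<delta> > 0"
 shows "\<exists>C>0. \<forall>(h :: real \<Rightarrow> real) a j. (\<forall>r. 0 \<le> h r) \<longrightarrow> a \<in> borel_measurable borel \<longrightarrow>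
   (\<forall>r r'. 0 < r \<longrightarrow> r < 1 \<longrightarrow> r \<le> r' \<longrightarrow> r' \<le> r + (1 - r) / 4 \<longrightarrow> ennreal (h r powr p) \<le> a r') \<longrightarrow>
   0 \<le> j \<longrightarrow> (\<integral>\<^sup>+r. ennreal ((1 - r) powr (\<delta> * p - 1)) * indicator {0<..<1} r * a r \<partial>lborel) = ennreal j \<longrightarrow>
   (\<integral>\<^sup>+r. ennreal ((1 - r) powr (\<delta> - 1) * h r) * indicator {0<..<1} r \<partial>lborel) \<le> ennreal (C * j powr (1 / p))"
proof -
 define \<gamma> where "\<gamma> = \<delta> * p - 1"
 define C1 where "C1 = 4 * 4 powr \<bar>\<gamma>\<bar>"
 have C1: "C1 > 0" by (simp add: C1_def)
 define C where "C = C1 powr ((1 - p) / p)"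
 have C: "C > 0" using C1 by (simp add: C_def)
 have "(\<integral>\<^sup>+r. ennreal ((1 - r) powr (\<delta> - 1) * h r) * indicator {0<..<1} r \<partial>lborel) \<le> ennreal (C * j powr (1 / p))"
  if h: "\<And>r. 0 \<le> h r" and [measurable]: "a \<in> borel_measurable borel"
   and ha: "\<And>r r'. 0 < r \<Longrightarrow> r < 1 \<Longrightarrow> r \<le> r' \<Longrightarrow> r' \<le> r + (1 - r) / 4 \<Longrightarrow> ennreal (h r powr p) \<le> a r'"
   and j: "0 \<le> j" and J: "(\<integral>\<^sup>+r. ennreal ((1 - r) powr \<gamma>) * indicator {0<..<1} r * a r \<partial>lborel) = ennreal j"
  for h :: "real \<Rightarrow> real" and a j
 proof -
  have point: "h r \<le> (C1 * j) powr (1 / p) * (1 - r) powr (- \<delta>)" if r: "0 < r" "r < 1" for r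
  proof -
   let ?c = "4 powr (- \<bar>\<gamma>\<bar>) * (1 - r) powr \<gamma> * h r powr p"
   have "ennreal (?c * ((1 - r) / 4)) = (\<integral>\<^sup>+r'. ennreal ?c * indicator {r..r + (1 - r) / 4} r' \<partial>lborel)"
   proof -
    have "emeasure lborel {r..r + (1 - r) / 4} = ennreal ((1 - r) / 4)" using r by simp
    moreover have "(\<integral>\<^sup>+r'. ennreal ?c * indicator {r..r + (1 - r) / 4} r' \<partial>lborel) = ennreal ?c * emeasure lborel {r..r + (1 - r) / 4}"
     by (rule nn_integral_cmult_indicator) simp
    moreover have "ennreal (?c * ((1 - r) / 4)) = ennreal ?c * ennreal ((1 - r) / 4)"
     by (rule ennreal_mult) (use r in simp_all)
    ultimately show ?thesis by simp
   qed
   also have "\<dots> \<le> (\<integral>\<^sup>+r. ennreal ((1 - r) powr \<gamma>) * indicator {0<..<1} r * a r \<partial>lborel)"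
   proof (rule nn_integral_mono)
    fix r'
    show "ennreal ?c * indicator {r..r + (1 - r) / 4} r' \<le> ennreal ((1 - r') powr \<gamma>) * indicator {0<..<1} r' * a r'"
    proof (cases "r' \<in> {r..r + (1 - r) / 4}")
     case True
     then have r': "r \<le> r'" "r' \<le> r + (1 - r) / 4" by auto
     have q: "1 - r' \<ge> 3 / 4 * (1 - r)" using r' by (simp add: field_simps)
     then have r1: "r' < 1" using r by (smt (verit) mult_pos_pos zero_less_divide_iff)
     have "(1 - r) powr \<gamma> \<le> 4 powr \<bar>\<gamma>\<bar> * (1 - r') powr \<gamma>"
      using r r' r1 q by (intro powr_comparable) auto
     then have "4 powr (- \<bar>\<gamma>\<bar>) * (1 - r) powr \<gamma> \<le> 4 powr (- \<bar>\<gamma>\<bar>) * (4 powr \<bar>\<gamma>\<bar> * (1 - r') powr \<gamma>)"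
      by (rule mult_left_mono) simp
     also have "\<dots> = (1 - r') powr \<gamma>" by (simp flip: mult.assoc powr_add)
     finally have "ennreal (4 powr (- \<bar>\<gamma>\<bar>) * (1 - r) powr \<gamma>) \<le> ennreal ((1 - r') powr \<gamma>)" by (rule ennreal_leI)
     then have "ennreal (4 powr (- \<bar>\<gamma>\<bar>) * (1 - r) powr \<gamma>) * ennreal (h r powr p) \<le> ennreal ((1 - r') powr \<gamma>) * a r'"
      using ha[OF r r'] by (rule mult_mono) auto
     then show ?thesis using True r r1 by (simp add: ennreal_mult)
    qed simp
   qed
   finally have "?c * ((1 - r) / 4) \<le> j" unfolding J using j by (subst (asm) ennreal_le_iff) auto
   then have "4 powr \<bar>\<gamma>\<bar> * (?c * ((1 - r) / 4)) \<le> 4 powr \<bar>\<gamma>\<bar> * j" by (rule mult_left_mono) simp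
   moreover have "4 powr \<bar>\<gamma>\<bar> * (?c * ((1 - r) / 4)) =
     (4 powr \<bar>\<gamma>\<bar> * 4 powr (- \<bar>\<gamma>\<bar>)) * (((1 - r) / 4) * (1 - r) powr \<gamma> * h r powr p)"
    by (simp only: mult_ac)
   moreover have "4 powr \<bar>\<gamma>\<bar> * 4 powr (- \<bar>\<gamma>\<bar>) = (1 :: real)" by (simp flip: powr_add)
   ultimately have "((1 - r) / 4) * (1 - r) powr \<gamma> * h r powr p \<le> 4 powr \<bar>\<gamma>\<bar> * j" by (simp only: mult_1_left)
   then have "4 * (((1 - r) / 4) * (1 - r) powr \<gamma> * h r powr p) \<le> 4 * (4 powr \<bar>\<gamma>\<bar> * j)" by (rule mult_left_mono) simp
   moreover have "4 * (((1 - r) / 4) * (1 - r) powr \<gamma> * h r powr p) = ((1 - r) * (1 - r) powr \<gamma>) * h r powr p" by simp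
   ultimately have "((1 - r) * (1 - r) powr \<gamma>) * h r powr p \<le> C1 * j" by (simp only: C1_def mult.assoc)
   moreover have "(1 - r) * (1 - r) powr \<gamma> = (1 - r) powr (\<delta> * p)"
    using r powr_mult_base[of "1 - r" \<gamma>] by (simp add: \<gamma>_def)
   ultimately have "(1 - r) powr (\<delta> * p) * h r powr p \<le> C1 * j" by simp
   moreover have "(1 - r) powr (\<delta> * p) * h r powr p = ((1 - r) powr \<delta> * h r) powr p"
    using h[of r] by (simp add: powr_mult powr_powr)
   ultimately have "(((1 - r) powr \<delta> * h r) powr p) powr (1 / p) \<le> (C1 * j) powr (1 / p)"
    using p by (intro powr_mono2) auto
   then have "(1 - r) powr \<delta> * h r \<le> (C1 * j) powr (1 / p)" using p h[of r] by (simp add: powr_powr)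
   then have i1: "(1 - r) powr (- \<delta>) * ((1 - r) powr \<delta> * h r) \<le> (1 - r) powr (- \<delta>) * (C1 * j) powr (1 / p)"
    by (rule mult_left_mono) simp
   have e1: "(1 - r) powr (- \<delta>) * (1 - r) powr \<delta> = 1" using r by (simp flip: powr_add)
   have e2: "(1 - r) powr (- \<delta>) * ((1 - r) powr \<delta> * h r) = h r"
    by (simp only: mult.assoc[symmetric] e1 mult_1_left)
   show ?thesis using i1 unfolding e2 by (simp only: mult.commute)
  qed
  define S where "S = ((C1 * j) powr (1 / p)) powr (1 - p)"
  have S0: "S \<ge> 0" by (simp add: S_def)
  have "(\<integral>\<^sup>+r. ennreal ((1 - r) powr (\<delta> - 1) * h r) * indicator {0<..<1} r \<partial>lborel) \<le>
    (\<integral>\<^sup>+r. ennreal S * (ennreal ((1 - r) powr \<gamma>) * indicator {0<..<1} r * a r) \<partial>lborel)"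
  proof (rule nn_integral_mono)
   fix r
   show "ennreal ((1 - r) powr (\<delta> - 1) * h r) * indicator {0<..<1} r \<le> ennreal S * (ennreal ((1 - r) powr \<gamma>) * indicator {0<..<1} r * a r)"
   proof (cases "0 < r \<and> r < 1")
    case True
    have "h r = h r powr (1 - p) * h r powr p" using h[of r] by (cases "h r = 0") (simp_all flip: powr_add)
    also have "\<dots> \<le> ((C1 * j) powr (1 / p) * (1 - r) powr (- \<delta>)) powr (1 - p) * h r powr p"
     using point[of r] True p h[of r] by (intro mult_right_mono powr_mono2) auto
    also have "\<dots> = S * (1 - r) powr (- \<delta> * (1 - p)) * h r powr p"
     unfolding S_def by (simp add: powr_mult powr_powr)
    finally have "(1 - r) powr (\<delta> - 1) * h r \<le> (1 - r) powr (\<delta> - 1) * (S * (1 - r) powr (- \<delta> * (1 - p)) * h r powr p)"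
     by (rule mult_left_mono) simp
    also have "\<dots> = S * ((1 - r) powr (\<delta> - 1) * (1 - r) powr (- \<delta> * (1 - p))) * h r powr p" by (simp only: mult_ac)
    also have "(1 - r) powr (\<delta> - 1) * (1 - r) powr (- \<delta> * (1 - p)) = (1 - r) powr \<gamma>"
     by (simp only: powr_add[symmetric] \<gamma>_def) (simp add: algebra_simps)
    finally have "ennreal ((1 - r) powr (\<delta> - 1) * h r) \<le> ennreal (S * (1 - r) powr \<gamma> * h r powr p)" by (rule ennreal_leI)
    also have "\<dots> = ennreal S * (ennreal ((1 - r) powr \<gamma>) * ennreal (h r powr p))"
     using S0 by (simp add: ennreal_mult mult.assoc)
    also have "\<dots> \<le> ennreal S * (ennreal ((1 - r) powr \<gamma>) * a r)"
     using ha[of r r] True by (intro mult_left_mono) auto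
    finally show ?thesis using True by simp
   qed auto
  qed
  also have "\<dots> = ennreal S * ennreal j" unfolding J[symmetric] by (rule nn_integral_cmult) measurable
  also have "\<dots> = ennreal (S * j)" using S0 j by (simp add: ennreal_mult)
  also have "S * j = C * j powr (1 / p)"
  proof (cases "j = 0")
   case False
   then have j0: "j > 0" using j by simp
   have "S = C1 powr (1 / p * (1 - p)) * j powr (1 / p * (1 - p))"
    unfolding S_def using C1 j by (simp add: powr_mult powr_powr)
   moreover have "j powr (1 / p * (1 - p)) * j = j powr (1 / p)"
   proof -
    have "j powr (1 / p * (1 - p)) * j powr 1 = j powr (1 / p * (1 - p) + 1)" by (simp only: powr_add)
    also have "1 / p * (1 - p) + 1 = 1 / p" using p by (simp add: field_simps)
    finally show ?thesis using j0 by simp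
   qed
   ultimately show ?thesis unfolding C_def by (simp add: mult.assoc)
  qed simp
  finally show ?thesis .
 qed
 then show ?thesis using C unfolding \<gamma>_def by (intro exI[of _ C]) blast
qed

section \<open>Multipliers of negative order\<close>

text \<open>The bound removes the singularity at \<open>r = 0\<close> of the quotient \<open>w(rx)/r\<close>.\<close>

lemma mean_value_small_ratio:
 fixes w :: "real ^ 'n \<Rightarrow> complex"
 assumes mv: "mean_value w" and w0: "w 0 = 0" and B: "\<And>z. norm z \<le> 3 / 4 \<Longrightarrow> norm (w z) \<le> B"
  and x: "norm x \<le> 1" and r: "0 \<le> r" "r \<le> 1 / 2"
 shows "norm (w (r *\<^sub>R x)) \<le> r * (real CARD('n) * (8 * cauchy_const TYPE('n) * B))"
proof -
 let ?K = "real CARD('n) * (8 * cauchy_const TYPE('n) * B)"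
 have pd: "norm (partial_deriv i w z) \<le> 8 * cauchy_const TYPE('n) * B" if z: "norm z \<le> 1 / 2" for i z
 proof -
  have "norm (partial_deriv i w z) \<le> cauchy_const TYPE('n) / (1 / 8) * B"
  proof (rule mean_value_cauchy_estimate[OF mv])
   fix y assume "y \<in> cball z (1 / 8)"
   then show "norm (w y) \<le> B"
    using z norm_triangle_sub[of y z] by (intro B) (simp add: dist_norm norm_minus_commute)
  qed (use z in auto)
  then show ?thesis by simp
 qed
 have tx: "norm (t *\<^sub>R x) \<le> 1 / 2" if "t \<in> {0..r}" for t
 proof -
  have "\<bar>t\<bar> * norm x \<le> (1 / 2) * 1" using that r x by (intro mult_mono) auto
  then show ?thesis by simp
 qed
 let ?D = "\<lambda>t. \<Sum>i\<in>UNIV. of_real (x $ i) * partial_deriv i w (t *\<^sub>R x)"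
 have D: "norm (?D t) \<le> ?K" if t: "t \<in> {0..r}" for t
 proof -
  have "norm (?D t) \<le> (\<Sum>i\<in>(UNIV :: 'n set). 1 * (8 * cauchy_const TYPE('n) * B))"
  proof (rule sum_norm_le)
   fix i
   have "\<bar>x $ i\<bar> \<le> 1" using component_le_norm_cart[of x i] x by linarith
   then show "norm (of_real (x $ i) * partial_deriv i w (t *\<^sub>R x)) \<le> 1 * (8 * cauchy_const TYPE('n) * B)"
    unfolding norm_mult norm_of_real using pd[OF tx[OF t]] by (intro mult_mono) auto
  qed
  then show ?thesis by simp
 qed
 have "norm (w (r *\<^sub>R x) - w (0 *\<^sub>R x)) \<le> ?K * norm (r - 0)"
 proof (rule differentiable_bound[of "{0..r}" "\<lambda>t. w (t *\<^sub>R x)" "\<lambda>t h. h *\<^sub>R ?D t"])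
  fix t assume t: "t \<in> {0..r}"
  have "((\<lambda>t. diff_form 0 w (0 + t *\<^sub>R x) x) has_vector_derivative diff_form (Suc 0) w (0 + t *\<^sub>R x) x) (at t within {0..r})"
  proof (rule diff_form_line_derivative[OF mv])
   show "0 + t *\<^sub>R x \<in> ball 0 1" using tx[OF t] by (simp del: norm_scaleR)
  qed
  then show "((\<lambda>t. w (t *\<^sub>R x)) has_derivative (\<lambda>h. h *\<^sub>R ?D t)) (at t within {0..r})"
   by (simp add: has_vector_derivative_def)
  show "onorm (\<lambda>h. h *\<^sub>R ?D t) \<le> ?K"
  proof (rule onorm_le)
   fix h :: real
   show "norm (h *\<^sub>R ?D t) \<le> ?K * norm h"
    using mult_left_mono[OF D[OF t], of "\<bar>h\<bar>"] by (simp add: mult.commute)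
  qed
 qed (use r in auto)
 then show ?thesis using w0 r by (simp add: mult.commute)
qed

text \<open>Subtracting \<open>u(0)\<close> and dividing by \<open>r\<close> amounts to starting the expansion with \<open>k = 1\<close>, so that
 \<open>b = 0\<close> is allowed; this includes the multiplier \<open>1/k\<close>, the inverse of the radial derivative. The
 remaining factor \<open>r\<^sup>b\<close> is at most \<open>1\<close>.\<close>

lemma mult_op_radial_representation:
 fixes u :: "real ^ 'n \<Rightarrow> complex"
 assumes mv: "mean_value u" and \<sigma>: "subexp \<sigma>" and \<delta>: "\<delta> > 0" and b: "b \<ge> 0"
  and \<sigma>0: "\<sigma> 0 = 0" and \<sigma>k: "\<And>k. k \<ge> 1 \<Longrightarrow> \<sigma> k = c * Beta (b + real k) \<delta>" and x: "x \<in> ball 0 1"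
 shows "ennreal (norm (mult_op \<sigma> u x)) \<le> ennreal \<bar>c\<bar> *
  (\<integral>\<^sup>+r. ennreal ((1 - r) powr (\<delta> - 1) * (norm (u (r *\<^sub>R x) - u 0) / r)) * indicator {0<..<1} r \<partial>lborel)"
proof -
 define U where "U k = taylor_part u (Suc k) x" for k
 define e where "e k r = indicator {0<..<1} r * (r powr (b + real (Suc k) - 1) * (1 - r) powr (\<delta> - 1))" for k and r :: real
 have e0: "0 \<le> e k r" for k r by (simp add: e_def)
 have em [measurable]: "e k \<in> borel_measurable borel" for k unfolding e_def by measurable
 have en: "(\<integral>\<^sup>+r. ennreal (e k r) \<partial>lborel) = ennreal (Beta (b + real (Suc k)) \<delta>)" for k
 proof -
  have "(\<integral>\<^sup>+r. ennreal (e k r) \<partial>lborel) = (\<integral>\<^sup>+r. ennreal (r powr (b + real (Suc k) - 1) * (1 - r) powr (\<delta> - 1)) * indicator {0<..<1} r \<partial>lborel)"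
   by (rule nn_integral_cong) (simp add: e_def indicator_def)
  also have "\<dots> = ennreal (Beta (b + real (Suc k)) \<delta>)" by (rule nn_integral_Beta) (use b \<delta> in auto)
  finally show ?thesis .
 qed
 have Bp: "Beta (b + real (Suc k)) \<delta> > 0" for k by (rule Beta_pos) (use b \<delta> in auto)
 have ei: "integrable lborel (e k)" for k
  by (rule integrableI_nonneg) (use e0 en in auto)
 have eI: "integral\<^sup>L lborel (e k) = Beta (b + real (Suc k)) \<delta>" for k
  using integral_eq_nn_integral[of "e k" lborel] e0 en[of k] Bp[of k] by (simp add: less_imp_le)
 have emono: "e k r \<le> e 0 r" for k r
 proof (cases "r \<in> {0<..<1}")
  case True
  then have "r powr (b + real (Suc k) - 1) \<le> r powr (b + real (Suc 0) - 1)" by (intro powr_mono') auto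
  then show ?thesis by (auto simp: e_def intro!: mult_left_mono mult_right_mono)
 qed (simp add: e_def)
 define f where "f k r = e k r *\<^sub>R U k" for k r
 have fi: "integrable lborel (f k)" for k unfolding f_def by (rule integrable_scaleR_left) (rule ei)
 have fI: "integral\<^sup>L lborel (f k) = Beta (b + real (Suc k)) \<delta> *\<^sub>R U k" for k
  unfolding f_def by (subst integral_scaleR_left) (use ei eI in auto)
 have sU: "summable (\<lambda>k. norm (U k))"
  using geometric_bound_summable[OF homogeneous_expansion_taylor(1)[OF mv] x]
  unfolding U_def by (subst summable_Suc_iff)
 have s1: "summable (\<lambda>k. norm (f k r))" for r
 proof (rule summable_comparison_test)
  show "summable (\<lambda>k. e 0 r * norm (U k))" by (rule summable_mult[OF sU])
  show "\<exists>N. \<forall>k\<ge>N. norm (norm (f k r)) \<le> e 0 r * norm (U k)"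
   using emono e0 by (auto simp: f_def intro!: mult_right_mono)
 qed
 have s2: "summable (\<lambda>k. \<integral>r. norm (f k r) \<partial>lborel)"
 proof (rule summable_comparison_test)
  show "summable (\<lambda>k. Beta (b + real (Suc 0)) \<delta> * norm (U k))" by (rule summable_mult[OF sU])
  have "norm (\<integral>r. norm (f k r) \<partial>lborel) \<le> Beta (b + real (Suc 0)) \<delta> * norm (U k)" for k
  proof -
   have "(\<integral>r. norm (f k r) \<partial>lborel) = (\<integral>r. e k r * norm (U k) \<partial>lborel)"
    by (rule Bochner_Integration.integral_cong) (use e0 in \<open>auto simp: f_def\<close>)
   also have "\<dots> = Beta (b + real (Suc k)) \<delta> * norm (U k)" using eI[of k] by simp
   also have "Beta (b + real (Suc k)) \<delta> \<le> Beta (b + real (Suc 0)) \<delta>"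
    unfolding eI[symmetric] by (rule integral_mono[OF ei ei emono])
   finally show ?thesis using Bp[of k] by (simp add: mult_right_mono)
  qed
  then show "\<exists>N. \<forall>k\<ge>N. norm (\<integral>r. norm (f k r) \<partial>lborel) \<le> Beta (b + real (Suc 0)) \<delta> * norm (U k)" by blast
 qed
 define F where "F r = (\<Sum>k. f k r)" for r
 have Fi: "integrable lborel F" unfolding F_def by (rule integrable_suminf[OF fi _ s2]) (use s1 in auto)
 have FI: "integral\<^sup>L lborel F = (\<Sum>k. Beta (b + real (Suc k)) \<delta> *\<^sub>R U k)"
  unfolding F_def by (subst integral_suminf[OF fi _ s2]) (use s1 fI in auto)
 have Feq: "norm (F r) \<le> (1 - r) powr (\<delta> - 1) * (norm (u (r *\<^sub>R x) - u 0) / r) * indicator {0<..<1} r" for r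
 proof (cases "r \<in> {0<..<1}")
  case False
  then show ?thesis by (simp add: F_def f_def e_def)
 next
  case True
  have rx: "r *\<^sub>R x \<in> ball 0 1" using True x mult_strict_mono'[of r 1 "norm x" 1] by simp
  have "(\<lambda>k. taylor_part u (Suc k) (r *\<^sub>R x)) sums (u (r *\<^sub>R x) - u 0)"
   using taylor_sums_ball[OF mv rx] sums_Suc_iff[of "\<lambda>k. taylor_part u k (r *\<^sub>R x)" "u (r *\<^sub>R x) - u 0"]
   by (simp add: taylor_part_0)
  then have "(\<lambda>k. (r powr (b - 1) * (1 - r) powr (\<delta> - 1)) *\<^sub>R taylor_part u (Suc k) (r *\<^sub>R x)) sums
    ((r powr (b - 1) * (1 - r) powr (\<delta> - 1)) *\<^sub>R (u (r *\<^sub>R x) - u 0))"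
   by (rule sums_scaleR_right)
  moreover have "(r powr (b - 1) * (1 - r) powr (\<delta> - 1)) *\<^sub>R taylor_part u (Suc k) (r *\<^sub>R x) = f k r" for k
  proof -
   have "r powr (b + real (Suc k) - 1) = r powr ((b - 1) + real (Suc k))" by (simp add: algebra_simps)
   also have "\<dots> = r powr (b - 1) * r ^ Suc k" using True powr_realpow[of r "Suc k"] by (simp only: powr_add) simp
   finally show ?thesis using True
    by (simp add: f_def e_def U_def taylor_part_scale complex_scaleR)
  qed
  ultimately have "F r = (r powr (b - 1) * (1 - r) powr (\<delta> - 1)) *\<^sub>R (u (r *\<^sub>R x) - u 0)"
   by (simp add: F_def sums_iff)
  then have "norm (F r) = r powr (b - 1) * ((1 - r) powr (\<delta> - 1) * norm (u (r *\<^sub>R x) - u 0))" by simp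
  also have "\<dots> \<le> r powr (- 1) * ((1 - r) powr (\<delta> - 1) * norm (u (r *\<^sub>R x) - u 0))"
   using True b by (intro mult_right_mono powr_mono') auto
  also have "r powr (- 1) = 1 / r" using True by (simp add: powr_minus divide_inverse)
  finally show ?thesis using True by simp
 qed
 have "mult_op \<sigma> u x = of_real c * integral\<^sup>L lborel F"
 proof -
  have "(\<lambda>k. of_real (\<sigma> (Suc k)) * U k) sums mult_op \<sigma> u x"
   using mult_op(3)[OF mv \<sigma> x] sums_Suc_iff[of "\<lambda>k. of_real (\<sigma> k) * taylor_part u k x" "mult_op \<sigma> u x"]
   by (simp add: U_def \<sigma>0)
  then have "mult_op \<sigma> u x = (\<Sum>k. of_real (\<sigma> (Suc k)) * U k)" by (simp add: sums_iff)
  also have "\<dots> = (\<Sum>k. of_real c * (Beta (b + real (Suc k)) \<delta> *\<^sub>R U k))"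
   by (rule suminf_cong) (subst \<sigma>k, simp, simp add: complex_scaleR mult.assoc)
  also have "\<dots> = of_real c * (\<Sum>k. Beta (b + real (Suc k)) \<delta> *\<^sub>R U k)"
  proof (rule suminf_mult)
   show "summable (\<lambda>k. Beta (b + real (Suc k)) \<delta> *\<^sub>R U k)"
    using sums_integral[OF fi _ s2] s1 unfolding fI by (auto simp: sums_iff)
  qed
  finally show ?thesis unfolding FI .
 qed
 then have "ennreal (norm (mult_op \<sigma> u x)) = ennreal \<bar>c\<bar> * ennreal (norm (integral\<^sup>L lborel F))"
  by (simp add: norm_mult ennreal_mult)
 also have "\<dots> \<le> ennreal \<bar>c\<bar> * (\<integral>\<^sup>+r. ennreal (norm (F r)) \<partial>lborel)"
  by (intro mult_left_mono integral_norm_bound_ennreal Fi) simp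
 also have "\<dots> \<le> ennreal \<bar>c\<bar> * (\<integral>\<^sup>+r. ennreal ((1 - r) powr (\<delta> - 1) * (norm (u (r *\<^sub>R x) - u 0) / r)) * indicator {0<..<1} r \<partial>lborel)"
 proof (rule mult_left_mono, rule nn_integral_mono)
  fix r :: real
  show "ennreal (norm (F r)) \<le> ennreal ((1 - r) powr (\<delta> - 1) * (norm (u (r *\<^sub>R x) - u 0) / r)) * indicator {0<..<1} r"
   using ennreal_leI[OF Feq[of r]] by (cases "r \<in> {0<..<1}") auto
 qed simp
 finally show ?thesis .
qed

text \<open>The radial representation with \<open>h(r) = |u(rx) - u(0)|/r\<close>. For \<open>r \<le> 1/2\<close> this is controlled by
 values in a compact part of the ball, for \<open>r > 1/2\<close> by the Whitney average at any slightly larger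
 \<open>r'x\<close>, which is what \<open>weighted_power_integral\<close> requires.\<close>

lemma mult_op_down_pointwise:
 fixes \<sigma> :: "nat \<Rightarrow> real"
 assumes p: "0 < p" "p < 1" and \<sigma>: "subexp \<sigma>" and \<delta>: "\<delta> > 0" and b: "b \<ge> 0"
  and \<sigma>0: "\<sigma> 0 = 0" and \<sigma>k: "\<And>k. k \<ge> 1 \<Longrightarrow> \<sigma> k = c * Beta (b + real k) \<delta>"
 shows "\<exists>C>0. \<forall>(u :: real ^ 'n \<Rightarrow> complex) x. mean_value u \<longrightarrow> x \<in> ball 0 1 \<longrightarrow>
  ennreal (norm (mult_op \<sigma> u x) powr p) \<le> ennreal C * (core_int p (\<lambda>x. u x - u 0) +
   (\<integral>\<^sup>+r. ennreal ((1 - r) powr (\<delta> * p - 1)) * indicator {1/2<..<1} r * whitney_avg p (\<lambda>x. u x - u 0) (r *\<^sub>R x) \<partial>lborel))"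
proof -
 obtain C1 where C1: "C1 > 0" and W: "\<And>(u :: real ^ 'n \<Rightarrow> complex) x y. mean_value u \<Longrightarrow> norm x < 1 \<Longrightarrow> dist x y \<le> (1 - norm x) / 2 \<Longrightarrow>
   ennreal (norm (u y) powr p) \<le> ennreal C1 * whitney_avg p u x"
  using whitney_avg_bound[OF p, where 'n='n] by blast
 obtain C2 where C2: "C2 > 0" and Co: "\<And>(u :: real ^ 'n \<Rightarrow> complex) y. mean_value u \<Longrightarrow> norm y \<le> 3 / 4 \<Longrightarrow>
   ennreal (norm (u y) powr p) \<le> ennreal C2 * core_int p u" using core_int_bound[OF p, where 'n='n] by blast
 obtain C3 where C3: "C3 > 0" and H: "\<forall>(h :: real \<Rightarrow> real) a j. (\<forall>r. 0 \<le> h r) \<longrightarrow> a \<in> borel_measurable borel \<longrightarrow>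
   (\<forall>r r'. 0 < r \<longrightarrow> r < 1 \<longrightarrow> r \<le> r' \<longrightarrow> r' \<le> r + (1 - r) / 4 \<longrightarrow> ennreal (h r powr p) \<le> a r') \<longrightarrow>
   0 \<le> j \<longrightarrow> (\<integral>\<^sup>+r. ennreal ((1 - r) powr (\<delta> * p - 1)) * indicator {0<..<1} r * a r \<partial>lborel) = ennreal j \<longrightarrow>
   (\<integral>\<^sup>+r. ennreal ((1 - r) powr (\<delta> - 1) * h r) * indicator {0<..<1} r \<partial>lborel) \<le> ennreal (C3 * j powr (1 / p))"
  using weighted_power_integral[OF p \<delta>] by (elim exE conjE) (rule that)
 define N where "N = real CARD('n) * (8 * cauchy_const TYPE('n))"
 have N: "N \<ge> 0" unfolding N_def using cauchy_const_nonneg[where 'n='n] by simp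
 define K where "K = N powr p * C2 + 2 powr p * C1"
 have K: "K > 0" unfolding K_def using C1 C2 by (simp add: add_nonneg_pos)
 define B where "B = Beta 1 (\<delta> * p)"
 have B: "B > 0" unfolding B_def using \<delta> p by (intro Beta_pos) auto
 define M where "M = (\<bar>c\<bar> * C3) powr p * K * (B + 1) + 1"
 have M: "M > 0" unfolding M_def using K B by (simp add: add_nonneg_pos)
 have "ennreal (norm (mult_op \<sigma> u x) powr p) \<le> ennreal M * (core_int p (\<lambda>x. u x - u 0) +
   (\<integral>\<^sup>+r. ennreal ((1 - r) powr (\<delta> * p - 1)) * indicator {1/2<..<1} r * whitney_avg p (\<lambda>x. u x - u 0) (r *\<^sub>R x) \<partial>lborel))"
  if mv: "mean_value u" and x: "x \<in> ball 0 1" for u :: "real ^ 'n \<Rightarrow> complex" and x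
 proof -
  define w where "w x = u x - u 0" for x
  have mw: "mean_value w" unfolding w_def by (rule mean_value_diff[OF mv mean_value_const])
  have w0: "w 0 = 0" by (simp add: w_def)
  have [measurable]: "whitney_avg p w \<in> borel_measurable borel"
   by (rule whitney_avg_measurable[OF mean_value_cont[OF mw]])
  have nx: "norm x < 1" using x by simp
  let ?W = "\<lambda>r. ennreal ((1 - r) powr (\<delta> * p - 1)) * indicator {1/2<..<1} r * whitney_avg p w (r *\<^sub>R x)"
  define L where "L = core_int p w"
  define R where "R = (\<integral>\<^sup>+r. ?W r \<partial>lborel)"
  define a where "a r = ennreal K * (L + indicator {1/2<..} r * whitney_avg p w (r *\<^sub>R x))" for r :: real
  have am [measurable]: "a \<in> borel_measurable borel" unfolding a_def by measurable
  define h where "h r = (if 0 < r then norm (w (r *\<^sub>R x)) / r else 0)" for r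
  have h0: "0 \<le> h r" for r by (simp add: h_def)
  have ha: "ennreal (h r powr p) \<le> a r'" if r: "0 < r" "r < 1" "r \<le> r'" "r' \<le> r + (1 - r) / 4" for r r'
  proof (cases "r \<le> 1 / 2")
   case True
   show ?thesis
   proof (cases "L = \<infinity>")
    case True
    then show ?thesis using K by (simp add: a_def ennreal_mult_top)
   next
    case False
    then obtain l where l: "L = ennreal l" "l \<ge> 0" by (cases L) auto
    have bnd: "norm (w z) \<le> (C2 * l) powr (1 / p)" if "norm z \<le> 3 / 4" for z
     by (rule powr_bound_transfer[OF p(1) order_refl l(1)[unfolded L_def] l(2) _ _ Co[OF mw that]]) (use C2 in auto)
    have "norm (w (r *\<^sub>R x)) \<le> r * (real CARD('n) * (8 * cauchy_const TYPE('n) * (C2 * l) powr (1 / p)))"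
     by (rule mean_value_small_ratio[OF mw w0 bnd]) (use nx True r in auto)
    then have "h r \<le> N * (C2 * l) powr (1 / p)"
     using r by (simp add: h_def N_def field_simps)
    then have "h r powr p \<le> (N * (C2 * l) powr (1 / p)) powr p" using p h0[of r] by (intro powr_mono2) auto
    also have "\<dots> = N powr p * ((C2 * l) powr (1 / p)) powr p" by (rule powr_mult; use N in simp)
    also have "((C2 * l) powr (1 / p)) powr p = C2 * l" unfolding powr_powr using p C2 l by simp
    also have "N powr p * (C2 * l) \<le> K * l" unfolding K_def using l C1 by (simp add: algebra_simps)
    finally have "ennreal (h r powr p) \<le> ennreal K * L" using l K by (simp add: ennreal_mult[symmetric] ennreal_leI)
    also have "\<dots> \<le> a r'" unfolding a_def by (intro mult_left_mono) auto
    finally show ?thesis .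
   qed
  next
   case False
   have r1: "r' < 1" using r by (simp add: field_simps)
   have nr: "norm (r' *\<^sub>R x) \<le> r'" using r nx by (simp add: mult_left_le)
   have "dist (r' *\<^sub>R x) (r *\<^sub>R x) = (r' - r) * norm x"
    using r by (simp add: dist_norm scaleR_diff_left[symmetric])
   also have "\<dots> \<le> (r' - r) * 1" using r nx by (intro mult_left_mono) auto
   also have "\<dots> \<le> (1 - r') / 2" using r by (simp add: field_simps)
   also have "\<dots> \<le> (1 - norm (r' *\<^sub>R x)) / 2" by (rule divide_right_mono[OF diff_left_mono[OF nr]]) simp
   finally have d: "dist (r' *\<^sub>R x) (r *\<^sub>R x) \<le> (1 - norm (r' *\<^sub>R x)) / 2" .
   have n1: "norm (r' *\<^sub>R x) < 1" by (rule le_less_trans[OF nr r1])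
   have "norm (w (r *\<^sub>R x)) / r \<le> norm (w (r *\<^sub>R x)) / (1 / 2)"
    by (rule divide_left_mono) (use False r in auto)
   then have "h r \<le> 2 * norm (w (r *\<^sub>R x))" using r by (simp add: h_def mult.commute)
   then have "h r powr p \<le> (2 * norm (w (r *\<^sub>R x))) powr p" using p h0[of r] by (intro powr_mono2) auto
   also have "\<dots> = 2 powr p * norm (w (r *\<^sub>R x)) powr p" by (rule powr_mult; simp)
   finally have "ennreal (h r powr p) \<le> ennreal (2 powr p) * ennreal (norm (w (r *\<^sub>R x)) powr p)"
    by (simp add: ennreal_mult[symmetric] ennreal_leI)
   also have "\<dots> \<le> ennreal (2 powr p) * (ennreal C1 * whitney_avg p w (r' *\<^sub>R x))"
    by (intro mult_left_mono W[OF mw n1 d]) simp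
   also have "\<dots> = ennreal (2 powr p * C1) * whitney_avg p w (r' *\<^sub>R x)" using C1 by (simp add: ennreal_mult mult.assoc)
   also have "\<dots> \<le> ennreal K * whitney_avg p w (r' *\<^sub>R x)"
    unfolding K_def using C2 by (intro mult_right_mono ennreal_leI) auto
   also have "\<dots> \<le> a r'" unfolding a_def using False r by (intro mult_left_mono) auto
   finally show ?thesis .
  qed
  define J where "J = (\<integral>\<^sup>+r. ennreal ((1 - r) powr (\<delta> * p - 1)) * indicator {0<..<1} r * a r \<partial>lborel)"
  have J: "J \<le> ennreal (K * (B + 1)) * (L + R)"
  proof -
   have "J = (\<integral>\<^sup>+r. (ennreal K * L) * (ennreal ((1 - r) powr (\<delta> * p - 1)) * indicator {0<..<1} r) +
     ennreal K * (?W r) \<partial>lborel)"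
    unfolding J_def a_def by (rule nn_integral_cong) (auto simp: indicator_def algebra_simps)
   also have "\<dots> = (\<integral>\<^sup>+r. (ennreal K * L) * (ennreal ((1 - r) powr (\<delta> * p - 1)) * indicator {0<..<1} r) \<partial>lborel) +
     (\<integral>\<^sup>+r. ennreal K * (?W r) \<partial>lborel)"
    by (rule nn_integral_add) measurable
   also have "(\<integral>\<^sup>+r. (ennreal K * L) * (ennreal ((1 - r) powr (\<delta> * p - 1)) * indicator {0<..<1} r) \<partial>lborel) = (ennreal K * L) * ennreal B"
    unfolding B_def by (subst nn_integral_cmult, measurable) (subst nn_integral_half_interval(1), use \<delta> p in auto)
   also have "(\<integral>\<^sup>+r. ennreal K * (?W r) \<partial>lborel) = ennreal K * R"
    unfolding R_def by (rule nn_integral_cmult) measurable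
   also have "(ennreal K * L) * ennreal B + ennreal K * R \<le> ennreal (K * (B + 1)) * L + ennreal (K * (B + 1)) * R"
   proof (rule add_mono)
    have "(ennreal K * L) * ennreal B = ennreal (K * B) * L" using K B by (simp add: ennreal_mult mult_ac)
    also have "\<dots> \<le> ennreal (K * (B + 1)) * L" using K by (intro mult_right_mono ennreal_leI) auto
    finally show "(ennreal K * L) * ennreal B \<le> ennreal (K * (B + 1)) * L" .
    show "ennreal K * R \<le> ennreal (K * (B + 1)) * R" using K B by (intro mult_right_mono ennreal_leI) auto
   qed
   finally show ?thesis by (simp add: distrib_left)
  qed
  have "ennreal (norm (mult_op \<sigma> u x) powr p) \<le> ennreal M * (L + R)"
  proof (cases "J = \<infinity>")
   case True
   then have "L + R = \<infinity>" using J by (auto simp: top_unique ennreal_mult_eq_top_iff)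
   then show ?thesis using M by (auto simp: ennreal_mult_top)
  next
   case False
   then obtain j where j: "J = ennreal j" "j \<ge> 0" by (cases J) auto
   have "(\<integral>\<^sup>+r. ennreal ((1 - r) powr (\<delta> - 1) * h r) * indicator {0<..<1} r \<partial>lborel) \<le> ennreal (C3 * j powr (1 / p))"
    by (rule H[rule_format, OF h0 am ha j(2)]) (use j(1) J_def in auto)
   then have i1: "(\<integral>\<^sup>+r. ennreal ((1 - r) powr (\<delta> - 1) * (norm (u (r *\<^sub>R x) - u 0) / r)) * indicator {0<..<1} r \<partial>lborel) \<le> ennreal (C3 * j powr (1 / p))"
    by (subst (asm) nn_integral_cong[where v = "\<lambda>r. ennreal ((1 - r) powr (\<delta> - 1) * (norm (u (r *\<^sub>R x) - u 0) / r)) * indicator {0<..<1} r"])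
     (auto simp: h_def w_def indicator_def)
   have "ennreal (norm (mult_op \<sigma> u x)) \<le> ennreal \<bar>c\<bar> * (\<integral>\<^sup>+r. ennreal ((1 - r) powr (\<delta> - 1) * (norm (u (r *\<^sub>R x) - u 0) / r)) * indicator {0<..<1} r \<partial>lborel)"
    by (rule mult_op_radial_representation[OF mv \<sigma> \<delta> b \<sigma>0 \<sigma>k x])
   also have "\<dots> \<le> ennreal \<bar>c\<bar> * ennreal (C3 * j powr (1 / p))" by (rule mult_left_mono[OF i1]) simp
   also have "\<dots> = ennreal (\<bar>c\<bar> * (C3 * j powr (1 / p)))" using C3 by (simp add: ennreal_mult)
   finally have "norm (mult_op \<sigma> u x) \<le> \<bar>c\<bar> * (C3 * j powr (1 / p))"
    using C3 by (subst (asm) ennreal_le_iff) auto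
   then have "norm (mult_op \<sigma> u x) powr p \<le> ((\<bar>c\<bar> * C3) * j powr (1 / p)) powr p"
    using p by (intro powr_mono2) (auto simp: mult.assoc)
   also have "\<dots> = (\<bar>c\<bar> * C3) powr p * (j powr (1 / p)) powr p" by (rule powr_mult; use C3 in simp)
   also have "(j powr (1 / p)) powr p = j" unfolding powr_powr using p j by simp
   finally have "ennreal (norm (mult_op \<sigma> u x) powr p) \<le> ennreal ((\<bar>c\<bar> * C3) powr p) * J"
    using j by (simp add: ennreal_mult[symmetric] ennreal_leI)
   also have "\<dots> \<le> ennreal ((\<bar>c\<bar> * C3) powr p) * (ennreal (K * (B + 1)) * (L + R))" by (rule mult_left_mono[OF J]) simp
   also have "\<dots> = ennreal ((\<bar>c\<bar> * C3) powr p * K * (B + 1)) * (L + R)"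
    using K B by (simp add: ennreal_mult[symmetric] mult.assoc[symmetric])
   also have "\<dots> \<le> ennreal M * (L + R)" unfolding M_def by (intro mult_right_mono ennreal_leI) auto
   finally show ?thesis .
  qed
  then show ?thesis unfolding L_def R_def w_def .
 qed
 then show ?thesis using M by blast
qed

lemma wint_change_at_0:
 fixes \<beta> :: real
 assumes p: "0 < p" "p < 1" and \<gamma>: "\<gamma> > -1"
 shows "\<exists>C>0. \<forall>(u :: real ^ 'n \<Rightarrow> complex). mean_value u \<longrightarrow> wint p \<gamma> (\<lambda>_ :: real ^ 'n. c * u 0) \<le> ennreal C * wint p \<beta> u"
proof -
 obtain C where C: "C > 0" and P: "\<And>u :: real ^ 'n \<Rightarrow> complex. mean_value u \<Longrightarrow> ennreal (norm (u 0) powr p) \<le> ennreal C * wint p \<beta> u"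
  using point_evaluation_bound[OF p, where 'n='n] by blast
 obtain I where I: "wint p \<gamma> (\<lambda>_ :: real ^ 'n. c) = ennreal I" "I \<ge> 0"
  using wint_const_finite[OF \<gamma>, of p c, where 'n='n] by (cases "wint p \<gamma> (\<lambda>_ :: real ^ 'n. c)") auto
 have "wint p \<gamma> (\<lambda>_ :: real ^ 'n. c * u 0) \<le> ennreal (C * I + 1) * wint p \<beta> u" if mv: "mean_value u" for u :: "real ^ 'n \<Rightarrow> complex"
 proof -
  have "wint p \<gamma> (\<lambda>_ :: real ^ 'n. c * u 0) = ennreal (norm (u 0) powr p) * wint p \<gamma> (\<lambda>_ :: real ^ 'n. c)"
   using wint_cmult[of "\<lambda>_ :: real ^ 'n. c" p \<gamma> "u 0"] by (simp add: mult.commute)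
  also have "\<dots> \<le> (ennreal C * wint p \<beta> u) * ennreal I" unfolding I(1) by (rule mult_right_mono[OF P[OF mv]]) simp
  also have "\<dots> = ennreal (C * I) * wint p \<beta> u" using C I by (simp add: ennreal_mult mult_ac)
  also have "\<dots> \<le> ennreal (C * I + 1) * wint p \<beta> u" by (intro mult_right_mono ennreal_leI) auto
  finally show ?thesis .
 qed
 then show ?thesis using C I by (intro exI[of _ "C * I + 1"]) (simp add: add_nonneg_pos)
qed

text \<open>The value \<open>\<sigma>(0)\<close> is arbitrary, since it only adds a multiple of the constant \<open>u(0)\<close>, which is
 controlled by point evaluation.\<close>

theorem mult_op_down:
 fixes \<sigma> :: "nat \<Rightarrow> real"
 assumes p: "0 < p" "p < 1" and \<sigma>: "subexp \<sigma>" and \<delta>: "\<delta> > 0" and b: "b \<ge> 0" and \<beta>: "\<beta> > -1"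
  and \<sigma>k: "\<And>k. k \<ge> 1 \<Longrightarrow> \<sigma> k = c * Beta (b + real k) \<delta>"
 shows "\<exists>C>0. \<forall>(u :: real ^ 'n \<Rightarrow> complex). mean_value u \<longrightarrow> wint p \<beta> (mult_op \<sigma> u) \<le> ennreal C * wint p (\<beta> + p * \<delta>) u"
proof -
 define \<sigma>' where "\<sigma>' k = (if k = 0 then 0 else \<sigma> k)" for k
 have \<sigma>': "subexp \<sigma>'"
 proof -
  have "subexp (\<lambda>k. if k = 0 then 0 else 1)" by (rule subexp_bounded[of _ 1]) auto
  from subexp_mult[OF \<sigma> this] show ?thesis by (simp add: \<sigma>'_def[abs_def] if_distrib cong: if_cong)
 qed
 obtain C1 where C1: "C1 > 0" and P: "\<And>(u :: real ^ 'n \<Rightarrow> complex) x. mean_value u \<Longrightarrow> x \<in> ball 0 1 \<Longrightarrow>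
  ennreal (norm (mult_op \<sigma>' u x) powr p) \<le> ennreal C1 * (core_int p (\<lambda>x. u x - u 0) +
   (\<integral>\<^sup>+r. ennreal ((1 - r) powr (\<delta> * p - 1)) * indicator {1/2<..<1} r * whitney_avg p (\<lambda>x. u x - u 0) (r *\<^sub>R x) \<partial>lborel))"
  using mult_op_down_pointwise[OF p \<sigma>' \<delta> b, of c, where 'n='n] \<sigma>k unfolding \<sigma>'_def by (auto split: if_splits)
 have \<delta>p: "\<delta> * p > 0" using \<delta> p by simp
 obtain C2 where C2: "C2 > 0" and W: "\<And>G :: real ^ 'n \<Rightarrow> ennreal. G \<in> borel_measurable borel \<Longrightarrow>
  (\<integral>\<^sup>+x. ennreal ((1 - norm x) powr \<beta>) * indicator (ball 0 1) x *
    (\<integral>\<^sup>+r. ennreal ((1 - r) powr (\<delta> * p - 1)) * indicator {1/2<..<1} r * G (r *\<^sub>R x) \<partial>lborel) \<partial>lborel) \<le>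
  ennreal C2 * (\<integral>\<^sup>+y. ennreal ((1 - norm y) powr (\<beta> + \<delta> * p)) * indicator (ball 0 1) y * G y \<partial>lborel)"
  using radial_integral_bound[OF \<delta>p \<beta>, where 'n='n] by blast
 define \<gamma> where "\<gamma> = \<beta> + p * \<delta>"
 have \<gamma>: "\<gamma> > -1" "\<beta> + \<delta> * p = \<gamma>" using \<beta> p \<delta> by (auto simp: \<gamma>_def mult.commute) (smt (verit) mult_pos_pos)
 obtain C3 where C3: "C3 > 0" and I: "\<And>u :: real ^ 'n \<Rightarrow> complex. continuous_on (ball 0 1) u \<Longrightarrow>
   (\<integral>\<^sup>+x. ennreal ((1 - norm x) powr \<gamma>) * indicator (ball 0 1) x * whitney_avg p u x \<partial>lborel) \<le> ennreal C3 * wint p \<gamma> u"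
  using whitney_avg_integral[where 'n='n] by blast
 obtain I1 where I1: "wint p \<beta> (\<lambda>_ :: real ^ 'n. 1) = ennreal I1" "I1 \<ge> 0"
  using wint_const_finite[OF \<beta>, of p 1, where 'n='n] by (cases "wint p \<beta> (\<lambda>_ :: real ^ 'n. 1)") auto
 obtain C4 where C4: "C4 > 0" and Z1: "\<And>u :: real ^ 'n \<Rightarrow> complex. mean_value u \<Longrightarrow> wint p \<gamma> (\<lambda>_ :: real ^ 'n. (- 1) * u 0) \<le> ennreal C4 * wint p \<gamma> u"
  using wint_change_at_0[OF p \<gamma>(1), where 'n='n] by blast
 obtain C5 where C5: "C5 > 0" and Z2: "\<And>u :: real ^ 'n \<Rightarrow> complex. mean_value u \<Longrightarrow> wint p \<beta> (\<lambda>_ :: real ^ 'n. of_real (\<sigma> 0) * u 0) \<le> ennreal C5 * wint p \<gamma> u"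
  using wint_change_at_0[OF p \<beta>, where 'n='n] by blast
 define A where "A = C1 * (I1 * 8 powr \<bar>\<gamma>\<bar> + C2 * C3) * (1 + C4) + C5"
 have A: "A > 0" unfolding A_def using C1 C2 C3 C4 C5 I1 by (intro add_nonneg_pos mult_nonneg_nonneg) auto
 have "wint p \<beta> (mult_op \<sigma> u) \<le> ennreal A * wint p \<gamma> u" if mv: "mean_value u" for u :: "real ^ 'n \<Rightarrow> complex"
 proof -
  define w where "w x = u x - u 0" for x
  have mw: "mean_value w" unfolding w_def by (rule mean_value_diff[OF mv mean_value_const])
  have [measurable]: "whitney_avg p w \<in> borel_measurable borel"
   by (rule whitney_avg_measurable[OF mean_value_cont[OF mw]])
  let ?R = "\<lambda>x. \<integral>\<^sup>+r. ennreal ((1 - r) powr (\<delta> * p - 1)) * indicator {1/2<..<1} r * whitney_avg p w (r *\<^sub>R x) \<partial>lborel"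
  let ?v = "\<lambda>x :: real ^ 'n. ennreal ((1 - norm x) powr \<beta>) * indicator (ball 0 1) x"
  have Rm [measurable]: "?R \<in> borel_measurable borel"
  proof -
   have "(\<lambda>(x, r). ennreal ((1 - r) powr (\<delta> * p - 1)) * indicator {1/2<..<1} r * whitney_avg p w (r *\<^sub>R x)) \<in> borel_measurable (borel \<Otimes>\<^sub>M lborel)"
    by measurable
   from lborel.borel_measurable_nn_integral[OF this] show ?thesis by simp
  qed
  have one: "(\<integral>\<^sup>+x. ?v x \<partial>lborel) = ennreal I1"
   unfolding I1(1)[symmetric] wint_def absp_def by (rule nn_integral_cong) (simp add: mult.commute)
  have "wint p \<beta> (mult_op \<sigma>' u) \<le> (\<integral>\<^sup>+x. (ennreal C1 * core_int p w) * ?v x + ennreal C1 * (?v x * ?R x) \<partial>lborel)"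
   unfolding wint_def
  proof (rule nn_integral_mono)
   fix x :: "real ^ 'n"
   show "absp p (mult_op \<sigma>' u) x * ennreal ((1 - norm x) powr \<beta>) \<le> (ennreal C1 * core_int p w) * ?v x + ennreal C1 * (?v x * ?R x)"
   proof (cases "x \<in> ball 0 1")
    case True
    have "ennreal (norm (mult_op \<sigma>' u x) powr p) \<le> ennreal C1 * (core_int p w + ?R x)"
     using P[OF mv True] unfolding w_def .
    then have "ennreal (norm (mult_op \<sigma>' u x) powr p) * ennreal ((1 - norm x) powr \<beta>) \<le> (ennreal C1 * (core_int p w + ?R x)) * ennreal ((1 - norm x) powr \<beta>)"
     by (rule mult_right_mono) simp
    then show ?thesis using True by (simp add: absp_def distrib_left distrib_right mult_ac)
   qed (simp add: absp_def)
  qed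
  also have "\<dots> = (\<integral>\<^sup>+x. (ennreal C1 * core_int p w) * ?v x \<partial>lborel) + (\<integral>\<^sup>+x. ennreal C1 * (?v x * ?R x) \<partial>lborel)"
   by (rule nn_integral_add) measurable
  also have "(\<integral>\<^sup>+x. (ennreal C1 * core_int p w) * ?v x \<partial>lborel) = (ennreal C1 * core_int p w) * ennreal I1"
   unfolding one[symmetric] by (rule nn_integral_cmult) measurable
  also have "(\<integral>\<^sup>+x. ennreal C1 * (?v x * ?R x) \<partial>lborel) = ennreal C1 * (\<integral>\<^sup>+x. ?v x * ?R x \<partial>lborel)"
   by (rule nn_integral_cmult) measurable
  also have "(ennreal C1 * core_int p w) * ennreal I1 + ennreal C1 * (\<integral>\<^sup>+x. ?v x * ?R x \<partial>lborel) \<le>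
    (ennreal C1 * (ennreal (8 powr \<bar>\<gamma>\<bar>) * wint p \<gamma> w)) * ennreal I1 + ennreal C1 * (ennreal C2 * (ennreal C3 * wint p \<gamma> w))"
  proof (intro add_mono mult_right_mono mult_left_mono core_int_le_wint mean_value_cont[OF mw])
   have "(\<integral>\<^sup>+x. ?v x * ?R x \<partial>lborel) \<le> ennreal C2 * (\<integral>\<^sup>+y. ennreal ((1 - norm y) powr \<gamma>) * indicator (ball 0 1) y * whitney_avg p w y \<partial>lborel)"
    using W[of "whitney_avg p w"] unfolding \<gamma>(2) by simp
   also have "\<dots> \<le> ennreal C2 * (ennreal C3 * wint p \<gamma> w)" by (intro mult_left_mono I mean_value_cont[OF mw]) simp
   finally show "(\<integral>\<^sup>+x. ?v x * ?R x \<partial>lborel) \<le> ennreal C2 * (ennreal C3 * wint p \<gamma> w)" .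
  qed auto
  also have "\<dots> = ennreal (C1 * (I1 * 8 powr \<bar>\<gamma>\<bar> + C2 * C3)) * wint p \<gamma> w"
   using C1 C2 C3 I1 by (simp add: ennreal_mult ennreal_plus distrib_left distrib_right mult_ac)
  also have "\<dots> \<le> ennreal (C1 * (I1 * 8 powr \<bar>\<gamma>\<bar> + C2 * C3)) * (ennreal (1 + C4) * wint p \<gamma> u)"
  proof (rule mult_left_mono)
   have "wint p \<gamma> w = wint p \<gamma> (\<lambda>x. u x + (- 1) * u 0)" by (simp add: w_def[abs_def])
   also have "\<dots> \<le> wint p \<gamma> u + wint p \<gamma> (\<lambda>_ :: real ^ 'n. (- 1) * u 0)"
    by (rule wint_add) (use p mean_value_cont[OF mv] in auto)
   also have "\<dots> \<le> wint p \<gamma> u + ennreal C4 * wint p \<gamma> u" by (intro add_left_mono Z1[OF mv])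
   also have "\<dots> = ennreal (1 + C4) * wint p \<gamma> u" using C4 by (simp add: ennreal_plus distrib_right)
   finally show "wint p \<gamma> w \<le> ennreal (1 + C4) * wint p \<gamma> u" .
  qed simp
  finally have 1: "wint p \<beta> (mult_op \<sigma>' u) \<le> ennreal (C1 * (I1 * 8 powr \<bar>\<gamma>\<bar> + C2 * C3) * (1 + C4)) * wint p \<gamma> u"
   using C1 C2 C3 C4 I1 by (simp add: ennreal_mult mult.assoc)
  have eq: "mult_op \<sigma> u x = mult_op \<sigma>' u x + of_real (\<sigma> 0) * u 0" if "x \<in> ball 0 1" for x
   using mult_op_change_0[OF mv \<sigma>' that, of \<sigma>] by (simp add: \<sigma>'_def)
  have "wint p \<beta> (mult_op \<sigma> u) = wint p \<beta> (\<lambda>x. mult_op \<sigma>' u x + of_real (\<sigma> 0) * u 0)"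
   by (rule wint_cong) (simp add: eq)
  also have "\<dots> \<le> wint p \<beta> (mult_op \<sigma>' u) + wint p \<beta> (\<lambda>_ :: real ^ 'n. of_real (\<sigma> 0) * u 0)"
   by (rule wint_add) (use p mean_value_cont[OF mult_op(1)[OF mv \<sigma>']] in auto)
  also have "\<dots> \<le> ennreal (C1 * (I1 * 8 powr \<bar>\<gamma>\<bar> + C2 * C3) * (1 + C4)) * wint p \<gamma> u + ennreal C5 * wint p \<gamma> u"
   by (intro add_mono 1 Z2[OF mv])
  also have "\<dots> = ennreal A * wint p \<gamma> u"
   unfolding A_def using C1 C2 C3 C4 C5 I1 by (subst ennreal_plus) (auto simp: distrib_right)
  finally show ?thesis .
 qed
 then show ?thesis using A unfolding \<gamma>_def by blast
qed

section \<open>The order of a multiplier\<close>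

definition wint_bounded :: "'n::finite itself \<Rightarrow> real \<Rightarrow> real \<Rightarrow> real \<Rightarrow> (nat \<Rightarrow> real) \<Rightarrow> bool" where
 "wint_bounded _ p \<beta> \<beta>' \<sigma> \<longleftrightarrow> subexp \<sigma> \<and>
   (\<exists>C>0. \<forall>u :: real ^ 'n \<Rightarrow> complex. mean_value u \<longrightarrow> wint p \<beta>' (mult_op \<sigma> u) \<le> ennreal C * wint p \<beta> u)"

lemma wint_boundedI:
 assumes "subexp \<sigma>" "C > 0"
  "\<And>u :: real ^ 'n::finite \<Rightarrow> complex. mean_value u \<Longrightarrow> wint p \<beta>' (mult_op \<sigma> u) \<le> ennreal C * wint p \<beta> u"
 shows "wint_bounded TYPE('n) p \<beta> \<beta>' \<sigma>"
 using assms unfolding wint_bounded_def by blast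

lemma wint_boundedE:
 assumes "wint_bounded TYPE('n::finite) p \<beta> \<beta>' \<sigma>"
 obtains C where "C > 0"
  "\<And>u :: real ^ 'n \<Rightarrow> complex. mean_value u \<Longrightarrow> wint p \<beta>' (mult_op \<sigma> u) \<le> ennreal C * wint p \<beta> u"
 using assms unfolding wint_bounded_def by blast

lemma wint_bounded_subexp: "wint_bounded TYPE('n::finite) p \<beta> \<beta>' \<sigma> \<Longrightarrow> subexp \<sigma>"
 by (simp add: wint_bounded_def)

lemma ennreal_bound_trans:
 fixes x y z :: ennreal
 assumes "x \<le> ennreal C * y" "y \<le> ennreal D * z" "C > 0" "D > 0"
 shows "x \<le> ennreal (C * D) * z"
proof -
 have "x \<le> ennreal C * (ennreal D * z)" using assms(1) mult_left_mono[OF assms(2), of "ennreal C"] by (rule order_trans) simp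
 also have "\<dots> = ennreal (C * D) * z" using assms by (simp add: ennreal_mult mult.assoc)
 finally show ?thesis .
qed

lemma wint_bounded_mult:
 assumes \<tau>: "wint_bounded TYPE('n::finite) p \<beta> \<beta>' \<tau>" and \<sigma>: "wint_bounded TYPE('n) p \<beta>' \<beta>'' \<sigma>"
 shows "wint_bounded TYPE('n) p \<beta> \<beta>'' (\<lambda>k. \<sigma> k * \<tau> k)"
proof -
 note s = wint_bounded_subexp[OF \<tau>] wint_bounded_subexp[OF \<sigma>]
 obtain C where C: "C > 0" "\<And>u :: real ^ 'n \<Rightarrow> complex. mean_value u \<Longrightarrow> wint p \<beta>' (mult_op \<tau> u) \<le> ennreal C * wint p \<beta> u"
  by (rule wint_boundedE[OF \<tau>]) (rule that)
 obtain D where D: "D > 0" "\<And>u :: real ^ 'n \<Rightarrow> complex. mean_value u \<Longrightarrow> wint p \<beta>'' (mult_op \<sigma> u) \<le> ennreal D * wint p \<beta>' u"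
  by (rule wint_boundedE[OF \<sigma>]) (rule that)
 show ?thesis
 proof (rule wint_boundedI[of _ "D * C"])
  fix u :: "real ^ 'n \<Rightarrow> complex" assume mv: "mean_value u"
  show "wint p \<beta>'' (mult_op (\<lambda>k. \<sigma> k * \<tau> k) u) \<le> ennreal (D * C) * wint p \<beta> u"
   unfolding mult_op_mult_op[OF mv s(1), symmetric]
   by (rule ennreal_bound_trans[OF D(2)[OF mult_op(1)[OF mv s(1)]] C(2)[OF mv] D(1) C(1)])
 qed (use C D s subexp_mult in auto)
qed

lemma wint_bounded_one: "wint_bounded TYPE('n::finite) p \<beta> \<beta> (\<lambda>_. 1)"
proof (rule wint_boundedI[of _ 1])
 fix u :: "real ^ 'n \<Rightarrow> complex" assume "mean_value u"
 then have "wint p \<beta> (mult_op (\<lambda>_. 1) u) = wint p \<beta> u" by (intro wint_cong) (simp add: mult_op_one)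
 then show "wint p \<beta> (mult_op (\<lambda>_. 1) u) \<le> ennreal 1 * wint p \<beta> u" by simp
qed (auto intro: subexp_bounded[of _ 1])

lemma wint_sum:
 fixes f :: "'i \<Rightarrow> real ^ 'n \<Rightarrow> complex"
 assumes p: "0 < p" "p \<le> 1" and I: "finite I" and f: "\<And>i. i \<in> I \<Longrightarrow> continuous_on (ball 0 1) (f i)"
 shows "wint p \<beta> (\<lambda>x. \<Sum>i\<in>I. f i x) \<le> (\<Sum>i\<in>I. wint p \<beta> (f i))"
 using I f
proof (induction I)
 case empty
 then show ?case using p by (simp add: wint_def absp_def)
next
 case (insert i I)
 have "wint p \<beta> (\<lambda>x. f i x + (\<Sum>i\<in>I. f i x)) \<le> wint p \<beta> (f i) + wint p \<beta> (\<lambda>x. \<Sum>i\<in>I. f i x)"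
  by (rule wint_add) (use p insert.prems in \<open>auto intro!: continuous_on_sum\<close>)
 also have "\<dots> \<le> wint p \<beta> (f i) + (\<Sum>i\<in>I. wint p \<beta> (f i))" using insert by (intro add_left_mono) auto
 finally show ?case using insert by simp
qed

lemma wint_radial_deriv:
 fixes u :: "real ^ 'n \<Rightarrow> complex"
 assumes p: "0 < p" "p \<le> 1" and mv: "mean_value u"
 shows "wint p \<beta> (mult_op real u) \<le> (\<Sum>i\<in>UNIV. wint p \<beta> (partial_deriv i u))"
proof -
 have "wint p \<beta> (mult_op real u) = wint p \<beta> (\<lambda>x. \<Sum>i\<in>UNIV. of_real (x $ i) * partial_deriv i u x)"
  by (rule wint_cong) (simp add: radial_deriv_mult_op[OF mv, symmetric] radial_deriv_def)
 also have "\<dots> \<le> (\<Sum>i\<in>UNIV. wint p \<beta> (\<lambda>x. of_real (x $ i) * partial_deriv i u x))"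
  by (rule wint_sum[OF p]) (auto intro!: continuous_on_mult continuous_intros mean_value_cont[OF mean_value_partial[OF mv]])
 also have "\<dots> \<le> (\<Sum>i\<in>UNIV. wint p \<beta> (partial_deriv i u))"
 proof (intro sum_mono wint_mono p)
  fix i and x :: "real ^ 'n" assume "x \<in> ball 0 1"
  then have "\<bar>x $ i\<bar> \<le> 1" using component_le_norm_cart[of x i] by simp
  then show "norm (of_real (x $ i) * partial_deriv i u x) \<le> norm (partial_deriv i u x)"
   by (simp add: norm_mult mult_left_le_one_le)
 qed
 finally show ?thesis .
qed

text \<open>The multiplier \<open>k + c\<close> is the differential operator \<open>\<R> + c\<close>.\<close>

lemma mult_op_affine:
 fixes u :: "real ^ 'n \<Rightarrow> complex"
 assumes mv: "mean_value u" and x: "x \<in> ball 0 1"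
 shows "mult_op (\<lambda>k. d * (real k + c)) u x = of_real d * mult_op real u x + of_real (d * c) * u x"
proof -
 have "subexp real" using subexp_affine[of 0] by simp
 then have "(\<lambda>k. of_real d * (of_real (real k) * taylor_part u k x) + of_real (d * c) * taylor_part u k x) sums
   (of_real d * mult_op real u x + of_real (d * c) * u x)"
  by (intro sums_add sums_mult mult_op(3)[OF mv _ x] taylor_sums_ball[OF mv x])
 then have "(\<lambda>k. of_real (d * (real k + c)) * taylor_part u k x) sums (of_real d * mult_op real u x + of_real (d * c) * u x)"
  by (simp add: algebra_simps)
 then show ?thesis by (simp add: mult_op_def sums_iff)
qed

lemma subexp_cmult: "subexp \<sigma> \<Longrightarrow> subexp (\<lambda>k. d * \<sigma> k)"
 using subexp_mult[OF subexp_bounded[of "\<lambda>_. d" "\<bar>d\<bar>"], of \<sigma>] by simp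

lemma wint_bounded_affine:
 assumes p: "0 < p" "p < 1"
 shows "wint_bounded TYPE('n::finite) p \<beta> (\<beta> + p) (\<lambda>k. d * (real k + c))"
proof -
 obtain C where C: "C > 0" and P: "\<And>(u :: real ^ 'n \<Rightarrow> complex) i. mean_value u \<Longrightarrow> wint p (\<beta> + p) (partial_deriv i u) \<le> ennreal C * wint p \<beta> u"
  using wint_partial[OF p, where 'n='n] by blast
 define A where "A = \<bar>d\<bar> powr p * (real CARD('n) * C) + \<bar>d * c\<bar> powr p"
 show ?thesis
 proof (rule wint_boundedI[of _ "A + 1"])
  fix u :: "real ^ 'n \<Rightarrow> complex" assume mv: "mean_value u"
  have mR: "mean_value (mult_op real u)" by (rule mult_op(1)[OF mv]) (use subexp_affine[of 0] in simp)
  have R: "wint p (\<beta> + p) (mult_op real u) \<le> ennreal (real CARD('n) * C) * wint p \<beta> u"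
  proof -
   have "wint p (\<beta> + p) (mult_op real u) \<le> (\<Sum>i\<in>UNIV. wint p (\<beta> + p) (partial_deriv i u))"
    by (rule wint_radial_deriv) (use p mv in auto)
   also have "\<dots> \<le> (\<Sum>i\<in>(UNIV :: 'n set). ennreal C * wint p \<beta> u)" by (intro sum_mono P mv)
   also have "\<dots> = ennreal (real CARD('n) * C) * wint p \<beta> u"
    using C by (simp add: ennreal_mult ennreal_of_nat_eq_real_of_nat mult.assoc)
   finally show ?thesis .
  qed
  have "wint p (\<beta> + p) (mult_op (\<lambda>k. d * (real k + c)) u) =
    wint p (\<beta> + p) (\<lambda>x. of_real d * mult_op real u x + of_real (d * c) * u x)"
   by (rule wint_cong) (simp only: mult_op_affine[OF mv])
  also have "\<dots> \<le> wint p (\<beta> + p) (\<lambda>x. of_real d * mult_op real u x) + wint p (\<beta> + p) (\<lambda>x. of_real (d * c) * u x)"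
   by (rule wint_add) (use p continuous_on_mult_left[OF mean_value_cont[OF mR]] continuous_on_mult_left[OF mean_value_cont[OF mv]] in auto)
  also have "\<dots> = ennreal (\<bar>d\<bar> powr p) * wint p (\<beta> + p) (mult_op real u) + ennreal (\<bar>d * c\<bar> powr p) * wint p (\<beta> + p) u"
   by (simp only: wint_cmult[OF mean_value_cont[OF mR]] wint_cmult[OF mean_value_cont[OF mv]] norm_of_real)
  also have "\<dots> \<le> ennreal (\<bar>d\<bar> powr p) * (ennreal (real CARD('n) * C) * wint p \<beta> u) + ennreal (\<bar>d * c\<bar> powr p) * wint p \<beta> u"
   by (intro add_mono mult_left_mono R wint_mono_weight) (use p in auto)
  also have "\<dots> = ennreal A * wint p \<beta> u"
   unfolding A_def using C by (subst ennreal_plus) (auto simp: distrib_right ennreal_mult mult.assoc)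
  also have "\<dots> \<le> ennreal (A + 1) * wint p \<beta> u" by (intro mult_right_mono ennreal_leI) auto
  finally show "wint p (\<beta> + p) (mult_op (\<lambda>k. d * (real k + c)) u) \<le> ennreal (A + 1) * wint p \<beta> u" .
 next
  show "A + 1 > 0" unfolding A_def using C by (simp add: add_nonneg_pos)
 qed (rule subexp_cmult[OF subexp_affine])
qed

text \<open>A multiplier that first raises the order by \<open>j\<close> and then lowers it by \<open>\<delta>\<close>. Raising is bounded for
 every exponent, lowering for exponents above \<open>-1\<close> in the target. Keeping the two factors apart
 makes the notion stable under products and lets the composition pass through intermediate weights
 that cause no new condition.\<close>

definition has_order :: "'n::finite itself \<Rightarrow> real \<Rightarrow> real \<Rightarrow> (nat \<Rightarrow> real) \<Rightarrow> bool" where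
 "has_order T p \<tau> \<sigma> \<longleftrightarrow> (\<exists>j \<delta> \<sigma>1 \<sigma>2. j \<ge> 0 \<and> \<delta> \<ge> 0 \<and> \<tau> = j - \<delta> \<and> \<sigma> = (\<lambda>k. \<sigma>2 k * \<sigma>1 k) \<and>
   (\<forall>\<beta>. wint_bounded T p \<beta> (\<beta> + p * j) \<sigma>1) \<and> (\<forall>\<beta>>-1. wint_bounded T p (\<beta> + p * \<delta>) \<beta> \<sigma>2))"

text \<open>The order is raised first, so that the exponent \<open>\<beta>'\<close> of the target is the only one that
 must exceed \<open>-1\<close>.\<close>

lemma has_order_wint_bounded:
 assumes "has_order TYPE('n::finite) p \<tau> \<sigma>" "\<beta>' > -1" "\<beta>' = \<beta> + p * \<tau>"
 shows "wint_bounded TYPE('n) p \<beta> \<beta>' \<sigma>"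
proof -
 obtain j \<delta> \<sigma>1 \<sigma>2 where *: "\<tau> = j - \<delta>" "\<sigma> = (\<lambda>k. \<sigma>2 k * \<sigma>1 k)"
   and 1: "\<And>\<beta>. wint_bounded TYPE('n) p \<beta> (\<beta> + p * j) \<sigma>1" and 2: "\<And>\<beta>. \<beta> > -1 \<Longrightarrow> wint_bounded TYPE('n) p (\<beta> + p * \<delta>) \<beta> \<sigma>2"
  using assms(1) unfolding has_order_def by blast
 have e: "\<beta>' + p * \<delta> = \<beta> + p * j" using assms(3) *(1) by (simp add: algebra_simps)
 show ?thesis unfolding *(2) by (rule wint_bounded_mult[OF 1 2[OF assms(2), unfolded e]])
qed

lemma has_order_subexp: "has_order TYPE('n::finite) p \<tau> \<sigma> \<Longrightarrow> subexp \<sigma>"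
 using wint_bounded_subexp[OF has_order_wint_bounded[of p \<tau> \<sigma> 0 "- p * \<tau>"]] by simp

lemma has_order_mult:
 assumes p: "p > 0" and s: "has_order TYPE('n::finite) p \<tau> \<sigma>" and s': "has_order TYPE('n) p \<tau>' \<sigma>'"
 shows "has_order TYPE('n) p (\<tau> + \<tau>') (\<lambda>k. \<sigma> k * \<sigma>' k)"
proof -
 obtain j \<delta> \<sigma>1 \<sigma>2 where a: "j \<ge> 0" "\<delta> \<ge> 0" "\<tau> = j - \<delta>" "\<sigma> = (\<lambda>k. \<sigma>2 k * \<sigma>1 k)"
   and 1: "\<And>\<beta>. wint_bounded TYPE('n) p \<beta> (\<beta> + p * j) \<sigma>1" and 2: "\<And>\<beta>. \<beta> > -1 \<Longrightarrow> wint_bounded TYPE('n) p (\<beta> + p * \<delta>) \<beta> \<sigma>2"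
  using s unfolding has_order_def by blast
 obtain j' \<delta>' \<sigma>1' \<sigma>2' where b: "j' \<ge> 0" "\<delta>' \<ge> 0" "\<tau>' = j' - \<delta>'" "\<sigma>' = (\<lambda>k. \<sigma>2' k * \<sigma>1' k)"
   and 3: "\<And>\<beta>. wint_bounded TYPE('n) p \<beta> (\<beta> + p * j') \<sigma>1'" and 4: "\<And>\<beta>. \<beta> > -1 \<Longrightarrow> wint_bounded TYPE('n) p (\<beta> + p * \<delta>') \<beta> \<sigma>2'"
  using s' unfolding has_order_def by blast
 have "wint_bounded TYPE('n) p \<beta> (\<beta> + p * (j + j')) (\<lambda>k. \<sigma>1' k * \<sigma>1 k)" for \<beta>
  using wint_bounded_mult[OF 1 3[of "\<beta> + p * j"]] by (simp add: algebra_simps)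
 moreover have "wint_bounded TYPE('n) p (\<beta> + p * (\<delta> + \<delta>')) \<beta> (\<lambda>k. \<sigma>2 k * \<sigma>2' k)" if "\<beta> > -1" for \<beta>
 proof -
  have "p * \<delta> \<ge> 0" using p a by simp
  then have "\<beta> + p * \<delta> > -1" using that by linarith
  from wint_bounded_mult[OF 4[OF this] 2[OF that]] show ?thesis by (simp add: algebra_simps)
 qed
 ultimately show ?thesis unfolding has_order_def
  by (intro exI[of _ "j + j'"] exI[of _ "\<delta> + \<delta>'"] exI[of _ "\<lambda>k. \<sigma>1' k * \<sigma>1 k"] exI[of _ "\<lambda>k. \<sigma>2 k * \<sigma>2' k"])
    (use a b in \<open>simp add: fun_eq_iff\<close>)
qed

lemma has_order_one: "has_order TYPE('n::finite) p 0 (\<lambda>_. 1)"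
 unfolding has_order_def
 by (intro exI[of _ 0] exI[of _ 0] exI[of _ "\<lambda>_. 1"] exI[of _ "\<lambda>_. 1"]) (simp add: wint_bounded_one)

lemma has_order_power:
 assumes p: "p > 0" and s: "has_order TYPE('n::finite) p \<tau> \<sigma>"
 shows "has_order TYPE('n) p (real N * \<tau>) (\<lambda>k. \<sigma> k ^ N)"
proof (induction N)
 case 0
 then show ?case using has_order_one by simp
next
 case (Suc N)
 show ?case using has_order_mult[OF p s Suc.IH] by (simp add: algebra_simps)
qed

lemma has_order_affine:
 assumes p: "0 < p" "p < 1"
 shows "has_order TYPE('n::finite) p 1 (\<lambda>k. d * (real k + c))"
 unfolding has_order_def
 by (intro exI[of _ 1] exI[of _ 0] exI[of _ "\<lambda>k. d * (real k + c)"] exI[of _ "\<lambda>_. 1"])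
  (simp add: wint_bounded_one wint_bounded_affine[OF p])

lemma has_order_Beta:
 fixes \<sigma> :: "nat \<Rightarrow> real"
 assumes p: "0 < p" "p < 1" and \<sigma>: "subexp \<sigma>" and \<delta>: "\<delta> > 0" and b: "b \<ge> 0"
  and \<sigma>k: "\<And>k. k \<ge> 1 \<Longrightarrow> \<sigma> k = c * Beta (b + real k) \<delta>"
 shows "has_order TYPE('n::finite) p (- \<delta>) \<sigma>"
proof -
 have "wint_bounded TYPE('n) p (\<beta> + p * \<delta>) \<beta> \<sigma>" if "\<beta> > -1" for \<beta>
  using mult_op_down[OF p \<sigma> \<delta> b that \<sigma>k, where 'n='n] \<sigma> unfolding wint_bounded_def by simp
 then show ?thesis unfolding has_order_def
  by (intro exI[of _ 0] exI[of _ \<delta>] exI[of _ "\<lambda>_. 1"] exI[of _ \<sigma>]) (use \<delta> in \<open>simp add: wint_bounded_one\<close>)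
qed

lemma Beta_one:
 assumes x: "x > 0"
 shows "Beta x 1 = 1 / (x :: real)"
proof -
 have "Gamma x \<noteq> 0" using Gamma_real_pos[OF x] by linarith
 moreover have "Gamma (x + 1) = x * Gamma x" using x by (intro Gamma_plus1) (auto elim!: nonpos_Ints_cases)
 ultimately show ?thesis by (simp add: Beta_def)
qed

lemma has_order_inverse:
 assumes p: "0 < p" "p < 1" and a: "a \<ge> 0"
 shows "has_order TYPE('n::finite) p (-1) (\<lambda>k. 1 / (real k + a))"
proof (rule has_order_Beta[OF p _ _ a, of _ _ 1])
 show "subexp (\<lambda>k. 1 / (real k + a))"
 proof (rule subexp_bounded)
  show "\<bar>1 / (real k + a)\<bar> \<le> 1 / a + 1" for k
  proof (cases "k = 0")
   case False
   then have "1 / (real k + a) \<le> 1 / 1" using a by (intro divide_left_mono) auto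
   moreover have "1 / a \<ge> 0" using a by simp
   moreover have "1 / (real k + a) \<ge> 0" using a by simp
   ultimately show ?thesis by linarith
  qed (use a in simp)
 qed
qed (use a in \<open>auto simp: Beta_one add.commute\<close>)

text \<open>For \<open>c > b\<close>, the ratio \<open>(b)\<^sub>k/(c)\<^sub>k\<close> is a multiple of the Beta function \<open>B(b + k, c - b)\<close>, so it
 lowers the order by \<open>c - b\<close>. The general case is reduced to this one with \<open>c = a + j\<close>, as
 \<open>(a + j)\<^sub>k/(a)\<^sub>k\<close> is a product of \<open>j\<close> affine functions of \<open>k\<close>.\<close>

lemma has_order_pochhammer_ratio:
 fixes a b :: real
 assumes p: "0 < p" "p < 1" and ab: "a > 0" "b > 0"
 shows "has_order TYPE('n::finite) p (b - a) (\<lambda>k. pochhammer b k / pochhammer a k)"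
proof -
 have up: "has_order TYPE('n) p (real j) (\<lambda>k. pochhammer (a + real j) k / pochhammer a k)" for j
 proof (induction j)
  case 0
  have "(\<lambda>k. pochhammer (a + real 0) k / pochhammer a k) = (\<lambda>_. 1)" using pochhammer_pos[OF ab(1)] by (simp add: less_imp_neq[symmetric])
  then show ?case using has_order_one by simp
 next
  case (Suc j)
  let ?c = "a + real j"
  have c: "?c > 0" using ab by simp
  have e: "(1 / ?c) * (real k + ?c) * (pochhammer ?c k / pochhammer a k) = pochhammer (a + real (Suc j)) k / pochhammer a k" for k
  proof -
   have "pochhammer ?c k * (?c + real k) = ?c * pochhammer (?c + 1) k"
    using pochhammer_rec[of ?c k] pochhammer_Suc[of ?c k] by simp
   then have "pochhammer (a + real (Suc j)) k = (1 / ?c) * (real k + ?c) * pochhammer ?c k"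
    using c by (simp add: field_simps)
   then show ?thesis by simp
  qed
  show ?case using has_order_mult[OF p(1) has_order_affine[OF p, of "1 / ?c" ?c] Suc.IH] unfolding e by (simp add: add.commute)
 qed
 obtain j :: nat where "b - a < real j" using reals_Archimedean2 by blast
 then have j: "a + real j > b" by simp
 let ?c = "a + real j"
 have "has_order TYPE('n) p (- (?c - b)) (\<lambda>k. pochhammer b k / pochhammer ?c k)"
 proof (rule has_order_Beta[OF p _ _ less_imp_le[OF ab(2)], of _ _ "Gamma ?c / (Gamma b * Gamma (?c - b))"])
  show "subexp (\<lambda>k. pochhammer b k / pochhammer ?c k)" by (rule subexp_pochhammer_ratio) (use ab in auto)
  fix k :: nat
  have e: "pochhammer b k = Gamma (b + real k) / Gamma b" "pochhammer ?c k = Gamma (?c + real k) / Gamma ?c"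
   using ab by (auto intro!: pochhammer_Gamma simp: nonpos_Ints_def)
  have e2: "b + real k + (?c - b) = ?c + real k" by simp
  have *: "(x / y) / (z / w) = w / (y * v) * (x * v / z)" if "y > 0" "z > 0" "w > 0" "v > 0" for x y z w v :: real
   using that by (simp add: field_simps)
  show "pochhammer b k / pochhammer ?c k = Gamma ?c / (Gamma b * Gamma (?c - b)) * Beta (b + real k) (?c - b)"
   unfolding e Beta_def e2 by (rule *) (use ab j in auto)
 qed (use j in auto)
 from has_order_mult[OF p(1) up[of j] this]
 have "has_order TYPE('n) p (b - a) (\<lambda>k. (pochhammer ?c k / pochhammer a k) * (pochhammer b k / pochhammer ?c k))" by simp
 moreover have "pochhammer ?c k \<noteq> 0" for k using pochhammer_pos[of ?c k] ab by simp
 ultimately show ?thesis by simp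
qed

lemma gamma_coeff_pos: "gamma_coeff CARD('n::finite) k a > 0"
 by (auto simp: gamma_coeff_def intro!: divide_pos_pos mult_pos_pos pochhammer_pos zero_less_power)

lemma gamma_coeff_0: "gamma_coeff n 0 a = 1"
 by (simp add: gamma_coeff_def)

text \<open>In each of the four combinations of the branches of \<open>gamma_coeff\<close> the ratio is a product of at most two ratios of
 Pochhammer symbols with positive bases, whose orders add up to \<open>t\<close>.\<close>

lemma has_order_gamma_ratio:
 assumes p: "0 < p" "p < 1"
 shows "has_order TYPE('n::finite) p t (\<lambda>k. gamma_coeff CARD('n) k (s + t) / gamma_coeff CARD('n) k s)"
proof -
 define h where "h = real CARD('n) / 2"
 have h: "h > 0" by (simp add: h_def)
 have ph: "pochhammer h k > 0" "pochhammer 1 k > (0 :: real)" for k using h by (auto intro: pochhammer_pos)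
 note ratio = has_order_pochhammer_ratio[OF p, where 'n='n]
 have g: "gamma_coeff CARD('n) k a = (if a > - (1 + h) then pochhammer (1 + h + a) k / pochhammer h k
   else (pochhammer 1 k)\<^sup>2 / (pochhammer (1 - (h + a)) k * pochhammer h k))" for k a
  by (simp add: gamma_coeff_def h_def)
 consider (a) "s > - (1 + h)" "s + t > - (1 + h)" | (b) "s > - (1 + h)" "\<not> s + t > - (1 + h)"
  | (c) "\<not> s > - (1 + h)" "s + t > - (1 + h)" | (d) "\<not> s > - (1 + h)" "\<not> s + t > - (1 + h)" by blast
 then show ?thesis
 proof cases
  case a
  then have "has_order TYPE('n) p ((1 + h + (s + t)) - (1 + h + s)) (\<lambda>k. pochhammer (1 + h + (s + t)) k / pochhammer (1 + h + s) k)"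
   by (intro ratio) auto
  then show ?thesis using a ph by (simp add: g less_imp_neq[symmetric])
 next
  case b
  then have pos: "1 + h + s > 0" "1 - (h + (s + t)) > 0" by auto
  have "has_order TYPE('n) p ((1 - (1 + h + s)) + (1 - (1 - (h + (s + t)))))
   (\<lambda>k. (pochhammer 1 k / pochhammer (1 + h + s) k) * (pochhammer 1 k / pochhammer (1 - (h + (s + t))) k))"
   by (intro has_order_mult ratio p pos) auto
  moreover have "(pochhammer 1 k / pochhammer (1 + h + s) k) * (pochhammer 1 k / pochhammer (1 - (h + (s + t))) k) =
   gamma_coeff CARD('n) k (s + t) / gamma_coeff CARD('n) k s" for k
   using b ph(1)[of k] by (simp add: g power2_eq_square)
  ultimately show ?thesis by simp
 next
  case c
  then have pos: "1 + h + (s + t) > 0" "1 - (h + s) > 0" by auto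
  have "has_order TYPE('n) p (((1 + h + (s + t)) - 1) + ((1 - (h + s)) - 1))
   (\<lambda>k. (pochhammer (1 + h + (s + t)) k / pochhammer 1 k) * (pochhammer (1 - (h + s)) k / pochhammer 1 k))"
   by (intro has_order_mult ratio p pos) auto
  moreover have "(pochhammer (1 + h + (s + t)) k / pochhammer 1 k) * (pochhammer (1 - (h + s)) k / pochhammer 1 k) =
   gamma_coeff CARD('n) k (s + t) / gamma_coeff CARD('n) k s" for k
   using c ph(1)[of k] by (simp add: g power2_eq_square)
  ultimately show ?thesis by simp
 next
  case d
  then have pos: "1 - (h + s) > 0" "1 - (h + (s + t)) > 0" using h by auto
  have "has_order TYPE('n) p ((1 - (h + s)) - (1 - (h + (s + t)))) (\<lambda>k. pochhammer (1 - (h + s)) k / pochhammer (1 - (h + (s + t))) k)"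
   by (intro ratio pos)
  moreover have "pochhammer (1 - (h + s)) k / pochhammer (1 - (h + (s + t))) k =
   gamma_coeff CARD('n) k (s + t) / gamma_coeff CARD('n) k s" for k
   using d ph[of k] by (simp add: g)
  ultimately show ?thesis by simp
 qed
qed

section \<open>Comparing the radial derivative with other derivatives\<close>

text \<open>For \<open>k \<ge> 1\<close> the multiplier is \<open>(\<sigma>(k)/k\<^sup>N) k\<^sup>N\<close>, of total order \<open>\<tau> - N\<close> after \<open>\<R>\<^sup>N\<close>; the
 coefficient at \<open>k = 0\<close>, which \<open>\<R>\<^sup>N\<close> loses for \<open>N > 0\<close>, is restored by the term with \<open>u(0)\<close>.\<close>

lemma multiplier_le_radial:
 assumes p: "0 < p" "p < 1" and \<sigma>: "has_order TYPE('n::finite) p \<tau> \<sigma>" and \<beta>': "\<beta>' > -1" "\<beta>' = \<beta> + p * (\<tau> - real N)"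
 shows "\<exists>C>0. \<forall>u :: real ^ 'n \<Rightarrow> complex. mean_value u \<longrightarrow> wint p \<beta>' (mult_op \<sigma> u) \<le>
  ennreal C * (ennreal (norm (u 0) powr p) + wint p \<beta> (mult_op (\<lambda>k. real k ^ N) u))"
proof -
 \<comment> \<open>at \<open>k = 0\<close> the division by zero gives \<open>0\<close> for \<open>N > 0\<close> and \<open>0\<^sup>0 = 1\<close> for \<open>N = 0\<close>; the defect is \<open>d\<close> below\<close>
 define \<rho> where "\<rho> k = \<sigma> k * (1 / (real k + 0)) ^ N" for k
 have "has_order TYPE('n) p (\<tau> + real N * (-1)) \<rho>"
  unfolding \<rho>_def by (intro has_order_mult has_order_power has_order_inverse p \<sigma> order_refl)
 then have "wint_bounded TYPE('n) p \<beta> \<beta>' \<rho>" by (rule has_order_wint_bounded) (use \<beta>' in auto)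
 then obtain C where C: "C > 0" and B: "\<And>u :: real ^ 'n \<Rightarrow> complex. mean_value u \<Longrightarrow> wint p \<beta>' (mult_op \<rho> u) \<le> ennreal C * wint p \<beta> u"
  and s\<rho>: "subexp \<rho>" by (meson wint_boundedE wint_bounded_subexp)
 note sN = subexp_real_power[of N]
 define d where "d = \<sigma> 0 - \<rho> 0 * real 0 ^ N"
 obtain I where I: "wint p \<beta>' (\<lambda>_ :: real ^ 'n. of_real d) = ennreal I" "I \<ge> 0"
  using wint_const_finite[OF \<beta>'(1), of p "of_real d", where 'n='n] by (cases "wint p \<beta>' (\<lambda>_ :: real ^ 'n. of_real d)") auto
 have "wint p \<beta>' (mult_op \<sigma> u) \<le> ennreal (C + I) * (ennreal (norm (u 0) powr p) + wint p \<beta> (mult_op (\<lambda>k. real k ^ N) u))"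
  if mv: "mean_value u" for u :: "real ^ 'n \<Rightarrow> complex"
 proof -
  let ?R = "mult_op (\<lambda>k. real k ^ N) u"
  have mR: "mean_value ?R" by (rule mult_op(1)[OF mv sN])
  have eq: "mult_op \<sigma> u x = mult_op \<rho> ?R x + u 0 * of_real d" if "x \<in> ball 0 1" for x
   using mult_op_change_0[OF mv subexp_mult[OF s\<rho> sN] that, of \<sigma>]
   unfolding mult_op_mult_op[OF mv sN] by (simp add: \<rho>_def d_def power_divide mult.commute)
  have "wint p \<beta>' (mult_op \<sigma> u) = wint p \<beta>' (\<lambda>x. mult_op \<rho> ?R x + u 0 * of_real d)"
   by (rule wint_cong) (simp add: eq)
  also have "\<dots> \<le> wint p \<beta>' (mult_op \<rho> ?R) + wint p \<beta>' (\<lambda>_ :: real ^ 'n. u 0 * of_real d)"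
   by (rule wint_add) (use p mean_value_cont[OF mult_op(1)[OF mR s\<rho>]] in auto)
  also have "wint p \<beta>' (\<lambda>_ :: real ^ 'n. u 0 * of_real d) = ennreal (norm (u 0) powr p) * ennreal I"
   using wint_cmult[of "\<lambda>_ :: real ^ 'n. of_real d" p \<beta>' "u 0"] unfolding I(1) by simp
  also have "wint p \<beta>' (mult_op \<rho> ?R) + ennreal (norm (u 0) powr p) * ennreal I \<le>
    ennreal (C + I) * wint p \<beta> ?R + ennreal (norm (u 0) powr p) * ennreal (C + I)"
  proof (rule add_mono)
   have "wint p \<beta>' (mult_op \<rho> ?R) \<le> ennreal C * wint p \<beta> ?R" by (rule B[OF mR])
   also have "\<dots> \<le> ennreal (C + I) * wint p \<beta> ?R" using I by (intro mult_right_mono ennreal_leI) auto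
   finally show "wint p \<beta>' (mult_op \<rho> ?R) \<le> ennreal (C + I) * wint p \<beta> ?R" .
  qed (use C in \<open>intro mult_left_mono ennreal_leI; simp\<close>)
  finally show ?thesis by (simp add: distrib_left mult.commute add.commute)
 qed
 then show ?thesis using C I by (intro exI[of _ "C + I"]) auto
qed

lemma radial_le_gamma_multiplier:
 fixes s t :: real
 assumes p: "0 < p" "p < 1" and \<beta>: "\<beta> > -1" "\<beta> = \<beta>' + p * (real N - t)"
 shows "\<exists>C>0. \<forall>u :: real ^ 'n \<Rightarrow> complex. mean_value u \<longrightarrow> wint p \<beta> (mult_op (\<lambda>k. real k ^ N) u) \<le>
  ennreal C * wint p \<beta>' (mult_op (\<lambda>k. gamma_coeff CARD('n) k (s + t) / gamma_coeff CARD('n) k s) u)"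
proof -
 let ?l = "\<lambda>k. gamma_coeff CARD('n) k (s + t) / gamma_coeff CARD('n) k s"
 let ?i = "\<lambda>k. gamma_coeff CARD('n) k (s + t + (- t)) / gamma_coeff CARD('n) k (s + t)"
 let ?m = "\<lambda>k. (1 * (real k + 0)) ^ N * ?i k"
 have "has_order TYPE('n) p (real N * 1 + (- t)) ?m"
  by (intro has_order_mult has_order_power has_order_affine has_order_gamma_ratio p)
 then have "wint_bounded TYPE('n) p \<beta>' \<beta> ?m" by (rule has_order_wint_bounded) (use \<beta> in auto)
 then obtain C where C: "C > 0" "\<And>u :: real ^ 'n \<Rightarrow> complex. mean_value u \<Longrightarrow> wint p \<beta> (mult_op ?m u) \<le> ennreal C * wint p \<beta>' u"
  by (rule wint_boundedE) (rule that)
 have sl: "subexp ?l" by (rule has_order_subexp[OF has_order_gamma_ratio[OF p]])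
 have e: "?m k * ?l k = real k ^ N" for k
  using gamma_coeff_pos[of k s, where 'n='n] gamma_coeff_pos[of k "s + t", where 'n='n] by simp
 have "wint p \<beta> (mult_op (\<lambda>k. real k ^ N) u) \<le> ennreal C * wint p \<beta>' (mult_op ?l u)" if mv: "mean_value u" for u :: "real ^ 'n \<Rightarrow> complex"
  using C(2)[OF mult_op(1)[OF mv sl]] unfolding mult_op_mult_op[OF mv sl] e .
 then show ?thesis using C(1) by blast
qed

lemma wint_iter_partial:
 assumes p: "0 < p" "p < 1"
 shows "\<exists>C>0. \<forall>u :: real ^ 'n \<Rightarrow> complex. mean_value u \<longrightarrow>
  wint p (\<beta> + p * real (length is)) (iter_partial is u) \<le> ennreal C * wint p \<beta> u"
proof (induction "is")
 case Nil
 show ?case by (intro exI[of _ 1]) simp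
next
 case (Cons i "is")
 obtain C where C: "C > 0" "\<And>u :: real ^ 'n \<Rightarrow> complex. mean_value u \<Longrightarrow>
  wint p (\<beta> + p * real (length is)) (iter_partial is u) \<le> ennreal C * wint p \<beta> u" using Cons by blast
 obtain D where D: "D > 0" "\<And>(u :: real ^ 'n \<Rightarrow> complex) i. mean_value u \<Longrightarrow>
  wint p (\<beta> + p * real (length is) + p) (partial_deriv i u) \<le> ennreal D * wint p (\<beta> + p * real (length is)) u"
  using wint_partial[OF p, where 'n='n] by blast
 have "wint p (\<beta> + p * real (length (i # is))) (iter_partial (i # is) u) \<le> ennreal (D * C) * wint p \<beta> u"
  if mv: "mean_value u" for u :: "real ^ 'n \<Rightarrow> complex"
  using ennreal_bound_trans[OF D(2)[OF mean_value_iter_partial[OF mv, of "is"], of i] C(2)[OF mv] D(1) C(1)]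
  by (simp add: algebra_simps)
 then show ?case using C(1) D(1) by (intro exI[of _ "D * C"]) auto
qed

text \<open>With \<open>N\<close> derivatives in front, \<open>\<R>\<^sup>N\<close> becomes the multiplier \<open>(k + N)\<^sup>N\<close>, which never vanishes for
 \<open>N > 0\<close>; its inverse lowers the order by \<open>N\<close>, which compensates for the \<open>N\<close> derivatives.\<close>

lemma iter_partial_le_radial:
 assumes p: "0 < p" "p < 1" and \<beta>: "\<beta> > -1"
 shows "\<exists>C>0. \<forall>u :: real ^ 'n \<Rightarrow> complex. mean_value u \<longrightarrow>
  wint p \<beta> (iter_partial is u) \<le> ennreal C * wint p \<beta> (mult_op (\<lambda>k. real k ^ length is) u)"
proof (cases "is")
 case Nil
 have "wint p \<beta> u = wint p \<beta> (mult_op (\<lambda>k. 1) u)" if "mean_value u" for u :: "real ^ 'n \<Rightarrow> complex"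
  by (rule wint_cong) (simp add: mult_op_one[OF that])
 then show ?thesis by (intro exI[of _ 1]) (simp add: Nil)
next
 case (Cons i js)
 let ?N = "length is"
 note sN = subexp_real_power[of ?N]
 let ?a = "\<lambda>k. (1 / (real k + real ?N)) ^ ?N"
 let ?b = "\<lambda>k. real (k + ?N) ^ ?N"
 have sb: "subexp ?b" using subexp_power[OF subexp_affine[of "real ?N"]] by simp
 have "has_order TYPE('n) p (real ?N * (-1)) ?a" by (intro has_order_power has_order_inverse p) simp
 then have "wint_bounded TYPE('n) p (\<beta> + p * real ?N) \<beta> ?a" by (rule has_order_wint_bounded) (use \<beta> in auto)
 then obtain C where C: "C > 0" "\<And>u :: real ^ 'n \<Rightarrow> complex. mean_value u \<Longrightarrow> wint p \<beta> (mult_op ?a u) \<le> ennreal C * wint p (\<beta> + p * real ?N) u"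
  by (rule wint_boundedE) (rule that)
 obtain D where D: "D > 0" "\<And>u :: real ^ 'n \<Rightarrow> complex. mean_value u \<Longrightarrow>
  wint p (\<beta> + p * real ?N) (iter_partial is u) \<le> ennreal D * wint p \<beta> u" using wint_iter_partial[OF p, where 'n='n] by blast
 have "(1 / y) ^ m * y ^ m = 1" if "y \<noteq> 0" for y :: real and m using that by (simp add: power_divide)
 then have ab: "?a k * ?b k = 1" for k unfolding of_nat_add using Cons by simp
 have "wint p \<beta> (iter_partial is u) \<le> ennreal (C * D) * wint p \<beta> (mult_op (\<lambda>k. real k ^ ?N) u)"
  if mv: "mean_value u" for u :: "real ^ 'n \<Rightarrow> complex"
 proof -
  let ?v = "iter_partial is u" and ?R = "mult_op (\<lambda>k. real k ^ ?N) u"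
  have mp: "mean_value ?v" by (rule mean_value_iter_partial[OF mv])
  have "wint p \<beta> ?v = wint p \<beta> (mult_op (\<lambda>k. 1) ?v)" by (rule wint_cong) (simp add: mult_op_one[OF mp])
  also have "\<dots> = wint p \<beta> (mult_op ?a (mult_op ?b ?v))" unfolding mult_op_mult_op[OF mp sb] ab ..
  also have "\<dots> \<le> ennreal C * wint p (\<beta> + p * real ?N) (mult_op ?b ?v)" by (rule C(2)[OF mult_op(1)[OF mp sb]])
  also have "wint p (\<beta> + p * real ?N) (mult_op ?b ?v) = wint p (\<beta> + p * real ?N) (iter_partial is ?R)"
   by (rule wint_cong) (simp add: iter_partial_mult_op[OF mv sN])
  also have "ennreal C * \<dots> \<le> ennreal C * (ennreal D * wint p \<beta> ?R)"
   by (intro mult_left_mono D(2) mult_op(1)[OF mv sN]) simp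
  finally show ?thesis using C D by (simp add: ennreal_mult mult.assoc)
 qed
 then show ?thesis using C D by (intro exI[of _ "C * D"]) auto
qed

text \<open>At the origin a derivative of order \<open>M\<close> of \<open>\<R>\<^sup>N u\<close> is \<open>M\<^sup>N\<close> times that of \<open>u\<close>.\<close>

lemma iter_partial_at_0_le_radial:
 assumes p: "0 < p" "p < 1" and len: "length is \<ge> 1"
 shows "\<exists>C>0. \<forall>u :: real ^ 'n \<Rightarrow> complex. mean_value u \<longrightarrow>
  ennreal (norm (iter_partial is u 0) powr p) \<le> ennreal C * wint p \<beta> (mult_op (\<lambda>k. real k ^ N) u)"
proof -
 let ?M = "length is"
 note sN = subexp_real_power[of N]
 have sb: "subexp (\<lambda>k. real (k + ?M) ^ N)" using subexp_power[OF subexp_affine[of "real ?M"]] by simp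
 obtain C where C: "C > 0" "\<And>u :: real ^ 'n \<Rightarrow> complex. mean_value u \<Longrightarrow> ennreal (norm (u 0) powr p) \<le> ennreal C * wint p (\<beta> + p * real ?M) u"
  using point_evaluation_bound[OF p, where 'n='n] by blast
 obtain D where D: "D > 0" "\<And>u :: real ^ 'n \<Rightarrow> complex. mean_value u \<Longrightarrow>
  wint p (\<beta> + p * real ?M) (iter_partial is u) \<le> ennreal D * wint p \<beta> u" using wint_iter_partial[OF p, where 'n='n] by blast
 have "ennreal (norm (iter_partial is u 0) powr p) \<le> ennreal (C * D) * wint p \<beta> (mult_op (\<lambda>k. real k ^ N) u)"
  if mv: "mean_value u" for u :: "real ^ 'n \<Rightarrow> complex"
 proof -
  let ?v = "iter_partial is u" and ?R = "mult_op (\<lambda>k. real k ^ N) u"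
  have mp: "mean_value ?v" by (rule mean_value_iter_partial[OF mv])
  have mR: "mean_value ?R" by (rule mult_op(1)[OF mv sN])
  have "iter_partial is ?R 0 = of_real (real ?M ^ N) * ?v 0"
   using iter_partial_mult_op[OF mv sN, of 0 "is"] unfolding mult_op_at_0[OF mp sb] by simp
  then have "norm (iter_partial is ?R 0) = real ?M ^ N * norm (?v 0)" by (simp add: norm_mult norm_power)
  moreover have "real ?M ^ N \<ge> 1" using len by (intro one_le_power) simp
  ultimately have "norm (?v 0) \<le> norm (iter_partial is ?R 0)" using mult_right_mono[of 1 "real ?M ^ N" "norm (?v 0)"] by simp
  then have "ennreal (norm (?v 0) powr p) \<le> ennreal (norm (iter_partial is ?R 0) powr p)"
   using p by (intro ennreal_leI powr_mono2) auto
  from order_trans[OF this C(2)[OF mean_value_iter_partial[OF mR]]] D(2)[OF mR] C(1) D(1)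
  show ?thesis by (rule ennreal_bound_trans)
 qed
 then show ?thesis using C D by (intro exI[of _ "C * D"]) auto
qed

lemma iter_partial_snoc: "iter_partial (is @ [i]) u = iter_partial is (partial_deriv i u)"
 by (simp add: iter_partial_def)

text \<open>Induction on \<open>N\<close>: \<open>\<R>\<^sup>N\<^sup>+\<^sup>1 u\<close> is bounded by the \<open>\<partial>\<^sub>i \<R>\<^sup>N u = (\<R> + 1)\<^sup>N \<partial>\<^sub>i u\<close>, and
 \<open>(\<R> + 1)\<^sup>N\<close> by \<open>\<R>\<^sup>N\<close> and the value at the origin. The bound \<open>A\<close> stands for the sum of all the
 quantities on the right-hand side, which avoids reindexing it in the induction.\<close>

lemma radial_le_iter_partials:
 assumes p: "0 < p" "p < 1" and \<beta>: "\<beta> > -1"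
 shows "\<exists>C>0. \<forall>(u :: real ^ 'n \<Rightarrow> complex) A. mean_value u \<longrightarrow>
  (\<forall>is. length is < N \<longrightarrow> ennreal (norm (iter_partial is u 0) powr p) \<le> A) \<longrightarrow>
  (\<forall>is. length is = N \<longrightarrow> wint p \<beta> (iter_partial is u) \<le> A) \<longrightarrow>
  ennreal (norm (u 0) powr p) \<le> ennreal C * A \<and> wint p \<beta> (mult_op (\<lambda>k. real k ^ N) u) \<le> ennreal C * A"
proof (induction N)
 case 0
 obtain C where C: "C > 0" "\<And>u :: real ^ 'n \<Rightarrow> complex. mean_value u \<Longrightarrow> ennreal (norm (u 0) powr p) \<le> ennreal C * wint p \<beta> u"
  using point_evaluation_bound[OF p, where 'n='n] by blast
 have "ennreal (norm (u 0) powr p) \<le> ennreal (C + 1) * A \<and> wint p \<beta> (mult_op (\<lambda>k. real k ^ 0) u) \<le> ennreal (C + 1) * A"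
  if mv: "mean_value u" and A: "\<forall>is. length is = 0 \<longrightarrow> wint p \<beta> (iter_partial is u) \<le> A" for u :: "real ^ 'n \<Rightarrow> complex" and A
 proof -
  have 1: "wint p \<beta> u \<le> A" using A[rule_format, of "[]"] by simp
  have 2: "wint p \<beta> (mult_op (\<lambda>k. real k ^ 0) u) = wint p \<beta> u" by (rule wint_cong) (simp add: mult_op_one[OF mv])
  have "ennreal (norm (u 0) powr p) \<le> ennreal C * A" using order_trans[OF C(2)[OF mv] mult_left_mono[OF 1]] by simp
  also have "\<dots> \<le> ennreal (C + 1) * A" by (intro mult_right_mono ennreal_leI) auto
  finally have 3: "ennreal (norm (u 0) powr p) \<le> ennreal (C + 1) * A" .
  have "ennreal 1 * A \<le> ennreal (C + 1) * A" using C by (intro mult_right_mono ennreal_leI) auto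
  then show ?thesis using 1 2 3 by simp
 qed
 then show ?case using C(1) by (intro exI[of _ "C + 1"]) auto
next
 case (Suc N)
 then obtain C where C: "C > 0" and IH: "\<And>(u :: real ^ 'n \<Rightarrow> complex) A. mean_value u \<Longrightarrow>
  (\<forall>is. length is < N \<longrightarrow> ennreal (norm (iter_partial is u 0) powr p) \<le> A) \<Longrightarrow>
  (\<forall>is. length is = N \<longrightarrow> wint p \<beta> (iter_partial is u) \<le> A) \<Longrightarrow>
  ennreal (norm (u 0) powr p) \<le> ennreal C * A \<and> wint p \<beta> (mult_op (\<lambda>k. real k ^ N) u) \<le> ennreal C * A" by blast
 have o: "has_order TYPE('n) p (real N * 1) (\<lambda>k. (1 * (real k + 1)) ^ N)" by (intro has_order_power has_order_affine p)
 obtain D where D: "D > 0" and M: "\<And>u :: real ^ 'n \<Rightarrow> complex. mean_value u \<Longrightarrow> wint p \<beta> (mult_op (\<lambda>k. (1 * (real k + 1)) ^ N) u) \<le>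
  ennreal D * (ennreal (norm (u 0) powr p) + wint p \<beta> (mult_op (\<lambda>k. real k ^ N) u))"
  using multiplier_le_radial[OF p o \<beta>, of \<beta> N] by auto
 note sN = subexp_real_power[of N]
 have s1: "subexp real" using subexp_affine[of 0] by simp
 define K where "K = real CARD('n) * (D * (2 * C))"
 have "ennreal (norm (u 0) powr p) \<le> ennreal (K + 1) * A \<and> wint p \<beta> (mult_op (\<lambda>k. real k ^ Suc N) u) \<le> ennreal (K + 1) * A"
  if mv: "mean_value u" and A0: "\<forall>is. length is < Suc N \<longrightarrow> ennreal (norm (iter_partial is u 0) powr p) \<le> A"
   and A1: "\<forall>is. length is = Suc N \<longrightarrow> wint p \<beta> (iter_partial is u) \<le> A" for u :: "real ^ 'n \<Rightarrow> complex" and A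
 proof
  have "ennreal (norm (u 0) powr p) \<le> A" using A0[rule_format, of "[]"] by simp
  also have "A = ennreal 1 * A" by simp
  also have "\<dots> \<le> ennreal (K + 1) * A" unfolding K_def using C D by (intro mult_right_mono ennreal_leI) auto
  finally show "ennreal (norm (u 0) powr p) \<le> ennreal (K + 1) * A" .
  have mR: "mean_value (mult_op (\<lambda>k. real k ^ N) u)" by (rule mult_op(1)[OF mv sN])
  have "wint p \<beta> (mult_op (\<lambda>k. real k ^ Suc N) u) = wint p \<beta> (mult_op real (mult_op (\<lambda>k. real k ^ N) u))"
   unfolding mult_op_mult_op[OF mv sN] by simp
  also have "\<dots> \<le> (\<Sum>i\<in>UNIV. wint p \<beta> (partial_deriv i (mult_op (\<lambda>k. real k ^ N) u)))"
   by (rule wint_radial_deriv[OF _ _ mR]) (use p in auto)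
  also have "\<dots> \<le> (\<Sum>i\<in>(UNIV :: 'n set). ennreal (D * (2 * C)) * A)"
  proof (rule sum_mono)
   fix i
   have mi: "mean_value (partial_deriv i u)" by (rule mean_value_partial[OF mv])
   have "ennreal (norm (partial_deriv i u 0) powr p) \<le> ennreal C * A \<and> wint p \<beta> (mult_op (\<lambda>k. real k ^ N) (partial_deriv i u)) \<le> ennreal C * A"
   proof (rule IH[OF mi]; intro allI impI)
    fix "is" :: "'n list"
    show "ennreal (norm (iter_partial is (partial_deriv i u) 0) powr p) \<le> A" if "length is < N"
     using A0[rule_format, of "is @ [i]"] that by (simp add: iter_partial_snoc)
    show "wint p \<beta> (iter_partial is (partial_deriv i u)) \<le> A" if "length is = N"
     using A1[rule_format, of "is @ [i]"] that by (simp add: iter_partial_snoc)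
   qed
   then have le: "ennreal (norm (partial_deriv i u 0) powr p) + wint p \<beta> (mult_op (\<lambda>k. real k ^ N) (partial_deriv i u)) \<le> ennreal C * A + ennreal C * A"
    by (intro add_mono) auto
   have "wint p \<beta> (partial_deriv i (mult_op (\<lambda>k. real k ^ N) u)) = wint p \<beta> (mult_op (\<lambda>k. (1 * (real k + 1)) ^ N) (partial_deriv i u))"
    by (rule wint_cong) (use iter_partial_mult_op[OF mv sN, of _ "[i]"] in \<open>simp add: add.commute\<close>)
   also have "\<dots> \<le> ennreal D * (ennreal C * A + ennreal C * A)"
    by (rule order_trans[OF M[OF mi] mult_left_mono[OF le]]) simp
   also have "\<dots> = ennreal (D * (2 * C)) * A" using C D by (simp add: ennreal_mult mult.assoc flip: mult_2)
   finally show "wint p \<beta> (partial_deriv i (mult_op (\<lambda>k. real k ^ N) u)) \<le> ennreal (D * (2 * C)) * A" .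
  qed
  also have "\<dots> = ennreal K * A"
   unfolding K_def using C D by (simp add: ennreal_mult ennreal_of_nat_eq_real_of_nat mult.assoc)
  also have "\<dots> \<le> ennreal (K + 1) * A" by (intro mult_right_mono ennreal_leI) auto
  finally show "wint p \<beta> (mult_op (\<lambda>k. real k ^ Suc N) u) \<le> ennreal (K + 1) * A" .
 qed
 moreover have "K + 1 > 0" unfolding K_def using C D by (simp add: add_nonneg_pos)
 ultimately show ?case by (intro exI[of _ "K + 1"]) blast
qed

section \<open>Multi-indices and lists of coordinates\<close>

definition mi_list :: "('n::{finite,linorder} \<Rightarrow> nat) \<Rightarrow> 'n list" where
 "mi_list m = concat (map (\<lambda>i. replicate (m i) i) (sorted_list_of_set UNIV))"

lemma foldr_partial_deriv_replicate: "foldr partial_deriv (replicate k i) f = (partial_deriv i ^^ k) f"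
 by (induction k) auto

lemma mi_deriv_iter_partial: "mi_deriv m u = iter_partial (mi_list m) u"
proof -
 have "foldr (\<lambda>i f. (partial_deriv i ^^ m i) f) L u = foldr partial_deriv (concat (map (\<lambda>i. replicate (m i) i) L)) u" for L
  by (induction L) (simp_all add: foldr_append foldr_partial_deriv_replicate)
 then show ?thesis by (simp add: mi_deriv_def iter_partial_def mi_list_def)
qed

lemma length_mi_list: "length (mi_list m) = mi_size m"
proof -
 have "length (mi_list m) = sum_list (map m (sorted_list_of_set UNIV))"
  by (simp add: mi_list_def length_concat comp_def)
 also have "\<dots> = sum m (set (sorted_list_of_set UNIV))" by (rule sum_list_distinct_conv_sum_set) simp
 finally show ?thesis by (simp add: mi_size_def)
qed

lemma mset_mi_list: "mset (mi_list (count_list xs)) = mset xs"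
proof -
 have "distinct L \<Longrightarrow> count (mset (concat (map (\<lambda>i. replicate (m i) i) L))) j = (if j \<in> set L then m j else 0)"
  for L :: "'a list" and m j by (induction L) auto
 from this[OF distinct_sorted_list_of_set]
 have "count (mset (mi_list (count_list xs))) j = count_list xs j" for j by (simp add: mi_list_def)
 then show ?thesis by (intro multiset_eqI) (simp add: count_mset)
qed

lemma iter_partial_move:
 assumes mv: "mean_value u" and x: "x \<in> ball 0 1"
 shows "iter_partial (ys @ i # zs) u x = iter_partial (i # ys @ zs) u x"
 using x
proof (induction ys arbitrary: x)
 case (Cons j ys)
 have "iter_partial ((j # ys) @ i # zs) u x = partial_deriv j (iter_partial (i # ys @ zs) u) x"
  using partial_deriv_cong[OF open_ball Cons.prems Cons.IH] by simp
 also have "\<dots> = partial_deriv i (partial_deriv j (iter_partial (ys @ zs) u)) x"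
  using mean_value_mixed_partials[OF mean_value_iter_partial[OF mv] Cons.prems] by simp
 finally show ?case by simp
qed simp

text \<open>Mixed partial derivatives commute, so an iterated derivative depends only on the multiset of its
 directions.\<close>

lemma iter_partial_perm:
 assumes mv: "mean_value u" and "mset xs = mset ys" and x: "x \<in> ball 0 1"
 shows "iter_partial xs u x = iter_partial ys u x"
 using assms(2) x
proof (induction xs arbitrary: ys x)
 case (Cons i xs)
 then have "i \<in> set ys" by (metis list.set_intros(1) set_mset_mset)
 then obtain as bs where ys: "ys = as @ i # bs" by (meson split_list)
 then have "mset xs = mset (as @ bs)" using Cons.prems(1) by simp
 from partial_deriv_cong[OF open_ball Cons.prems(2) Cons.IH[OF this]]
 have "iter_partial (i # xs) u x = iter_partial (i # as @ bs) u x" by simp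
 then show ?case unfolding ys iter_partial_move[OF mv Cons.prems(2)] .
qed simp

lemma iter_partial_eq_mi_deriv:
 assumes "mean_value u" "x \<in> ball 0 1"
 shows "iter_partial is u x = mi_deriv (count_list is) u x"
 unfolding mi_deriv_iter_partial by (rule iter_partial_perm[OF assms(1) mset_mi_list[symmetric] assms(2)])

lemma mi_size_count_list:
 fixes "is" :: "'n::{finite,linorder} list"
 shows "mi_size (count_list is) = length is"
 using length_mi_list[of "count_list is"] arg_cong[OF mset_mi_list[of "is"], of size] by simp

section \<open>Weighted norms\<close>

definition root_ennreal :: "real \<Rightarrow> ennreal \<Rightarrow> ennreal" where
 "root_ennreal p I = (if I = \<infinity> then \<infinity> else ennreal (enn2real I powr (1 / p)))"

lemma root_ennreal_ennreal: "a \<ge> 0 \<Longrightarrow> root_ennreal p (ennreal a) = ennreal (a powr (1 / p))"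
 by (simp add: root_ennreal_def)

lemma root_ennreal_powr: "p > 0 \<Longrightarrow> a \<ge> 0 \<Longrightarrow> root_ennreal p (ennreal (a powr p)) = ennreal a"
 by (simp add: root_ennreal_ennreal powr_powr)

lemma root_ennreal_mono:
 assumes "p > 0" "x \<le> y"
 shows "root_ennreal p x \<le> root_ennreal p y"
proof (cases "y = \<infinity>")
 case False
 then obtain b where b: "y = ennreal b" "b \<ge> 0" by (cases y) auto
 with assms(2) obtain a where a: "x = ennreal a" "a \<ge> 0" by (cases x) (auto simp: top_unique)
 show ?thesis using assms a b by (auto simp: root_ennreal_ennreal intro!: ennreal_leI powr_mono2)
qed (simp add: root_ennreal_def)

lemma root_ennreal_cmult:
 assumes "C > 0"
 shows "root_ennreal p (ennreal C * x) = ennreal (C powr (1 / p)) * root_ennreal p x"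
proof (cases x)
 case (real a)
 then have "root_ennreal p (ennreal C * x) = ennreal ((C * a) powr (1 / p))"
  using assms by (simp add: ennreal_mult[symmetric] root_ennreal_ennreal)
 also have "(C * a) powr (1 / p) = C powr (1 / p) * a powr (1 / p)" by (rule powr_mult; use assms real in simp)
 finally show ?thesis using real by (simp add: root_ennreal_ennreal ennreal_mult)
qed (use assms in \<open>auto simp: root_ennreal_def ennreal_mult_top\<close>)

text \<open>For \<open>p < 1\<close> the root is not subadditive; comparison with the maximum costs a constant.\<close>

lemma root_ennreal_add_le:
 assumes p: "p > 0"
 shows "root_ennreal p (x + y) \<le> ennreal (2 powr (1 / p)) * (root_ennreal p x + root_ennreal p y)"
proof -
 have "x + y \<le> ennreal 2 * max x y" by (auto simp: max_def mult_2 intro!: add_mono)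
 then have "root_ennreal p (x + y) \<le> ennreal (2 powr (1 / p)) * root_ennreal p (max x y)"
  using root_ennreal_mono[OF p] root_ennreal_cmult[of 2] by (metis zero_less_numeral)
 also have "root_ennreal p (max x y) \<le> root_ennreal p x + root_ennreal p y" by (auto simp: max_def)
 finally show ?thesis by (simp add: mult_left_mono)
qed

lemma root_ennreal_le_imp:
 assumes p: "p > 0" and a: "a \<ge> 0" and le: "root_ennreal p x \<le> ennreal a"
 shows "x \<le> ennreal (a powr p)"
proof (cases x)
 case (real b)
 then have "b powr (1 / p) \<le> a" using le a by (simp add: root_ennreal_ennreal)
 then have "(b powr (1 / p)) powr p \<le> a powr p" using p by (intro powr_mono2) auto
 then show ?thesis using real p by (simp add: powr_powr)
qed (use le in \<open>simp add: root_ennreal_def top_unique\<close>)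

lemma Lp_norm_root: "Lp_norm p \<alpha> f = root_ennreal p (\<integral>\<^sup>+ x. ennreal (norm (f x) powr p) \<partial>nu_weighted \<alpha>)"
 by (simp add: Lp_norm_def root_ennreal_def Let_def)

abbreviation "unit_ball_volume \<equiv> (\<lambda>_ :: 'n::finite itself. measure lborel (ball 0 1 :: (real ^ 'n) set))"

lemma nn_integral_nu:
 fixes G :: "real ^ 'n \<Rightarrow> ennreal"
 assumes G: "G \<in> borel_measurable (lebesgue_on (ball 0 1))"
 shows "(\<integral>\<^sup>+x. G x \<partial>nu) = (\<integral>\<^sup>+x. G x * indicator (ball 0 1) x \<partial>lborel) / ennreal (unit_ball_volume TYPE('n))"
proof -
 have b: "ball 0 1 \<in> sets (lebesgue_on (ball 0 1 :: (real ^ 'n) set))" by (simp add: sets_restrict_space_iff)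
 have "(\<integral>\<^sup>+x. G x \<partial>nu) = (\<integral>\<^sup>+x. G x * indicator (ball 0 1) x \<partial>lebesgue_on (ball 0 1)) / emeasure (lebesgue_on (ball 0 1)) (ball 0 1 :: (real ^ 'n) set)"
  unfolding nu_def by (rule nn_integral_uniform_measure[OF G b])
 also have "emeasure (lebesgue_on (ball 0 1)) (ball 0 1 :: (real ^ 'n) set) = emeasure lborel (ball 0 1 :: (real ^ 'n) set)"
  by (subst emeasure_restrict_space) auto
 also have "\<dots> = ennreal (unit_ball_volume TYPE('n))"
  using emeasure_lborel_ball_finite[of "0 :: real ^ 'n" 1] by (intro emeasure_eq_ennreal_measure) auto
 also have "(\<integral>\<^sup>+x. G x * indicator (ball 0 1) x \<partial>lebesgue_on (ball 0 1)) = (\<integral>\<^sup>+x. G x * indicator (ball 0 1) x * indicator (ball 0 1) x \<partial>lebesgue)"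
  by (rule nn_integral_restrict_space) simp
 also have "\<dots> = (\<integral>\<^sup>+x. G x * indicator (ball 0 1) x * indicator (ball 0 1) x \<partial>lborel)" by (rule nn_integral_completion)
 also have "\<dots> = (\<integral>\<^sup>+x. G x * indicator (ball 0 1) x \<partial>lborel)" by (rule nn_integral_cong) (simp add: indicator_def)
 finally show ?thesis .
qed

lemma one_minus_norm_square:
 fixes x :: "real ^ 'n"
 assumes "norm x < 1"
 shows "1 - (norm x)\<^sup>2 > 0" "1 - norm x \<le> 1 - (norm x)\<^sup>2" "1 - (norm x)\<^sup>2 \<le> 2 * (1 - norm x)"
proof -
 have e: "1 - (norm x)\<^sup>2 = (1 - norm x) * (1 + norm x)" by (simp add: power2_eq_square algebra_simps)
 have "(1 - norm x) * 1 \<le> (1 - norm x) * (1 + norm x)" by (rule mult_left_mono) (use assms in auto)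
 then show "1 - norm x \<le> 1 - (norm x)\<^sup>2" unfolding e by simp
 have "(1 - norm x) * (1 + norm x) \<le> (1 - norm x) * 2" by (rule mult_left_mono) (use assms in auto)
 then show "1 - (norm x)\<^sup>2 \<le> 2 * (1 - norm x)" unfolding e by (simp only: mult.commute)
 from \<open>1 - norm x \<le> 1 - (norm x)\<^sup>2\<close> show "1 - (norm x)\<^sup>2 > 0" using assms by linarith
qed

text \<open>The weight \<open>1 - |x|\<^sup>2\<close> of the norms in place of \<open>1 - |x|\<close>; on the ball the two are comparable.\<close>

definition square_wint :: "real \<Rightarrow> real \<Rightarrow> (real ^ 'n \<Rightarrow> complex) \<Rightarrow> ennreal" where
 "square_wint p \<beta> f = (\<integral>\<^sup>+x. absp p f x * ennreal ((1 - (norm x)\<^sup>2) powr \<beta>) \<partial>lborel)"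

lemma square_wint_comparable:
 fixes f :: "real ^ 'n \<Rightarrow> complex"
 assumes f: "continuous_on (ball 0 1) f"
 shows "square_wint p \<beta> f \<le> ennreal (4 powr \<bar>\<beta>\<bar>) * wint p \<beta> f" "wint p \<beta> f \<le> ennreal (4 powr \<bar>\<beta>\<bar>) * square_wint p \<beta> f"
proof -
 note [measurable] = absp_measurable[OF f]
 have c: "(\<integral>\<^sup>+x. absp p f x * ennreal (w x) \<partial>lborel) \<le> ennreal (4 powr \<bar>\<beta>\<bar>) * (\<integral>\<^sup>+x. absp p f x * ennreal (v x) \<partial>lborel)"
  if [measurable]: "v \<in> borel_measurable borel" and le: "\<And>x. norm x < 1 \<Longrightarrow> w x \<le> 4 powr \<bar>\<beta>\<bar> * v x" and v: "\<And>x. v x \<ge> 0" for v w :: "real ^ 'n \<Rightarrow> real"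
 proof -
  have "(\<integral>\<^sup>+x. absp p f x * ennreal (w x) \<partial>lborel) \<le> (\<integral>\<^sup>+x. ennreal (4 powr \<bar>\<beta>\<bar>) * (absp p f x * ennreal (v x)) \<partial>lborel)"
  proof (rule nn_integral_mono)
   fix x :: "real ^ 'n"
   show "absp p f x * ennreal (w x) \<le> ennreal (4 powr \<bar>\<beta>\<bar>) * (absp p f x * ennreal (v x))"
   proof (cases "norm x < 1")
    case True
    have "absp p f x * ennreal (w x) \<le> absp p f x * ennreal (4 powr \<bar>\<beta>\<bar> * v x)" by (intro mult_left_mono ennreal_leI le True) simp
    then show ?thesis using v by (simp add: ennreal_mult mult_ac)
   qed (simp add: absp_def)
  qed
  also have "\<dots> = ennreal (4 powr \<bar>\<beta>\<bar>) * (\<integral>\<^sup>+x. absp p f x * ennreal (v x) \<partial>lborel)" by (rule nn_integral_cmult) measurable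
  finally show ?thesis .
 qed
 show "square_wint p \<beta> f \<le> ennreal (4 powr \<bar>\<beta>\<bar>) * wint p \<beta> f"
  unfolding square_wint_def wint_def
 proof (rule c)
  fix x :: "real ^ 'n" assume x: "norm x < 1"
  show "(1 - (norm x)\<^sup>2) powr \<beta> \<le> 4 powr \<bar>\<beta>\<bar> * (1 - norm x) powr \<beta>"
   by (rule powr_comparable) (use one_minus_norm_square[OF x] x in auto)
 next
  show "(\<lambda>x :: real ^ 'n. (1 - norm x) powr \<beta>) \<in> borel_measurable borel" by measurable
 qed simp
 show "wint p \<beta> f \<le> ennreal (4 powr \<bar>\<beta>\<bar>) * square_wint p \<beta> f"
  unfolding square_wint_def wint_def
 proof (rule c)
  fix x :: "real ^ 'n" assume x: "norm x < 1"
  show "(1 - norm x) powr \<beta> \<le> 4 powr \<bar>\<beta>\<bar> * (1 - (norm x)\<^sup>2) powr \<beta>"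
   by (rule powr_comparable) (use one_minus_norm_square[OF x] x in auto)
 next
  show "(\<lambda>x :: real ^ 'n. (1 - (norm x)\<^sup>2) powr \<beta>) \<in> borel_measurable borel" by measurable
 qed simp
qed

lemma unit_ball_volume_pos: "unit_ball_volume TYPE('n::finite) > 0"
 using content_ball_pos[of 1 "0 :: real ^ 'n"] by simp

lemma weight_continuous: "continuous_on (ball 0 1) (\<lambda>x :: real ^ 'n. (1 - (norm x)\<^sup>2) powr t)"
 using one_minus_norm_square(1) by (intro continuous_intros) fastforce

lemma weight_measurable: "(\<lambda>x :: real ^ 'n. (1 - (norm x)\<^sup>2) powr t) \<in> borel_measurable (lebesgue_on (ball 0 1))"
 by (rule continuous_imp_measurable_on_sets_lebesgue[OF weight_continuous]) simp

text \<open>For \<open>\<alpha> > -1\<close> the normalizing integral must be seen to be finite, as otherwise the Bochner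
 integral would be \<open>0\<close>; it is positive by point evaluation of the constant \<open>1\<close>.\<close>

lemma V_const_pos: "V_const TYPE('n::finite) \<alpha> > 0"
proof (cases "\<alpha> > -1")
 case True
 let ?w = "\<lambda>x :: real ^ 'n. (1 - (norm x)\<^sup>2) powr \<alpha>"
 let ?one = "\<lambda>_ :: real ^ 'n. 1 :: complex"
 let ?v = "unit_ball_volume TYPE('n)"
 have "(\<integral>\<^sup>+x. ennreal (?w x) \<partial>nu) = (\<integral>\<^sup>+x. ennreal (?w x) * indicator (ball 0 1) x \<partial>lborel) / ennreal ?v"
  by (rule nn_integral_nu) (use weight_measurable in measurable)
 also have "(\<integral>\<^sup>+x. ennreal (?w x) * indicator (ball 0 1) x \<partial>lborel) = square_wint (1/2) \<alpha> ?one"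
  unfolding square_wint_def by (rule nn_integral_cong) (simp add: absp_def mult.commute)
 finally have I: "(\<integral>\<^sup>+x. ennreal (?w x) \<partial>nu) = square_wint (1/2) \<alpha> ?one / ennreal ?v" .
 have "square_wint (1/2) \<alpha> ?one \<le> ennreal (4 powr \<bar>\<alpha>\<bar>) * wint (1/2) \<alpha> ?one" by (rule square_wint_comparable) simp
 also have "\<dots> < \<infinity>" using wint_const_finite[OF True, of "1/2" 1, where 'n='n] by (simp add: ennreal_mult_less_top)
 finally obtain a where a: "square_wint (1/2) \<alpha> ?one = ennreal a" "a \<ge> 0" by (cases "square_wint (1/2) \<alpha> ?one") auto
 obtain C where C: "C > 0" "\<And>u :: real ^ 'n \<Rightarrow> complex. mean_value u \<Longrightarrow> ennreal (norm (u 0) powr (1/2)) \<le> ennreal C * wint (1/2) \<alpha> u"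
  using point_evaluation_bound[of "1/2" \<alpha>, where 'n='n] by auto
 have "1 \<le> ennreal C * wint (1/2) \<alpha> ?one" using C(2)[OF mean_value_const, of 1] by simp
 moreover have "wint (1/2) \<alpha> ?one \<le> ennreal (4 powr \<bar>\<alpha>\<bar>) * ennreal a"
  unfolding a(1)[symmetric] by (rule square_wint_comparable) simp
 ultimately have "a \<noteq> 0" by auto
 then have "a > 0" using a by simp
 have "V_const TYPE('n) \<alpha> = integral\<^sup>L nu ?w" using True by (simp add: V_const_def)
 also have "\<dots> = enn2real (\<integral>\<^sup>+x. ennreal (?w x) \<partial>nu)"
  by (rule integral_eq_nn_integral) (use weight_measurable in \<open>auto simp: nu_def cong: measurable_cong_sets\<close>)
 also have "\<dots> = a / ?v" unfolding I a(1) using a \<open>a > 0\<close> unit_ball_volume_pos[where 'n='n] by (simp add: divide_ennreal)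
 finally show ?thesis using \<open>a > 0\<close> unit_ball_volume_pos[where 'n='n] by simp
qed (simp add: V_const_def)

lemma sets_nu_weighted: "sets (nu_weighted \<alpha>) = sets (lebesgue_on (ball 0 1))"
 by (simp add: nu_weighted_def nu_def)

lemma weighted_measurable:
 assumes f: "continuous_on (ball 0 1) f"
 shows "weighted t f \<in> borel_measurable (lebesgue_on (ball 0 1))"
proof (rule continuous_imp_measurable_on_sets_lebesgue)
 show "continuous_on (ball 0 1) (weighted t f)"
  unfolding weighted_def[abs_def] by (intro continuous_on_mult continuous_on_of_real weight_continuous f)
qed simp

text \<open>The weight \<open>(1 - |x|\<^sup>2)\<^sup>t\<close> of the function becomes \<open>(1 - |x|\<^sup>2)\<^sup>p\<^sup>t\<close> in the integral and merges
 with the weight of the measure.\<close>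

lemma nn_integral_nu_weighted:
 fixes f :: "real ^ 'n \<Rightarrow> complex"
 assumes f: "continuous_on (ball 0 1) f"
 shows "(\<integral>\<^sup>+x. ennreal (norm (weighted t f x) powr p) \<partial>nu_weighted \<alpha>) =
  ennreal (1 / (V_const TYPE('n) \<alpha> * unit_ball_volume TYPE('n))) * square_wint p (\<alpha> + p * t) f"
proof -
 let ?V = "V_const TYPE('n) \<alpha>" and ?v = "unit_ball_volume TYPE('n)"
 let ?d = "\<lambda>x :: real ^ 'n. ennreal ((1 - (norm x)\<^sup>2) powr \<alpha> / ?V)"
 let ?g = "\<lambda>x. ennreal (norm (weighted t f x) powr p)"
 have V: "?V > 0" and v: "?v > 0" by (rule V_const_pos, rule unit_ball_volume_pos)
 note [measurable] = weighted_measurable[OF f] weight_measurable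
 have d: "?d \<in> borel_measurable (lebesgue_on (ball 0 1))" by measurable
 have g: "?g \<in> borel_measurable (lebesgue_on (ball 0 1))" by measurable
 have s: "sets nu = sets (lebesgue_on (ball 0 1 :: (real ^ 'n) set))" by (simp add: nu_def)
 have "(\<integral>\<^sup>+x. ?g x \<partial>nu_weighted \<alpha>) = (\<integral>\<^sup>+x. ?d x * ?g x \<partial>nu)"
  unfolding nu_weighted_def by (rule nn_integral_density) (use d g in \<open>simp_all cong: measurable_cong_sets add: measurable_cong_sets[OF s refl]\<close>)
 also have "\<dots> = (\<integral>\<^sup>+x. ?d x * ?g x * indicator (ball 0 1) x \<partial>lborel) / ennreal ?v"
  by (rule nn_integral_nu) (use d g in measurable)
 also have "(\<integral>\<^sup>+x. ?d x * ?g x * indicator (ball 0 1) x \<partial>lborel) =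
  (\<integral>\<^sup>+x. ennreal (1 / ?V) * (absp p f x * ennreal ((1 - (norm x)\<^sup>2) powr (\<alpha> + p * t))) \<partial>lborel)"
 proof (rule nn_integral_cong)
  fix x :: "real ^ 'n"
  show "?d x * ?g x * indicator (ball 0 1) x = ennreal (1 / ?V) * (absp p f x * ennreal ((1 - (norm x)\<^sup>2) powr (\<alpha> + p * t)))"
  proof (cases "norm x < 1")
   case True
   let ?q = "1 - (norm x)\<^sup>2"
   have "norm (weighted t f x) powr p = (?q powr t * norm (f x)) powr p" by (simp add: weighted_def norm_mult)
   also have "\<dots> = (?q powr t) powr p * norm (f x) powr p" by (rule powr_mult; simp)
   finally have "?q powr \<alpha> / ?V * norm (weighted t f x) powr p = 1 / ?V * (norm (f x) powr p * ?q powr (\<alpha> + p * t))"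
    by (simp add: powr_powr powr_add mult.commute)
   then have "ennreal (?q powr \<alpha> / ?V * norm (weighted t f x) powr p) = ennreal (1 / ?V * (norm (f x) powr p * ?q powr (\<alpha> + p * t)))" by (rule arg_cong)
   then have "?d x * ?g x = ennreal (1 / ?V) * (ennreal (norm (f x) powr p) * ennreal (?q powr (\<alpha> + p * t)))"
    by (subst (asm) ennreal_mult, use V in simp, simp, subst (asm) ennreal_mult, use V in simp, simp, subst (asm) ennreal_mult, simp, simp)
   then show ?thesis using True by (simp add: absp_def)
  qed (simp add: absp_def)
 qed
 also have "\<dots> = ennreal (1 / ?V) * square_wint p (\<alpha> + p * t) f"
  unfolding square_wint_def
 proof (rule nn_integral_cmult)
  note [measurable] = absp_measurable[OF f]
  show "(\<lambda>x. absp p f x * ennreal ((1 - (norm x)\<^sup>2) powr (\<alpha> + p * t))) \<in> borel_measurable lborel" by measurable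
 qed
 also have "ennreal (1 / ?V) * square_wint p (\<alpha> + p * t) f / ennreal ?v = ennreal (1 / (?V * ?v)) * square_wint p (\<alpha> + p * t) f"
 proof -
  have "ennreal (1 / (?V * ?v)) = ennreal (1 / ?V) * inverse (ennreal ?v)"
   using V v by (simp add: inverse_ennreal ennreal_mult[symmetric] divide_inverse)
  then show ?thesis by (simp add: divide_ennreal_def mult_ac)
 qed
 finally show ?thesis .
qed

lemma Lp_norm_comparable:
 assumes p: "p > 0"
 shows "\<exists>C>0. \<forall>f :: real ^ 'n \<Rightarrow> complex. continuous_on (ball 0 1) f \<longrightarrow>
  Lp_norm p \<alpha> (weighted t f) \<le> ennreal C * root_ennreal p (wint p (\<alpha> + p * t) f) \<and>
  root_ennreal p (wint p (\<alpha> + p * t) f) \<le> ennreal C * Lp_norm p \<alpha> (weighted t f)"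
proof -
 define a where "a = 1 / (V_const TYPE('n) \<alpha> * unit_ball_volume TYPE('n))"
 have a: "a > 0" unfolding a_def using V_const_pos[where 'n='n] unit_ball_volume_pos[where 'n='n] by simp
 define q where "q = 4 powr \<bar>\<alpha> + p * t\<bar>"
 have q: "q > 0" by (simp add: q_def)
 define A where "A = (a * q) powr (1 / p)"
 define B where "B = (q * (1 / a)) powr (1 / p)"
 have AB: "A \<ge> 0" "B \<ge> 0" by (simp_all add: A_def B_def)
 have "Lp_norm p \<alpha> (weighted t f) \<le> ennreal A * root_ennreal p (wint p (\<alpha> + p * t) f) \<and>
  root_ennreal p (wint p (\<alpha> + p * t) f) \<le> ennreal B * Lp_norm p \<alpha> (weighted t f)"
  if f: "continuous_on (ball 0 1) f" for f :: "real ^ 'n \<Rightarrow> complex"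
 proof
  let ?I = "\<integral>\<^sup>+x. ennreal (norm (weighted t f x) powr p) \<partial>nu_weighted \<alpha>"
  let ?s = "square_wint p (\<alpha> + p * t) f" and ?w = "wint p (\<alpha> + p * t) f"
  have I: "?I = ennreal a * ?s" unfolding a_def by (rule nn_integral_nu_weighted[OF f])
  note c = square_wint_comparable[OF f, of p "\<alpha> + p * t", folded q_def]
  have "?I \<le> ennreal (a * q) * ?w" by (rule ennreal_bound_trans[OF _ c(1) a q]) (simp add: I)
  then show "Lp_norm p \<alpha> (weighted t f) \<le> ennreal A * root_ennreal p ?w"
   using root_ennreal_mono[OF p] root_ennreal_cmult[of "a * q"] a q unfolding Lp_norm_root A_def by (metis mult_pos_pos)
  have "?s = ennreal (1 / a) * ?I" unfolding I using a by (simp add: mult.assoc[symmetric] ennreal_mult[symmetric])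
  then have "?w \<le> ennreal (q * (1 / a)) * ?I" by (intro ennreal_bound_trans[OF c(2) _ q]) (use a in auto)
  moreover have "q * (1 / a) > 0" using a q by simp
  ultimately show "root_ennreal p ?w \<le> ennreal B * Lp_norm p \<alpha> (weighted t f)"
   using root_ennreal_mono[OF p] root_ennreal_cmult[of "q * (1 / a)"] unfolding Lp_norm_root B_def by metis
 qed
 moreover have "ennreal A * x \<le> ennreal (A + B + 1) * x" "ennreal B * x \<le> ennreal (A + B + 1) * x" for x
  using AB by (auto intro!: mult_right_mono ennreal_leI)
 ultimately show ?thesis using AB by (intro exI[of _ "A + B + 1"]) (fastforce intro: order_trans)
qed

section \<open>Domination between functionals\<close>

definition dominated :: "'a set \<Rightarrow> ('a \<Rightarrow> ennreal) \<Rightarrow> ('a \<Rightarrow> ennreal) \<Rightarrow> bool" where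
 "dominated A X Y \<longleftrightarrow> (\<exists>C>0. \<forall>u\<in>A. X u \<le> ennreal C * Y u)"

lemma comparable_on_dominated: "comparable_on A X Y \<longleftrightarrow> dominated A X Y \<and> dominated A Y X"
 by (simp add: comparable_on_def dominated_def)

lemma dominatedI: "C > 0 \<Longrightarrow> (\<And>u. u \<in> A \<Longrightarrow> X u \<le> ennreal C * Y u) \<Longrightarrow> dominated A X Y"
 by (auto simp: dominated_def)

lemma dominatedE:
 assumes "dominated A X Y"
 obtains C where "C > 0" "\<And>u. u \<in> A \<Longrightarrow> X u \<le> ennreal C * Y u"
 using assms unfolding dominated_def by blast

lemma dominated_le: "(\<And>u. u \<in> A \<Longrightarrow> X u \<le> Y u) \<Longrightarrow> dominated A X Y"
 by (rule dominatedI[of 1]) auto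

lemma dominated_trans:
 assumes "dominated A X Y" "dominated A Y Z"
 shows "dominated A X Z"
proof -
 obtain C where C: "C > 0" "\<And>u. u \<in> A \<Longrightarrow> X u \<le> ennreal C * Y u" by (rule dominatedE[OF assms(1)]) (rule that)
 obtain D where D: "D > 0" "\<And>u. u \<in> A \<Longrightarrow> Y u \<le> ennreal D * Z u" by (rule dominatedE[OF assms(2)]) (rule that)
 show ?thesis
 proof (rule dominatedI[of "C * D"])
  fix u assume "u \<in> A"
  then show "X u \<le> ennreal (C * D) * Z u" by (intro ennreal_bound_trans[OF C(2) D(2) C(1) D(1)])
 qed (use C D in simp)
qed

lemma dominated_add:
 assumes "dominated A X Z" "dominated A Y Z"
 shows "dominated A (\<lambda>u. X u + Y u) Z"
proof -
 obtain C where C: "C > 0" "\<And>u. u \<in> A \<Longrightarrow> X u \<le> ennreal C * Z u" by (rule dominatedE[OF assms(1)]) (rule that)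
 obtain D where D: "D > 0" "\<And>u. u \<in> A \<Longrightarrow> Y u \<le> ennreal D * Z u" by (rule dominatedE[OF assms(2)]) (rule that)
 have "X u + Y u \<le> ennreal (C + D) * Z u" if "u \<in> A" for u
  using add_mono[OF C(2)[OF that] D(2)[OF that]] C D by (simp add: ennreal_plus distrib_right)
 then show ?thesis using C D by (intro dominatedI[of "C + D"]) auto
qed

lemma dominated_sum:
 assumes "finite S" "\<And>m. m \<in> S \<Longrightarrow> dominated A (X m) Y"
 shows "dominated A (\<lambda>u. \<Sum>m\<in>S. X m u) Y"
 using assms
proof (induction S)
 case (insert m S)
 then have "dominated A (\<lambda>u. X m u + (\<Sum>m\<in>S. X m u)) Y" by (intro dominated_add) auto
 then show ?case using insert by simp
qed (simp add: dominated_le)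

lemma dominated_root:
 assumes "p > 0" "dominated A X Y"
 shows "dominated A (\<lambda>u. root_ennreal p (X u)) (\<lambda>u. root_ennreal p (Y u))"
proof -
 obtain C where C: "C > 0" "\<And>u. u \<in> A \<Longrightarrow> X u \<le> ennreal C * Y u" by (rule dominatedE[OF assms(2)]) (rule that)
 show ?thesis
 proof (rule dominatedI[of "C powr (1 / p)"])
  fix u assume "u \<in> A"
  from root_ennreal_mono[OF assms(1) C(2)[OF this]]
  show "root_ennreal p (X u) \<le> ennreal (C powr (1 / p)) * root_ennreal p (Y u)" unfolding root_ennreal_cmult[OF C(1)] .
 qed (use C in simp)
qed

lemma dominated_finite:
 assumes "dominated A X Y" "u \<in> A" "Y u < \<infinity>"
 shows "X u < \<infinity>"
proof -
 obtain C where C: "C > 0" "\<And>u. u \<in> A \<Longrightarrow> X u \<le> ennreal C * Y u" by (rule dominatedE[OF assms(1)]) (rule that)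
 then show ?thesis using assms by (auto intro: le_less_trans[OF C(2)[OF assms(2)]] simp: ennreal_mult_less_top)
qed

section \<open>Equivalence of the norms\<close>

lemma mean_value_radial_iterate:
 assumes mv: "mean_value u"
 shows "continuous_on (ball 0 1) ((radial_deriv ^^ N) u)"
  and "wint p \<beta> ((radial_deriv ^^ N) u) = wint p \<beta> (mult_op (\<lambda>k. real k ^ N) u)"
proof -
 note sN = subexp_real_power[of N]
 show "continuous_on (ball 0 1) ((radial_deriv ^^ N) u)"
  using mean_value_cont[OF mult_op(1)[OF mv sN]]
  by (rule continuous_on_eq) (simp add: radial_deriv_iterate[OF mv])
 show "wint p \<beta> ((radial_deriv ^^ N) u) = wint p \<beta> (mult_op (\<lambda>k. real k ^ N) u)"
  by (rule wint_cong) (simp add: radial_deriv_iterate[OF mv])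
qed

lemma Lp_norm_dominated:
 fixes T :: "'a \<Rightarrow> real ^ 'n \<Rightarrow> complex"
 assumes p: "p > 0" and T: "\<And>u. u \<in> A \<Longrightarrow> continuous_on (ball 0 1) (T u)"
 shows "dominated A (\<lambda>u. Lp_norm p \<alpha> (weighted t (T u))) (\<lambda>u. root_ennreal p (wint p (\<alpha> + p * t) (T u)))"
  and "dominated A (\<lambda>u. root_ennreal p (wint p (\<alpha> + p * t) (T u))) (\<lambda>u. Lp_norm p \<alpha> (weighted t (T u)))"
 using Lp_norm_comparable[OF p, of \<alpha> t, where 'n='n] T unfolding dominated_def by blast+

lemma mean_value_D_op:
 fixes u :: "real ^ 'n \<Rightarrow> complex"
 assumes mv: "mean_value u"
 shows "mean_value (D_op s t u)" "D_op s t u 0 = u 0"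
proof -
 have sl: "subexp (\<lambda>k. gamma_coeff CARD('n) k (s + t) / gamma_coeff CARD('n) k s)"
  by (rule has_order_subexp[OF has_order_gamma_ratio[of "1/2"], where 'n='n]) auto
 show "mean_value (D_op s t u)" unfolding D_op_mult_op[OF mv] by (rule mult_op(1)[OF mv sl])
 show "D_op s t u 0 = u 0" unfolding D_op_mult_op[OF mv] mult_op_at_0[OF mv sl] by (simp add: gamma_coeff_0)
qed

text \<open>One direction writes \<open>D\<^sup>t\<^sub>s u\<close> as a multiplier of order \<open>t - N\<close> of \<open>\<R>\<^sup>N u\<close>, up to a constant;
 the other one writes \<open>\<R>\<^sup>N u\<close> as a multiplier of order \<open>N - t\<close> of \<open>D\<^sup>t\<^sub>s u\<close>, which has the same
 value as \<open>u\<close> at the origin.\<close>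

lemma D_op_comparable_radial:
 assumes p: "0 < p" "p < 1" and N: "\<alpha> + p * real N > -1" and t: "\<alpha> + p * t > -1"
 shows "comparable_on (harmonic_ball :: (real ^ 'n \<Rightarrow> complex) set) (\<lambda>u. Lp_norm p \<alpha> (weighted t (D_op s t u)))
  (\<lambda>u. ennreal (norm (u 0)) + Lp_norm p \<alpha> (weighted (real N) ((radial_deriv ^^ N) u)))"
  (is "comparable_on ?A ?X (\<lambda>u. ?z u + ?R u)")
proof -
 let ?q = "\<lambda>u :: real ^ 'n \<Rightarrow> complex. wint p (\<alpha> + p * t) (D_op s t u)"
 let ?r = "\<lambda>u :: real ^ 'n \<Rightarrow> complex. wint p (\<alpha> + p * real N) ((radial_deriv ^^ N) u)"
 note h = harmonic_ball_iff_mean_value[THEN iffD1]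
 have X: "dominated ?A ?X (\<lambda>u. root_ennreal p (?q u))" "dominated ?A (\<lambda>u. root_ennreal p (?q u)) ?X"
  by (intro Lp_norm_dominated p(1) mean_value_cont mean_value_D_op h; assumption)+
 have R: "dominated ?A ?R (\<lambda>u. root_ennreal p (?r u))" "dominated ?A (\<lambda>u. root_ennreal p (?r u)) ?R"
  by (intro Lp_norm_dominated p(1) mean_value_radial_iterate h; assumption)+
 have z: "?z u = root_ennreal p (ennreal (norm (u 0) powr p))" for u :: "real ^ 'n \<Rightarrow> complex"
  using p by (simp add: root_ennreal_powr)
 have e: "\<alpha> + p * t = \<alpha> + p * real N + p * (t - real N)" "\<alpha> + p * real N = \<alpha> + p * t + p * (real N - t)"
  by (simp_all add: algebra_simps)
 have 1: "dominated ?A ?q (\<lambda>u. ennreal (norm (u 0) powr p) + ?r u)"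
  using multiplier_le_radial[OF p has_order_gamma_ratio[OF p] t e(1), of s, where 'n='n] unfolding dominated_def
  by (simp add: Ball_def harmonic_ball_iff_mean_value D_op_mult_op mean_value_radial_iterate(2))
 have 2: "dominated ?A (\<lambda>u. root_ennreal p (ennreal (norm (u 0) powr p) + ?r u)) (\<lambda>u. ?z u + root_ennreal p (?r u))"
  unfolding z by (rule dominatedI[of "2 powr (1 / p)"]) (use root_ennreal_add_le p in auto)
 have 3: "dominated ?A (\<lambda>u. ?z u + root_ennreal p (?r u)) (\<lambda>u. ?z u + ?R u)"
  by (intro dominated_add dominated_trans[OF R(2)] dominated_le) auto
 have XY: "dominated ?A ?X (\<lambda>u. ?z u + ?R u)"
  by (rule dominated_trans[OF X(1) dominated_trans[OF dominated_root[OF p(1) 1] dominated_trans[OF 2 3]]])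
 have 5: "dominated ?A ?r ?q"
  using radial_le_gamma_multiplier[OF p N e(2), of s, where 'n='n] unfolding dominated_def
  by (simp add: Ball_def harmonic_ball_iff_mean_value D_op_mult_op mean_value_radial_iterate(2))
 have 4: "dominated ?A (\<lambda>u. ennreal (norm (u 0) powr p)) ?q"
 proof -
  obtain C where C: "C > 0" "\<And>u :: real ^ 'n \<Rightarrow> complex. mean_value u \<Longrightarrow> ennreal (norm (u 0) powr p) \<le> ennreal C * wint p (\<alpha> + p * t) u"
   using point_evaluation_bound[OF p, where 'n='n] by blast
  show ?thesis
  proof (rule dominatedI[OF C(1)])
   fix u :: "real ^ 'n \<Rightarrow> complex" assume "u \<in> ?A"
   then have mv: "mean_value u" by (rule h)
   show "ennreal (norm (u 0) powr p) \<le> ennreal C * ?q u"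
    using C(2)[OF mean_value_D_op(1)[OF mv], of s t] unfolding mean_value_D_op(2)[OF mv] .
  qed
 qed
 have "dominated ?A (\<lambda>u. ?z u + ?R u) (\<lambda>u. root_ennreal p (?q u))"
 proof (rule dominated_add)
  show "dominated ?A ?z (\<lambda>u. root_ennreal p (?q u))" unfolding z by (rule dominated_root[OF p(1) 4])
  show "dominated ?A ?R (\<lambda>u. root_ennreal p (?q u))" by (rule dominated_trans[OF R(1) dominated_root[OF p(1) 5]])
 qed
 then have "dominated ?A (\<lambda>u. ?z u + ?R u) ?X" by (rule dominated_trans[OF _ X(2)])
 with XY show ?thesis by (simp add: comparable_on_dominated)
qed

lemma radial_comparable_partials:
 assumes p: "0 < p" "p < 1" and N: "\<alpha> + p * real N > -1"
 shows "comparable_on (harmonic_ball :: (real ^ 'n::{finite,linorder} \<Rightarrow> complex) set)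
  (\<lambda>u. ennreal (norm (u 0)) + Lp_norm p \<alpha> (weighted (real N) ((radial_deriv ^^ N) u)))
  (\<lambda>u. (\<Sum>m | mi_size m < N. ennreal (norm (mi_deriv m u 0))) +
     (\<Sum>m | mi_size m = N. Lp_norm p \<alpha> (weighted (real N) (mi_deriv m u))))"
  (is "comparable_on ?A (\<lambda>u. ?z u + ?R u) ?Z")
proof -
 let ?r = "\<lambda>u :: real ^ 'n::{finite,linorder} \<Rightarrow> complex. wint p (\<alpha> + p * real N) ((radial_deriv ^^ N) u)"
 let ?L = "\<lambda>m u. Lp_norm p \<alpha> (weighted (real N) (mi_deriv m u))"
 let ?l = "\<lambda>m u. wint p (\<alpha> + p * real N) (mi_deriv m u)"
 note h = harmonic_ball_iff_mean_value[THEN iffD1]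
 have R: "dominated ?A ?R (\<lambda>u. root_ennreal p (?r u))" "dominated ?A (\<lambda>u. root_ennreal p (?r u)) ?R"
  by (intro Lp_norm_dominated p(1) mean_value_radial_iterate h; assumption)+
 have mv_mi: "mean_value (mi_deriv m u)" if "mean_value u" for m and u :: "real ^ 'n::{finite,linorder} \<Rightarrow> complex"
  unfolding mi_deriv_iter_partial by (rule mean_value_iter_partial[OF that])
 have L: "dominated ?A (?L m) (\<lambda>u. root_ennreal p (?l m u))" "dominated ?A (\<lambda>u. root_ennreal p (?l m u)) (?L m)" for m
  by (intro Lp_norm_dominated p(1) mean_value_cont mv_mi h; assumption)+
 have fin: "finite {m :: 'n::{finite,linorder} \<Rightarrow> nat. mi_size m < N}" by (rule finite_subset[OF _ finite_mi_size_le[of N]]) auto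
 have z: "ennreal (norm (c :: complex)) = root_ennreal p (ennreal (norm c powr p))" for c
  using p by (simp add: root_ennreal_powr)
 have "dominated ?A ?Z (\<lambda>u. ?z u + ?R u)"
 proof (intro dominated_add dominated_sum fin finite_mi_size_eq; clarify)
  fix m :: "'n \<Rightarrow> nat" assume m: "mi_size m < N"
  show "dominated ?A (\<lambda>u. ennreal (norm (mi_deriv m u 0))) (\<lambda>u. ?z u + ?R u)"
  proof (cases "mi_list m = []")
   case True
   then show ?thesis by (intro dominated_le) (simp add: mi_deriv_iter_partial)
  next
   case False
   then have "length (mi_list m) \<ge> 1" by (cases "mi_list m") auto
   then have "dominated ?A (\<lambda>u. ennreal (norm (mi_deriv m u 0) powr p)) ?r"
    using iter_partial_at_0_le_radial[OF p, of "mi_list m" "\<alpha> + p * real N" N] unfolding dominated_def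
    by (simp add: Ball_def harmonic_ball_iff_mean_value mi_deriv_iter_partial mean_value_radial_iterate(2))
   from dominated_trans[OF dominated_root[OF p(1) this] R(2)]
   have "dominated ?A (\<lambda>u. ennreal (norm (mi_deriv m u 0))) ?R" unfolding z .
   then show ?thesis by (rule dominated_trans) (rule dominated_le, simp)
  qed
 next
  fix m :: "'n \<Rightarrow> nat" assume m: "N = mi_size m"
  have "dominated ?A (?l m) ?r"
   using iter_partial_le_radial[OF p N, of "mi_list m"] unfolding dominated_def
   by (simp add: Ball_def harmonic_ball_iff_mean_value mi_deriv_iter_partial mean_value_radial_iterate(2) length_mi_list m)
  from dominated_trans[OF dominated_root[OF p(1) this] R(2)] have "dominated ?A (\<lambda>u. root_ennreal p (?l m u)) ?R" .
  then have "dominated ?A (?L m) ?R" by (rule dominated_trans[OF L(1)])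
  then have "dominated ?A (?L m) (\<lambda>u. ?z u + ?R u)" by (rule dominated_trans) (rule dominated_le, simp)
  then show "dominated ?A (\<lambda>u. Lp_norm p \<alpha> (weighted (real (mi_size m)) (mi_deriv m u)))
    (\<lambda>u. ?z u + Lp_norm p \<alpha> (weighted (real (mi_size m)) ((radial_deriv ^^ mi_size m) u)))" unfolding m .
 qed
 moreover have "dominated ?A (\<lambda>u. ?z u + ?R u) ?Z"
 proof -
  obtain C1 where C1: "C1 > 0" and le1: "\<And>f :: real ^ 'n::{finite,linorder} \<Rightarrow> complex. continuous_on (ball 0 1) f \<Longrightarrow>
    Lp_norm p \<alpha> (weighted (real N) f) \<le> ennreal C1 * root_ennreal p (wint p (\<alpha> + p * real N) f)"
   and le2: "\<And>f :: real ^ 'n::{finite,linorder} \<Rightarrow> complex. continuous_on (ball 0 1) f \<Longrightarrow>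
    root_ennreal p (wint p (\<alpha> + p * real N) f) \<le> ennreal C1 * Lp_norm p \<alpha> (weighted (real N) f)"
   using Lp_norm_comparable[OF p(1), of \<alpha> "real N", where 'n='n] by blast
  obtain C2 where C2: "C2 > 0" and B: "\<And>(u :: real ^ 'n::{finite,linorder} \<Rightarrow> complex) A. mean_value u \<Longrightarrow>
   \<forall>is. length is < N \<longrightarrow> ennreal (norm (iter_partial is u 0) powr p) \<le> A \<Longrightarrow>
   \<forall>is. length is = N \<longrightarrow> wint p (\<alpha> + p * real N) (iter_partial is u) \<le> A \<Longrightarrow>
   ennreal (norm (u 0) powr p) \<le> ennreal C2 * A \<and> wint p (\<alpha> + p * real N) (mult_op (\<lambda>k. real k ^ N) u) \<le> ennreal C2 * A"
   using radial_le_iter_partials[OF p N, of N, where 'n='n] by blast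
  define K where "K = C2 powr (1 / p) * (1 + C1)"
  have K: "K > 0" using C1 C2 by (simp add: K_def)
  show ?thesis
  proof (rule dominatedI[of "K * (1 + C1)"])
   fix u :: "real ^ 'n::{finite,linorder} \<Rightarrow> complex" assume "u \<in> ?A"
   then have mv: "mean_value u" by (rule h)
   show "?z u + ?R u \<le> ennreal (K * (1 + C1)) * ?Z u"
   proof (cases "?Z u = \<infinity>")
    case True
    then show ?thesis using K C1 by (simp add: ennreal_mult_top)
   next
    case False
    then obtain zu where zu: "?Z u = ennreal zu" "zu \<ge> 0" by (cases "?Z u") auto
    \<comment> \<open>a real bound whose \<open>p\<close>-th power dominates the \<open>p\<close>-th power integrals of all the derivatives\<close>
    let ?a = "(1 + C1) * zu"
    have a: "?a \<ge> 0" using C1 zu by simp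
    have le_a: "x \<le> ennreal (?a powr p)" if "root_ennreal p x \<le> ?Z u \<or> root_ennreal p x \<le> ennreal C1 * ?Z u" for x
    proof (rule root_ennreal_le_imp[OF p(1) a])
     have "?Z u \<le> ennreal ?a" "ennreal C1 * ?Z u \<le> ennreal ?a"
      using C1 zu by (auto simp: ennreal_mult[symmetric] algebra_simps intro!: ennreal_leI)
     then show "root_ennreal p x \<le> ennreal ?a" using that by (auto intro: order_trans)
    qed
    have "ennreal (norm (iter_partial is u 0) powr p) \<le> ennreal (?a powr p)" if len: "length is < N" for "is"
    proof (rule le_a, rule disjI1)
     let ?m = "count_list is"
     have "ennreal (norm (mi_deriv ?m u 0)) \<le> (\<Sum>m | mi_size m < N. ennreal (norm (mi_deriv m u 0)))"
      by (rule member_le_sum) (use fin len in \<open>auto simp: mi_size_count_list\<close>)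
     also have "\<dots> \<le> ?Z u" by simp
     finally show "root_ennreal p (ennreal (norm (iter_partial is u 0) powr p)) \<le> ?Z u"
      unfolding z[symmetric] by (simp add: iter_partial_eq_mi_deriv[OF mv])
    qed
    moreover have "wint p (\<alpha> + p * real N) (iter_partial is u) \<le> ennreal (?a powr p)" if len: "length is = N" for "is"
    proof (rule le_a, rule disjI2)
     let ?m = "count_list is"
     have "wint p (\<alpha> + p * real N) (iter_partial is u) = ?l ?m u"
      by (rule wint_cong) (simp add: iter_partial_eq_mi_deriv[OF mv])
     then have "root_ennreal p (wint p (\<alpha> + p * real N) (iter_partial is u)) \<le> ennreal C1 * ?L ?m u"
      using le2[OF mean_value_cont[OF mv_mi[OF mv]]] by simp
     also have "?L ?m u \<le> (\<Sum>m | mi_size m = N. ?L m u)"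
      by (rule member_le_sum) (use finite_mi_size_eq len in \<open>auto simp: mi_size_count_list\<close>)
     also have "\<dots> \<le> ?Z u" by simp
     finally show "root_ennreal p (wint p (\<alpha> + p * real N) (iter_partial is u)) \<le> ennreal C1 * ?Z u" by (simp add: mult_left_mono)
    qed
    ultimately have b: "ennreal (norm (u 0) powr p) \<le> ennreal C2 * ennreal (?a powr p)" "?r u \<le> ennreal C2 * ennreal (?a powr p)"
     using B[OF mv, of "ennreal (?a powr p)"] by (auto simp: mean_value_radial_iterate(2)[OF mv])
    have Ka: "root_ennreal p x \<le> ennreal (K * zu)" if "x \<le> ennreal C2 * ennreal (?a powr p)" for x
    proof -
     have "root_ennreal p x \<le> ennreal (C2 powr (1 / p)) * ennreal ?a"
      using root_ennreal_mono[OF p(1) that] unfolding root_ennreal_cmult[OF C2] root_ennreal_powr[OF p(1) a] .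
     also have "\<dots> = ennreal (K * zu)" using a by (simp add: ennreal_mult[symmetric] K_def mult.assoc)
     finally show ?thesis .
    qed
    have "?R u \<le> ennreal C1 * ennreal (K * zu)"
     by (rule order_trans[OF le1[OF mean_value_radial_iterate(1)[OF mv]] mult_left_mono[OF Ka[OF b(2)]]]) simp
    then have "?z u + ?R u \<le> ennreal (K * zu) + ennreal C1 * ennreal (K * zu)"
     using Ka[OF b(1)] unfolding z[symmetric] by (intro add_mono)
    also have "\<dots> = ennreal (K * (1 + C1)) * ?Z u"
     unfolding zu(1) using K C1 zu(2) by (simp add: ennreal_mult[symmetric] ennreal_plus[symmetric] algebra_simps del: ennreal_plus)
    finally show ?thesis .
   qed
  qed (use K C1 in simp)
 qed
 ultimately show ?thesis by (simp add: comparable_on_dominated)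
qed

lemma Lp_space_iff:
 assumes "continuous_on (ball 0 1) f"
 shows "weighted t f \<in> Lp_space p \<alpha> \<longleftrightarrow> Lp_norm p \<alpha> (weighted t f) < \<infinity>"
 using weighted_measurable[OF assms, of t] by (simp add: Lp_space_def measurable_cong_sets[OF sets_nu_weighted refl])

lemma comparable_on_finite_iff: "comparable_on A X Y \<Longrightarrow> u \<in> A \<Longrightarrow> X u < \<infinity> \<longleftrightarrow> Y u < \<infinity>"
 using dominated_finite[of A X Y u] dominated_finite[of A Y X u] by (auto simp: comparable_on_dominated)

theorem theorem1p1:
 fixes p \<alpha> :: real
 assumes "CARD('n::{finite,linorder}) \<ge> 2" and "0 < p" and "p < 1"
 shows
  "(\<forall>u \<in> (harmonic_ball :: (real ^ 'n::{finite,linorder} \<Rightarrow> complex) set).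
    let a = (\<forall>N::nat. \<alpha> + p * real N > -1 \<longrightarrow>
          (\<forall>m. mi_size m = N \<longrightarrow> weighted (real N) (mi_deriv m u) \<in> Lp_space p \<alpha>));
      b = (\<exists>N::nat. \<alpha> + p * real N > -1 \<and>
          (\<forall>m. mi_size m = N \<longrightarrow> weighted (real N) (mi_deriv m u) \<in> Lp_space p \<alpha>));
      c = (\<forall>N::nat. \<alpha> + p * real N > -1 \<longrightarrow>
          weighted (real N) ((radial_deriv ^^ N) u) \<in> Lp_space p \<alpha>);
      d = (\<exists>N::nat. \<alpha> + p * real N > -1 \<and>
          weighted (real N) ((radial_deriv ^^ N) u) \<in> Lp_space p \<alpha>);
      e = (\<forall>s t::real. \<alpha> + p * t > -1 \<longrightarrow> weighted t (D_op s t u) \<in> Lp_space p \<alpha>);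
      f = (\<exists>s t::real. \<alpha> + p * t > -1 \<and> weighted t (D_op s t u) \<in> Lp_space p \<alpha>)
    in (a \<longleftrightarrow> b) \<and> (b \<longleftrightarrow> c) \<and> (c \<longleftrightarrow> d) \<and> (d \<longleftrightarrow> e) \<and> (e \<longleftrightarrow> f)) \<and>
   (\<forall>(N::nat) (s::real) (t::real).
    \<alpha> + p * real N > -1 \<longrightarrow> \<alpha> + p * t > -1 \<longrightarrow>
    (let X = (\<lambda>u. Lp_norm p \<alpha> (weighted t (D_op s t u)));
       Y = (\<lambda>u. ennreal (norm (u 0)) +
           Lp_norm p \<alpha> (weighted (real N) ((radial_deriv ^^ N) u)));
       Z = (\<lambda>u. (\<Sum>m | mi_size m < N. ennreal (norm (mi_deriv m u 0))) +
           (\<Sum>m | mi_size m = N. Lp_norm p \<alpha> (weighted (real N) (mi_deriv m u))))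
     in comparable_on (harmonic_ball :: (real ^ 'n::{finite,linorder} \<Rightarrow> complex) set) X Y \<and>
      comparable_on (harmonic_ball :: (real ^ 'n::{finite,linorder} \<Rightarrow> complex) set) Y Z))"
proof (intro conjI ballI, goal_cases)
 case u: (1 u)
 note p = assms(2,3)
 have mv: "mean_value u" using u by (simp add: harmonic_ball_iff_mean_value)
 \<comment> \<open>all six conditions are shown to be equivalent to \<open>F\<close>\<close>
 define F where "F \<longleftrightarrow> (\<exists>N::nat. \<alpha> + p * real N > -1 \<and> Lp_norm p \<alpha> (weighted (real N) ((radial_deriv ^^ N) u)) < \<infinity>)"
 obtain M :: nat where "(-1 - \<alpha>) / p < real M" using reals_Archimedean2 by blast
 then have M: "\<alpha> + p * real M > -1" using p by (simp add: field_simps)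
 have RD: "Lp_norm p \<alpha> (weighted (real N) ((radial_deriv ^^ N) u)) < \<infinity> \<longleftrightarrow> Lp_norm p \<alpha> (weighted t (D_op s t u)) < \<infinity>"
  if "\<alpha> + p * real N > -1" "\<alpha> + p * t > -1" for N s t
  using comparable_on_finite_iff[OF D_op_comparable_radial[OF p that, of s] u] by auto
 have R: "weighted (real N) ((radial_deriv ^^ N) u) \<in> Lp_space p \<alpha> \<longleftrightarrow> F" if "\<alpha> + p * real N > -1" for N
  unfolding Lp_space_iff[OF mean_value_radial_iterate(1)[OF mv]] F_def using RD[OF _ M, of _ 0] that by blast
 have D: "weighted t (D_op s t u) \<in> Lp_space p \<alpha> \<longleftrightarrow> F" if "\<alpha> + p * t > -1" for s t
  using RD[OF M that, of s] R[OF M]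
  unfolding Lp_space_iff[OF mean_value_cont[OF mean_value_D_op(1)[OF mv]]] Lp_space_iff[OF mean_value_radial_iterate(1)[OF mv]] by blast
 have P: "(\<forall>m. mi_size m = N \<longrightarrow> weighted (real N) (mi_deriv m u) \<in> Lp_space p \<alpha>) \<longleftrightarrow> F" if N: "\<alpha> + p * real N > -1" for N
 proof -
  have "(\<forall>m. mi_size m = N \<longrightarrow> weighted (real N) (mi_deriv m u) \<in> Lp_space p \<alpha>) \<longleftrightarrow>
    (\<forall>m. mi_size m = N \<longrightarrow> Lp_norm p \<alpha> (weighted (real N) (mi_deriv m u)) < \<infinity>)"
   by (simp add: Lp_space_iff mean_value_cont mi_deriv_iter_partial mean_value_iter_partial mv)
  also have "\<dots> \<longleftrightarrow> (\<Sum>m | mi_size m < N. ennreal (norm (mi_deriv m u 0))) +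
           (\<Sum>m | mi_size m = N. Lp_norm p \<alpha> (weighted (real N) (mi_deriv m u))) < \<infinity>"
  proof -
   have "finite {m :: 'n::{finite,linorder} \<Rightarrow> nat. mi_size m < N}" by (rule finite_subset[OF _ finite_mi_size_le[of N]]) auto
   then have "(\<Sum>m | mi_size m < N. ennreal (norm (mi_deriv m u 0))) < top" by simp
   then show ?thesis using finite_mi_size_eq[of N, where 'n='n] by (simp add: less_top[symmetric])
  qed
  also have "\<dots> \<longleftrightarrow> Lp_norm p \<alpha> (weighted (real N) ((radial_deriv ^^ N) u)) < \<infinity>"
   using comparable_on_finite_iff[OF radial_comparable_partials[OF p N] u] by simp
  also have "\<dots> \<longleftrightarrow> F" using R[OF N] unfolding Lp_space_iff[OF mean_value_radial_iterate(1)[OF mv]] .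
  finally show ?thesis .
 qed
 have all_ex: "(\<forall>N::nat. \<alpha> + p * real N > -1 \<longrightarrow> S N) \<longleftrightarrow> F" "(\<exists>N::nat. \<alpha> + p * real N > -1 \<and> S N) \<longleftrightarrow> F"
  if "\<And>N::nat. \<alpha> + p * real N > -1 \<Longrightarrow> S N \<longleftrightarrow> F" for S
  using that M by blast+
 have Pe: "(\<forall>N::nat. \<alpha> + p * real N > -1 \<longrightarrow> (\<forall>m. mi_size m = N \<longrightarrow> weighted (real N) (mi_deriv m u) \<in> Lp_space p \<alpha>)) \<longleftrightarrow> F"
  "(\<exists>N::nat. \<alpha> + p * real N > -1 \<and> (\<forall>m. mi_size m = N \<longrightarrow> weighted (real N) (mi_deriv m u) \<in> Lp_space p \<alpha>)) \<longleftrightarrow> F"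
  by (rule all_ex, rule P, assumption)+
 have Re: "(\<forall>N::nat. \<alpha> + p * real N > -1 \<longrightarrow> weighted (real N) ((radial_deriv ^^ N) u) \<in> Lp_space p \<alpha>) \<longleftrightarrow> F"
  "(\<exists>N::nat. \<alpha> + p * real N > -1 \<and> weighted (real N) ((radial_deriv ^^ N) u) \<in> Lp_space p \<alpha>) \<longleftrightarrow> F"
  by (rule all_ex, rule R, assumption)+
 have De: "(\<forall>s t. \<alpha> + p * t > -1 \<longrightarrow> weighted t (D_op s t u) \<in> Lp_space p \<alpha>) \<longleftrightarrow> F"
  "(\<exists>s t. \<alpha> + p * t > -1 \<and> weighted t (D_op s t u) \<in> Lp_space p \<alpha>) \<longleftrightarrow> F"
  using D M by blast+
 show ?case
  unfolding Let_def Pe Re De by simp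
next
 case 2
 note p = assms(2,3)
 show ?case
  unfolding Let_def using D_op_comparable_radial[OF p] radial_comparable_partials[OF p] by blast
qed

end
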